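(* Let $(G,X)$ be a self-similar group, $|X|=d\ge 2$. A completion $\mathcal{A}$ of the group algebra $\mathbb{C}[G]$ is self-similar if and only if it is the closure of (the image of) $\mathbb{C}[G]$ in a nonzero homomorphic image of the Cuntz-Pimsner algebra $O_G$. In particular, every such completion is a homomorphic image of the algebra $\mathcal{A}_{max}$.
   Context: Let $X$ be a finite alphabet, $d=|X|\ge 2$, and let $X^*$ be the rooted tree of finite words over $X$ ($v$ adjacent to $vx$ for $x\in X$). A self-similar group $(G,X)$ is a group $G$ acting faithfully on the rooted tree $X^*$ such that for every $g\in G$ and $x\in X$ there exist $h\in G$ and $y\in X$ with $g(xw)=yh(w)$ for all $w\in X^*$; then $y=g(x)$ and one writes $h=g|_x$. A $d$-fold similarity of an infinite-dimensional Hilbert space $H$ is an isomorphism of Hilbert spaces $\psi:H\to H^X=\bigoplus_{x\in X}H$; let $T_x(\xi)=\psi^{-1}(\text{the vector with }\xi\text{ in coordinate }x\text{ and }0\text{ elsewhere})$. A unitary representation $\rho$ of $G$ on $H$ is self-similar with respect to $\psi$ if $\rho(g)T_x=T_y\rho(h)$ whenever $g(xw)=yh(w)$ for all $w\in X^*$, and self-similar if this holds for some $\psi$. A completion of $\mathbb{C}[G]$ is the $C^*$-algebra obtained by separating and completing $\mathbb{C}[G]$ with respect to a $C^*$-seminorm; for a unitary representation $\rho$ the completion with respect to $\rho$ is given by $\|a\|_\rho=\|\rho(a)\|$, so it is the closure of $\rho(\mathbb{C}[G])$. Completions are compared via the identity map on $G$. A completion is called self-similar if it is the completion with respect to a self-similar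 representation of $G$. The (universal) Cuntz-Pimsner algebra $O_G$ is the universal unital $C^*$-algebra generated by $G$ (as unitaries) and $a_x$, $x\in X$, subject to: all relations of $G$; $a_x^*a_x=1$ for all $x\in X$ and $\sum_{x\in X}a_xa_x^*=1$; and $ga_x=a_yh$ whenever $g(xw)=yh(w)$ for all $w\in X^*$. $\mathcal{A}_{max}$ is the $C^*$-subalgebra of $O_G$ generated by $G$. *)

theory Defs
  imports
    Complex_Main
    "HOL-Library.Cardinality"
    "HOL-Algebra.Group_Action"
    "HOL-Algebra.Module"
    "HOL-Algebra.Algebraic_Closure_Type"
begin

section \<open>Self-similar groups\<close>

text \<open>
  The alphabet is a finite type \<open>'x\<close>; the vertices of the tree are all lists over it, and a list
  \<open>v\<close> is joined to each \<open>v @ [x]\<close>. In \<open>x # w\<close> the letter \<open>x\<close> is the one next to the root.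
\<close>

definition tree_adjacent :: "'x list \<Rightarrow> 'x list \<Rightarrow> bool" where
  "tree_adjacent v w \<longleftrightarrow> (\<exists>x. w = v @ [x] \<or> v = w @ [x])"

definition restricts :: "('g \<Rightarrow> 'x list \<Rightarrow> 'x list) \<Rightarrow> 'g \<Rightarrow> 'x \<Rightarrow> 'x \<Rightarrow> 'g \<Rightarrow> bool" where
  "restricts act g x y h \<longleftrightarrow> (\<forall>w. act g (x # w) = y # act h w)"

locale self_similar_group = faithful_action G "UNIV :: 'x list set" act
  for G :: "('g, 'm) monoid_scheme" (structure) and act :: "'g \<Rightarrow> 'x::finite list \<Rightarrow> 'x list" +
  assumes act_root: "g \<in> carrier G \<Longrightarrow> act g [] = []"
    and act_adjacent: "g \<in> carrier G \<Longrightarrow>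
      tree_adjacent (act g v) (act g w) \<longleftrightarrow> tree_adjacent v w"
    and self_similar: "g \<in> carrier G \<Longrightarrow> \<exists>h\<in>carrier G. \<exists>y. restricts act g x y h"


section \<open>Unital *-algebras and C*-algebras\<close>

abbreviation complex_ring :: "complex ring" where
  "complex_ring \<equiv> ring_of_type_algebra"

record 'a star_alg = "(complex, 'a) module" +
  star :: "'a \<Rightarrow> 'a"

record 'a cstar_alg = "'a star_alg" +
  nrm :: "'a \<Rightarrow> real"

locale star_algebra = ring A + Module.module complex_ring A
  for A :: "('a, 'm) star_alg_scheme" (structure) +
  assumes smult_mult_left: "\<lbrakk>a \<in> carrier A; b \<in> carrier A\<rbrakk> \<Longrightarrow> (c \<odot> a) \<otimes> b = c \<odot> (a \<otimes> b)"
    and smult_mult_right: "\<lbrakk>a \<in> carrier A; b \<in> carrier A\<rbrakk> \<Longrightarrow> a \<otimes> (c \<odot> b) = c \<odot> (a \<otimes> b)"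
    and star_closed: "a \<in> carrier A \<Longrightarrow> star A a \<in> carrier A"
    and star_star: "a \<in> carrier A \<Longrightarrow> star A (star A a) = a"
    and star_add: "\<lbrakk>a \<in> carrier A; b \<in> carrier A\<rbrakk> \<Longrightarrow> star A (a \<oplus> b) = star A a \<oplus> star A b"
    and star_smult: "a \<in> carrier A \<Longrightarrow> star A (c \<odot> a) = cnj c \<odot> star A a"
    and star_mult: "\<lbrakk>a \<in> carrier A; b \<in> carrier A\<rbrakk> \<Longrightarrow> star A (a \<otimes> b) = star A b \<otimes> star A a"

definition cstar_seminorm :: "('a, 'm) star_alg_scheme \<Rightarrow> ('a \<Rightarrow> real) \<Rightarrow> bool" where
  "cstar_seminorm A p \<longleftrightarrow>
    (\<forall>a\<in>carrier A. 0 \<le> p a) \<and>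
    (\<forall>a\<in>carrier A. \<forall>c. p (c \<odot>\<^bsub>A\<^esub> a) = cmod c * p a) \<and>
    (\<forall>a\<in>carrier A. \<forall>b\<in>carrier A. p (a \<oplus>\<^bsub>A\<^esub> b) \<le> p a + p b) \<and>
    (\<forall>a\<in>carrier A. \<forall>b\<in>carrier A. p (a \<otimes>\<^bsub>A\<^esub> b) \<le> p a * p b) \<and>
    (\<forall>a\<in>carrier A. p (star A a \<otimes>\<^bsub>A\<^esub> a) = (p a)\<^sup>2)"

definition cauchy_seq :: "('a, 'm) ring_scheme \<Rightarrow> ('a \<Rightarrow> real) \<Rightarrow> (nat \<Rightarrow> 'a) \<Rightarrow> bool" where
  "cauchy_seq A p s \<longleftrightarrow> (\<forall>n. s n \<in> carrier A) \<and>
    (\<forall>e>0. \<exists>N. \<forall>m\<ge>N. \<forall>n\<ge>N. p (s m \<ominus>\<^bsub>A\<^esub> s n) < e)"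

definition complete_wrt :: "('a, 'm) ring_scheme \<Rightarrow> ('a \<Rightarrow> real) \<Rightarrow> bool" where
  "complete_wrt A p \<longleftrightarrow>
    (\<forall>s. cauchy_seq A p s \<longrightarrow> (\<exists>l\<in>carrier A. (\<lambda>n. p (s n \<ominus>\<^bsub>A\<^esub> l)) \<longlonglongrightarrow> 0))"

locale unital_cstar_algebra = star_algebra A
  for A :: "('a, 'm) cstar_alg_scheme" (structure) +
  assumes nrm_cstar_seminorm: "cstar_seminorm A (nrm A)"
    and nrm_definite: "\<lbrakk>a \<in> carrier A; nrm A a = 0\<rbrakk> \<Longrightarrow> a = \<zero>"
    and nrm_complete: "complete_wrt A (nrm A)"

text \<open>Membership in \<^const>\<open>ring_hom\<close> makes these homomorphisms unital.\<close>

definition star_hom ::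
    "('a, 'm) star_alg_scheme \<Rightarrow> ('b, 'n) star_alg_scheme \<Rightarrow> ('a \<Rightarrow> 'b) \<Rightarrow> bool" where
  "star_hom A B f \<longleftrightarrow> f \<in> ring_hom A B \<and>
    (\<forall>a\<in>carrier A. \<forall>c. f (c \<odot>\<^bsub>A\<^esub> a) = c \<odot>\<^bsub>B\<^esub> f a) \<and>
    (\<forall>a\<in>carrier A. f (star A a) = star B (f a))"

definition cstar_iso ::
    "('a, 'm) cstar_alg_scheme \<Rightarrow> ('b, 'n) cstar_alg_scheme \<Rightarrow> ('a \<Rightarrow> 'b) \<Rightarrow> bool" where
  "cstar_iso A B f \<longleftrightarrow> star_hom A B f \<and> bij_betw f (carrier A) (carrier B) \<and>
    (\<forall>a\<in>carrier A. nrm B (f a) = nrm A a)"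

definition norm_closure :: "('a, 'm) cstar_alg_scheme \<Rightarrow> 'a set \<Rightarrow> 'a set" where
  "norm_closure A S = {a \<in> carrier A. \<forall>e>0. \<exists>s\<in>S. nrm A (a \<ominus>\<^bsub>A\<^esub> s) < e}"

definition cstar_subalgebra :: "'a set \<Rightarrow> ('a, 'm) cstar_alg_scheme \<Rightarrow> bool" where
  "cstar_subalgebra C A \<longleftrightarrow> C \<subseteq> carrier A \<and> \<zero>\<^bsub>A\<^esub> \<in> C \<and>
    (\<forall>a\<in>C. \<forall>b\<in>C. a \<oplus>\<^bsub>A\<^esub> b \<in> C \<and> a \<otimes>\<^bsub>A\<^esub> b \<in> C) \<and>
    (\<forall>a\<in>C. star A a \<in> C \<and> (\<forall>c. c \<odot>\<^bsub>A\<^esub> a \<in> C)) \<and>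
    norm_closure A C \<subseteq> C"

definition cstar_generated :: "('a, 'm) cstar_alg_scheme \<Rightarrow> 'a set \<Rightarrow> 'a set" where
  "cstar_generated A S = \<Inter>{C. cstar_subalgebra C A \<and> S \<subseteq> C}"


section \<open>Separation and completion with respect to a C*-seminorm\<close>

text \<open>
  Elements of the completion are classes of \<open>p\<close>-Cauchy sequences modulo \<open>p\<close>-null sequences, so
  that elements at \<open>p\<close>-distance zero are identified.
\<close>

definition completion_class ::
    "('a, 'm) star_alg_scheme \<Rightarrow> ('a \<Rightarrow> real) \<Rightarrow> (nat \<Rightarrow> 'a) \<Rightarrow> (nat \<Rightarrow> 'a) set" where
  "completion_class A p s =
    {t. cauchy_seq A p t \<and> (\<lambda>n. p (s n \<ominus>\<^bsub>A\<^esub> t n)) \<longlonglongrightarrow> 0}"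

definition class_rep :: "(nat \<Rightarrow> 'a) set \<Rightarrow> nat \<Rightarrow> 'a" where
  "class_rep P = (SOME s. s \<in> P)"

definition cstar_completion ::
    "('a, 'm) star_alg_scheme \<Rightarrow> ('a \<Rightarrow> real) \<Rightarrow> (nat \<Rightarrow> 'a) set cstar_alg" where
  "cstar_completion A p =
    \<lparr>carrier = completion_class A p ` {s. cauchy_seq A p s},
     monoid.mult = (\<lambda>P Q. completion_class A p (\<lambda>n. class_rep P n \<otimes>\<^bsub>A\<^esub> class_rep Q n)),
     one = completion_class A p (\<lambda>_. \<one>\<^bsub>A\<^esub>),
     zero = completion_class A p (\<lambda>_. \<zero>\<^bsub>A\<^esub>),
     add = (\<lambda>P Q. completion_class A p (\<lambda>n. class_rep P n \<oplus>\<^bsub>A\<^esub> class_rep Q n)),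
     module.smult = (\<lambda>c P. completion_class A p (\<lambda>n. c \<odot>\<^bsub>A\<^esub> class_rep P n)),
     star = (\<lambda>P. completion_class A p (\<lambda>n. star A (class_rep P n))),
     nrm = (\<lambda>P. lim (\<lambda>n. p (class_rep P n)))\<rparr>"

definition completion_embed ::
    "('a, 'm) star_alg_scheme \<Rightarrow> ('a \<Rightarrow> real) \<Rightarrow> 'a \<Rightarrow> (nat \<Rightarrow> 'a) set" where
  "completion_embed A p a = completion_class A p (\<lambda>_. a)"


section \<open>Group algebras and free *-algebras\<close>

text \<open>
  The complex algebra of a monoid \<open>M\<close> carrying an involutive anti-automorphism \<open>\<sigma>\<close>, with
  \<open>(\<Sum> c\<^sub>m m)\<^sup>* = \<Sum> cnj c\<^sub>m \<sigma>(m)\<close>. It is used for a group with inversion and for a free monoid.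
\<close>

definition point_mass :: "'g \<Rightarrow> 'g \<Rightarrow> complex" where
  "point_mass m = (\<lambda>k. if k = m then 1 else 0)"

definition monoid_star_algebra ::
    "('g, 'm) monoid_scheme \<Rightarrow> ('g \<Rightarrow> 'g) \<Rightarrow> ('g \<Rightarrow> complex) star_alg" where
  "monoid_star_algebra M \<sigma> =
    \<lparr>carrier = {f. finite {m. f m \<noteq> 0} \<and> {m. f m \<noteq> 0} \<subseteq> carrier M},
     monoid.mult = (\<lambda>f h m. \<Sum>k | f k \<noteq> 0. \<Sum>l | h l \<noteq> 0. if k \<otimes>\<^bsub>M\<^esub> l = m then f k * h l else 0),
     one = point_mass \<one>\<^bsub>M\<^esub>,
     zero = (\<lambda>m. 0),
     add = (\<lambda>f h m. f m + h m),
     module.smult = (\<lambda>c f m. c * f m),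
     star = (\<lambda>f m. if m \<in> carrier M then cnj (f (\<sigma> m)) else 0)\<rparr>"

definition group_algebra :: "('g, 'm) monoid_scheme \<Rightarrow> ('g \<Rightarrow> complex) star_alg" where
  "group_algebra G = monoid_star_algebra G (m_inv G)"

definition group_algebra_map ::
    "('b, 'n) star_alg_scheme \<Rightarrow> ('g \<Rightarrow> 'b) \<Rightarrow> ('g \<Rightarrow> complex) \<Rightarrow> 'b" where
  "group_algebra_map B u f = (\<Oplus>\<^bsub>B\<^esub>g\<in>{g. f g \<noteq> 0}. f g \<odot>\<^bsub>B\<^esub> u g)"

text \<open>The letter \<open>(i, False)\<close> stands for the generator \<open>i\<close> and \<open>(i, True)\<close> for its adjoint.\<close>

definition free_star_algebra :: "'i set \<Rightarrow> (('i \<times> bool) list \<Rightarrow> complex) star_alg" where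
  "free_star_algebra S = monoid_star_algebra
     \<lparr>carrier = lists (S \<times> UNIV), monoid.mult = (@), one = []\<rparr>
     (\<lambda>w. rev (map (\<lambda>(i, b). (i, \<not> b)) w))"

definition free_gen :: "'i \<Rightarrow> ('i \<times> bool) list \<Rightarrow> complex" where
  "free_gen i = point_mass [(i, False)]"


section \<open>Universal C*-algebras and the Cuntz-Pimsner algebra\<close>

text \<open>
  The universal unital C*-algebra on generators \<open>S\<close> subject to the equations \<open>l = r\<close> for
  \<open>(l, r) \<in> R\<close> is the completion of the free unital *-algebra on \<open>S\<close> in the largest
  C*-seminorm that respects the equations. This is meaningful only if the C*-seminorms
  respecting \<open>R\<close> are pointwise bounded. For the Cuntz-Pimsner algebra they are, since every
  generator has seminorm at most 1.
\<close>

definition universal_seminorm ::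
    "('a, 'm) star_alg_scheme \<Rightarrow> ('a \<times> 'a) set \<Rightarrow> 'a \<Rightarrow> real" where
  "universal_seminorm F R a =
    (SUP p\<in>{p. cstar_seminorm F p \<and> (\<forall>(l, r)\<in>R. p (l \<ominus>\<^bsub>F\<^esub> r) = 0)}. p a)"

datatype ('g, 'x) cp_gen = Group_Gen 'g | Letter_Gen 'x

type_synonym ('g, 'x) cp_free = "(('g, 'x) cp_gen \<times> bool) list \<Rightarrow> complex"
type_synonym ('g, 'x) cp_elem = "(nat \<Rightarrow> ('g, 'x) cp_free) set"

definition cp_free_algebra :: "('g, 'm) monoid_scheme \<Rightarrow> ('g, 'x) cp_free star_alg" where
  "cp_free_algebra G = free_star_algebra (Group_Gen ` carrier G \<union> range Letter_Gen)"

definition cp_relations ::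
    "('g, 'm) monoid_scheme \<Rightarrow> ('g \<Rightarrow> 'x::finite list \<Rightarrow> 'x list) \<Rightarrow>
     (('g, 'x) cp_free \<times> ('g, 'x) cp_free) set" where
  "cp_relations G act =
    (let F = cp_free_algebra G;
         u = (\<lambda>g. free_gen (Group_Gen g));
         a = (\<lambda>x. free_gen (Letter_Gen x))
     in {(u \<one>\<^bsub>G\<^esub>, \<one>\<^bsub>F\<^esub>)}
      \<union> {(u g \<otimes>\<^bsub>F\<^esub> u h, u (g \<otimes>\<^bsub>G\<^esub> h)) | g h. g \<in> carrier G \<and> h \<in> carrier G}
      \<union> {(star F (u g) \<otimes>\<^bsub>F\<^esub> u g, \<one>\<^bsub>F\<^esub>) | g. g \<in> carrier G}
      \<union> {(u g \<otimes>\<^bsub>F\<^esub> star F (u g), \<one>\<^bsub>F\<^esub>) | g. g \<in> carrier G}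
      \<union> {(star F (a x) \<otimes>\<^bsub>F\<^esub> a x, \<one>\<^bsub>F\<^esub>) | x. True}
      \<union> {((\<Oplus>\<^bsub>F\<^esub>x\<in>UNIV. a x \<otimes>\<^bsub>F\<^esub> star F (a x)), \<one>\<^bsub>F\<^esub>)}
      \<union> {(u g \<otimes>\<^bsub>F\<^esub> a x, a y \<otimes>\<^bsub>F\<^esub> u h) | g h x y.
           g \<in> carrier G \<and> h \<in> carrier G \<and> restricts act g x y h})"

definition cp_seminorm ::
    "('g, 'm) monoid_scheme \<Rightarrow> ('g \<Rightarrow> 'x::finite list \<Rightarrow> 'x list) \<Rightarrow> ('g, 'x) cp_free \<Rightarrow> real" where
  "cp_seminorm G act = universal_seminorm (cp_free_algebra G) (cp_relations G act)"

definition cuntz_pimsner ::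
    "('g, 'm) monoid_scheme \<Rightarrow> ('g \<Rightarrow> 'x::finite list \<Rightarrow> 'x list) \<Rightarrow>
     ('g, 'x) cp_elem cstar_alg" where
  "cuntz_pimsner G act = cstar_completion (cp_free_algebra G) (cp_seminorm G act)"

definition cp_unitary ::
    "('g, 'm) monoid_scheme \<Rightarrow> ('g \<Rightarrow> 'x::finite list \<Rightarrow> 'x list) \<Rightarrow> 'g \<Rightarrow> ('g, 'x) cp_elem" where
  "cp_unitary G act g =
    completion_embed (cp_free_algebra G) (cp_seminorm G act) (free_gen (Group_Gen g))"

definition A_max ::
    "('g, 'm) monoid_scheme \<Rightarrow> ('g \<Rightarrow> 'x::finite list \<Rightarrow> 'x list) \<Rightarrow>
     ('g, 'x) cp_elem cstar_alg" where
  "A_max G act = (cuntz_pimsner G act)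
    \<lparr>carrier := cstar_generated (cuntz_pimsner G act) (cp_unitary G act ` carrier G)\<rparr>"


section \<open>Hilbert spaces and self-similar representations\<close>

text \<open>
  The ring fields \<^const>\<open>monoid.mult\<close> and \<^const>\<open>one\<close> inherited from the module record are not used.
  The inner product is linear in the first argument.
\<close>

record 'h hilbert_space = "(complex, 'h) module" +
  cinner :: "'h \<Rightarrow> 'h \<Rightarrow> complex"

definition hnorm :: "('h, 'm) hilbert_space_scheme \<Rightarrow> 'h \<Rightarrow> real" where
  "hnorm H v = sqrt (Re (cinner H v v))"

locale hilbert = Module.module complex_ring H
  for H :: "('h, 'm) hilbert_space_scheme" (structure) +
  assumes cinner_add: "\<lbrakk>u \<in> carrier H; v \<in> carrier H; w \<in> carrier H\<rbrakk> \<Longrightarrow>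
      cinner H (u \<oplus> v) w = cinner H u w + cinner H v w"
    and cinner_smult: "\<lbrakk>u \<in> carrier H; v \<in> carrier H\<rbrakk> \<Longrightarrow>
      cinner H (c \<odot> u) v = c * cinner H u v"
    and cinner_commute: "\<lbrakk>u \<in> carrier H; v \<in> carrier H\<rbrakk> \<Longrightarrow>
      cinner H v u = cnj (cinner H u v)"
    and cinner_pos: "\<lbrakk>v \<in> carrier H; v \<noteq> \<zero>\<rbrakk> \<Longrightarrow> 0 < Re (cinner H v v)"
    and hnorm_complete: "complete_wrt H (hnorm H)"

definition infinite_dimensional :: "('h, 'm) hilbert_space_scheme \<Rightarrow> bool" where
  "infinite_dimensional H \<longleftrightarrow>
    \<not> (\<exists>S. finite S \<and> S \<subseteq> carrier H \<and>
          (\<forall>v\<in>carrier H. \<exists>c. v = (\<Oplus>\<^bsub>H\<^esub>s\<in>S. c s \<odot>\<^bsub>H\<^esub> s)))"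

definition hilbert_iso ::
    "('h, 'm) hilbert_space_scheme \<Rightarrow> ('k, 'n) hilbert_space_scheme \<Rightarrow> ('h \<Rightarrow> 'k) \<Rightarrow> bool" where
  "hilbert_iso H K f \<longleftrightarrow> bij_betw f (carrier H) (carrier K) \<and>
    (\<forall>v\<in>carrier H. \<forall>w\<in>carrier H. f (v \<oplus>\<^bsub>H\<^esub> w) = f v \<oplus>\<^bsub>K\<^esub> f w) \<and>
    (\<forall>v\<in>carrier H. \<forall>c. f (c \<odot>\<^bsub>H\<^esub> v) = c \<odot>\<^bsub>K\<^esub> f v) \<and>
    (\<forall>v\<in>carrier H. \<forall>w\<in>carrier H. cinner K (f v) (f w) = cinner H v w)"

definition hilbert_power ::
    "('h, 'm) hilbert_space_scheme \<Rightarrow> ('x::finite \<Rightarrow> 'h) hilbert_space" where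
  "hilbert_power H =
    \<lparr>carrier = {v. \<forall>x. v x \<in> carrier H},
     monoid.mult = undefined,
     one = undefined,
     zero = (\<lambda>x. \<zero>\<^bsub>H\<^esub>),
     add = (\<lambda>v w x. v x \<oplus>\<^bsub>H\<^esub> w x),
     module.smult = (\<lambda>c v x. c \<odot>\<^bsub>H\<^esub> v x),
     cinner = (\<lambda>v w. \<Sum>x\<in>UNIV. cinner H (v x) (w x))\<rparr>"

definition similarity :: "('h, 'm) hilbert_space_scheme \<Rightarrow> ('h \<Rightarrow> 'x::finite \<Rightarrow> 'h) \<Rightarrow> bool" where
  "similarity H \<psi> \<longleftrightarrow> hilbert H \<and> infinite_dimensional H \<and> hilbert_iso H (hilbert_power H) \<psi>"

definition similarity_shift ::
    "('h, 'm) hilbert_space_scheme \<Rightarrow> ('h \<Rightarrow> 'x::finite \<Rightarrow> 'h) \<Rightarrow> 'x \<Rightarrow> 'h \<Rightarrow> 'h" where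
  "similarity_shift H \<psi> x \<xi> =
    inv_into (carrier H) \<psi> (\<lambda>y. if y = x then \<xi> else \<zero>\<^bsub>H\<^esub>)"

definition unitary_rep ::
    "('g, 'm) monoid_scheme \<Rightarrow> ('h, 'n) hilbert_space_scheme \<Rightarrow> ('g \<Rightarrow> 'h \<Rightarrow> 'h) \<Rightarrow> bool" where
  "unitary_rep G H \<rho> \<longleftrightarrow>
    (\<forall>g\<in>carrier G. hilbert_iso H H (\<rho> g)) \<and>
    (\<forall>g\<in>carrier G. \<forall>h\<in>carrier G. \<forall>v\<in>carrier H. \<rho> (g \<otimes>\<^bsub>G\<^esub> h) v = \<rho> g (\<rho> h v))"

definition self_similar_rep ::
    "('g, 'm) monoid_scheme \<Rightarrow> ('g \<Rightarrow> 'x::finite list \<Rightarrow> 'x list) \<Rightarrow>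
     ('h, 'n) hilbert_space_scheme \<Rightarrow> ('g \<Rightarrow> 'h \<Rightarrow> 'h) \<Rightarrow> bool" where
  "self_similar_rep G act H \<rho> \<longleftrightarrow> unitary_rep G H \<rho> \<and>
    (\<exists>\<psi>. similarity H \<psi> \<and>
      (\<forall>g\<in>carrier G. \<forall>h\<in>carrier G. \<forall>x y. restricts act g x y h \<longrightarrow>
        (\<forall>\<xi>\<in>carrier H. \<rho> g (similarity_shift H \<psi> x \<xi>) = similarity_shift H \<psi> y (\<rho> h \<xi>))))"

definition rep_seminorm ::
    "('h, 'n) hilbert_space_scheme \<Rightarrow> ('g \<Rightarrow> 'h \<Rightarrow> 'h) \<Rightarrow> ('g \<Rightarrow> complex) \<Rightarrow> real" where
  "rep_seminorm H \<rho> f =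
    (SUP v\<in>{v \<in> carrier H. hnorm H v \<le> 1}. hnorm H (\<Oplus>\<^bsub>H\<^esub>g\<in>{g. f g \<noteq> 0}. f g \<odot>\<^bsub>H\<^esub> \<rho> g v))"


section \<open>Completions of the group algebra\<close>

definition group_completion ::
    "('g, 'm) monoid_scheme \<Rightarrow> (('g \<Rightarrow> complex) \<Rightarrow> real) \<Rightarrow> (nat \<Rightarrow> 'g \<Rightarrow> complex) set cstar_alg" where
  "group_completion G p = cstar_completion (group_algebra G) p"

definition completion_unitary ::
    "('g, 'm) monoid_scheme \<Rightarrow> (('g \<Rightarrow> complex) \<Rightarrow> real) \<Rightarrow> 'g \<Rightarrow> (nat \<Rightarrow> 'g \<Rightarrow> complex) set" where
  "completion_unitary G p g = completion_embed (group_algebra G) p (point_mass g)"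

text \<open>Equality of two completions \<open>j : G \<rightarrow> A\<close> and \<open>k : G \<rightarrow> B\<close>: an isomorphism over the identity of \<open>G\<close>.\<close>

definition same_completion ::
    "('g, 'm) monoid_scheme \<Rightarrow> ('a, 'n) cstar_alg_scheme \<Rightarrow> ('g \<Rightarrow> 'a) \<Rightarrow>
     ('b, 'k) cstar_alg_scheme \<Rightarrow> ('g \<Rightarrow> 'b) \<Rightarrow> bool" where
  "same_completion G A j B k \<longleftrightarrow> (\<exists>\<Phi>. cstar_iso A B \<Phi> \<and> (\<forall>g\<in>carrier G. \<Phi> (j g) = k g))"

text \<open>
  HOL has no quantification over types, so the next two predicates take as a parameter the type
  in which the Hilbert space, respectively the homomorphic image, lives.
\<close>

definition self_similar_completion ::
    "'h itself \<Rightarrow> ('g, 'm) monoid_scheme \<Rightarrow> ('g \<Rightarrow> 'x::finite list \<Rightarrow> 'x list) \<Rightarrow>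
     (('g \<Rightarrow> complex) \<Rightarrow> real) \<Rightarrow> bool" where
  "self_similar_completion _ G act p \<longleftrightarrow>
    (\<exists>(H :: 'h hilbert_space) \<rho>. self_similar_rep G act H \<rho> \<and>
      same_completion G (group_completion G p) (completion_unitary G p)
        (group_completion G (rep_seminorm H \<rho>)) (completion_unitary G (rep_seminorm H \<rho>)))"

definition closure_in_cuntz_pimsner_image ::
    "'b itself \<Rightarrow> ('g, 'm) monoid_scheme \<Rightarrow> ('g \<Rightarrow> 'x::finite list \<Rightarrow> 'x list) \<Rightarrow>
     (('g \<Rightarrow> complex) \<Rightarrow> real) \<Rightarrow> bool" where
  "closure_in_cuntz_pimsner_image _ G act p \<longleftrightarrow>
    (\<exists>(B :: 'b cstar_alg) \<pi>. unital_cstar_algebra B \<and> \<one>\<^bsub>B\<^esub> \<noteq> \<zero>\<^bsub>B\<^esub> \<and>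
      star_hom (cuntz_pimsner G act) B \<pi> \<and>
      \<pi> ` carrier (cuntz_pimsner G act) = carrier B \<and>
      same_completion G (group_completion G p) (completion_unitary G p)
        (B\<lparr>carrier := norm_closure B
             (group_algebra_map B (\<lambda>g. \<pi> (cp_unitary G act g)) ` carrier (group_algebra G))\<rparr>)
        (\<lambda>g. \<pi> (cp_unitary G act g)))"

definition image_of_A_max ::
    "('g, 'm) monoid_scheme \<Rightarrow> ('g \<Rightarrow> 'x::finite list \<Rightarrow> 'x list) \<Rightarrow>
     (('g \<Rightarrow> complex) \<Rightarrow> real) \<Rightarrow> bool" where
  "image_of_A_max G act p \<longleftrightarrow>
    (\<exists>\<theta>. star_hom (A_max G act) (group_completion G p) \<theta> \<and>
      \<theta> ` carrier (A_max G act) = carrier (group_completion G p) \<and>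
      (\<forall>g\<in>carrier G. \<theta> (cp_unitary G act g) = completion_unitary G p g))"

text \<open>
  Types large enough to be universal: whenever a completion is witnessed by a Hilbert space or a
  homomorphic image in some type, it is witnessed by one in the corresponding type below. For images this is the type of the elements of the
  Cuntz-Pimsner algebra itself. For Hilbert spaces it accommodates a direct sum, indexed by the
  free *-algebra, of completions of quotients of the free *-algebra.
\<close>

type_synonym ('g, 'x) cp_hilbert = "('g, 'x) cp_free \<Rightarrow> ('g, 'x) cp_elem"

end

theory Submission
  imports Defs "HOL-Library.Poly_Mapping"
begin

text \<open>
  The two kinds of completions are the same: they are the restrictions to the group algebra of the
  C*-seminorms \<open>q\<close> with \<open>q 1 \<noteq> 0\<close> on the free *-algebra over \<open>G\<close> and the letters that
  respect the Cuntz-Pimsner relations. A self-similar representation, together with the isometries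
  \<open>T\<^sub>x\<close> and their adjoints, represents the free *-algebra, and its operator norm is such a \<open>q\<close>.
  Conversely, the direct sum of GNS representations, one for each element of the free *-algebra, has
  operator norm \<open>q\<close>, and the images of the letters assemble to a similarity of this space;
  two isometries with orthogonal ranges force infinite dimension.

  Positivity of a self-adjoint \<open>k\<close> is expressed by the norms of \<open>t - k\<close> for real \<open>t\<close>; states then
  come from the Hahn-Banach theorem. That the image of a C*-algebra under a *-homomorphism is closed
  becomes a statement on lifting Cauchy sequences along a smaller C*-seminorm, proved by successive
  approximate lifts.
\<close>

text \<open>The free *-algebra with a C*-seminorm is neither separated nor complete, so it offers no
  spectrum, functional calculus or inverses. Roots and inverses are therefore replaced by polynomial
  expressions with a controlled error; these stay in every *-subalgebra and commute with whatever
  commutes with the argument. The hardest point is the positivity of \<open>st x * x\<close>, which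
  makes the form of a state positive and its operators bounded. The condition
  \<open>q 1 \<noteq> 0\<close> matches a nonzero image on one side and a nonzero Hilbert space on
  the other. Lifting is needed where density does not suffice: O_G has to map onto the completion
  for \<open>q\<close>, and A_max onto the completion of the group algebra. Positivity is developed
  in a type of class \<open>ring_1\<close> for the sake of ring arithmetic. The generators belonging
  to \<open>G\<close> form a set and not a type, so seminorms are transported to the free algebra
  over a whole type by discarding words with foreign letters.\<close>

lemma complex_ring_simps [simp]:
  "carrier complex_ring = UNIV" "x \<oplus>\<^bsub>complex_ring\<^esub> y = x + y" "x \<otimes>\<^bsub>complex_ring\<^esub> y = x * y"
  "\<one>\<^bsub>complex_ring\<^esub> = 1" "\<zero>\<^bsub>complex_ring\<^esub> = 0"
  by (simp_all add: ring_of_type_algebra_def)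

section \<open>Positivity in *-algebras with a C*-seminorm\<close>

text \<open>Scalars enter as a homomorphism \<open>cs\<close> into the centre rather than through a
  module, so that the arithmetic and the simplifier setup of \<open>ring_1\<close> apply to all
  computations below.\<close>

locale star_ring =
  fixes cs :: "complex \<Rightarrow> 'a::ring_1" and st :: "'a \<Rightarrow> 'a"
  assumes cs_add: "cs (c + d) = cs c + cs d"
    and cs_mult: "cs (c * d) = cs c * cs d"
    and cs_1 [simp]: "cs 1 = 1"
    and cs_central: "x * cs c = cs c * x"
    and st_add: "st (x + y) = st x + st y"
    and st_mult: "st (x * y) = st y * st x"
    and st_st [simp]: "st (st x) = x"
    and st_cs [simp]: "st (cs c) = cs (cnj c)"
begin

abbreviation rc :: "real \<Rightarrow> 'a" where "rc r \<equiv> cs (complex_of_real r)"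

lemma cs_0 [simp]: "cs 0 = 0"
  using cs_add[of 0 0] by simp

lemma cs_minus: "cs (- c) = - cs c"
  using cs_add[of c "- c"] by (simp add: eq_neg_iff_add_eq_0 add.commute)

lemma cs_diff: "cs (c - d) = cs c - cs d"
  using cs_add[of c "- d"] by (simp add: cs_minus)

lemma cs_left: "x * (cs c * y) = cs c * (x * y)"
  by (metis cs_central mult.assoc)

lemma cs_cs: "cs c * (cs d * x) = cs (c * d) * x"
  by (simp add: cs_mult mult.assoc)

lemma cs_2: "cs 2 = 2"
  using cs_add[of 1 1] by simp

lemma st_0 [simp]: "st 0 = 0"
  using st_add[of 0 0] by simp

lemma st_1 [simp]: "st 1 = 1"
  using st_cs[of 1] by (simp del: st_cs)

lemma st_minus: "st (- x) = - st x"
  using st_add[of x "- x"] by (simp add: eq_neg_iff_add_eq_0 add.commute)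

lemma st_diff: "st (x - y) = st x - st y"
  using st_add[of x "- y"] by (simp add: st_minus)

lemma st_cs_mult: "st (cs c * x) = cs (cnj c) * st x"
  by (simp add: st_mult cs_central[of "st x"])

lemma st_power: "st (x ^ n) = st x ^ n"
  by (induction n) (simp_all add: st_mult power_commutes)

lemma st_sum: "st (sum f A) = (\<Sum>i\<in>A. st (f i))"
  by (induction A rule: infinite_finite_induct) (simp_all add: st_add)

lemma rc_add: "rc (r + s) = rc r + rc s"
  by (simp add: cs_add)

lemma rc_diff: "rc (r - s) = rc r - rc s"
  by (simp add: cs_diff)

lemma rc_mult: "rc (r * s) = rc r * rc s"
  by (simp add: cs_mult)

text \<open>These rules carry commutation with \<open>z\<close> along the steps of an iteration:
  roots are built by such steps and inherit what commutes with the given element.\<close>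

lemma commute_mult: "z * x = x * z \<Longrightarrow> z * y = y * z \<Longrightarrow> z * (x * y) = x * y * (z::'a)"
  by (metis mult.assoc)

lemma commute_diff: "z * x = x * z \<Longrightarrow> z * y = y * z \<Longrightarrow> z * (x - y) = (x - y) * (z::'a)"
  by (simp add: algebra_simps)

lemma commute_add: "z * x = x * z \<Longrightarrow> z * y = y * z \<Longrightarrow> z * (x + y) = (x + y) * (z::'a)"
  by (simp add: algebra_simps)

lemma commute_cs: "z * x = x * z \<Longrightarrow> z * (cs c * x) = cs c * x * z"
  by (simp add: cs_left[of z] mult.assoc)

lemma commute_rc: "z * x = x * z \<Longrightarrow> z * (rc c - x) = (rc c - x) * z"
  by (simp add: commute_diff cs_central[of z])

end

text \<open>Tailored to the free *-algebra, where nonzero elements may have seminorm 0 and Cauchy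
  sequences need not converge. Identities involving roots can thus only hold up to a prescribed
  error.\<close>

locale cstar_seminormed = star_ring +
  fixes Q :: "'a \<Rightarrow> real"
  assumes Q_cs_mult: "Q (cs c * x) = cmod c * Q x"
    and Q_add: "Q (x + y) \<le> Q x + Q y"
    and Q_mult: "Q (x * y) \<le> Q x * Q y"
    and Q_cstar: "Q (st x * x) = (Q x)\<^sup>2"
begin

lemma Q_minus [simp]: "Q (- x) = Q x"
  using Q_cs_mult[of "-1" x] by (simp add: cs_minus)

lemma Q_0 [simp]: "Q 0 = 0"
  using Q_cs_mult[of 0 0] by simp

lemma Q_nonneg [simp]: "0 \<le> Q x"
  using Q_add[of x "- x"] by simp

lemma Q_diff: "Q (x - y) \<le> Q x + Q y"
  using Q_add[of x "- y"] by simp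

lemma Q_commute: "Q (x - y) = Q (y - x)"
  using Q_minus[of "x - y"] by simp

lemma Q_triangle: "Q x \<le> Q (x - y) + Q y"
  using Q_add[of "x - y" y] by simp

text \<open>The C*-identity gives \<open>(Q y)\<^sup>2 \<le> Q (st y) * Q y\<close>, and
  \<open>Q y\<close> cancels; the same for \<open>st y\<close> gives the converse.\<close>

lemma Q_st [simp]: "Q (st x) = Q x"
proof -
  have *: "Q y \<le> Q (st y)" for y
  proof (cases "Q y = 0")
    case False
    have "Q y * Q y \<le> Q (st y) * Q y"
      using Q_cstar[of y] Q_mult[of "st y" y] by (simp add: power2_eq_square)
    then show ?thesis
      using False by (simp add: less_le)
  qed simp
  show ?thesis
    using *[of x] *[of "st x"] by simp
qed

text \<open>The value 0 occurs only for the zero seminorm, because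
  \<open>Q x \<le> Q x * Q 1\<close>; the later hypothesis \<open>Q 1 = 1\<close> excludes exactly
  this case.\<close>

lemma Q_1_cases: "Q 1 = 0 \<or> Q 1 = 1"
  using Q_cstar[of 1] by (auto simp: power2_eq_square)

lemma Q_1_le: "Q 1 \<le> 1"
  using Q_1_cases by auto

lemma Q_cs_le: "Q (cs c) \<le> cmod c"
  using Q_cs_mult[of c 1] Q_1_le by (simp add: mult_left_le)

lemma Q_rc_le: "0 \<le> r \<Longrightarrow> Q (rc r) \<le> r"
  using Q_cs_le[of "of_real r"] by simp

lemma Q_rc_mult: "Q (rc r * x) = \<bar>r\<bar> * Q x"
  by (simp add: Q_cs_mult)

lemma Q_power: "0 < n \<Longrightarrow> Q (x ^ n) \<le> Q x ^ n"
proof (induction n rule: nat_induct_non_zero)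
  case (Suc n)
  then show ?case
    using Q_mult[of x "x ^ n"] by (simp add: order.trans mult_left_mono)
qed simp

lemma Q_square: "st a = a \<Longrightarrow> Q (a * a) = (Q a)\<^sup>2"
  using Q_cstar[of a] by simp

text \<open>The element \<open>s\<close> is \<open>1 - y\<close> for an iterate \<open>y\<close> of the contraction \<open>y \<mapsto> (k + y\<^sup>2) / 2\<close>.\<close>

lemma approx_sqrt_one_minus:
  assumes sa: "st k = k" and k: "Q k \<le> \<rho>" and \<rho>: "\<rho> < 1" and \<epsilon>: "0 < \<epsilon>"
  obtains s where "st s = s" "\<And>z. z * k = k * z \<Longrightarrow> z * s = s * z"
    "Q (s * s - (1 - k)) \<le> \<epsilon>" "Q (1 - s) \<le> \<rho>"
proof -
  define y where "y = rec_nat 0 (\<lambda>_ y. rc (1/2) * (k + y * y))"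
  have y0: "y 0 = 0" and yS: "y (Suc n) = rc (1/2) * (k + y n * y n)" for n
    by (simp_all add: y_def)
  have \<rho>0: "0 \<le> \<rho>"
    using k Q_nonneg[of k] by linarith
  have sa_y: "st (y n) = y n" for n
    unfolding y_def by (induction n) (simp_all add: st_cs_mult st_add, simp add: st_mult sa)
  have comm: "z * y n = y n * z" if "z * k = k * z" for z n
  proof (induction n)
    case (Suc n)
    then show ?case
      unfolding yS by (intro commute_cs commute_add commute_mult that)
  qed (simp add: y0)
  have comm_y: "y m * y n = y n * y m" for m n
    by (intro comm) (metis comm)
  have Qy: "Q (y n) \<le> \<rho>" for n
  proof (induction n)
    case (Suc n)
    have "Q (k + y n * y n) \<le> \<rho> + \<rho> * \<rho>"
      using Q_add[of k "y n * y n"] Q_mult[of "y n" "y n"] k mult_mono[OF Suc Suc \<rho>0 Q_nonneg]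
      by linarith
    also have "\<dots> \<le> \<rho> + \<rho>"
      using \<rho> \<rho>0 by (simp add: mult_left_le)
    finally show ?case
      by (simp add: yS Q_cs_mult)
  qed (simp add: y0 \<rho>0)
  have half: "rc (1/2) * x + rc (1/2) * x = x" for x
    using cs_add[of "1/2" "1/2"] by (simp flip: distrib_right)
  \<comment> \<open>The iterates commute, so each increment is half the product of the previous
    increment with the sum of two iterates. That sum has seminorm at most \<open>2 * \<rho>\<close>,
    hence increments shrink by the factor \<rho>.\<close>
  have step: "Q (y (Suc n) - y n) \<le> \<rho> ^ Suc n" for n
  proof (induction n)
    case 0
    have "Q (y (Suc 0) - y 0) = Q k / 2"
      by (simp add: y0 yS Q_cs_mult)
    also have "\<dots> \<le> \<rho> ^ Suc 0"
      using k \<rho>0 by simp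
    finally show ?case .
  next
    case (Suc n)
    have "rc (1/2) * (k + y (Suc n) * y (Suc n)) - rc (1/2) * (k + y n * y n)
        = rc (1/2) * ((y (Suc n) - y n) * (y (Suc n) + y n))"
      by (simp add: algebra_simps comm_y[of "Suc n" n])
    then have "y (Suc (Suc n)) - y (Suc n)
        = rc (1/2) * ((y (Suc n) - y n) * (y (Suc n) + y n))"
      by (metis yS)
    then have "Q (y (Suc (Suc n)) - y (Suc n)) = Q ((y (Suc n) - y n) * (y (Suc n) + y n)) / 2"
      by (simp add: Q_cs_mult)
    also have "\<dots> \<le> Q (y (Suc n) - y n) * Q (y (Suc n) + y n) / 2"
      using Q_mult by (simp add: divide_right_mono)
    also have "\<dots> \<le> \<rho> ^ Suc n * (\<rho> + \<rho>) / 2"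
      using Q_add[of "y (Suc n)" "y n"] Qy[of n] Qy[of "Suc n"] Suc \<rho>0
      by (intro divide_right_mono mult_mono) auto
    finally show ?case
      by (simp add: mult_ac)
  qed
  have "(\<lambda>n. \<rho> ^ n) \<longlonglongrightarrow> 0"
    using \<rho> \<rho>0 by (intro LIMSEQ_realpow_zero) auto
  then have "\<forall>\<^sub>F n in sequentially. \<rho> ^ n < \<epsilon> / 2"
    using \<epsilon> by (intro order_tendstoD) auto
  then obtain n where n: "\<rho> ^ n < \<epsilon> / 2"
    by (auto simp: eventually_sequentially)
  define s where "s = 1 - y n"
  \<comment> \<open>The defect is \<open>k + y\<^sup>2 - 2 y\<close>, twice the next increment of
    the iteration.\<close>
  have "s * s - (1 - k) = (y (Suc n) - y n) + (y (Suc n) - y n)"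
    using half[of "k + y n * y n"] by (simp add: s_def yS algebra_simps)
  then have "Q (s * s - (1 - k)) \<le> \<rho> ^ Suc n + \<rho> ^ Suc n"
    using Q_add[of "y (Suc n) - y n" "y (Suc n) - y n"] step[of n] by simp
  also have "\<dots> \<le> \<rho> ^ n + \<rho> ^ n"
    using \<rho> \<rho>0 by (simp add: mult_left_le_one_le)
  finally have "Q (s * s - (1 - k)) \<le> \<epsilon>"
    using n by linarith
  moreover have "z * s = s * z" if "z * k = k * z" for z
    unfolding s_def by (intro commute_diff comm that) simp
  moreover have "st s = s" "Q (1 - s) \<le> \<rho>"
    using sa_y Qy[of n] by (simp_all add: s_def st_diff)
  ultimately show ?thesis
    using that by blast
qed

text \<open>Both sides are read off the square of the normal element \<open>l + \<i> r\<close>.\<close>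

lemma Q_diff_squares_le:
  assumes "st l = l" "st r = r" "l * r = r * l"
  shows "Q (l * l - r * r) \<le> Q (l * l + r * r)"
proof -
  define u where "u = l + cs \<i> * r"
  have st_u: "st u = l - cs \<i> * r"
    by (simp add: u_def st_add st_cs_mult assms cs_minus)
  have I: "cs \<i> * (cs \<i> * x) = - x" for x
    by (simp add: cs_cs cs_minus)
  have "st u * u = l * l + r * r"
    by (simp add: st_u) (simp add: u_def algebra_simps cs_left[of l] cs_left[of r] cs_central[of l] cs_central[of r] I assms(3))
  then have 1: "(Q u)\<^sup>2 = Q (l * l + r * r)"
    using Q_cstar[of u] by simp
  have "u * u + st u * st u = (l * l - r * r) + (l * l - r * r)"
    by (simp add: st_u) (simp add: u_def algebra_simps cs_left[of l] cs_left[of r] cs_central[of l] cs_central[of r] I assms(3))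
  then have "u * u + st u * st u = rc 2 * (l * l - r * r)"
    by (simp add: cs_2 mult_2)
  then have "2 * Q (l * l - r * r) = Q (u * u + st u * st u)"
    by (simp add: Q_cs_mult)
  also have "\<dots> \<le> 2 * (Q u)\<^sup>2"
    using Q_add[of "u * u" "st u * st u"] Q_mult[of u u] Q_mult[of "st u" "st u"]
    by (simp add: power2_eq_square)
  finally show ?thesis
    using 1 by simp
qed

text \<open>
  Nonnegativity of the spectrum, expressed through the norm: \<open>k\<close> is positive iff the infimum of
  \<open>Q (t - k) - t\<close> over all \<open>t\<close> is at most 0.
\<close>

definition Pos :: "'a \<Rightarrow> bool" where
  "Pos k \<longleftrightarrow> st k = k \<and> (\<forall>\<delta>>0. \<exists>t. Q (rc t - k) \<le> t + \<delta>)"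

lemma Pos_sa: "Pos k \<Longrightarrow> st k = k"
  by (simp add: Pos_def)

lemma PosI: "st k = k \<Longrightarrow> Q (rc t - k) \<le> t \<Longrightarrow> Pos k"
  unfolding Pos_def by (meson less_eq_real_def add_increasing2 order.trans)

text \<open>The formulation through norms pays off here: the shifts add up and the triangle
  inequality does the rest.\<close>

lemma Pos_add:
  assumes "Pos k" "Pos l" shows "Pos (k + l)"
  unfolding Pos_def
proof (intro conjI allI impI)
  show "st (k + l) = k + l"
    using assms by (simp add: Pos_sa st_add)
next
  fix \<delta> :: real assume "0 < \<delta>"
  then obtain s t where "Q (rc s - k) \<le> s + \<delta> / 2" "Q (rc t - l) \<le> t + \<delta> / 2"
    using assms unfolding Pos_def by (meson half_gt_zero)
  moreover have "rc (s + t) - (k + l) = (rc s - k) + (rc t - l)"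
    by (simp add: rc_add del: of_real_add)
  then have "Q (rc (s + t) - (k + l)) \<le> Q (rc s - k) + Q (rc t - l)"
    by (metis Q_add)
  ultimately have "Q (rc (s + t) - (k + l)) \<le> (s + t) + \<delta>"
    by argo
  then show "\<exists>t. Q (rc t - (k + l)) \<le> t + \<delta>" ..
qed

text \<open>The slack \<delta> in \<open>Pos\<close> makes positivity a closed condition, so it may
  be verified on approximants such as approximate squares.\<close>

lemma Pos_limit:
  assumes "st k = k" "\<And>\<epsilon>. 0 < \<epsilon> \<Longrightarrow> \<exists>l. Pos l \<and> Q (k - l) \<le> \<epsilon>"
  shows "Pos k"
  unfolding Pos_def
proof (intro conjI allI impI assms(1))
  fix \<delta> :: real assume "0 < \<delta>"
  then obtain l where l: "Pos l" "Q (k - l) \<le> \<delta> / 2"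
    using assms(2)[of "\<delta> / 2"] by auto
  then obtain t where "Q (rc t - l) \<le> t + \<delta> / 2"
    using \<open>0 < \<delta>\<close> unfolding Pos_def by (meson half_gt_zero)
  then have "Q (rc t - k) \<le> t + \<delta>"
    using Q_add[of "rc t - l" "l - k"] l(2) Q_commute[of k l] by simp
  then show "\<exists>t. Q (rc t - k) \<le> t + \<delta>" ..
qed

lemma Pos_scale:
  assumes "Pos k" "0 \<le> c" shows "Pos (rc c * k)"
proof (cases "c = 0")
  case True
  then show ?thesis
    using PosI[of 0 0] by simp
next
  case False
  then have c: "0 < c" using assms by simp
  show ?thesis
    unfolding Pos_def
  proof (intro conjI allI impI)
    show "st (rc c * k) = rc c * k"
      using assms by (simp add: Pos_sa st_cs_mult)
    fix \<delta> :: real assume "0 < \<delta>"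
    then obtain t where "Q (rc t - k) \<le> t + \<delta> / c"
      using assms c unfolding Pos_def by (meson divide_pos_pos)
    then have "c * Q (rc t - k) \<le> c * (t + \<delta> / c)"
      using c by (intro mult_left_mono) auto
    moreover have "rc (c * t) - rc c * k = rc c * (rc t - k)"
      by (simp add: cs_mult right_diff_distrib)
    ultimately have "Q (rc (c * t) - rc c * k) \<le> c * t + \<delta>"
      using c by (simp add: Q_cs_mult distrib_left del: of_real_mult)
    then show "\<exists>t. Q (rc t - rc c * k) \<le> t + \<delta>" ..
  qed
qed

lemma Pos_unscale:
  assumes "Pos (rc c * k)" "0 < c" shows "Pos k"
  using Pos_scale[OF assms(1), of "1 / c"] assms(2) by (simp add: cs_cs flip: of_real_mult)

lemma Pos_double: "Pos (k + k) \<Longrightarrow> Pos k"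
  using Pos_unscale[of 2 k] by (simp add: cs_2 mult_2)

lemma Pos_const: "0 \<le> c \<Longrightarrow> Pos (rc c)"
  by (rule PosI[of _ c]) simp_all

lemma Pos_norm: "st k = k \<Longrightarrow> Q k \<le> c \<Longrightarrow> Pos (rc c - k)"
  by (rule PosI[of _ c]) (simp_all add: st_diff)

text \<open>For \<open>Q a < 1\<close> take \<open>s\<close> commuting with \<open>a\<close> and
  with \<open>s\<^sup>2\<close> close to \<open>1 - a\<^sup>2\<close>. Then
  \<open>2 a\<^sup>2 - 1\<close> is close to \<open>a\<^sup>2 - s\<^sup>2\<close>, whose seminorm is
  bounded by that of \<open>a\<^sup>2 + s\<^sup>2\<close>, about 1. So the shift by 1 certifies
  \<open>2 a\<^sup>2\<close>.\<close>

lemma Pos_square: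
  assumes sa: "st a = a" shows "Pos (a * a)"
proof -
  have small: "Pos (a * a)" if sa: "st a = a" and "Q a < 1" for a
  proof -
    have sq: "st (a * a) = a * a" "Q (a * a) \<le> (Q a)\<^sup>2" "(Q a)\<^sup>2 < 1"
      using that Q_square[OF sa] by (simp_all add: st_mult power_less_one_iff)
    have "Q (a * a + a * a - 1) \<le> 1 + \<epsilon>" if "0 < \<epsilon>" for \<epsilon>
    proof -
      obtain s where s: "st s = s" "\<And>z. z * (a * a) = a * a * z \<Longrightarrow> z * s = s * z"
        "Q (s * s - (1 - a * a)) \<le> \<epsilon> / 2"
        using approx_sqrt_one_minus[OF sq(1,2,3), of "\<epsilon> / 2"] \<open>0 < \<epsilon>\<close> by (metis half_gt_zero)
      let ?e = "s * s - (1 - a * a)"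
      have "a * s = s * a"
        by (intro s(2)) (simp add: mult.assoc)
      then have "Q (a * a - s * s) \<le> Q (a * a + s * s)"
        by (intro Q_diff_squares_le sa s(1))
      also have "\<dots> = Q (1 + ?e)"
        by (simp add: algebra_simps)
      also have "\<dots> \<le> 1 + \<epsilon> / 2"
        using Q_add[of 1 ?e] Q_1_le s(3) by linarith
      finally have "Q (a * a - s * s) \<le> 1 + \<epsilon> / 2" .
      moreover have "a * a + a * a - 1 = (a * a - s * s) + ?e"
        by (simp add: algebra_simps)
      ultimately have "Q (a * a + a * a - 1) \<le> Q (a * a - s * s) + Q ?e"
        by (metis Q_add)
      then show ?thesis
        using \<open>Q (a * a - s * s) \<le> 1 + \<epsilon> / 2\<close> s(3) by linarith
    qed
    then have "Q (a * a + a * a - 1) \<le> 1"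
      by (rule field_le_epsilon)
    then have "Q (rc 1 - (a * a + a * a)) \<le> 1"
      using Q_commute[of "a * a + a * a" 1] by simp
    then have "Pos (a * a + a * a)"
      by (intro PosI[of _ 1]) (simp_all add: st_add sq)
    then show ?thesis
      by (rule Pos_double)
  qed
  \<comment> \<open>Scaling by \<open>c\<close> moves \<open>a\<close> into the open unit ball;
    \<open>Pos_unscale\<close> undoes it.\<close>
  define c where "c = 1 / (Q a + 1)"
  have c: "0 < c" "c * Q a < 1"
    by (auto simp: c_def divide_simps add_nonneg_eq_0_iff add_nonneg_pos)
  have "Pos ((rc c * a) * (rc c * a))"
    using c by (intro small) (simp_all add: st_cs_mult sa Q_cs_mult)
  also have "(rc c * a) * (rc c * a) = rc (c * c) * (a * a)"
    by (simp add: mult.assoc cs_left[of a] cs_cs)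
  finally show ?thesis
    using c by (auto dest: Pos_unscale[of "c * c"] simp del: of_real_mult)
qed

text \<open>With \<open>T = t + 2 \<delta>\<close> the element \<open>k' = (t - k) / T\<close> has
  seminorm below 1, and \<open>T (1 - k') = k + 2 \<delta>\<close>. So the root of
  \<open>1 - k'\<close>, scaled by the root of \<open>T\<close>, works: the shift costs
  \<open>2 \<delta>\<close> and the approximation another \<delta>, whence
  \<open>\<delta> = \<epsilon> / 3\<close>.\<close>

lemma approx_sqrt:
  assumes "Pos k" "0 < \<epsilon>"
  obtains r where "st r = r" "\<And>z. z * k = k * z \<Longrightarrow> z * r = r * z" "Q (r * r - k) \<le> \<epsilon>" "Pos r"
proof -
  define \<delta> where "\<delta> = \<epsilon> / 3"
  have \<delta>: "0 < \<delta>" using assms by (simp add: \<delta>_def)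
  then obtain t where t: "Q (rc t - k) \<le> t + \<delta>"
    using assms(1) unfolding Pos_def by blast
  define T where "T = t + 2 * \<delta>"
  have T: "0 < T"
    using t Q_nonneg[of "rc t - k"] \<delta> unfolding T_def by linarith
  define k' where "k' = rc (1 / T) * (rc t - k)"
  have sa: "st k = k" by (rule Pos_sa[OF assms(1)])
  have "Q k' = Q (rc t - k) / T"
    using T unfolding k'_def Q_rc_mult by simp
  then have k': "st k' = k'" "Q k' \<le> (t + \<delta>) / T" "(t + \<delta>) / T < 1"
    using t T \<delta> by (simp_all add: k'_def st_cs_mult st_diff sa divide_right_mono)
      (simp add: T_def)
  obtain s where s: "st s = s" "\<And>z. z * k' = k' * z \<Longrightarrow> z * s = s * z"
    "Q (s * s - (1 - k')) \<le> \<delta> / T" "Q (1 - s) \<le> (t + \<delta>) / T"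
    using approx_sqrt_one_minus[OF k', of "\<delta> / T"] \<delta> T by (metis divide_pos_pos)
  define r where "r = rc (sqrt T) * s"
  have Pos_s: "Pos s"
    using s(4) k'(3) by (intro PosI[of s 1] s(1)) simp
  have rr: "r * r = rc T * (s * s)"
    using T by (simp add: r_def mult.assoc cs_left[of s] cs_cs flip: of_real_mult)
  have "rc T * k' = rc t - k"
    using T by (simp add: k'_def cs_cs flip: of_real_mult)
  then have "r * r - k = rc T * (s * s - (1 - k')) + rc (2 * \<delta>)"
    by (simp add: rr T_def cs_add algebra_simps)
  then have "Q (r * r - k) \<le> T * Q (s * s - (1 - k')) + 2 * \<delta>"
    using Q_add[of "rc T * (s * s - (1 - k'))" "rc (2 * \<delta>)"] Q_rc_le[of "2 * \<delta>"] T \<delta>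
    by (simp add: Q_rc_mult)
  also have "\<dots> \<le> T * (\<delta> / T) + 2 * \<delta>"
    using s(3) T by (intro add_mono mult_left_mono) auto
  finally have "Q (r * r - k) \<le> \<epsilon>"
    using T by (simp add: \<delta>_def)
  moreover have "z * r = r * z" if "z * k = k * z" for z
    unfolding r_def by (intro commute_cs s(2)) (simp add: k'_def commute_cs commute_rc that)
  moreover have "st r = r" "Pos r"
    using T Pos_s s(1) by (simp_all add: r_def Pos_scale st_cs_mult)
  ultimately show ?thesis
    using that by blast
qed

text \<open>Order bounds give norm bounds: if \<open>c - m\<close> and \<open>c + m\<close> are
  nearly squares of commuting \<open>r\<close> and \<open>l\<close>, then \<open>2 m\<close> is
  nearly \<open>l\<^sup>2 - r\<^sup>2\<close>, and \<open>Q_diff_squares_le\<close> bounds this by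
  \<open>l\<^sup>2 + r\<^sup>2\<close>, which is nearly \<open>2 c\<close>.\<close>

lemma Q_le_Pos:
  assumes "Pos (rc c - m)" "Pos (rc c + m)" "0 \<le> c"
  shows "Q m \<le> c"
proof (rule field_le_epsilon)
  fix \<epsilon> :: real assume "0 < \<epsilon>"
  have sa: "st m = m"
    using Pos_sa[OF assms(2)] by (simp add: st_add)
  have \<epsilon>: "0 < \<epsilon> / 2" using \<open>0 < \<epsilon>\<close> by simp
  obtain r where r: "st r = r" "\<And>z. z * (rc c - m) = (rc c - m) * z \<Longrightarrow> z * r = r * z"
    "Q (r * r - (rc c - m)) \<le> \<epsilon> / 2" using approx_sqrt[OF assms(1) \<epsilon>] by metis
  obtain l where l: "st l = l" "\<And>z. z * (rc c + m) = (rc c + m) * z \<Longrightarrow> z * l = l * z"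
    "Q (l * l - (rc c + m)) \<le> \<epsilon> / 2" using approx_sqrt[OF assms(2) \<epsilon>] by metis
  let ?e = "r * r - (rc c - m)" and ?f = "l * l - (rc c + m)"
  have "m * r = r * m"
    by (intro r(2)) (simp add: algebra_simps cs_central[of m])
  then have "r * l = l * r"
    by (intro l(2)) (simp add: algebra_simps cs_central[of r] \<open>m * r = r * m\<close>)
  then have "Q (l * l - r * r) \<le> Q (l * l + r * r)"
    by (intro Q_diff_squares_le l(1) r(1)) simp
  also have "l * l + r * r = rc (2 * c) + (?e + ?f)"
    using cs_add[of "of_real c" "of_real c"] by (simp add: algebra_simps)
  also have "Q \<dots> \<le> Q (rc (2 * c)) + Q (?e + ?f)"
    by (rule Q_add)
  also have "\<dots> \<le> 2 * c + \<epsilon>"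
    using Q_rc_le[of "2 * c"] Q_add[of ?e ?f] r(3) l(3) assms(3) by linarith
  finally have "Q (l * l - r * r) \<le> 2 * c + \<epsilon>" .
  moreover have "rc 2 * m = (l * l - r * r) + (?e - ?f)"
    by (simp add: algebra_simps cs_2 mult_2)
  then have "2 * Q m \<le> Q (l * l - r * r) + Q (?e - ?f)"
    using Q_rc_mult[of 2 m] Q_add[of "l * l - r * r" "?e - ?f"] by simp
  ultimately show "Q m \<le> c + \<epsilon>"
    using Q_diff[of ?e ?f] r(3) l(3) by linarith
qed

text \<open>Classically, the negative part of \<open>h\<close> yields \<open>y\<close> with
  \<open>st y * y \<le> 0\<close>, and \<open>y = 0\<close> follows because \<open>y * st y\<close>
  and \<open>st y * y\<close> have the same nonzero spectrum. Here \<open>r\<close> plays the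
  absolute value of \<open>h\<close>, \<open>m\<close> its root and \<open>v = r - h\<close> twice
  the negative part, all up to small errors. In place of spectra, the identity
  \<open>w\<^sup>2 - \<sigma> w = st y * (z - \<sigma>) * y\<close> compares the two products. The
  outcome is that \<open>v\<close> is small, so \<open>h\<close> is a limit of positive elements
  \<open>r\<close>.\<close>

lemma Pos_adjoint_mult: "Pos (st x * x)"
proof -
  define h where "h = st x * x"
  have sa_h: "st h = h" by (simp add: h_def st_mult)
  \<comment> \<open>A bound for \<open>Q v\<close>, since \<open>Q r \<le> Q h + 1\<close> will
    hold.\<close>
  define B where "B = 2 * Q h + 1"
  have B: "1 \<le> B" by (simp add: B_def)
  have "\<exists>l. Pos l \<and> Q (h - l) \<le> \<eta>" if \<eta>: "0 < \<eta>" for \<eta>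
  proof -
    \<comment> \<open>Chosen so that \<open>6 * B * \<delta> \<le> \<eta> ^ 4\<close>, the bound
      needed for \<open>Q v ^ 4\<close> at the end; the cap 1 serves the bound on
      \<open>Q r\<close>.\<close>
    define \<epsilon> where "\<epsilon> = min 1 (\<eta> ^ 4 / (6 * B * (B + B * B)))"
    define \<delta> where "\<delta> = \<epsilon> * B + \<epsilon> * (B * B)"
    have \<epsilon>: "0 < \<epsilon>" "\<epsilon> \<le> 1"
      using B \<eta> by (auto simp: \<epsilon>_def intro!: divide_pos_pos mult_pos_pos add_pos_pos)
    then have \<delta>: "0 < \<delta>"
      using B by (auto simp: \<delta>_def intro!: add_pos_pos)
    have "\<delta> * (6 * B) = \<epsilon> * (6 * B * (B + B * B))"
      by (simp add: \<delta>_def algebra_simps)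
    also have "\<dots> \<le> \<eta> ^ 4 / (6 * B * (B + B * B)) * (6 * B * (B + B * B))"
      using B by (intro mult_right_mono) (auto simp: \<epsilon>_def)
    also have "\<dots> = \<eta> ^ 4"
      using B by (simp add: add_nonneg_eq_0_iff)
    finally have \<delta>_small: "\<delta> * (6 * B) \<le> \<eta> ^ 4" .
    obtain r where r: "st r = r" "\<And>z. z * (h * h) = h * h * z \<Longrightarrow> z * r = r * z"
      "Q (r * r - h * h) \<le> \<epsilon>" "Pos r"
      using approx_sqrt[OF Pos_square[OF sa_h] \<epsilon>(1)] by metis
    obtain m where m: "st m = m" "\<And>z. z * r = r * z \<Longrightarrow> z * m = m * z" "Q (m * m - r) \<le> \<epsilon>"
      using approx_sqrt[OF r(4) \<epsilon>(1)] by metis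
    have hr: "h * r = r * h" by (intro r(2)) (simp add: mult.assoc)
    have hm: "h * m = m * h" by (intro m(2) hr)
    have rm: "r * m = m * r" by (intro m(2)) simp
    have mr': "m * (r * z) = r * (m * z)" for z by (metis rm mult.assoc)
    have mh': "m * (h * z) = h * (m * z)" for z by (metis hm mult.assoc)
    have rh': "r * (h * z) = h * (r * z)" for z by (metis hr mult.assoc)
    note comm = hr[symmetric] hm[symmetric] rm[symmetric] mr' mh' rh'
    define v where "v = r - h"
    have sa_v: "st v = v" by (simp add: v_def st_diff r sa_h)
    have "(Q r)\<^sup>2 \<le> (Q h + 1)\<^sup>2"
    proof -
      have "(Q r)\<^sup>2 = Q ((r * r - h * h) + h * h)"
        using Q_square[OF r(1)] by simp
      also have "\<dots> \<le> 1 + (Q h)\<^sup>2"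
        using Q_add[of "r * r - h * h" "h * h"] r(3) \<epsilon>(2) Q_square[OF sa_h] by linarith
      also have "\<dots> \<le> (Q h + 1)\<^sup>2"
        by (simp add: power2_eq_square algebra_simps)
      finally show ?thesis .
    qed
    then have "Q r \<le> Q h + 1"
      by (rule power2_le_imp_le) simp
    then have Qv: "Q v \<le> B"
      using Q_diff[of r h] by (simp add: v_def B_def)
    have Qvv: "Q (v * v) \<le> B * B"
      using Q_mult[of v v] mult_mono[OF Qv Qv] B by simp
    define y where "y = x * v"
    define w where "w = st y * y"
    define z where "z = y * st y"
    define k where "k = (m * v) * (m * v)"
    define e where "e = w + k"
    have w: "w = v * h * v"
      by (simp add: w_def y_def h_def st_mult sa_v mult.assoc)
    have sa_mv: "st (m * v) = m * v"
      unfolding st_mult sa_v m(1) by (simp add: v_def algebra_simps comm)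
    have sa_w: "st w = w" by (simp add: w_def st_mult)
    have sa_z: "st z = z" by (simp add: z_def st_mult)
    have Pos_k: "Pos k" unfolding k_def by (intro Pos_square sa_mv)
    have sa_e: "st e = e" by (simp add: e_def st_add sa_w Pos_sa[OF Pos_k])
    \<comment> \<open>\<open>(r + h) * v = r\<^sup>2 - h\<^sup>2\<close> is small, hence
      \<open>w = h v\<^sup>2\<close> is close to \<open>- k\<close>, a negative element.\<close>
    have "e = (r * r - h * h) * v + (m * m - r) * (v * v)"
      unfolding e_def w k_def by (simp add: v_def algebra_simps comm)
    then have "Q e \<le> Q ((r * r - h * h) * v) + Q ((m * m - r) * (v * v))"
      by (simp add: Q_add)
    also have "\<dots> \<le> \<epsilon> * B + \<epsilon> * (B * B)"
      using B \<epsilon> r(3) m(3) Qv Qvv by (intro add_mono order.trans[OF Q_mult] mult_mono) auto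
    finally have Qe: "Q e \<le> \<delta>" by (simp add: \<delta>_def)
    define W where "W = Q w"
    have W: "W = (Q y)\<^sup>2" by (simp add: W_def w_def Q_cstar)
    have W0: "0 \<le> W" by (simp add: W_def)
    \<comment> \<open>\<open>a\<close> and \<open>c\<close> are, up to a factor 2 and a sign, the
      real and imaginary parts of \<open>y\<close>; they are self-adjoint, and their squares add up
      to \<open>2 (z + w)\<close>.\<close>
    have Pos_zw: "Pos (z + w)"
    proof -
      define a where "a = y + st y"
      define c where "c = cs \<i> * (st y - y)"
      have "st a = a" by (simp add: a_def st_add add.commute)
      moreover have "st c = c"
        by (simp add: c_def st_cs_mult st_diff cs_minus algebra_simps)
      ultimately have "Pos (a * a + c * c)"
        by (intro Pos_add Pos_square)
      also have "a * a + c * c = (z + w) + (z + w)"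
      proof -
        have "c * c = - ((st y - y) * (st y - y))"
          by (simp add: c_def mult.assoc cs_left[of "st y - y"] cs_cs cs_minus)
        then show ?thesis
          by (simp add: a_def z_def w_def algebra_simps)
      qed
      finally show ?thesis by (rule Pos_double)
    qed
    \<comment> \<open>Adding \<open>k\<close> turns \<open>w\<close> into the small
      \<open>e\<close>. So \<open>z\<close> is nearly positive, although \<open>w\<close> is nearly
      negative.\<close>
    have "Pos ((z + w) + k + (rc \<delta> - e))"
      by (rule Pos_add[OF Pos_add[OF Pos_zw Pos_k] Pos_norm[OF sa_e Qe]])
    then have Pos_z: "Pos (z + rc \<delta>)"
      by (simp add: e_def algebra_simps)
    have "Q z \<le> W"
      using Q_mult[of y "st y"] by (simp add: z_def W power2_eq_square)
    then have Qz: "Q (z + rc \<delta>) \<le> W + \<delta>"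
      using Q_add[of z "rc \<delta>"] Q_rc_le[of \<delta>] \<delta> by linarith
    \<comment> \<open>As \<open>z + \<delta>\<close> lies between 0 and \<open>2 \<sigma>\<close>,
      its distance from \<sigma> is at most \<sigma>, which leaves
      \<open>\<sigma> + \<delta>\<close> for \<open>z\<close>.\<close>
    define \<sigma> where "\<sigma> = W + \<delta>"
    have \<sigma>: "0 < \<sigma>" using W0 \<delta> by (simp add: \<sigma>_def)
    have "Pos (rc \<sigma> - (z + rc \<delta> - rc \<sigma>))"
    proof -
      have "Pos (rc (\<sigma> + \<sigma>) - (z + rc \<delta>))"
        using Qz \<sigma> by (intro Pos_norm Pos_sa[OF Pos_z]) (simp add: \<sigma>_def)
      then show ?thesis unfolding rc_add by (simp add: algebra_simps)
    qed
    moreover have "Pos (rc \<sigma> + (z + rc \<delta> - rc \<sigma>))"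
      using Pos_z by (simp add: algebra_simps)
    ultimately have "Q (z + rc \<delta> - rc \<sigma>) \<le> \<sigma>"
      using \<sigma> by (intro Q_le_Pos) auto
    then have zs: "Q (z - rc \<sigma>) \<le> \<sigma> + \<delta>"
      using Q_diff[of "z + rc \<delta> - rc \<sigma>" "rc \<delta>"] Q_rc_le[of \<delta>] \<delta> by simp
    have "w * w - rc \<sigma> * w = st y * (z - rc \<sigma>) * y"
      by (simp add: w_def z_def algebra_simps cs_left[of "st y"])
    then have "Q (w * w - rc \<sigma> * w) \<le> Q (st y) * Q (z - rc \<sigma>) * Q y"
      by (metis Q_mult Q_nonneg mult_right_mono order.trans)
    also have "\<dots> = W * Q (z - rc \<sigma>)"
      by (simp add: W power2_eq_square)
    also have "\<dots> \<le> W * (\<sigma> + \<delta>)"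
      using zs W0 by (intro mult_left_mono)
    finally have "Pos (rc (W * (\<sigma> + \<delta>)) - (w * w - rc \<sigma> * w))"
      by (intro Pos_norm) (simp_all add: st_diff st_cs_mult sa_w, simp add: st_mult sa_w)
    \<comment> \<open>This square cancels \<open>w\<^sup>2\<close> in the preceding inequality and
      leaves a lower bound linear in \<open>w\<close>.\<close>
    moreover have "Pos ((w + rc W) * (w + rc W))"
      by (intro Pos_square) (simp add: st_add sa_w)
    ultimately have "Pos ((rc (W * (\<sigma> + \<delta>)) - (w * w - rc \<sigma> * w)) + (w + rc W) * (w + rc W))"
      by (rule Pos_add)
    also have "(rc (W * (\<sigma> + \<delta>)) - (w * w - rc \<sigma> * w)) + (w + rc W) * (w + rc W)
        = rc (W * \<sigma> + W * \<delta> + W * W) + rc (\<sigma> + 2 * W) * w"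
      by (simp add: rc_add rc_mult algebra_simps cs_central[of w] cs_2 mult_2 del: of_real_add of_real_mult)
    finally have *: "Pos (rc (W * \<sigma> + W * \<delta> + W * W) + rc (\<sigma> + 2 * W) * w)" .
    define \<beta> where "\<beta> = \<sigma> + 2 * W"
    have \<beta>: "0 < \<beta>" using \<sigma> W0 by (simp add: \<beta>_def)
    define \<gamma> where "\<gamma> = (W * \<sigma> + W * \<delta> + W * W) / \<beta>"
    have "W * \<sigma> + W * \<delta> + W * W = \<beta> * \<gamma>"
      using \<beta> by (simp add: \<gamma>_def)
    then have "Pos (rc \<beta> * (rc \<gamma> + w))"
      using * unfolding \<beta>_def[symmetric] by (simp add: rc_mult distrib_left del: of_real_mult)
    then have Pos1: "Pos (rc \<gamma> + w)"
      using \<beta> by (rule Pos_unscale)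
    have "Pos (k + (rc \<delta> - e))"
      by (intro Pos_add Pos_k Pos_norm sa_e Qe)
    then have Pos2: "Pos (rc \<delta> - w)" by (simp add: e_def algebra_simps)
    define c where "c = max \<gamma> \<delta>"
    have "Pos (rc (c - \<gamma>) + (rc \<gamma> + w))"
      by (intro Pos_add Pos1 Pos_const) (simp add: c_def)
    moreover have "Pos (rc (c - \<delta>) + (rc \<delta> - w))"
      by (intro Pos_add Pos2 Pos_const) (simp add: c_def)
    ultimately have "Q w \<le> c"
      using \<delta> by (intro Q_le_Pos) (simp_all add: rc_diff c_def del: of_real_diff)
    \<comment> \<open>The two cases of \<open>Q w \<le> max \<gamma> \<delta>\<close>. In the second
      one, inserting \<beta> leaves \<open>W\<^sup>2 \<le> W \<delta>\<close>, so
      \<open>W \<le> \<delta>\<close> either way.\<close>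
    then have "W \<le> \<delta> \<or> W * \<beta> \<le> W * \<sigma> + W * \<delta> + W * W"
      using \<beta> by (auto simp: c_def W_def \<gamma>_def field_simps max_def split: if_splits)
    then have "W \<le> \<delta> \<or> W * W \<le> W * \<delta>"
      by (auto simp: \<beta>_def algebra_simps)
    then have Ws: "Q w \<le> \<delta>"
      using \<delta> W0 unfolding W_def[symmetric] by (auto simp: mult_le_cancel_left)
    \<comment> \<open>\<open>v\<^sup>3 = (r - h) v\<^sup>2 = 2 r v\<^sup>2 - (r\<^sup>2 - h\<^sup>2)
      v\<close>, and \<open>2 r v\<^sup>2\<close> is close to \<open>2 k\<close>, which is small
      because \<open>w\<close> and \<open>e\<close> are.\<close>
    have vvv: "v * v * v = (k + k) + ((r - m * m) * (v * v) + (r - m * m) * (v * v))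
        - (r * r - h * h) * v"
      unfolding k_def by (simp add: v_def algebra_simps comm)
    have 1: "Q ((r - m * m) * (v * v)) \<le> \<epsilon> * (B * B)"
      using B \<epsilon> m(3) Q_commute[of r "m * m"]
      by (intro order.trans[OF Q_mult[of _ "v * v"]] mult_mono Qvv) auto
    have 2: "Q ((r * r - h * h) * v) \<le> \<epsilon> * B"
      using B \<epsilon> r(3) Qv by (intro order.trans[OF Q_mult] mult_mono) auto
    have "Q k \<le> 2 * \<delta>"
      using Q_diff[of e w] Qe Ws by (simp add: e_def)
    moreover have "Q (v * v * v) \<le> (Q k + Q k) + (\<epsilon> * (B * B) + \<epsilon> * (B * B)) + \<epsilon> * B"
      unfolding vvv using 1 2 by (intro order.trans[OF Q_diff] order.trans[OF Q_add] add_mono) auto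
    moreover have "\<epsilon> * (B * B) + \<epsilon> * (B * B) + \<epsilon> * B \<le> 2 * \<delta>"
      using \<epsilon> B by (simp add: \<delta>_def)
    ultimately have "Q (v * v * v) \<le> 6 * \<delta>"
      by linarith
    \<comment> \<open>For self-adjoint \<open>v\<close> the C*-identity, used twice, gives
      \<open>Q v ^ 4 = Q (v ^ 4)\<close>; so a small cube forces a small \<open>v\<close>.\<close>
    have "Q v ^ 4 = (Q (v * v))\<^sup>2"
      by (simp add: Q_square[OF sa_v] flip: power_mult)
    also have "\<dots> = Q (v * (v * v * v))"
      using Q_square[of "v * v"] by (simp add: st_mult sa_v mult.assoc)
    also have "\<dots> \<le> B * (6 * \<delta>)"
      using B by (intro order.trans[OF Q_mult[of v]] mult_mono Qv \<open>Q (v * v * v) \<le> 6 * \<delta>\<close>) auto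
    also have "\<dots> \<le> \<eta> ^ 4"
      using \<delta>_small by (simp add: mult_ac)
    finally have "Q v \<le> \<eta>"
      using \<eta> by (intro power_le_imp_le_base[of "Q v" 3]) auto
    then have "Q (h - r) \<le> \<eta>"
      using Q_commute[of h r] by (simp add: v_def)
    then show ?thesis using r(4) by blast
  qed
  then show ?thesis
    using Pos_limit[OF sa_h] by (simp add: h_def)
qed

text \<open>With \<open>r\<^sup>2\<close> close to \<open>k\<close>, the element is close to
  \<open>st (r * y) * (r * y)\<close>. The error is multiplied by \<open>(Q y)\<^sup>2\<close>,
  which determines \<delta>.\<close>

lemma Pos_conjugate:
  assumes "Pos k" shows "Pos (st y * k * y)"
proof (rule Pos_limit)
  show "st (st y * k * y) = st y * k * y"
    by (simp add: st_mult Pos_sa[OF assms] mult.assoc)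
  fix \<epsilon> :: real assume \<epsilon>: "0 < \<epsilon>"
  define \<delta> where "\<delta> = \<epsilon> / ((Q y)\<^sup>2 + 1)"
  have \<delta>: "0 < \<delta>" using \<epsilon> by (simp add: \<delta>_def add_nonneg_pos)
  obtain r where r: "st r = r" "Q (r * r - k) \<le> \<delta>"
    using approx_sqrt[OF assms \<delta>] by metis
  have "Pos (st (r * y) * (r * y))"
    by (rule Pos_adjoint_mult)
  moreover have "st y * k * y - st (r * y) * (r * y) = st y * (k - r * r) * y"
    by (simp add: st_mult r algebra_simps)
  then have "Q (st y * k * y - st (r * y) * (r * y)) \<le> Q (st y) * Q (k - r * r) * Q y"
    by (metis Q_mult Q_nonneg mult_right_mono order.trans)
  moreover have "Q (st y) * Q (k - r * r) * Q y \<le> (Q y)\<^sup>2 * \<delta>"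
    using mult_left_mono[OF r(2), of "(Q y)\<^sup>2"] Q_commute[of k "r * r"]
    by (simp add: power2_eq_square mult_ac)
  moreover have "(Q y)\<^sup>2 * \<delta> \<le> \<epsilon>"
    using \<epsilon> by (simp add: \<delta>_def divide_simps add_nonneg_pos)
  ultimately show "\<exists>l. Pos l \<and> Q (st y * k * y - l) \<le> \<epsilon>"
    by (meson order.trans)
qed

end

section \<open>The Hahn-Banach theorem\<close>

definition sublinear :: "(real \<Rightarrow> 'v \<Rightarrow> 'v::ab_group_add) \<Rightarrow> ('v \<Rightarrow> real) \<Rightarrow> bool" where
  "sublinear sc q \<longleftrightarrow> (\<forall>x y. q (x + y) \<le> q x + q y) \<and> (\<forall>c\<ge>0. \<forall>x. q (sc c x) = c * q x)"

text \<open>The scaling is a parameter because the real structure in the application is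
  multiplication by the central elements \<open>rc r\<close>.\<close>

locale real_vector_space = vector_space scale
  for scale :: "real \<Rightarrow> 'v \<Rightarrow> 'v::ab_group_add" (infixr \<open>*r\<close> 75)
begin

lemma sublinear_0: "sublinear scale q \<Longrightarrow> q 0 = 0"
  unfolding sublinear_def by (metis mult_zero_left order_refl scale_zero_left)

lemma sublinear_minus: "sublinear scale q \<Longrightarrow> - q (- x) \<le> q x"
  using sublinear_0[of q] unfolding sublinear_def
  by (metis add.right_inverse minus_le_iff le_add_same_cancel1 neg_le_iff_le add_le_imp_le_left
      add.commute neg_eq_iff_add_eq_0 diff_le_eq diff_0)

text \<open>Descent in the direction \<open>y\<close>: a sublinear functional below \<open>q\<close>, with value at most \<open>- q y\<close> at \<open>- y\<close>.\<close>

definition descend :: "('v \<Rightarrow> real) \<Rightarrow> 'v \<Rightarrow> 'v \<Rightarrow> real" where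
  "descend q y x = (INF t\<in>{0..}. q (x + t *r y) - t * q y)"

lemma descend_bdd:
  assumes "sublinear scale q"
  shows "bdd_below ((\<lambda>t. q (x + t *r y) - t * q y) ` {0..})"
proof (rule bdd_belowI2)
  fix t :: real assume "t \<in> {0..}"
  then have "t * q y \<le> q (x + t *r y) + q (- x)"
    using assms unfolding sublinear_def by (metis add.commute add_uminus_conv_diff add_diff_cancel_left' atLeast_iff)
  then show "- q (- x) \<le> q (x + t *r y) - t * q y" by simp
qed

lemma descend_le: "sublinear scale q \<Longrightarrow> 0 \<le> t \<Longrightarrow> descend q y x \<le> q (x + t *r y) - t * q y"
  unfolding descend_def by (rule cINF_lower[OF descend_bdd]) auto

lemma descend_greatest:
  "(\<And>t. 0 \<le> t \<Longrightarrow> c \<le> q (x + t *r y) - t * q y) \<Longrightarrow> c \<le> descend q y x"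
  unfolding descend_def by (rule cINF_greatest) auto

text \<open>A shift \<open>s\<close> for \<open>x\<close> and a shift \<open>t\<close> for
  \<open>z\<close> combine to the shift \<open>s + t\<close> for \<open>x + z\<close>; the two
  infima are then taken one after the other. Homogeneity needs only one inequality, which is applied
  to \<open>c\<close> and to \<open>1 / c\<close>.\<close>

lemma sublinear_descend:
  assumes q: "sublinear scale q" shows "sublinear scale (descend q y)"
proof -
  have scale_le: "descend q y (c *r x) \<le> c * descend q y x" if c: "0 < c" for c x
  proof -
    have "descend q y (c *r x) / c \<le> descend q y x"
    proof (rule descend_greatest)
      fix t :: real assume t: "0 \<le> t"
      have "descend q y (c *r x) \<le> q (c *r x + (c * t) *r y) - (c * t) * q y"
        using q c t by (intro descend_le) auto
      also have "c *r x + (c * t) *r y = c *r (x + t *r y)"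
        by (simp add: scale_right_distrib)
      also have "q \<dots> = c * q (x + t *r y)"
        using q c by (simp add: sublinear_def)
      finally show "descend q y (c *r x) / c \<le> q (x + t *r y) - t * q y"
        unfolding pos_divide_le_eq[OF c] by (simp add: algebra_simps)
    qed
    then show ?thesis using c by (simp add: pos_divide_le_eq mult.commute)
  qed
  have scale: "descend q y (c *r x) = c * descend q y x" if "0 \<le> c" for c x
  proof (cases "c = 0")
    case True
    have "descend q y 0 \<le> 0"
      using descend_le[OF q, of 0 y 0] sublinear_0[OF q] by simp
    moreover have "0 \<le> descend q y 0"
      using q by (intro descend_greatest) (simp add: sublinear_def)
    ultimately show ?thesis using True by simp
  next
    case False
    then have c: "0 < c" using that by simp
    have "c * descend q y ((1 / c) *r (c *r x)) \<le> descend q y (c *r x)"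
      using scale_le[of "1 / c" "c *r x"] c by (simp add: field_simps del: scale_scale)
    then show ?thesis
      using scale_le[OF c, of x] c by simp
  qed
  have "descend q y (x + z) \<le> descend q y x + descend q y z" for x z
  proof -
    have 1: "descend q y (x + z) \<le> (q (x + s *r y) - s * q y) + (q (z + t *r y) - t * q y)"
      if "0 \<le> s" "0 \<le> t" for s t
    proof -
      have "descend q y (x + z) \<le> q ((x + z) + (s + t) *r y) - (s + t) * q y"
        using that by (intro descend_le q) auto
      also have "(x + z) + (s + t) *r y = (x + s *r y) + (z + t *r y)"
        by (simp add: scale_left_distrib)
      also have "q \<dots> \<le> q (x + s *r y) + q (z + t *r y)"
        using q by (simp add: sublinear_def)
      finally show ?thesis by (simp add: algebra_simps)
    qed
    have "descend q y (x + z) - descend q y z \<le> descend q y x"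
    proof (rule descend_greatest)
      fix s :: real assume s: "0 \<le> s"
      have "descend q y (x + z) - (q (x + s *r y) - s * q y) \<le> descend q y z"
        using 1[OF s] by (intro descend_greatest) (simp add: algebra_simps)
      then show "descend q y (x + z) - descend q y z \<le> q (x + s *r y) - s * q y"
        by simp
    qed
    then show ?thesis by simp
  qed
  with scale show ?thesis by (simp add: sublinear_def)
qed

lemma descend_below: "sublinear scale q \<Longrightarrow> descend q y x \<le> q x"
  using descend_le[of q 0 y x] by simp

text \<open>A minimal sublinear functional below \<open>q\<close> equals all its descents, hence is linear.\<close>

lemma minimal_sublinear:
  assumes q: "sublinear scale q"
  obtains f where "sublinear scale f" "\<And>x. f x \<le> q x" "\<And>x y. f (x + y) = f x + f y"
    "\<And>c x. f (c *r x) = c * f x"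
proof -
  define A where "A = {f. sublinear scale f \<and> (\<forall>x. f x \<le> q x)}"
  define P where "P = (\<lambda>f g :: 'v \<Rightarrow> real. \<forall>x. g x \<le> f x)"
  have "partial_order_on A (relation_of P A)"
    unfolding P_def by (rule partial_order_on_relation_ofI) (auto intro: order.trans intro!: ext order.antisym)
  moreover have "\<exists>u\<in>A. \<forall>a\<in>C. P a u" if "C \<in> Chains (relation_of P A)" for C
  proof (cases "C = {}")
    case True
    then show ?thesis using q by (intro bexI[of _ q]) (auto simp: A_def)
  next
    case False
    have CA: "C \<subseteq> A" using that by (auto simp: Chains_def relation_of_def)
    have sub: "sublinear scale f" "f x \<le> q x" if "f \<in> C" for f x
      using CA that by (auto simp: A_def)
    have chain: "P f g \<or> P g f" if "f \<in> C" "g \<in> C" for f g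
      using that \<open>C \<in> Chains (relation_of P A)\<close> by (auto simp: Chains_def relation_of_def)
    \<comment> \<open>The infimum of a chain is finite, since every member stays above
      \<open>- q (- x)\<close>.\<close>
    define u where "u = (\<lambda>x. INF f\<in>C. f x)"
    have bdd: "bdd_below ((\<lambda>f. f x) ` C)" for x
    proof (rule bdd_belowI2)
      fix f assume "f \<in> C"
      then show "- q (- x) \<le> f x"
        using sublinear_minus[OF sub(1), of f x] sub(2)[of f "- x"] by linarith
    qed
    have u_le: "u x \<le> f x" if "f \<in> C" for f x
      unfolding u_def by (rule cINF_lower[OF bdd that])
    have u_greatest: "c \<le> u x" if "\<And>f. f \<in> C \<Longrightarrow> c \<le> f x" for c x
      unfolding u_def using False that by (intro cINF_greatest)
    have add: "u (x + y) \<le> u x + u y" for x y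
    proof -
      \<comment> \<open>Subadditivity of an infimum needs one member for both summands: of two
        members of a chain the smaller one serves.\<close>
      have key: "u (x + y) \<le> f x + g y" if fg: "f \<in> C" "g \<in> C" for f g
      proof -
        have "u (x + y) \<le> f x + f y" "u (x + y) \<le> g x + g y"
          using u_le[OF fg(1)] u_le[OF fg(2)] sub(1)[OF fg(1)] sub(1)[OF fg(2)]
          unfolding sublinear_def by (meson order.trans)+
        moreover have "f x \<le> g x \<or> g y \<le> f y"
          using chain[OF fg] by (auto simp: P_def)
        moreover have "f y \<le> g y \<and> f x \<le> g x \<or> g x \<le> f x \<and> g y \<le> f y"
          using chain[OF fg] by (auto simp: P_def)
        ultimately show ?thesis by linarith
      qed
      have key2: "u (x + y) - f x \<le> u y" if "f \<in> C" for f
      proof (rule u_greatest)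
        fix g assume "g \<in> C"
        show "u (x + y) - f x \<le> g y"
          using key[OF that \<open>g \<in> C\<close>] by simp
      qed
      have "u (x + y) - u y \<le> u x"
      proof (rule u_greatest)
        fix f assume "f \<in> C"
        show "u (x + y) - u y \<le> f x"
          using key2[OF \<open>f \<in> C\<close>] by simp
      qed
      then show ?thesis by simp
    qed
    have scale_le: "c * u x \<le> u (c *r x)" if "0 \<le> c" for c x
    proof (rule u_greatest)
      fix f assume "f \<in> C"
      then have "f (c *r x) = c * f x"
        using sub(1) that by (simp add: sublinear_def)
      then show "c * u x \<le> f (c *r x)"
        using mult_left_mono[OF u_le[OF \<open>f \<in> C\<close>] that] by simp
    qed
    have "u (c *r x) = c * u x" if "0 \<le> c" for c x
    proof (cases "c = 0")
      case True
      obtain f where "f \<in> C" using False by blast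
      then have "u 0 \<le> 0" using u_le[of f 0] sublinear_0[OF sub(1)[of f]] by simp
      moreover have "0 \<le> u 0" using scale_le[of 0 0] by simp
      ultimately show ?thesis using True by simp
    next
      case c: False
      have "(1 / c) * u (c *r x) \<le> u x"
        using scale_le[of "1 / c" "c *r x"] that c by simp
      then show ?thesis
        using scale_le[OF that, of x] that c by (simp add: field_simps)
    qed
    then have "sublinear scale u"
      using add by (simp add: sublinear_def)
    moreover obtain f where "f \<in> C" using False by blast
    then have "u x \<le> q x" for x
      using u_le[of f x] sub(2)[of f x] by linarith
    ultimately have "u \<in> A"
      by (simp add: A_def)
    then show ?thesis
      using u_le by (auto simp: P_def)
  qed
  ultimately obtain f where f: "f \<in> A" and min: "\<And>g. g \<in> A \<Longrightarrow> P f g \<Longrightarrow> g = f"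
    using predicate_Zorn[of A P] by blast
  have sub: "sublinear scale f" and le: "\<And>x. f x \<le> q x"
    using f by (auto simp: A_def)
  \<comment> \<open>A descent of \<open>f\<close> lies again in \<open>A\<close> and below
    \<open>f\<close>, so minimality forces equality. The parameter 1 in \<open>descend_le\<close>
    then reads \<open>f x \<le> f (x + y) - f y\<close>, which is superadditivity.\<close>
  have eq: "descend f y = f" for y
    using descend_below[OF sub, of y] le sublinear_descend[OF sub]
    by (intro min) (auto simp: A_def P_def intro: order.trans)
  have add: "f (x + y) = f x + f y" for x y
    using descend_le[OF sub, of 1 y x] sub unfolding eq by (simp add: sublinear_def order.antisym)
  have neg: "f (- x) = - f x" for x
    using add[of x "- x"] sublinear_0[OF sub] by simp
  have "f (c *r x) = c * f x" for c x
  proof (cases "0 \<le> c")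
    case True
    then show ?thesis using sub by (simp add: sublinear_def)
  next
    case False
    then have "f ((- c) *r x) = (- c) * f x"
      using sub unfolding sublinear_def by (metis le_minus_iff linear minus_zero)
    then show ?thesis using neg[of "c *r x"] by simp
  qed
  with add le sub show ?thesis using that by blast
qed

text \<open>The minimal functional is taken below the descent of \<open>q\<close> in the direction
  \<open>h\<close>. This forces \<open>f (- h) \<le> - q h\<close>, so the bound
  \<open>f h \<le> q h\<close> is attained.\<close>

theorem Hahn_Banach:
  assumes q: "sublinear scale q"
  obtains f where "\<And>x. f x \<le> q x" "\<And>x y. f (x + y) = f x + f y"
    "\<And>c x. f (c *r x) = c * f x" "f h = q h"
proof -
  obtain f where f: "\<And>x. f x \<le> descend q h x" "\<And>x y. f (x + y) = f x + f y"
    "\<And>c x. f (c *r x) = c * f x"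
    using minimal_sublinear[OF sublinear_descend[OF q, of h]] by metis
  have le: "f x \<le> q x" for x
    using f(1) descend_below[OF q] order.trans by blast
  have "f (- h) \<le> - q h"
    using f(1)[of "- h"] descend_le[OF q, of 1 h "- h"] sublinear_0[OF q] by simp
  moreover have "f (- h) = - f h"
    using f(3)[of "-1" h] by simp
  ultimately have "f h = q h"
    using le[of h] by simp
  with le f(2,3) show ?thesis using that by blast
qed

end

section \<open>States and approximate lifting\<close>

context cstar_seminormed
begin

text \<open>Monotonicity of the norm on positive elements, through
  \<open>c\<^sup>2 \<le> a\<^sup>2 \<le> (Q a)\<^sup>2\<close>; stated for squares so that the
  C*-identity returns to \<open>Q c\<close> and \<open>Q a\<close>.\<close>

lemma Q_le_of_Pos_square:
  assumes "st a = a" "st c = c" "Pos (a * a - c * c)"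
  shows "Q c \<le> Q a"
proof -
  have "Pos (rc ((Q a)\<^sup>2) - a * a)"
    using assms by (intro Pos_norm) (simp_all add: st_mult Q_square)
  from Pos_add[OF this assms(3)] have "Pos (rc ((Q a)\<^sup>2) - c * c)"
    by simp
  moreover have "Pos (rc ((Q a)\<^sup>2) + c * c)"
    by (intro Pos_add Pos_const Pos_square assms) simp
  ultimately have "Q (c * c) \<le> (Q a)\<^sup>2"
    by (intro Q_le_Pos) auto
  then have "(Q c)\<^sup>2 \<le> (Q a)\<^sup>2"
    using assms by (simp add: Q_square)
  then show ?thesis
    by (rule power2_le_imp_le) simp
qed

text \<open>For self-adjoint \<open>x\<close> this is the upper bound of the spectrum.\<close>

definition specmax :: "'a \<Rightarrow> real" where
  "specmax x = (INF t. Q (rc t + x) - t)"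

section \<open>The upper spectral bound as a sublinear functional\<close>

context
  assumes Q_1: "Q 1 = 1"
begin

lemma Q_rc: "Q (rc t) = \<bar>t\<bar>"
  using Q_rc_mult[of t 1] Q_1 by simp

lemma specmax_bdd: "bdd_below (range (\<lambda>t. Q (rc t + x) - t))"
proof (rule bdd_belowI2)
  fix t
  show "- Q x \<le> Q (rc t + x) - t"
    using Q_triangle[of "rc t" "- x"] Q_rc[of t] by simp
qed

lemma specmax_le: "specmax x \<le> Q (rc t + x) - t"
  unfolding specmax_def by (rule cINF_lower[OF specmax_bdd]) auto

lemma specmax_greatest: "(\<And>t. c \<le> Q (rc t + x) - t) \<Longrightarrow> c \<le> specmax x"
  unfolding specmax_def by (rule cINF_greatest) auto

lemma specmax_approx: "0 < \<delta> \<Longrightarrow> \<exists>t. Q (rc t + x) - t \<le> specmax x + \<delta>"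
proof (rule ccontr)
  assume "0 < \<delta>" "\<nexists>t. Q (rc t + x) - t \<le> specmax x + \<delta>"
  then have "specmax x + \<delta> \<le> specmax x"
    by (intro specmax_greatest) (auto simp: not_le intro: less_imp_le)
  then show False using \<open>0 < \<delta>\<close> by simp
qed

lemma real_vector_space_rc: "real_vector_space (\<lambda>r x. rc r * x)"
  by unfold_locales (simp_all add: algebra_simps cs_add cs_mult)

text \<open>Domination by \<open>specmax\<close> gives a real functional everything a state needs:
  positivity by \<open>specmax_Pos\<close>, vanishing on skew elements by
  \<open>specmax_skew\<close>, and the value 1 at the unit. The norm would not give positivity so
  directly.\<close>

lemma sublinear_specmax: "sublinear (\<lambda>r x. rc r * x) specmax"
  unfolding sublinear_def
proof (intro conjI allI impI)
  fix x y
  show "specmax (x + y) \<le> specmax x + specmax y"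
  proof (rule field_le_epsilon)
    fix \<epsilon> :: real assume "0 < \<epsilon>"
    then obtain s t where st: "Q (rc s + x) - s \<le> specmax x + \<epsilon> / 2"
      "Q (rc t + y) - t \<le> specmax y + \<epsilon> / 2"
      using specmax_approx[of "\<epsilon> / 2"] by (meson half_gt_zero)
    have "rc (s + t) + (x + y) = (rc s + x) + (rc t + y)"
      by (simp add: rc_add algebra_simps del: of_real_add)
    then have "Q (rc (s + t) + (x + y)) \<le> Q (rc s + x) + Q (rc t + y)"
      by (metis Q_add)
    then show "specmax (x + y) \<le> specmax x + specmax y + \<epsilon>"
      using specmax_le[of "x + y" "s + t"] st by linarith
  qed
next
  have le: "c * specmax x \<le> specmax (rc c * x)" if c: "0 < c" for c x
  proof (rule specmax_greatest)
    fix t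
    have "rc t + rc c * x = rc c * (rc (t / c) + x)"
      using c by (simp add: distrib_left flip: cs_mult)
    then have "Q (rc t + rc c * x) = c * Q (rc (t / c) + x)"
      using c Q_rc_mult by (metis abs_of_pos)
    then show "c * specmax x \<le> Q (rc t + rc c * x) - t"
      using mult_left_mono[OF specmax_le[of x "t / c"], of c] c
      by (simp add: right_diff_distrib)
  qed
  fix c x assume c: "(0::real) \<le> c"
  show "specmax (rc c * x) = c * specmax x"
  proof (cases "c = 0")
    case True
    have "specmax 0 \<le> 0" using specmax_le[of 0 0] by simp
    moreover have "0 \<le> specmax 0" by (rule specmax_greatest) (simp add: Q_rc)
    ultimately show ?thesis using True by simp
  next
    case False
    then have "(1 / c) * specmax (rc c * x) \<le> specmax x"
      using le[of "1 / c" "rc c * x"] c by (simp add: cs_cs)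
    then show ?thesis using le[of c x] c False by (simp add: field_simps)
  qed
qed

lemma specmax_Pos: "Pos k \<Longrightarrow> specmax (- k) \<le> 0"
proof (rule field_le_epsilon)
  fix \<epsilon> :: real assume "Pos k" "0 < \<epsilon>"
  then obtain t where "Q (rc t - k) \<le> t + \<epsilon>"
    unfolding Pos_def by blast
  then show "specmax (- k) \<le> 0 + \<epsilon>"
    using specmax_le[of "- k" t] by simp
qed

text \<open>With \<open>s = specmax h\<close> both \<open>h\<close> and \<open>s - h\<close> are
  positive, so \<open>h\<close> has distance at most \<open>s / 2\<close> from \<open>s / 2\<close>,
  and hence seminorm at most \<open>s\<close>.\<close>

lemma specmax_eq_Q:
  assumes "Pos h" shows "specmax h = Q h"
proof (rule antisym)
  show le: "specmax h \<le> Q h"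
    using specmax_le[of h 0] by simp
  define s where "s = specmax h"
  have "Pos (rc s - h)"
    unfolding Pos_def
  proof (intro conjI allI impI)
    show "st (rc s - h) = rc s - h"
      by (simp add: st_diff Pos_sa[OF assms])
    fix \<delta> :: real assume "0 < \<delta>"
    then obtain t where "Q (rc t + h) - t \<le> s + \<delta>"
      using specmax_approx unfolding s_def by blast
    moreover have "Q (rc (t + s) - (rc s - h)) = Q (rc t + h)"
      by (rule arg_cong[where f = Q]) (simp add: rc_add algebra_simps del: of_real_add)
    ultimately have "Q (rc (t + s) - (rc s - h)) \<le> (t + s) + \<delta>"
      by linarith
    then show "\<exists>t. Q (rc t - (rc s - h)) \<le> t + \<delta>" ..
  qed
  note P = this
  \<comment> \<open>A negative \<open>s\<close> would make the constant \<open>s\<close>, as the sum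
    of \<open>h\<close> and \<open>s - h\<close>, positive.\<close>
  have "0 \<le> s"
  proof (rule ccontr)
    assume "\<not> 0 \<le> s"
    have "Pos (rc s)" using Pos_add[OF assms P] by simp
    from specmax_Pos[OF this] have "specmax (- rc s) \<le> 0" .
    moreover have "- s \<le> specmax (- rc s)"
    proof (rule specmax_greatest)
      fix t
      have "rc t + - rc s = rc (t - s)" by (simp add: rc_diff del: of_real_diff)
      then show "- s \<le> Q (rc t + - rc s) - t" unfolding \<open>rc t + - rc s = rc (t - s)\<close> Q_rc by linarith
    qed
    ultimately show False using \<open>\<not> 0 \<le> s\<close> by linarith
  qed
  have half: "rc s = rc (s / 2) + rc (s / 2)"
    using rc_add[of "s / 2" "s / 2"] by (simp del: of_real_add)
  have "Q (h - rc (s / 2)) \<le> s / 2"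
    using P assms \<open>0 \<le> s\<close> by (intro Q_le_Pos) (simp_all add: half algebra_simps del: of_real_divide)
  then show "Q h \<le> specmax h"
    using Q_triangle[of h "rc (s / 2)"] Q_rc[of "s / 2"] \<open>0 \<le> s\<close> unfolding s_def[symmetric] by linarith
qed

text \<open>The spectrum of a skew element is imaginary. In norms,
  \<open>(Q (t + k))\<^sup>2 \<le> t\<^sup>2 + (Q k)\<^sup>2\<close>, so
  \<open>Q (t + k) - t\<close> tends to 0 for large \<open>t\<close>; the choice of \<open>t\<close>
  makes it at most \<epsilon>.\<close>

lemma specmax_skew:
  assumes "st k = - k" shows "specmax k \<le> 0"
proof (rule field_le_epsilon)
  fix \<epsilon> :: real assume \<epsilon>: "0 < \<epsilon>"
  define t where "t = (Q k)\<^sup>2 / \<epsilon>"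
  have t: "0 \<le> t" "(Q k)\<^sup>2 = t * \<epsilon>" using \<epsilon> by (auto simp: t_def)
  have "st (rc t + k) * (rc t + k) = rc (t * t) - k * k"
    by (simp add: st_add assms algebra_simps cs_central[of k] cs_mult)
  then have "(Q (rc t + k))\<^sup>2 = Q (rc (t * t) - k * k)"
    by (metis Q_cstar)
  also have "\<dots> \<le> t * t + (Q k)\<^sup>2"
    using Q_diff[of "rc (t * t)" "k * k"] Q_rc[of "t * t"] Q_mult[of k k] t
    by (simp add: power2_eq_square del: of_real_mult)
  also have "\<dots> \<le> (t + \<epsilon>)\<^sup>2"
    unfolding t(2) using t(1) \<epsilon> by (simp add: power2_eq_square distrib_left distrib_right)
  finally have "Q (rc t + k) \<le> t + \<epsilon>"
    by (rule power2_le_imp_le) (use t(1) \<epsilon> in simp)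
  then show "specmax k \<le> 0 + \<epsilon>"
    using specmax_le[of k t] by simp
qed

end

definition state :: "('a \<Rightarrow> complex) \<Rightarrow> bool" where
  "state \<omega> \<longleftrightarrow> (\<forall>x y. \<omega> (x + y) = \<omega> x + \<omega> y) \<and> (\<forall>c x. \<omega> (cs c * x) = c * \<omega> x) \<and>
     (\<forall>x. \<omega> (st x) = cnj (\<omega> x)) \<and> (\<forall>k. Pos k \<longrightarrow> 0 \<le> Re (\<omega> k)) \<and> \<omega> 1 = 1"

text \<open>Hahn-Banach gives a real functional \<open>f\<close> below \<open>specmax\<close> that
  attains \<open>specmax (st a * a) = (Q a)\<^sup>2\<close>. The usual formula
  \<open>f x - \<i> f (\<i> x)\<close> makes it complex linear.\<close>

theorem state_exists:
  assumes Q_1: "Q 1 = 1"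
  obtains \<omega> where "state \<omega>" "\<omega> (st a * a) = of_real ((Q a)\<^sup>2)"
proof -
  interpret R: real_vector_space "\<lambda>r x. rc r * x" by (rule real_vector_space_rc[OF Q_1])
  obtain f where f: "\<And>x. f x \<le> specmax x" "\<And>x y. f (x + y) = f x + f y"
    "\<And>c x. f (rc c * x) = c * f x" "f (st a * a) = specmax (st a * a)"
    using R.Hahn_Banach[OF sublinear_specmax[OF Q_1]] by metis
  have neg: "f (- x) = - f x" for x
    using f(3)[of "-1" x] by (simp add: cs_minus)
  \<comment> \<open>Both \<open>k\<close> and \<open>- k\<close> are skew, so \<open>f\<close>
    vanishes there by domination. Applied to \<open>st x - x\<close>, this makes \<omega>
    hermitian.\<close>
  have skew: "f k = 0" if "st k = - k" for k
    using f(1)[of k] f(1)[of "- k"] specmax_skew[OF Q_1, of k] specmax_skew[OF Q_1, of "- k"] that neg[of k]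
    by (simp add: st_minus)
  have f_st: "f (st x) = f x" for x
    using skew[of "st x - x"] f(2)[of "st x - x" x] by (simp add: st_diff)
  define \<omega> where "\<omega> = (\<lambda>x. Complex (f x) (- f (cs \<i> * x)))"
  have add: "\<omega> (x + y) = \<omega> x + \<omega> y" for x y
    by (simp add: \<omega>_def f(2) distrib_left complex_eq_iff)
  have scale: "\<omega> (cs c * x) = c * \<omega> x" for c x
  proof -
    have c: "cs c = rc (Re c) + cs \<i> * rc (Im c)"
      by (subst complex_eq[of c]) (simp add: cs_add cs_mult)
    have 1: "f (cs c * y) = Re c * f y + Im c * f (cs \<i> * y)" for y
    proof -
      have "cs c * y = rc (Re c) * y + rc (Im c) * (cs \<i> * y)"
        by (simp add: c distrib_right cs_cs mult.commute flip: cs_mult)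
      then show ?thesis by (simp only: f(2,3))
    qed
    have 2: "f (cs \<i> * (cs \<i> * x)) = - f x"
      by (simp add: cs_cs cs_minus neg)
    have "cs \<i> * (cs c * x) = cs c * (cs \<i> * x)"
      by (simp add: cs_cs mult.commute)
    then show ?thesis
      by (simp add: \<omega>_def 1 2 complex_eq_iff)
  qed
  have herm: "\<omega> (st x) = cnj (\<omega> x)" for x
  proof -
    have "cs \<i> * st x = - st (cs \<i> * x)"
      by (simp add: st_cs_mult cs_minus)
    then have "f (cs \<i> * st x) = - f (cs \<i> * x)"
      by (simp only: neg f_st)
    then show ?thesis by (simp add: \<omega>_def f_st complex_eq_iff)
  qed
  have pos: "0 \<le> Re (\<omega> k)" if "Pos k" for k
    using f(1)[of "- k"] specmax_Pos[OF Q_1 that] by (simp add: \<omega>_def neg)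
  \<comment> \<open>Taking \<open>t = 1\<close> in the infimum gives
    \<open>specmax (- 1) \<le> - 1\<close>, hence \<open>f 1 \<ge> 1\<close>.\<close>
  have f1: "f 1 = 1"
  proof -
    have "specmax 1 \<le> 1" using specmax_le[OF Q_1, of 1 0] Q_1 by simp
    moreover have "specmax (- 1) \<le> - 1" using specmax_le[OF Q_1, of "- 1" 1] by simp
    ultimately show ?thesis using f(1)[of 1] f(1)[of "- 1"] neg[of 1] by linarith
  qed
  have "\<omega> 1 = 1"
  proof -
    have "Im (\<omega> 1) = 0" using herm[of 1] by (simp add: complex_eq_iff)
    then show ?thesis by (simp add: \<omega>_def complex_eq_iff f1)
  qed
  moreover have "\<omega> (st a * a) = of_real ((Q a)\<^sup>2)"
  proof -
    have "\<omega> (st a * a) = cnj (\<omega> (st a * a))"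
      using herm[of "st a * a"] by (simp add: st_mult)
    then have "Im (\<omega> (st a * a)) = 0" by (simp add: complex_eq_iff)
    moreover have "Re (\<omega> (st a * a)) = (Q a)\<^sup>2"
      using f(4) specmax_eq_Q[OF Q_1 Pos_adjoint_mult[of a]] by (simp add: \<omega>_def Q_cstar)
    ultimately show ?thesis by (simp add: complex_eq_iff)
  qed
  ultimately show ?thesis
    using that[of \<omega>] add scale herm pos unfolding state_def by blast
qed

text \<open>Conjugating the positive element \<open>(Q x)\<^sup>2 - st x * x\<close> by
  \<open>y\<close>. This is what bounds left multiplication by \<open>x\<close> on the GNS
  space.\<close>

lemma state_bound:
  assumes "state \<omega>"
  shows "Re (\<omega> (st y * (st x * x) * y)) \<le> (Q x)\<^sup>2 * Re (\<omega> (st y * y))"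
proof -
  have "Pos (rc ((Q x)\<^sup>2) - st x * x)"
    by (intro Pos_norm) (simp_all add: st_mult Q_cstar)
  then have "Pos (st y * (rc ((Q x)\<^sup>2) - st x * x) * y)"
    by (rule Pos_conjugate)
  also have "st y * (rc ((Q x)\<^sup>2) - st x * x) * y
      = rc ((Q x)\<^sup>2) * (st y * y) + cs (- 1) * (st y * (st x * x) * y)"
    by (simp add: algebra_simps cs_central[of "st y"] cs_minus)
  finally have "0 \<le> Re (\<omega> (rc ((Q x)\<^sup>2) * (st y * y) + cs (- 1) * (st y * (st x * x) * y)))"
    using assms unfolding state_def by blast
  also have "\<omega> (rc ((Q x)\<^sup>2) * (st y * y) + cs (- 1) * (st y * (st x * x) * y))
      = of_real ((Q x)\<^sup>2) * \<omega> (st y * y) + (- 1) * \<omega> (st y * (st x * x) * y)"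
    using assms unfolding state_def by metis
  finally show ?thesis by simp
qed

end

text \<open>
  The approximate lift is \<open>x (1 + h\<^sup>2 / 4)\<inverse>\<close> with \<open>h = x\<^sup>* x\<close>, the inverse being replaced by a
  partial sum \<open>r\<close> of its Neumann series, so that it stays in the given *-subalgebra.
\<close>

lemma approximate_lift:
  fixes cs :: "complex \<Rightarrow> 'a::ring_1"
  assumes Q: "cstar_seminormed cs st Q" and Q': "cstar_seminormed cs st Q'"
    and le: "\<And>x. Q' x \<le> Q x"
    and D: "1 \<in> D" "\<And>x y. x \<in> D \<Longrightarrow> y \<in> D \<Longrightarrow> x + y \<in> D" "\<And>x y. x \<in> D \<Longrightarrow> y \<in> D \<Longrightarrow> x * y \<in> D"
      "\<And>x c. x \<in> D \<Longrightarrow> cs c * x \<in> D" "\<And>x. x \<in> D \<Longrightarrow> st x \<in> D"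
    and x: "x \<in> D" "Q' x \<le> 1"
  obtains x' where "x' \<in> D" "Q x' \<le> 2" "Q' (x - x') \<le> 5 / 8"
proof -
  interpret A: cstar_seminormed cs st Q by fact
  interpret B: cstar_seminormed cs st Q' by fact
  let ?rc = "\<lambda>r. cs (complex_of_real r)"
  define h where "h = st x * x"
  have sa_h: "st h = h" by (simp add: h_def A.st_mult)
  define \<kappa> where "\<kappa> = (Q h)\<^sup>2 / 4"
  have \<kappa>: "0 \<le> \<kappa>" by (simp add: \<kappa>_def)
  \<comment> \<open>The factor 1/4 gives \<open>h\<^sup>2 = 4 g\<close>, hence
    \<open>(1 + g)\<^sup>2 - h\<^sup>2 = (1 - g)\<^sup>2\<close>. This square will bound
    \<open>h * r\<close>.\<close>
  define g where "g = ?rc (1/4) * (h * h)"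
  have sa_g: "st g = g" by (simp add: g_def A.st_cs_mult) (simp add: A.st_mult sa_h)
  have Pos_g: "A.Pos g" unfolding g_def by (intro A.Pos_scale A.Pos_square sa_h) simp
  have Qg: "Q g \<le> \<kappa>"
    by (simp add: g_def A.Q_cs_mult A.Q_square[OF sa_h] \<kappa>_def)
  define f where "f = ?rc \<kappa> - g"
  have "Q f \<le> \<kappa>"
  proof (rule A.Q_le_Pos)
    show "A.Pos (?rc \<kappa> - f)" using Pos_g by (simp add: f_def)
    show "A.Pos (?rc \<kappa> + f)"
      unfolding f_def by (intro A.Pos_add A.Pos_const A.Pos_norm sa_g Qg \<kappa>)
  qed (rule \<kappa>)
  \<comment> \<open>Then \<open>1 + g = M (1 - e)\<close> with
    \<open>Q e \<le> \<kappa> / (1 + \<kappa>)\<close>: the Neumann series has ratio below 1 however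
    large \<open>g\<close> is.\<close>
  define M where "M = 1 + \<kappa>"
  have M: "0 < M" using \<kappa> by (simp add: M_def)
  define e where "e = ?rc (1 / M) * f"
  define \<theta> where "\<theta> = \<kappa> / M"
  have \<theta>: "0 \<le> \<theta>" "\<theta> < 1" using \<kappa> by (simp_all add: \<theta>_def M_def)
  have Qe: "Q e \<le> \<theta>"
    using \<open>Q f \<le> \<kappa>\<close> M unfolding e_def A.Q_rc_mult by (simp add: \<theta>_def divide_right_mono)
  have sa_e: "st e = e" by (simp add: e_def f_def A.st_cs_mult A.st_diff sa_g)
  have "h * g = g * h" unfolding g_def by (rule A.commute_cs) (simp add: mult.assoc)
  then have he: "h * e = e * h"
    unfolding e_def f_def by (intro A.commute_cs A.commute_rc)
  define d where "d = 1 + g"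
  have d: "d = ?rc M * (1 - e)"
  proof -
    have "?rc M * e = f" using M by (simp add: e_def A.cs_cs flip: of_real_mult)
    then show ?thesis
      by (simp add: right_diff_distrib f_def d_def M_def A.cs_add)
  qed
  have "(\<lambda>n. \<theta> ^ n) \<longlonglongrightarrow> 0"
    using \<theta> by (intro LIMSEQ_realpow_zero) auto
  \<comment> \<open>The truncation error \<open>x * p\<close> is to stay below 1/8.\<close>
  then have "\<forall>\<^sub>F n in sequentially. \<theta> ^ n < 1 / (8 * (Q x + 1))"
    by (rule order_tendstoD) (simp add: add_nonneg_pos)
  then obtain n where n: "0 < n" "\<theta> ^ n < 1 / (8 * (Q x + 1))"
    unfolding eventually_sequentially by (metis gr0_conv_Suc le_Suc_eq order_refl)
  define p where "p = e ^ n"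
  have Qp: "Q p \<le> \<theta> ^ n"
    using A.Q_power[OF n(1), of e] Qe power_mono[OF Qe A.Q_nonneg, of n] unfolding p_def
    by linarith
  have Q1p: "Q (1 - p) \<le> 2"
    using A.Q_diff[of 1 p] A.Q_1_le Qp power_le_one[of \<theta> n] \<theta> by linarith
  define r where "r = ?rc (1 / M) * (\<Sum>k<n. e ^ k)"
  have sa_r: "st r = r"
    by (simp add: r_def A.st_cs_mult A.st_sum A.st_power sa_e)
  have hr: "h * r = r * h"
    unfolding r_def by (rule A.commute_cs) (simp add: sum_distrib_left sum_distrib_right
        power_commuting_commutes[OF he[symmetric]])
  have gr: "g * r = r * g"
    unfolding g_def by (simp add: mult.assoc hr A.cs_left[of r]) (simp add: hr flip: mult.assoc)
  have "(1 - e) * (\<Sum>k<n. e ^ k) = 1 - e ^ n" for n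
  proof (induction n)
    case (Suc n)
    then show ?case
      by (simp add: distrib_left) (simp add: left_diff_distrib)
  qed simp
  then have dr: "d * r = 1 - p"
    using M by (simp add: d r_def p_def mult.assoc A.cs_left[of "1 - e"] A.cs_cs flip: of_real_mult)
  have sa_1p: "st (1 - p) = 1 - p"
    by (simp add: p_def A.st_diff A.st_power sa_e)
  have hh: "h * h = ?rc 4 * g"
    by (simp add: g_def A.cs_cs flip: of_real_mult)
  have gr': "r * (g * z) = g * (r * z)" for z
    by (metis gr mult.assoc)
  \<comment> \<open>Expansion of \<open>((1 + g) r)\<^sup>2\<close>. Dropping the positive terms
    with \<open>g\<close> leaves \<open>r\<^sup>2 \<le> (1 - p)\<^sup>2\<close>.\<close>
  have sq: "(1 - p) * (1 - p) = r * r + (g * (r * r) + g * (r * r)) + g * g * (r * r)"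
    unfolding dr[symmetric] by (simp add: d_def algebra_simps gr' gr[symmetric])
  have hr': "r * (h * z) = h * (r * z)" for z
    by (metis hr mult.assoc)
  have Pos_grr: "A.Pos (g * (r * r))"
  proof -
    have "A.Pos (?rc (1/4) * ((h * r) * (h * r)))"
      by (intro A.Pos_scale A.Pos_square) (simp_all add: A.st_mult sa_h sa_r hr)
    also have "?rc (1/4) * ((h * r) * (h * r)) = g * (r * r)"
      by (simp add: g_def mult.assoc hr')
    finally show ?thesis .
  qed
  have Pos_ggrr: "A.Pos (g * g * (r * r))"
  proof -
    have "A.Pos ((g * r) * (g * r))"
      by (intro A.Pos_square) (simp add: A.st_mult sa_g sa_r gr)
    then show ?thesis by (simp add: mult.assoc gr')
  qed
  have "Q r \<le> Q (1 - p)"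
  proof (rule A.Q_le_of_Pos_square[OF sa_1p sa_r])
    have "A.Pos ((g * (r * r) + g * (r * r)) + g * g * (r * r))"
      by (rule A.Pos_add[OF A.Pos_add[OF Pos_grr Pos_grr] Pos_ggrr])
    then show "A.Pos ((1 - p) * (1 - p) - r * r)"
      by (simp add: sq)
  qed
  then have Qr: "Q r \<le> 2" using Q1p by linarith
  have "Q (h * r) \<le> Q (1 - p)"
  proof (rule A.Q_le_of_Pos_square[OF sa_1p])
    show "st (h * r) = h * r" by (simp add: A.st_mult sa_h sa_r hr)
    have "A.Pos (((1 - g) * r) * ((1 - g) * r))"
      by (intro A.Pos_square) (simp add: A.st_mult A.st_diff sa_g sa_r algebra_simps gr)
    also have "((1 - g) * r) * ((1 - g) * r)
        = r * r - (g * (r * r) + g * (r * r)) + g * g * (r * r)"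
      by (simp add: algebra_simps gr' gr[symmetric])
    also have "\<dots> = (1 - p) * (1 - p) - (h * r) * (h * r)"
    proof -
      have "(h * r) * (h * r) = (h * h) * (r * r)"
        by (simp add: mult.assoc hr')
      also have "\<dots> = (g + g + g + g) * (r * r)"
      proof -
        have "?rc 4 = 1 + 1 + (1 + 1)" using A.cs_add[of 2 2] by (simp add: A.cs_2)
        then have "h * h = (1 + 1 + (1 + 1)) * g" by (simp only: hh)
        then show ?thesis by (simp only: distrib_right mult_1_left add.assoc)
      qed
      finally show ?thesis unfolding sq by (simp add: algebra_simps)
    qed
    finally show "A.Pos ((1 - p) * (1 - p) - (h * r) * (h * r))" .
  qed
  then have Qhr: "Q (h * r) \<le> 2" using Q1p by linarith
  \<comment> \<open>By the C*-identity \<open>x * r\<close> is controlled by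
    \<open>r * h * r\<close>; this is why \<open>r\<close> and \<open>h * r\<close> were bounded
    separately.\<close>
  have "(Q (x * r))\<^sup>2 = Q (r * (h * r))"
    by (simp add: h_def A.st_mult sa_r mult.assoc flip: A.Q_cstar)
  also have "\<dots> \<le> 2 * 2"
    by (intro order.trans[OF A.Q_mult[of r]] mult_mono Qr Qhr) auto
  finally have "(Q (x * r))\<^sup>2 \<le> 2\<^sup>2"
    by simp
  then have "Q (x * r) \<le> 2"
    by (rule power2_le_imp_le) simp
  moreover have "Q' (x - x * r) \<le> 5 / 8"
  proof -
    \<comment> \<open>So the error splits into the truncation \<open>x * p\<close>, at most 1/8, and
      \<open>x * g * r\<close>, at most \<open>1 * (1/4) * 2\<close> because
      \<open>Q' x \<le> 1\<close>. This is the origin of 5/8.\<close>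
    have "x * (p + (r + g * r)) = x"
      using dr by (simp add: d_def algebra_simps)
    then have "x - x * r = x * p + x * (g * r)"
      by (simp add: distrib_left algebra_simps)
    then have "Q' (x - x * r) \<le> Q' (x * p) + Q' (x * (g * r))"
      by (simp add: B.Q_add)
    moreover have "Q' (x * p) \<le> 1 / 8"
    proof -
      have "Q' (x * p) \<le> Q x * \<theta> ^ n"
        using le[of "x * p"] A.Q_mult[of x p] mult_left_mono[OF Qp, of "Q x"] by simp
      also have "\<dots> \<le> Q x * (1 / (8 * (Q x + 1)))"
        using n(2) by (intro mult_left_mono) auto
      also have "\<dots> \<le> 1 / 8"
        by (simp add: divide_simps add_nonneg_pos)
      finally show ?thesis .
    qed
    moreover have "Q' (x * (g * r)) \<le> 1 / 2"
    proof -
      have "Q' h \<le> 1"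
        using B.Q_cstar[of x] x(2) by (simp add: h_def power_le_one)
      then have "(Q' h)\<^sup>2 \<le> 1" by (simp add: power_le_one)
      then have "Q' g \<le> 1 / 4"
        using B.Q_square[OF sa_h] by (simp add: g_def B.Q_cs_mult)
      then have "Q' (g * r) \<le> (1 / 4) * 2"
        using le[of r] Qr by (intro order.trans[OF B.Q_mult[of g]] mult_mono) auto
      then have "Q' (x * (g * r)) \<le> 1 * ((1 / 4) * 2)"
        by (intro order.trans[OF B.Q_mult[of x]] mult_mono x(2)) auto
      then show ?thesis by simp
    qed
    ultimately show ?thesis by simp
  qed
  moreover have "x * r \<in> D"
  proof -
    have zero: "0 \<in> D" using D(4)[OF D(1), of 0] by simp
    have const: "cs c \<in> D" for c using D(4)[OF D(1), of c] by simp
    have "cs (- 1) * g \<in> D" unfolding g_def h_def by (intro D x)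
    then have "?rc \<kappa> + cs (- 1) * g \<in> D" using const by (intro D(2))
    then have "f \<in> D" by (simp add: f_def A.cs_minus)
    then have "e \<in> D" unfolding e_def by (intro D)
    have "e ^ k \<in> D" for k by (induction k) (auto intro: D \<open>e \<in> D\<close>)
    then have "(\<Sum>k<m. e ^ k) \<in> D" for m by (induction m) (auto intro: D zero)
    then show ?thesis unfolding r_def by (intro D x)
  qed
  ultimately show ?thesis using that by blast
qed

section \<open>The *-algebra of a monoid with involution\<close>

lemma monoid_star_algebra_simps:
  "carrier (monoid_star_algebra M \<sigma>) = {f. finite {m. f m \<noteq> 0} \<and> {m. f m \<noteq> 0} \<subseteq> carrier M}"
  "\<one>\<^bsub>monoid_star_algebra M \<sigma>\<^esub> = point_mass \<one>\<^bsub>M\<^esub>"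
  "\<zero>\<^bsub>monoid_star_algebra M \<sigma>\<^esub> = (\<lambda>m. 0)"
  "f \<oplus>\<^bsub>monoid_star_algebra M \<sigma>\<^esub> h = (\<lambda>m. f m + h m)"
  "c \<odot>\<^bsub>monoid_star_algebra M \<sigma>\<^esub> f = (\<lambda>m. c * f m)"
  "star (monoid_star_algebra M \<sigma>) f = (\<lambda>m. if m \<in> carrier M then cnj (f (\<sigma> m)) else 0)"
  by (simp_all add: monoid_star_algebra_def)

text \<open>The definition sums over exact supports, which change with the arguments. Fixed finite
  supersets make such sums comparable.\<close>

lemma monoid_star_algebra_mult:
  assumes "finite K" "{m. f m \<noteq> 0} \<subseteq> K" "finite L" "{m. h m \<noteq> 0} \<subseteq> L"
  shows "(f \<otimes>\<^bsub>monoid_star_algebra M \<sigma>\<^esub> h) m =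
    (\<Sum>k\<in>K. \<Sum>l\<in>L. if k \<otimes>\<^bsub>M\<^esub> l = m then f k * h l else 0)"
proof -
  have "(f \<otimes>\<^bsub>monoid_star_algebra M \<sigma>\<^esub> h) m =
      (\<Sum>k | f k \<noteq> 0. \<Sum>l | h l \<noteq> 0. if k \<otimes>\<^bsub>M\<^esub> l = m then f k * h l else 0)"
    by (simp add: monoid_star_algebra_def)
  also have "\<dots> = (\<Sum>k | f k \<noteq> 0. \<Sum>l\<in>L. if k \<otimes>\<^bsub>M\<^esub> l = m then f k * h l else 0)"
    using assms by (intro sum.cong[OF refl] sum.mono_neutral_left) auto
  also have "\<dots> = (\<Sum>k\<in>K. \<Sum>l\<in>L. if k \<otimes>\<^bsub>M\<^esub> l = m then f k * h l else 0)"
  proof (intro sum.mono_neutral_left ballI)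
    fix k assume "k \<in> K - {k. f k \<noteq> 0}"
    then have "f k = 0" by simp
    then show "(\<Sum>l\<in>L. if k \<otimes>\<^bsub>M\<^esub> l = m then f k * h l else 0) = 0"
      by (simp cong: if_cong)
  qed (use assms in auto)
  finally show ?thesis .
qed

lemma monoid_star_algebra_mult_support:
  assumes "finite {m. f m \<noteq> 0}" "finite {m. h m \<noteq> 0}"
  shows "{m. (f \<otimes>\<^bsub>monoid_star_algebra M \<sigma>\<^esub> h) m \<noteq> 0}
    \<subseteq> (\<lambda>(k, l). k \<otimes>\<^bsub>M\<^esub> l) ` ({m. f m \<noteq> 0} \<times> {m. h m \<noteq> 0})"
proof
  fix m assume "m \<in> {m. (f \<otimes>\<^bsub>monoid_star_algebra M \<sigma>\<^esub> h) m \<noteq> 0}"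
  then have "(\<Sum>k | f k \<noteq> 0. \<Sum>l | h l \<noteq> 0. if k \<otimes>\<^bsub>M\<^esub> l = m then f k * h l else 0) \<noteq> 0"
    by (simp add: monoid_star_algebra_def)
  then obtain k where k: "k \<in> {m. f m \<noteq> 0}"
    "(\<Sum>l | h l \<noteq> 0. if k \<otimes>\<^bsub>M\<^esub> l = m then f k * h l else 0) \<noteq> 0"
    by (rule sum.not_neutral_contains_not_neutral)
  from k(2) obtain l where l: "l \<in> {m. h m \<noteq> 0}" "(if k \<otimes>\<^bsub>M\<^esub> l = m then f k * h l else 0) \<noteq> 0"
    by (rule sum.not_neutral_contains_not_neutral)
  then have "m = (\<lambda>(k, l). k \<otimes>\<^bsub>M\<^esub> l) (k, l)"
    by (simp split: if_splits)
  with k l show "m \<in> (\<lambda>(k, l). k \<otimes>\<^bsub>M\<^esub> l) ` ({m. f m \<noteq> 0} \<times> {m. h m \<noteq> 0})"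
    by blast
qed

lemma sum_if_pair:
  assumes "finite N" "(p::'a) \<in> N"
  shows "(\<Sum>n\<in>N. if n = p then (F n :: complex) else 0) = F p"
  using assms by simp

text \<open>Both sides reduce to the sum of \<open>f k * h l * j q\<close> over the triples with
  product \<open>m\<close>. The intermediate products run over the finite sets \<open>N\<close> and
  \<open>N'\<close>, where each pair selects exactly one value.\<close>

lemma monoid_star_algebra_mult_assoc:
  assumes M: "monoid M"
    and f: "f \<in> carrier (monoid_star_algebra M \<sigma>)" and h: "h \<in> carrier (monoid_star_algebra M \<sigma>)"
    and j: "j \<in> carrier (monoid_star_algebra M \<sigma>)"
  shows "f \<otimes>\<^bsub>monoid_star_algebra M \<sigma>\<^esub> h \<otimes>\<^bsub>monoid_star_algebra M \<sigma>\<^esub> j =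
    f \<otimes>\<^bsub>monoid_star_algebra M \<sigma>\<^esub> (h \<otimes>\<^bsub>monoid_star_algebra M \<sigma>\<^esub> j)"
proof
  fix m
  interpret monoid M by fact
  let ?A = "monoid_star_algebra M \<sigma>"
  define K L J where "K = {m. f m \<noteq> 0}" and "L = {m. h m \<noteq> 0}" and "J = {m. j m \<noteq> 0}"
  have fin: "finite K" "finite L" "finite J" and sub: "K \<subseteq> carrier M" "L \<subseteq> carrier M" "J \<subseteq> carrier M"
    using f h j by (auto simp: K_def L_def J_def monoid_star_algebra_simps)
  define N where "N = (\<lambda>(k, l). k \<otimes>\<^bsub>M\<^esub> l) ` (K \<times> L)"
  define N' where "N' = (\<lambda>(k, l). k \<otimes>\<^bsub>M\<^esub> l) ` (L \<times> J)"
  have N: "finite N" "finite N'" using fin by (auto simp: N_def N'_def)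
  have supp: "{m. (f \<otimes>\<^bsub>?A\<^esub> h) m \<noteq> 0} \<subseteq> N" "{m. (h \<otimes>\<^bsub>?A\<^esub> j) m \<noteq> 0} \<subseteq> N'"
    unfolding N_def N'_def K_def L_def J_def using fin
    by (intro monoid_star_algebra_mult_support; simp add: K_def L_def J_def)+
  have "(f \<otimes>\<^bsub>?A\<^esub> h \<otimes>\<^bsub>?A\<^esub> j) m
      = (\<Sum>n\<in>N. \<Sum>q\<in>J. if n \<otimes>\<^bsub>M\<^esub> q = m then (f \<otimes>\<^bsub>?A\<^esub> h) n * j q else 0)"
    by (rule monoid_star_algebra_mult) (use N supp fin in \<open>auto simp: J_def\<close>)
  also have "\<dots> = (\<Sum>n\<in>N. \<Sum>q\<in>J. \<Sum>k\<in>K. \<Sum>l\<in>L.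
      if n = k \<otimes>\<^bsub>M\<^esub> l then (if n \<otimes>\<^bsub>M\<^esub> q = m then f k * h l * j q else 0) else 0)"
  proof (intro sum.cong refl)
    fix n q
    have "(f \<otimes>\<^bsub>?A\<^esub> h) n = (\<Sum>k\<in>K. \<Sum>l\<in>L. if k \<otimes>\<^bsub>M\<^esub> l = n then f k * h l else 0)"
      by (rule monoid_star_algebra_mult) (use fin in \<open>auto simp: K_def L_def\<close>)
    then show "(if n \<otimes>\<^bsub>M\<^esub> q = m then (f \<otimes>\<^bsub>?A\<^esub> h) n * j q else 0) = (\<Sum>k\<in>K. \<Sum>l\<in>L.
      if n = k \<otimes>\<^bsub>M\<^esub> l then (if n \<otimes>\<^bsub>M\<^esub> q = m then f k * h l * j q else 0) else 0)"
      by (cases "n \<otimes>\<^bsub>M\<^esub> q = m") (auto simp: sum_distrib_right intro!: sum.cong sum.neutral)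
  qed
  also have "\<dots> = (\<Sum>q\<in>J. \<Sum>k\<in>K. \<Sum>l\<in>L. \<Sum>n\<in>N.
      if n = k \<otimes>\<^bsub>M\<^esub> l then (if n \<otimes>\<^bsub>M\<^esub> q = m then f k * h l * j q else 0) else 0)"
    by (simp only: sum.swap[where A = N])
  also have "\<dots> = (\<Sum>q\<in>J. \<Sum>k\<in>K. \<Sum>l\<in>L. if k \<otimes>\<^bsub>M\<^esub> l \<otimes>\<^bsub>M\<^esub> q = m then f k * h l * j q else 0)"
    by (intro sum.cong refl sum_if_pair N) (auto simp: N_def)
  also have "\<dots> = (\<Sum>k\<in>K. \<Sum>l\<in>L. \<Sum>q\<in>J. if k \<otimes>\<^bsub>M\<^esub> (l \<otimes>\<^bsub>M\<^esub> q) = m then f k * h l * j q else 0)"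
    unfolding sum.swap[where A = J] using sub
    by (intro sum.cong refl) (auto simp: m_assoc subset_iff)
  also have "\<dots> = (\<Sum>k\<in>K. \<Sum>l\<in>L. \<Sum>q\<in>J. \<Sum>n\<in>N'.
      if n = l \<otimes>\<^bsub>M\<^esub> q then (if k \<otimes>\<^bsub>M\<^esub> n = m then f k * h l * j q else 0) else 0)"
    by (intro sum.cong refl sum_if_pair[symmetric] N) (auto simp: N'_def)
  also have "\<dots> = (\<Sum>k\<in>K. \<Sum>n\<in>N'. \<Sum>l\<in>L. \<Sum>q\<in>J.
      if n = l \<otimes>\<^bsub>M\<^esub> q then (if k \<otimes>\<^bsub>M\<^esub> n = m then f k * h l * j q else 0) else 0)"
    by (simp only: sum.swap[where A = N'])
  also have "\<dots> = (\<Sum>k\<in>K. \<Sum>n\<in>N'. if k \<otimes>\<^bsub>M\<^esub> n = m then f k * (h \<otimes>\<^bsub>?A\<^esub> j) n else 0)"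
  proof (intro sum.cong refl)
    fix k n
    have "(h \<otimes>\<^bsub>?A\<^esub> j) n = (\<Sum>l\<in>L. \<Sum>q\<in>J. if l \<otimes>\<^bsub>M\<^esub> q = n then h l * j q else 0)"
      by (rule monoid_star_algebra_mult) (use fin in \<open>auto simp: J_def L_def\<close>)
    then show "(\<Sum>l\<in>L. \<Sum>q\<in>J. if n = l \<otimes>\<^bsub>M\<^esub> q then (if k \<otimes>\<^bsub>M\<^esub> n = m then f k * h l * j q else 0) else 0)
      = (if k \<otimes>\<^bsub>M\<^esub> n = m then f k * (h \<otimes>\<^bsub>?A\<^esub> j) n else 0)"
      by (cases "k \<otimes>\<^bsub>M\<^esub> n = m") (auto simp: sum_distrib_left mult.assoc intro!: sum.cong sum.neutral)
  qed
  also have "\<dots> = (f \<otimes>\<^bsub>?A\<^esub> (h \<otimes>\<^bsub>?A\<^esub> j)) m"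
    by (rule monoid_star_algebra_mult[symmetric]) (use N supp fin in \<open>auto simp: K_def\<close>)
  finally show "(f \<otimes>\<^bsub>?A\<^esub> h \<otimes>\<^bsub>?A\<^esub> j) m = (f \<otimes>\<^bsub>?A\<^esub> (h \<otimes>\<^bsub>?A\<^esub> j)) m" .
qed

lemma finite_support_add:
  "finite {m. f m \<noteq> (0::complex)} \<Longrightarrow> finite {m. h m \<noteq> 0} \<Longrightarrow> finite {m. f m + h m \<noteq> 0}"
  by (rule finite_subset[of _ "{m. f m \<noteq> 0} \<union> {m. h m \<noteq> 0}"]) auto

lemma monoid_star_algebra_mult_closed:
  assumes M: "monoid M"
    and f: "f \<in> carrier (monoid_star_algebra M \<sigma>)" and h: "h \<in> carrier (monoid_star_algebra M \<sigma>)"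
  shows "f \<otimes>\<^bsub>monoid_star_algebra M \<sigma>\<^esub> h \<in> carrier (monoid_star_algebra M \<sigma>)"
proof -
  have fin: "finite {m. f m \<noteq> 0}" "finite {m. h m \<noteq> 0}"
    using f h by (auto simp: monoid_star_algebra_simps)
  have "(\<lambda>(k, l). k \<otimes>\<^bsub>M\<^esub> l) ` ({m. f m \<noteq> 0} \<times> {m. h m \<noteq> 0}) \<subseteq> carrier M"
    using f h monoid.m_closed[OF M] by (auto simp: monoid_star_algebra_simps subset_iff)
  then show ?thesis
    using monoid_star_algebra_mult_support[OF fin, of M \<sigma>] fin
      finite_subset[OF monoid_star_algebra_mult_support[OF fin, of M \<sigma>]]
    unfolding monoid_star_algebra_simps by (simp add: order.trans)
qed

theorem star_algebra_monoid_star_algebra: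
  assumes M: "monoid M"
    and \<sigma>: "\<And>m. m \<in> carrier M \<Longrightarrow> \<sigma> m \<in> carrier M" "\<And>m. m \<in> carrier M \<Longrightarrow> \<sigma> (\<sigma> m) = m"
      "\<And>k l. k \<in> carrier M \<Longrightarrow> l \<in> carrier M \<Longrightarrow> \<sigma> (k \<otimes>\<^bsub>M\<^esub> l) = \<sigma> l \<otimes>\<^bsub>M\<^esub> \<sigma> k"
  shows "star_algebra (monoid_star_algebra M \<sigma>)"
proof -
  let ?A = "monoid_star_algebra M \<sigma>"
  interpret M: monoid M by fact
  have mult: "(f \<otimes>\<^bsub>?A\<^esub> h) m = (\<Sum>k\<in>K. \<Sum>l\<in>L. if k \<otimes>\<^bsub>M\<^esub> l = m then f k * h l else 0)"
    if "finite K" "{m. f m \<noteq> 0} \<subseteq> K" "finite L" "{m. h m \<noteq> 0} \<subseteq> L" for f h m K L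
    using that by (rule monoid_star_algebra_mult)
  have ab: "abelian_group ?A"
  proof (rule abelian_groupI)
    fix f assume "f \<in> carrier ?A"
    then show "\<exists>h\<in>carrier ?A. h \<oplus>\<^bsub>?A\<^esub> f = \<zero>\<^bsub>?A\<^esub>"
      by (intro bexI[of _ "\<lambda>m. - f m"]) (auto simp: monoid_star_algebra_simps)
  next
    fix f h assume "f \<in> carrier ?A" "h \<in> carrier ?A"
    then show "f \<oplus>\<^bsub>?A\<^esub> h \<in> carrier ?A"
      using finite_support_add[of f h]
      by (simp add: monoid_star_algebra_simps subset_iff) (metis add.right_neutral)
  qed (auto simp: monoid_star_algebra_simps add_ac)
  have mon: "monoid ?A"
  proof (rule monoidI)
    show one: "\<one>\<^bsub>?A\<^esub> \<in> carrier ?A"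
      by (auto simp: monoid_star_algebra_simps point_mass_def)
    fix f assume f: "f \<in> carrier ?A"
    then have fin: "finite {m. f m \<noteq> 0}" and sub: "{m. f m \<noteq> 0} \<subseteq> carrier M"
      by (auto simp: monoid_star_algebra_simps)
    show "\<one>\<^bsub>?A\<^esub> \<otimes>\<^bsub>?A\<^esub> f = f"
    proof
      fix m
      have "(\<one>\<^bsub>?A\<^esub> \<otimes>\<^bsub>?A\<^esub> f) m = (\<Sum>k\<in>{\<one>\<^bsub>M\<^esub>}. \<Sum>l | f l \<noteq> 0. if k \<otimes>\<^bsub>M\<^esub> l = m then \<one>\<^bsub>?A\<^esub> k * f l else 0)"
        using fin by (intro mult) (auto simp: monoid_star_algebra_simps point_mass_def split: if_splits)
      also have "\<dots> = (\<Sum>l | f l \<noteq> 0. if l = m then f l else 0)"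
        using sub by (auto simp: monoid_star_algebra_simps point_mass_def subset_iff intro!: sum.cong)
      also have "\<dots> = f m"
        using fin by simp
      finally show "(\<one>\<^bsub>?A\<^esub> \<otimes>\<^bsub>?A\<^esub> f) m = f m" .
    qed
    show "f \<otimes>\<^bsub>?A\<^esub> \<one>\<^bsub>?A\<^esub> = f"
    proof
      fix m
      have "(f \<otimes>\<^bsub>?A\<^esub> \<one>\<^bsub>?A\<^esub>) m = (\<Sum>l | f l \<noteq> 0. \<Sum>k\<in>{\<one>\<^bsub>M\<^esub>}. if l \<otimes>\<^bsub>M\<^esub> k = m then f l * \<one>\<^bsub>?A\<^esub> k else 0)"
        using fin by (intro mult) (auto simp: monoid_star_algebra_simps point_mass_def split: if_splits)
      also have "\<dots> = (\<Sum>l | f l \<noteq> 0. if l = m then f l else 0)"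
        using sub by (auto simp: monoid_star_algebra_simps point_mass_def subset_iff intro!: sum.cong)
      also have "\<dots> = f m"
        using fin by simp
      finally show "(f \<otimes>\<^bsub>?A\<^esub> \<one>\<^bsub>?A\<^esub>) m = f m" .
    qed
  qed (auto intro: monoid_star_algebra_mult_closed monoid_star_algebra_mult_assoc M)
  have dist: "(f \<oplus>\<^bsub>?A\<^esub> g) \<otimes>\<^bsub>?A\<^esub> h = f \<otimes>\<^bsub>?A\<^esub> h \<oplus>\<^bsub>?A\<^esub> g \<otimes>\<^bsub>?A\<^esub> h"
    "h \<otimes>\<^bsub>?A\<^esub> (f \<oplus>\<^bsub>?A\<^esub> g) = h \<otimes>\<^bsub>?A\<^esub> f \<oplus>\<^bsub>?A\<^esub> h \<otimes>\<^bsub>?A\<^esub> g"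
    if "f \<in> carrier ?A" "g \<in> carrier ?A" "h \<in> carrier ?A" for f g h
  proof -
    define K L where "K = {m. f m \<noteq> 0} \<union> {m. g m \<noteq> 0}" and "L = {m. h m \<noteq> 0}"
    have fin: "finite K" "finite L" using that by (auto simp: K_def L_def monoid_star_algebra_simps)
    note mults = mult[OF fin(1) _ fin(2)] mult[OF fin(2) _ fin(1)]
    have supp: "{m. f m \<noteq> 0} \<subseteq> K" "{m. g m \<noteq> 0} \<subseteq> K" "{m. h m \<noteq> 0} \<subseteq> L" "{m. (f \<oplus>\<^bsub>?A\<^esub> g) m \<noteq> 0} \<subseteq> K"
      by (auto simp: K_def L_def monoid_star_algebra_simps)
    show "(f \<oplus>\<^bsub>?A\<^esub> g) \<otimes>\<^bsub>?A\<^esub> h = f \<otimes>\<^bsub>?A\<^esub> h \<oplus>\<^bsub>?A\<^esub> g \<otimes>\<^bsub>?A\<^esub> h"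
      by (rule ext) (simp add: mults supp monoid_star_algebra_simps(4)[of _ _ "f \<otimes>\<^bsub>?A\<^esub> h"]
          del: Collect_mem_eq, simp add: monoid_star_algebra_simps(4) flip: sum.distrib,
          auto intro!: sum.cong simp: monoid_star_algebra_simps(4) algebra_simps)
    show "h \<otimes>\<^bsub>?A\<^esub> (f \<oplus>\<^bsub>?A\<^esub> g) = h \<otimes>\<^bsub>?A\<^esub> f \<oplus>\<^bsub>?A\<^esub> h \<otimes>\<^bsub>?A\<^esub> g"
      by (rule ext) (simp add: mults supp monoid_star_algebra_simps(4)[of _ _ "h \<otimes>\<^bsub>?A\<^esub> f"]
          del: Collect_mem_eq, simp add: monoid_star_algebra_simps(4) flip: sum.distrib,
          auto intro!: sum.cong simp: monoid_star_algebra_simps(4) algebra_simps)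
  qed
  have ring: "ring ?A"
    by (rule ringI[OF ab mon]) (simp_all add: dist)
  have supp_scale: "{m. (c * f m :: complex) \<noteq> 0} \<subseteq> {m. f m \<noteq> 0}" for c f
    by auto
  have scale_closed: "c \<odot>\<^bsub>?A\<^esub> f \<in> carrier ?A" if "f \<in> carrier ?A" for c f
    using that finite_subset[OF supp_scale] by (auto simp: monoid_star_algebra_simps)
  have mod: "Module.module complex_ring ?A"
    by (rule moduleI[OF cring_from_type_algebra ab]) (use scale_closed in \<open>auto simp: monoid_star_algebra_simps algebra_simps\<close>)
  have star_supp: "{m. star ?A f m \<noteq> 0} \<subseteq> \<sigma> ` {m. f m \<noteq> 0}" for f
    using \<sigma>(2) by (auto simp: monoid_star_algebra_simps split: if_splits intro!: image_eqI)
  have star_closed: "star ?A f \<in> carrier ?A" if "f \<in> carrier ?A" for f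
    using finite_subset[OF star_supp[of f]] that by (auto simp: monoid_star_algebra_simps)
  show ?thesis
  proof (intro star_algebra.intro ring mod star_algebra_axioms.intro)
    fix f h c assume fh: "f \<in> carrier ?A" "h \<in> carrier ?A"
    have fin: "finite {m. f m \<noteq> 0}" "finite {m. h m \<noteq> 0}"
      and sub: "{m. f m \<noteq> 0} \<subseteq> carrier M" "{m. h m \<noteq> 0} \<subseteq> carrier M"
      using fh by (auto simp: monoid_star_algebra_simps)
    show "c \<odot>\<^bsub>?A\<^esub> f \<otimes>\<^bsub>?A\<^esub> h = c \<odot>\<^bsub>?A\<^esub> (f \<otimes>\<^bsub>?A\<^esub> h)"
      by (rule ext, subst mult[OF fin(1) _ fin(2)])
        (auto simp: monoid_star_algebra_simps mult[OF fin(1) _ fin(2)] sum_distrib_left intro!: sum.cong)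
    show "f \<otimes>\<^bsub>?A\<^esub> (c \<odot>\<^bsub>?A\<^esub> h) = c \<odot>\<^bsub>?A\<^esub> (f \<otimes>\<^bsub>?A\<^esub> h)"
      by (rule ext, subst mult[OF fin(1) _ fin(2)])
        (auto simp: monoid_star_algebra_simps mult[OF fin(1) _ fin(2)] sum_distrib_left intro!: sum.cong)
    show "star ?A (f \<otimes>\<^bsub>?A\<^esub> h) = star ?A h \<otimes>\<^bsub>?A\<^esub> star ?A f"
    proof
      fix m
      show "star ?A (f \<otimes>\<^bsub>?A\<^esub> h) m = (star ?A h \<otimes>\<^bsub>?A\<^esub> star ?A f) m"
      proof (cases "m \<in> carrier M")
        case True
        have inj: "inj_on \<sigma> {m. f m \<noteq> 0}" "inj_on \<sigma> {m. h m \<noteq> 0}"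
          by (rule inj_on_inverseI[of _ \<sigma>], use sub \<sigma>(2) in auto)+
        have "star ?A (f \<otimes>\<^bsub>?A\<^esub> h) m = cnj ((f \<otimes>\<^bsub>?A\<^esub> h) (\<sigma> m))"
          using True by (simp add: monoid_star_algebra_simps)
        also have "\<dots> = (\<Sum>k | f k \<noteq> 0. \<Sum>l | h l \<noteq> 0. if k \<otimes>\<^bsub>M\<^esub> l = \<sigma> m then cnj (f k) * cnj (h l) else 0)"
          by (subst mult[OF fin(1) _ fin(2)]) (auto intro!: sum.cong)
        also have "\<dots> = (\<Sum>l | h l \<noteq> 0. \<Sum>k | f k \<noteq> 0.
            if \<sigma> l \<otimes>\<^bsub>M\<^esub> \<sigma> k = m then star ?A h (\<sigma> l) * star ?A f (\<sigma> k) else 0)"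
        proof (subst sum.swap, intro sum.cong refl)
          fix l k assume "l \<in> {m. h m \<noteq> 0}" "k \<in> {m. f m \<noteq> 0}"
          then have lk: "l \<in> carrier M" "k \<in> carrier M" using sub by auto
          then have "k \<otimes>\<^bsub>M\<^esub> l = \<sigma> m \<longleftrightarrow> \<sigma> l \<otimes>\<^bsub>M\<^esub> \<sigma> k = m"
            using \<sigma> True by (metis M.m_closed)
          then show "(if k \<otimes>\<^bsub>M\<^esub> l = \<sigma> m then cnj (f k) * cnj (h l) else 0) =
            (if \<sigma> l \<otimes>\<^bsub>M\<^esub> \<sigma> k = m then star ?A h (\<sigma> l) * star ?A f (\<sigma> k) else 0)"
            using lk \<sigma> by (simp add: monoid_star_algebra_simps)
        qed
        also have "\<dots> = (\<Sum>l\<in>\<sigma> ` {m. h m \<noteq> 0}. \<Sum>k\<in>\<sigma> ` {m. f m \<noteq> 0}.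
            if l \<otimes>\<^bsub>M\<^esub> k = m then star ?A h l * star ?A f k else 0)"
          by (simp add: sum.reindex inj)
        also have "\<dots> = (star ?A h \<otimes>\<^bsub>?A\<^esub> star ?A f) m"
          using fin star_supp by (intro mult[symmetric]) auto
        finally show ?thesis .
      next
        case False
        have "(star ?A h \<otimes>\<^bsub>?A\<^esub> star ?A f) \<in> carrier ?A"
          by (intro monoid_star_algebra_mult_closed M star_closed fh)
        then have "(star ?A h \<otimes>\<^bsub>?A\<^esub> star ?A f) m = 0"
          using False by (auto simp: monoid_star_algebra_simps)
        then show ?thesis
          using False by (simp add: monoid_star_algebra_simps)
      qed
    qed
    show "star ?A f \<in> carrier ?A" by (rule star_closed[OF fh(1)])
    show "star ?A (star ?A f) = f"
      using sub \<sigma> by (auto simp: monoid_star_algebra_simps fun_eq_iff subset_iff)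
    show "star ?A (f \<oplus>\<^bsub>?A\<^esub> h) = star ?A f \<oplus>\<^bsub>?A\<^esub> star ?A h"
      "star ?A (c \<odot>\<^bsub>?A\<^esub> f) = cnj c \<odot>\<^bsub>?A\<^esub> star ?A f"
      by (auto simp: monoid_star_algebra_simps fun_eq_iff)
  qed
qed

lemma monoid_star_algebra_induct [consumes 1, case_names zero add]:
  assumes "f \<in> carrier (monoid_star_algebra M \<sigma>)"
    and "P (\<lambda>m. 0)"
    and "\<And>f c m. f \<in> carrier (monoid_star_algebra M \<sigma>) \<Longrightarrow> m \<in> carrier M \<Longrightarrow> f m = 0 \<Longrightarrow> c \<noteq> 0 \<Longrightarrow> P f \<Longrightarrow>
      P (c \<odot>\<^bsub>monoid_star_algebra M \<sigma>\<^esub> point_mass m \<oplus>\<^bsub>monoid_star_algebra M \<sigma>\<^esub> f)"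
  shows "P f"
proof -
  have "P f" if "finite K" "{m. f m \<noteq> 0} = K" "K \<subseteq> carrier M" for K f
    using that
  proof (induction K arbitrary: f rule: finite_induct)
    case empty
    then have "f = (\<lambda>m. 0)" by auto
    then show ?case using assms(2) by simp
  next
    case (insert m K)
    define g where "g = f(m := 0)"
    have supp: "{m. g m \<noteq> 0} = K"
      using insert.prems(1) insert.hyps(2) by (auto simp: g_def)
    have "P (f m \<odot>\<^bsub>monoid_star_algebra M \<sigma>\<^esub> point_mass m \<oplus>\<^bsub>monoid_star_algebra M \<sigma>\<^esub> g)"
    proof (rule assms(3))
      show "P g" using insert.IH[OF supp] insert.prems(2) by simp
      show "g \<in> carrier (monoid_star_algebra M \<sigma>)"
        using supp insert.hyps insert.prems by (simp add: monoid_star_algebra_simps)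
    qed (use insert.prems in \<open>auto simp: g_def\<close>)
    also have "f m \<odot>\<^bsub>monoid_star_algebra M \<sigma>\<^esub> point_mass m \<oplus>\<^bsub>monoid_star_algebra M \<sigma>\<^esub> g = f"
      by (auto simp: monoid_star_algebra_simps g_def point_mass_def)
    finally show ?case .
  qed
  then show ?thesis
    using assms(1) by (auto simp: monoid_star_algebra_simps)
qed

lemma point_mass_closed:
  "m \<in> carrier M \<Longrightarrow> point_mass m \<in> carrier (monoid_star_algebra M \<sigma>)"
  by (auto simp: monoid_star_algebra_simps point_mass_def)

lemma point_mass_mult:
  "point_mass k \<otimes>\<^bsub>monoid_star_algebra M \<sigma>\<^esub> point_mass l = point_mass (k \<otimes>\<^bsub>M\<^esub> l)"
  by (rule ext, subst monoid_star_algebra_mult[of "{k}" _ "{l}"]) (auto simp: point_mass_def)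

lemma point_mass_star:
  assumes "\<And>m. m \<in> carrier M \<Longrightarrow> \<sigma> m \<in> carrier M" "\<And>m. m \<in> carrier M \<Longrightarrow> \<sigma> (\<sigma> m) = m"
    and "m \<in> carrier M"
  shows "star (monoid_star_algebra M \<sigma>) (point_mass m) = point_mass (\<sigma> m)"
  using assms by (auto simp: monoid_star_algebra_simps point_mass_def fun_eq_iff)

section \<open>Completion with respect to a C*-seminorm\<close>

lemma null_comparison:
  "(\<And>n. 0 \<le> f n) \<Longrightarrow> (\<And>n. f n \<le> g n) \<Longrightarrow> g \<longlonglongrightarrow> 0 \<Longrightarrow> f \<longlonglongrightarrow> (0::real)"
  by (rule tendsto_sandwich[of "\<lambda>_. 0" f _ g]) (auto intro: always_eventually)

context star_algebra
begin

lemma scale_closed [simp, intro]: "a \<in> carrier A \<Longrightarrow> c \<odot> a \<in> carrier A"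
  by (rule smult_closed) simp_all

lemma ag: "abelian_group A"
  by unfold_locales

lemmas l_minus_self = abelian_group.l_neg[OF ag]
lemmas minus_unique_left = abelian_group.minus_equality[OF ag]

lemma ring_A: "ring A"
  by unfold_locales

lemmas ring_rules = ring.ring_simprules[OF ring_A]

lemma diff_zero: "a \<in> carrier A \<Longrightarrow> a \<ominus> \<zero> = a"
  by (simp add: ring_rules)

lemma diff_self: "a \<in> carrier A \<Longrightarrow> a \<ominus> a = \<zero>"
  by (simp add: ring_rules)

lemma minus_eq_smult: "a \<in> carrier A \<Longrightarrow> \<ominus> a = (- 1) \<odot> a"
  using smult_l_distr[of "- 1" 1 a] smult_l_null[of a] smult_one[of a]
  by (intro minus_unique_left) simp_all

end

locale seminormed_star_algebra = star_algebra A
  for A :: "('a, 'm) star_alg_scheme" (structure) +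
  fixes p :: "'a \<Rightarrow> real"
  assumes seminorm: "cstar_seminorm A p"
begin

lemma p_nonneg: "a \<in> carrier A \<Longrightarrow> 0 \<le> p a"
  and p_smult: "a \<in> carrier A \<Longrightarrow> p (c \<odot> a) = cmod c * p a"
  and p_add: "a \<in> carrier A \<Longrightarrow> b \<in> carrier A \<Longrightarrow> p (a \<oplus> b) \<le> p a + p b"
  and p_mult: "a \<in> carrier A \<Longrightarrow> b \<in> carrier A \<Longrightarrow> p (a \<otimes> b) \<le> p a * p b"
  and p_cstar: "a \<in> carrier A \<Longrightarrow> p (star A a \<otimes> a) = (p a)\<^sup>2"
  using seminorm unfolding cstar_seminorm_def by blast+

lemma p_zero [simp]: "p \<zero> = 0"
  using p_smult[of \<zero> 0] smult_l_null[of \<zero>] by simp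

lemma p_minus: "a \<in> carrier A \<Longrightarrow> p (\<ominus> a) = p a"
  by (simp add: minus_eq_smult p_smult)

lemma p_diff_commute:
  assumes "a \<in> carrier A" "b \<in> carrier A" shows "p (a \<ominus> b) = p (b \<ominus> a)"
proof -
  have "b \<ominus> a = \<ominus> (a \<ominus> b)"
    using assms by (simp add: ring_rules)
  then show ?thesis using assms by (simp add: p_minus)
qed

lemma p_triangle:
  assumes "a \<in> carrier A" "b \<in> carrier A" "c \<in> carrier A"
  shows "p (a \<ominus> c) \<le> p (a \<ominus> b) + p (b \<ominus> c)"
proof -
  have "a \<ominus> c = (a \<ominus> b) \<oplus> (b \<ominus> c)"
    using assms by (simp add: ring_rules)
  then show ?thesis using assms by (simp add: p_add)
qed

lemma p_diff_le: "a \<in> carrier A \<Longrightarrow> b \<in> carrier A \<Longrightarrow> p a \<le> p (a \<ominus> b) + p b"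
  using p_triangle[of a b \<zero>] by (simp add: diff_zero)

lemma p_abs_diff: "a \<in> carrier A \<Longrightarrow> b \<in> carrier A \<Longrightarrow> \<bar>p a - p b\<bar> \<le> p (a \<ominus> b)"
  using p_diff_le[of a b] p_diff_le[of b a] p_diff_commute[of a b] by linarith

lemma p_star: assumes "a \<in> carrier A" shows "p (star A a) = p a"
proof -
  have *: "p b \<le> p (star A b)" if b: "b \<in> carrier A" for b
  proof (cases "p b = 0")
    case False
    have "p b * p b \<le> p (star A b) * p b"
      using p_cstar[OF b] p_mult[of "star A b" b] b by (simp add: power2_eq_square star_closed)
    then show ?thesis using False p_nonneg[OF b] by simp
  qed (use b p_nonneg star_closed in simp)
  show ?thesis
    using *[of a] *[of "star A a"] assms by (simp add: star_closed star_star)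
qed

lemma smult_diff: "a \<in> carrier A \<Longrightarrow> b \<in> carrier A \<Longrightarrow> c \<odot> a \<ominus> c \<odot> b = c \<odot> (a \<ominus> b)"
  by (simp add: ring_rules smult_r_distr smult_r_minus)

lemma star_minus: "a \<in> carrier A \<Longrightarrow> star A (\<ominus> a) = \<ominus> star A a"
  by (simp add: minus_eq_smult star_smult star_closed)

lemma star_diff: "a \<in> carrier A \<Longrightarrow> b \<in> carrier A \<Longrightarrow> star A a \<ominus> star A b = star A (a \<ominus> b)"
  by (simp add: ring_rules star_add star_minus star_closed)

lemma add_diff_add:
  assumes "a \<in> carrier A" "b \<in> carrier A" "c \<in> carrier A" "d \<in> carrier A"
  shows "(a \<oplus> b) \<ominus> (c \<oplus> d) = (a \<ominus> c) \<oplus> (b \<ominus> d)"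
  using assms by (simp add: ring_rules)

lemma mult_diff_mult:
  assumes "a \<in> carrier A" "b \<in> carrier A" "c \<in> carrier A" "d \<in> carrier A"
  shows "a \<otimes> b \<ominus> c \<otimes> d = a \<otimes> (b \<ominus> d) \<oplus> (a \<ominus> c) \<otimes> d"
  using assms by (simp add: ring_rules)

lemma p_mult_diff_mult:
  assumes "a \<in> carrier A" "b \<in> carrier A" "c \<in> carrier A" "d \<in> carrier A"
  shows "p (a \<otimes> b \<ominus> c \<otimes> d) \<le> p a * p (b \<ominus> d) + p (a \<ominus> c) * p d"
  unfolding mult_diff_mult[OF assms]
  by (intro order.trans[OF p_add] add_mono p_mult) (use assms in auto)

abbreviation "cauchy \<equiv> cauchy_seq A p"
abbreviation "cls \<equiv> completion_class A p"
abbreviation "C \<equiv> cstar_completion A p"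

lemma cauchy_closed [simp]: "cauchy s \<Longrightarrow> s n \<in> carrier A"
  by (simp add: cauchy_seq_def)

lemma cauchyD: "cauchy s \<Longrightarrow> 0 < e \<Longrightarrow> \<exists>N. \<forall>m\<ge>N. \<forall>n\<ge>N. p (s m \<ominus> s n) < e"
  by (simp add: cauchy_seq_def)

lemma cauchy_convergent:
  assumes "cauchy s" shows "convergent (\<lambda>n. p (s n))"
proof (rule Cauchy_convergent, rule metric_CauchyI)
  fix e :: real assume "0 < e"
  then obtain N where N: "\<forall>m\<ge>N. \<forall>n\<ge>N. p (s m \<ominus> s n) < e"
    using cauchyD[OF assms] by blast
  have "dist (p (s m)) (p (s n)) < e" if "m \<ge> N" "n \<ge> N" for m n
  proof -
    have "\<bar>p (s m) - p (s n)\<bar> \<le> p (s m \<ominus> s n)"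
      using assms by (intro p_abs_diff) auto
    also have "\<dots> < e" using N that by simp
    finally show ?thesis by (simp add: dist_real_def)
  qed
  then show "\<exists>M. \<forall>m\<ge>M. \<forall>n\<ge>M. dist (p (s m)) (p (s n)) < e" by blast
qed

lemma cauchy_bounded:
  assumes "cauchy s" obtains B where "0 < B" "\<And>n. p (s n) \<le> B"
proof -
  obtain K where K: "0 < K" "\<And>n. norm (p (s n)) \<le> K"
    using convergent_imp_Bseq[OF cauchy_convergent[OF assms]] unfolding Bseq_def by blast
  then have "p (s n) \<le> K" for n using abs_le_D1[of "p (s n)" K] by simp
  then show ?thesis using that K(1) by blast
qed

lemma cauchy_const [simp]: "a \<in> carrier A \<Longrightarrow> cauchy (\<lambda>_. a)"
  by (simp add: cauchy_seq_def diff_self)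

lemma cauchyI:
  assumes "\<And>n. s n \<in> carrier A"
    and "\<And>e. 0 < e \<Longrightarrow> \<exists>N. \<forall>m\<ge>N. \<forall>n\<ge>N. p (s m \<ominus> s n) \<le> e"
  shows "cauchy s"
  unfolding cauchy_seq_def
proof (intro conjI allI impI assms(1))
  fix e :: real assume "0 < e"
  then obtain N where "\<forall>m\<ge>N. \<forall>n\<ge>N. p (s m \<ominus> s n) \<le> e / 2"
    using assms(2)[of "e / 2"] by auto
  then show "\<exists>N. \<forall>m\<ge>N. \<forall>n\<ge>N. p (s m \<ominus> s n) < e"
    using \<open>0 < e\<close> by (intro exI[of _ N]) force
qed

lemma cauchy_add:
  assumes "cauchy s" "cauchy t" shows "cauchy (\<lambda>n. s n \<oplus> t n)"
proof (rule cauchyI)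
  fix e :: real assume "0 < e"
  then obtain M N where "\<forall>m\<ge>M. \<forall>n\<ge>M. p (s m \<ominus> s n) < e / 2" "\<forall>m\<ge>N. \<forall>n\<ge>N. p (t m \<ominus> t n) < e / 2"
    using cauchyD[OF assms(1), of "e / 2"] cauchyD[OF assms(2), of "e / 2"] by auto
  moreover have "p (s m \<oplus> t m \<ominus> (s n \<oplus> t n)) \<le> p (s m \<ominus> s n) + p (t m \<ominus> t n)" for m n
    using assms by (simp add: add_diff_add p_add)
  ultimately have "p (s m \<oplus> t m \<ominus> (s n \<oplus> t n)) \<le> e" if "m \<ge> max M N" "n \<ge> max M N" for m n
    using that by (smt (verit) field_sum_of_halves max.bounded_iff)
  then show "\<exists>N. \<forall>m\<ge>N. \<forall>n\<ge>N. p (s m \<oplus> t m \<ominus> (s n \<oplus> t n)) \<le> e"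
    by blast
qed (use assms in simp)

lemma cauchy_image:
  assumes "cauchy s" "\<And>n. t n \<in> carrier A" "\<And>m n. p (t m \<ominus> t n) \<le> K * p (s m \<ominus> s n)" "0 \<le> K"
  shows "cauchy t"
proof (rule cauchyI)
  fix e :: real assume e: "0 < e"
  then have "0 < e / (K + 1)" using assms(4) by simp
  then obtain N where N: "\<forall>m\<ge>N. \<forall>n\<ge>N. p (s m \<ominus> s n) < e / (K + 1)"
    using cauchyD[OF assms(1)] by blast
  have "p (t m \<ominus> t n) \<le> e" if "m \<ge> N" "n \<ge> N" for m n
  proof -
    have "p (t m \<ominus> t n) \<le> K * (e / (K + 1))"
      using assms(3)[of m n] N that assms(4) by (meson less_imp_le mult_left_mono order.trans)
    also have "\<dots> \<le> e" using e assms(4) by (simp add: divide_simps)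
    finally show ?thesis .
  qed
  then show "\<exists>N. \<forall>m\<ge>N. \<forall>n\<ge>N. p (t m \<ominus> t n) \<le> e" by blast
qed (rule assms(2))

lemma cauchy_smult: "cauchy s \<Longrightarrow> cauchy (\<lambda>n. c \<odot> s n)"
  by (rule cauchy_image[of s _ "cmod c"]) (simp_all add: smult_diff p_smult)

lemma cauchy_star: "cauchy s \<Longrightarrow> cauchy (\<lambda>n. star A (s n))"
  by (rule cauchy_image[of s _ 1]) (simp_all add: star_diff p_star star_closed)

lemma cauchy_minus: "cauchy s \<Longrightarrow> cauchy (\<lambda>n. \<ominus> s n)"
  using cauchy_smult[of s "- 1"] by (simp add: minus_eq_smult)

lemma cauchy_diff: "cauchy s \<Longrightarrow> cauchy t \<Longrightarrow> cauchy (\<lambda>n. s n \<ominus> t n)"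
  unfolding a_minus_def by (intro cauchy_add cauchy_minus)

lemma cauchy_mult:
  assumes "cauchy s" "cauchy t" shows "cauchy (\<lambda>n. s n \<otimes> t n)"
proof (rule cauchyI)
  obtain K where K: "0 < K" "\<And>n. p (s n) \<le> K" using cauchy_bounded[OF assms(1)] by blast
  obtain L where L: "0 < L" "\<And>n. p (t n) \<le> L" using cauchy_bounded[OF assms(2)] by blast
  fix e :: real assume e: "0 < e"
  have "0 < e / (2 * L)" "0 < e / (2 * K)" using e K L by simp_all
  then obtain M N where MN: "\<forall>m\<ge>M. \<forall>n\<ge>M. p (s m \<ominus> s n) < e / (2 * L)"
    "\<forall>m\<ge>N. \<forall>n\<ge>N. p (t m \<ominus> t n) < e / (2 * K)"
    using cauchyD[OF assms(1)] cauchyD[OF assms(2)] by metis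
  have "p (s m \<otimes> t m \<ominus> s n \<otimes> t n) \<le> e" if "m \<ge> max M N" "n \<ge> max M N" for m n
  proof -
    have "p (s m \<otimes> t m \<ominus> s n \<otimes> t n) \<le> p (s m) * p (t m \<ominus> t n) + p (s m \<ominus> s n) * p (t n)"
      using assms by (intro p_mult_diff_mult) auto
    also have "\<dots> \<le> K * (e / (2 * K)) + (e / (2 * L)) * L"
      using MN that K L assms e by (intro add_mono mult_mono) (auto simp: less_imp_le intro!: p_nonneg)
    also have "\<dots> = e" using K L by simp
    finally show ?thesis .
  qed
  then show "\<exists>N. \<forall>m\<ge>N. \<forall>n\<ge>N. p (s m \<otimes> t m \<ominus> s n \<otimes> t n) \<le> e" by blast
qed (use assms in simp)

lemma null_sym:
  "cauchy s \<Longrightarrow> cauchy t \<Longrightarrow> (\<lambda>n. p (s n \<ominus> t n)) \<longlonglongrightarrow> 0 \<Longrightarrow> (\<lambda>n. p (t n \<ominus> s n)) \<longlonglongrightarrow> 0"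
  by (simp add: p_diff_commute[of "t _"])

lemma null_trans:
  assumes "cauchy s" "cauchy t" "cauchy u"
    and "(\<lambda>n. p (s n \<ominus> t n)) \<longlonglongrightarrow> 0" "(\<lambda>n. p (t n \<ominus> u n)) \<longlonglongrightarrow> 0"
  shows "(\<lambda>n. p (s n \<ominus> u n)) \<longlonglongrightarrow> 0"
  by (rule null_comparison[OF _ _ tendsto_add_zero[OF assms(4,5)]])
    (use assms(1-3) p_triangle in \<open>auto intro!: p_nonneg\<close>)

lemma null_refl: "cauchy s \<Longrightarrow> (\<lambda>n. p (s n \<ominus> s n)) \<longlonglongrightarrow> 0"
  by (simp add: diff_self)

lemma class_eq_iff:
  assumes "cauchy s" "cauchy t"
  shows "cls s = cls t \<longleftrightarrow> (\<lambda>n. p (s n \<ominus> t n)) \<longlonglongrightarrow> 0"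
proof
  assume "cls s = cls t"
  moreover have "t \<in> cls t" using assms null_refl by (simp add: completion_class_def)
  ultimately have "t \<in> cls s" by simp
  then show "(\<lambda>n. p (s n \<ominus> t n)) \<longlonglongrightarrow> 0" by (simp add: completion_class_def)
next
  assume "(\<lambda>n. p (s n \<ominus> t n)) \<longlonglongrightarrow> 0"
  then show "cls s = cls t"
    using assms null_trans null_sym unfolding completion_class_def by blast
qed

lemma class_rep:
  assumes "cauchy s"
  shows "cauchy (class_rep (cls s))" "(\<lambda>n. p (s n \<ominus> class_rep (cls s) n)) \<longlonglongrightarrow> 0"
proof -
  have "s \<in> cls s" using assms null_refl by (simp add: completion_class_def)
  then have "class_rep (cls s) \<in> cls s"
    unfolding class_rep_def by (rule someI[of "\<lambda>t. t \<in> cls s"])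
  then show "cauchy (class_rep (cls s))" "(\<lambda>n. p (s n \<ominus> class_rep (cls s) n)) \<longlonglongrightarrow> 0"
    by (simp_all add: completion_class_def)
qed

lemma carrier_completion: "carrier C = cls ` {s. cauchy s}"
  by (simp add: cstar_completion_def)

lemma class_closed [simp]: "cauchy s \<Longrightarrow> cls s \<in> carrier C"
  by (simp add: carrier_completion)

lemma completionE:
  assumes "P \<in> carrier C" obtains s where "cauchy s" "P = cls s"
  using assms by (auto simp: carrier_completion)

text \<open>The operations of the completion are defined through \<open>class_rep\<close>. This
  lemma and the following ones replace the chosen representatives by arbitrary ones; afterwards all
  laws hold termwise.\<close>

lemma completion_add: 
  assumes "cauchy s" "cauchy t" shows "cls s \<oplus>\<^bsub>C\<^esub> cls t = cls (\<lambda>n. s n \<oplus> t n)"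
proof -
  note r = class_rep[OF assms(1)] class_rep[OF assms(2)]
  have "(\<lambda>n. p (s n \<oplus> t n \<ominus> (class_rep (cls s) n \<oplus> class_rep (cls t) n))) \<longlonglongrightarrow> 0"
    by (rule null_comparison[OF _ _ tendsto_add_zero[OF r(2,4)]])
      (use assms r in \<open>auto simp: add_diff_add intro!: p_nonneg p_add\<close>)
  then show ?thesis
    using assms r by (simp add: cstar_completion_def) (subst eq_commute, simp add: class_eq_iff cauchy_add)
qed

lemma completion_mult:
  assumes "cauchy s" "cauchy t" shows "cls s \<otimes>\<^bsub>C\<^esub> cls t = cls (\<lambda>n. s n \<otimes> t n)"
proof -
  note r = class_rep[OF assms(1)] class_rep[OF assms(2)]
  obtain K where K: "0 < K" "\<And>n. p (s n) \<le> K" using cauchy_bounded[OF assms(1)] by blast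
  obtain L where L: "0 < L" "\<And>n. p (class_rep (cls t) n) \<le> L" using cauchy_bounded[OF r(3)] by blast
  have "(\<lambda>n. p (s n \<otimes> t n \<ominus> class_rep (cls s) n \<otimes> class_rep (cls t) n)) \<longlonglongrightarrow> 0"
  proof (rule null_comparison)
    show "(\<lambda>n. K * p (t n \<ominus> class_rep (cls t) n) + p (s n \<ominus> class_rep (cls s) n) * L) \<longlonglongrightarrow> 0"
      using r(2,4) by (intro tendsto_add_zero tendsto_mult_right_zero tendsto_mult_left_zero)
    fix n
    show "p (s n \<otimes> t n \<ominus> class_rep (cls s) n \<otimes> class_rep (cls t) n)
      \<le> K * p (t n \<ominus> class_rep (cls t) n) + p (s n \<ominus> class_rep (cls s) n) * L"
      using assms r K L
      by (intro order.trans[OF p_mult_diff_mult] add_mono mult_mono) (auto intro!: p_nonneg)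
  qed (use assms r in \<open>auto intro!: p_nonneg\<close>)
  then show ?thesis
    using assms r by (simp add: cstar_completion_def) (subst eq_commute, simp add: class_eq_iff cauchy_mult)
qed

lemma completion_smult:
  assumes "cauchy s" shows "c \<odot>\<^bsub>C\<^esub> cls s = cls (\<lambda>n. c \<odot> s n)"
proof -
  note r = class_rep[OF assms(1)]
  have "(\<lambda>n. p (c \<odot> s n \<ominus> c \<odot> class_rep (cls s) n)) \<longlonglongrightarrow> 0"
    using tendsto_mult_right_zero[OF r(2)] assms r by (simp add: smult_diff p_smult)
  then show ?thesis
    using assms r by (simp add: cstar_completion_def) (subst eq_commute, simp add: class_eq_iff cauchy_smult)
qed

lemma completion_star:
  assumes "cauchy s" shows "star C (cls s) = cls (\<lambda>n. star A (s n))"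
proof -
  note r = class_rep[OF assms(1)]
  have "(\<lambda>n. p (star A (s n) \<ominus> star A (class_rep (cls s) n))) \<longlonglongrightarrow> 0"
    using r assms by (simp add: star_diff p_star)
  then show ?thesis
    using assms r by (simp add: cstar_completion_def) (subst eq_commute, simp add: class_eq_iff cauchy_star)
qed

lemma completion_one: "\<one>\<^bsub>C\<^esub> = cls (\<lambda>_. \<one>)"
  and completion_zero: "\<zero>\<^bsub>C\<^esub> = cls (\<lambda>_. \<zero>)"
  by (simp_all add: cstar_completion_def)

lemma completion_nrm:
  assumes "cauchy s" shows "(\<lambda>n. p (s n)) \<longlonglongrightarrow> nrm C (cls s)"
proof -
  note r = class_rep[OF assms]
  have "(\<lambda>n. p (class_rep (cls s) n)) \<longlonglongrightarrow> nrm C (cls s)"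
    using cauchy_convergent[OF r(1)] by (simp add: cstar_completion_def convergent_LIMSEQ_iff)
  moreover have "(\<lambda>n. p (s n) - p (class_rep (cls s) n)) \<longlonglongrightarrow> 0"
    by (rule tendsto_rabs_zero_cancel, rule null_comparison[OF _ _ r(2)])
      (use assms r p_abs_diff in auto)
  ultimately have "(\<lambda>n. p (class_rep (cls s) n) + (p (s n) - p (class_rep (cls s) n))) \<longlonglongrightarrow> nrm C (cls s) + 0"
    by (rule tendsto_add)
  then show ?thesis by simp
qed

lemma completion_nrm_eqI: "cauchy s \<Longrightarrow> (\<lambda>n. p (s n)) \<longlonglongrightarrow> x \<Longrightarrow> nrm C (cls s) = x"
  using LIMSEQ_unique[OF completion_nrm] .

lemmas completion_ops = completion_add completion_mult completion_smult completion_star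
  completion_one completion_zero cauchy_add cauchy_mult cauchy_smult cauchy_star cauchy_minus

lemma star_algebra_completion: "star_algebra C"
proof -
  have ab: "abelian_group C"
  proof (rule abelian_groupI)
    fix P assume "P \<in> carrier C"
    then obtain s where s: "cauchy s" "P = cls s" by (rule completionE)
    then show "\<exists>Q\<in>carrier C. Q \<oplus>\<^bsub>C\<^esub> P = \<zero>\<^bsub>C\<^esub>"
      by (intro bexI[of _ "cls (\<lambda>n. \<ominus> s n)"]) (simp_all add: completion_ops l_minus_self)
  qed (auto elim!: completionE simp: completion_ops ring_rules)
  have mon: "monoid C"
    by (rule monoidI) (auto elim!: completionE simp: completion_ops ring_rules)
  have ring: "ring C"
    by (rule ringI[OF ab mon]) (auto elim!: completionE simp: completion_ops ring_rules)
  have mod: "Module.module complex_ring C"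
    by (rule moduleI[OF cring_from_type_algebra ab])
      (auto elim!: completionE simp: completion_ops smult_l_distr[simplified] smult_r_distr smult_assoc1[simplified] smult_one[simplified])
  show ?thesis
    by (intro star_algebra.intro ring mod star_algebra_axioms.intro)
      (auto elim!: completionE simp: completion_ops smult_mult_left smult_mult_right star_closed
        star_star star_add star_smult star_mult)
qed

lemma completion_diff:
  assumes "cauchy s" "cauchy t" shows "cls s \<ominus>\<^bsub>C\<^esub> cls t = cls (\<lambda>n. s n \<ominus> t n)"
proof -
  interpret C: star_algebra C by (rule star_algebra_completion)
  have "\<ominus>\<^bsub>C\<^esub> cls t = cls (\<lambda>n. \<ominus> t n)"
    using assms by (intro abelian_group.minus_equality[OF C.abelian_group_axioms]) (simp_all add: completion_ops l_minus_self)
  then show ?thesis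
    using assms unfolding a_minus_def by (simp add: completion_ops)
qed

lemma cstar_seminorm_completion: "cstar_seminorm C (nrm C)"
  unfolding cstar_seminorm_def
proof (intro conjI ballI allI)
  fix P c assume "P \<in> carrier C"
  then obtain s where s: "cauchy s" "P = cls s" by (rule completionE)
  note ns = completion_nrm[OF s(1)]
  show "0 \<le> nrm C P"
    unfolding s(2) by (rule LIMSEQ_le_const[OF ns]) (use s in \<open>auto intro!: p_nonneg\<close>)
  show "nrm C (c \<odot>\<^bsub>C\<^esub> P) = cmod c * nrm C P"
    using s tendsto_mult_left[OF ns, of "cmod c"]
    by (simp add: completion_ops p_smult completion_nrm_eqI)
  show "nrm C (star C P \<otimes>\<^bsub>C\<^esub> P) = (nrm C P)\<^sup>2"
    using s tendsto_power[OF ns, of 2]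
    by (simp add: completion_ops p_cstar completion_nrm_eqI)
  fix Q assume "Q \<in> carrier C"
  then obtain t where t: "cauchy t" "Q = cls t" by (rule completionE)
  note nt = completion_nrm[OF t(1)]
  show "nrm C (P \<oplus>\<^bsub>C\<^esub> Q) \<le> nrm C P + nrm C Q"
    using LIMSEQ_le[OF completion_nrm[OF cauchy_add[OF s(1) t(1)]] tendsto_add[OF ns nt]] s t
    by (simp add: completion_ops p_add)
  show "nrm C (P \<otimes>\<^bsub>C\<^esub> Q) \<le> nrm C P * nrm C Q"
    using LIMSEQ_le[OF completion_nrm[OF cauchy_mult[OF s(1) t(1)]] tendsto_mult[OF ns nt]] s t
    by (simp add: completion_ops p_mult)
qed

lemma embed_cauchy: "completion_embed A p a = cls (\<lambda>_. a)"
  by (simp add: completion_embed_def)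

lemma embed_closed [simp]: "a \<in> carrier A \<Longrightarrow> completion_embed A p a \<in> carrier C"
  by (simp add: embed_cauchy)

lemma nrm_embed: "a \<in> carrier A \<Longrightarrow> nrm C (completion_embed A p a) = p a"
  unfolding embed_cauchy by (rule completion_nrm_eqI) simp_all

lemma star_hom_embed: "star_hom A C (completion_embed A p)"
  unfolding star_hom_def by (auto intro!: ring_hom_memI simp: embed_cauchy completion_ops)

lemma nrm_diff:
  assumes "cauchy s" "cauchy t"
  shows "(\<lambda>n. p (s n \<ominus> t n)) \<longlonglongrightarrow> nrm C (cls s \<ominus>\<^bsub>C\<^esub> cls t)"
  using completion_nrm[OF cauchy_diff[OF assms]] assms by (simp add: completion_diff)

text \<open>Density of the embedded algebra in quantitative form: the terms of a sequence converge
  to its class.\<close>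

lemma class_limit:
  assumes "cauchy s" "0 < e"
  shows "\<exists>N. \<forall>n\<ge>N. nrm C (cls s \<ominus>\<^bsub>C\<^esub> completion_embed A p (s n)) \<le> e"
proof -
  obtain N where N: "\<forall>m\<ge>N. \<forall>n\<ge>N. p (s m \<ominus> s n) < e"
    using cauchyD[OF assms] by blast
  have "nrm C (cls s \<ominus>\<^bsub>C\<^esub> completion_embed A p (s n)) \<le> e" if "n \<ge> N" for n
    unfolding embed_cauchy
    by (rule LIMSEQ_le_const2[OF nrm_diff]) (use assms N that in \<open>auto simp: less_imp_le intro!: exI[of _ N]\<close>)
  then show ?thesis by blast
qed

text \<open>For completeness, the \<open>k\<close>-th term of a Cauchy sequence of classes is
  approximated within \<open>1 / (k + 1)\<close> by an embedded element \<open>a k\<close>. The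
  sequence \<open>a\<close> is Cauchy and its class is the limit.\<close>

theorem unital_cstar_algebra_completion: "unital_cstar_algebra C"
proof -
  interpret C: star_algebra C by (rule star_algebra_completion)
  interpret C: seminormed_star_algebra C "nrm C"
    by unfold_locales (rule cstar_seminorm_completion)
  have "complete_wrt C (nrm C)"
    unfolding complete_wrt_def
  proof (intro allI impI)
    fix S assume S: "cauchy_seq C (nrm C) S"
    have "\<exists>a. a \<in> carrier A \<and> nrm C (S k \<ominus>\<^bsub>C\<^esub> completion_embed A p a) \<le> 1 / Suc k" for k
    proof -
      obtain s where s: "cauchy s" "S k = cls s"
        using C.cauchy_closed[OF S] by (rule completionE)
      then show ?thesis
        using class_limit[OF s(1), of "1 / Suc k"] by (metis cauchy_closed divide_pos_pos of_nat_0_less_iff order_refl zero_less_Suc zero_less_one)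
    qed
    then obtain a where a: "\<And>k. a k \<in> carrier A"
      "\<And>k. nrm C (S k \<ominus>\<^bsub>C\<^esub> completion_embed A p (a k)) \<le> 1 / Suc k"
      by metis
    let ?E = "\<lambda>k. completion_embed A p (a k)"
    have tri: "p (a m \<ominus> a n) \<le> 1 / Suc m + nrm C (S m \<ominus>\<^bsub>C\<^esub> S n) + 1 / Suc n" for m n
    proof -
      have "p (a m \<ominus> a n) = nrm C (?E m \<ominus>\<^bsub>C\<^esub> ?E n)"
        using a(1) completion_diff[of "\<lambda>_. a m" "\<lambda>_. a n"] nrm_embed[of "a m \<ominus> a n"]
        by (simp add: embed_cauchy)
      also have "\<dots> \<le> nrm C (?E m \<ominus>\<^bsub>C\<^esub> S m) + (nrm C (S m \<ominus>\<^bsub>C\<^esub> S n) + nrm C (S n \<ominus>\<^bsub>C\<^esub> ?E n))"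
        using a(1) C.cauchy_closed[OF S]
        by (intro order.trans[OF C.p_triangle[of _ "S m"]] add_mono C.p_triangle order_refl) auto
      finally show ?thesis
        using a(2)[of m] a(2)[of n] C.p_diff_commute[of "?E m" "S m"] a(1) C.cauchy_closed[OF S] by simp
    qed
    have lim0: "(\<lambda>k. 1 / real (Suc k)) \<longlonglongrightarrow> 0"
      by (rule LIMSEQ_Suc) (rule lim_1_over_n)
    have "cauchy a"
    proof (rule cauchyI)
      fix e :: real assume e: "0 < e"
      then obtain M where M: "\<forall>m\<ge>M. \<forall>n\<ge>M. nrm C (S m \<ominus>\<^bsub>C\<^esub> S n) < e / 3"
        using C.cauchyD[OF S, of "e / 3"] by auto
      have "\<forall>\<^sub>F k in sequentially. 1 / real (Suc k) < e / 3"
        using e by (intro order_tendstoD(2)[OF lim0]) simp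
      then obtain N where N: "\<forall>k\<ge>N. 1 / real (Suc k) < e / 3"
        unfolding eventually_sequentially by blast
      have "p (a m \<ominus> a n) \<le> e" if "m \<ge> max M N" "n \<ge> max M N" for m n
      proof -
        have "1 / real (Suc m) < e / 3" "1 / real (Suc n) < e / 3" "nrm C (S m \<ominus>\<^bsub>C\<^esub> S n) < e / 3"
          using that M N by simp_all
        then show ?thesis using tri[of m n] by linarith
      qed
      then show "\<exists>N. \<forall>m\<ge>N. \<forall>n\<ge>N. p (a m \<ominus> a n) \<le> e" by blast
    qed (rule a(1))
    have "(\<lambda>n. nrm C (S n \<ominus>\<^bsub>C\<^esub> cls a)) \<longlonglongrightarrow> 0"
    proof (rule null_comparison)
      fix n
      show "0 \<le> nrm C (S n \<ominus>\<^bsub>C\<^esub> cls a)"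
        using C.cauchy_closed[OF S] \<open>cauchy a\<close> by (intro C.p_nonneg) auto
      show "nrm C (S n \<ominus>\<^bsub>C\<^esub> cls a) \<le> 1 / Suc n + nrm C (cls a \<ominus>\<^bsub>C\<^esub> ?E n)"
        using C.p_triangle[of "S n" "?E n" "cls a"] a(2)[of n] C.p_diff_commute[of "?E n" "cls a"]
          C.cauchy_closed[OF S] \<open>cauchy a\<close> a(1) by simp
    next
      have "(\<lambda>n. nrm C (cls a \<ominus>\<^bsub>C\<^esub> ?E n)) \<longlonglongrightarrow> 0"
      proof (rule LIMSEQ_I)
        fix r :: real assume "0 < r"
        then obtain N where "\<forall>n\<ge>N. nrm C (cls a \<ominus>\<^bsub>C\<^esub> ?E n) \<le> r / 2"
          using class_limit[OF \<open>cauchy a\<close>, of "r / 2"] by auto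
        then show "\<exists>N. \<forall>n\<ge>N. norm (nrm C (cls a \<ominus>\<^bsub>C\<^esub> ?E n) - 0) < r"
          using \<open>0 < r\<close> \<open>cauchy a\<close> a(1) C.p_nonneg[of "cls a \<ominus>\<^bsub>C\<^esub> ?E _"] by (intro exI[of _ N]) force
      qed
      then show "(\<lambda>n. 1 / Suc n + nrm C (cls a \<ominus>\<^bsub>C\<^esub> ?E n)) \<longlonglongrightarrow> 0"
        using tendsto_add_zero[OF lim0] by simp
    qed
    then show "\<exists>l\<in>carrier C. (\<lambda>n. nrm C (S n \<ominus>\<^bsub>C\<^esub> l)) \<longlonglongrightarrow> 0"
      using \<open>cauchy a\<close> by (intro bexI[of _ "cls a"]) auto
  qed
  moreover have "P = \<zero>\<^bsub>C\<^esub>" if P: "P \<in> carrier C" "nrm C P = 0" for P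
  proof -
    obtain s where s: "cauchy s" "P = cls s" using P(1) by (rule completionE)
    have "(\<lambda>n. p (s n \<ominus> \<zero>)) \<longlonglongrightarrow> 0"
      using completion_nrm[OF s(1)] P(2) s by (simp add: diff_zero)
    then show ?thesis using s by (simp add: completion_zero class_eq_iff)
  qed
  ultimately show ?thesis
    by (intro unital_cstar_algebra.intro star_algebra_completion unital_cstar_algebra_axioms.intro
        cstar_seminorm_completion)
qed

end

section \<open>Lifting Cauchy sequences along a smaller C*-seminorm\<close>

text \<open>The subalgebra \<open>D\<close> is carried along because lifting is used twice: in the
  whole algebra for the surjection from O_G, and near the group algebra for A_max.\<close>

locale cstar_seminorm_pair =
  A: cstar_seminormed cs st Q + B: cstar_seminormed cs st Q'
  for cs :: "complex \<Rightarrow> 'a::ring_1" and st Q Q' +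
  fixes D :: "'a set"
  assumes le: "Q' x \<le> Q x"
    and one_D: "1 \<in> D" and add_D: "x \<in> D \<Longrightarrow> y \<in> D \<Longrightarrow> x + y \<in> D"
    and mult_D: "x \<in> D \<Longrightarrow> y \<in> D \<Longrightarrow> x * y \<in> D"
    and cs_D: "x \<in> D \<Longrightarrow> cs c * x \<in> D" and st_D: "x \<in> D \<Longrightarrow> st x \<in> D"
begin

lemma zero_D: "0 \<in> D"
  using cs_D[OF one_D, of 0] by simp

lemma diff_D: "x \<in> D \<Longrightarrow> y \<in> D \<Longrightarrow> x - y \<in> D"
  using add_D[OF _ cs_D[of y "- 1"], of x] by (simp add: A.cs_minus)

lemma approximate_lift_scaled:
  assumes x: "x \<in> D" "Q' x \<le> c" and c: "0 < c"
  shows "\<exists>y\<in>D. Q y \<le> 2 * c \<and> Q' (x - y) \<le> 5 / 8 * c"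
proof -
  let ?u = "cs (complex_of_real (1 / c)) * x"
  have "Q' ?u \<le> 1"
    using x(2) c unfolding B.Q_rc_mult by (simp add: divide_simps)
  then obtain y where y: "y \<in> D" "Q y \<le> 2" "Q' (?u - y) \<le> 5 / 8"
    using approximate_lift[OF A.cstar_seminormed_axioms B.cstar_seminormed_axioms le one_D add_D mult_D cs_D st_D cs_D[OF x(1)]]
    by metis
  let ?y = "cs (complex_of_real c) * y"
  have "x - ?y = cs (complex_of_real c) * (?u - y)"
    using c by (simp add: right_diff_distrib A.cs_cs flip: of_real_mult)
  then have "Q' (x - ?y) = c * Q' (?u - y)"
    using c by (simp only: B.Q_rc_mult abs_of_pos)
  also have "\<dots> \<le> c * (5 / 8)"
    using y(3) c by (intro mult_left_mono) auto
  finally have "Q' (x - ?y) \<le> 5 / 8 * c"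
    by simp
  moreover have "Q ?y \<le> 2 * c"
    using y(2) c unfolding A.Q_rc_mult by simp
  ultimately show ?thesis
    using cs_D[OF y(1)] by blast
qed

text \<open>The remainder is lifted again and again. The costs form the geometric series
  \<open>2 c (1 + 5/8 + ...) = 16/3 c\<close>, which is below \<open>6 c\<close> independently of
  the tolerance.\<close>

lemma lift_within_tolerance:
  assumes x: "x \<in> D" "Q' x \<le> c" and c: "0 < c" and \<epsilon>: "0 < \<epsilon>"
  shows "\<exists>y\<in>D. Q y \<le> 6 * c \<and> Q' (x - y) \<le> \<epsilon>"
proof -
  have *: "\<exists>y\<in>D. Q y \<le> 16 / 3 * c * (1 - (5 / 8) ^ n) \<and> Q' (x - y) \<le> (5 / 8) ^ n * c" for n
  proof (induction n)
    case 0
    then show ?case using x(2) zero_D by (intro bexI[of _ 0]) auto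
  next
    case (Suc n)
    then obtain y where y: "y \<in> D" "Q y \<le> 16 / 3 * c * (1 - (5 / 8) ^ n)" "Q' (x - y) \<le> (5 / 8) ^ n * c"
      by blast
    obtain z where z: "z \<in> D" "Q z \<le> 2 * ((5 / 8) ^ n * c)" "Q' (x - y - z) \<le> 5 / 8 * ((5 / 8) ^ n * c)"
      using approximate_lift_scaled[OF diff_D[OF x(1) y(1)] y(3)] c by auto
    have "Q (y + z) \<le> 16 / 3 * c * (1 - (5 / 8) ^ Suc n)"
      using A.Q_add[of y z] y(2) z(2) by (simp add: algebra_simps)
    moreover have "Q' (x - (y + z)) \<le> (5 / 8) ^ Suc n * c"
      using z(3) by (simp add: algebra_simps)
    ultimately show ?case using add_D[OF y(1) z(1)] by blast
  qed
  have "(\<lambda>n. (5 / 8) ^ n * c) \<longlonglongrightarrow> 0 * c"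
    by (intro tendsto_mult tendsto_const LIMSEQ_realpow_zero) auto
  then have "\<forall>\<^sub>F n in sequentially. (5 / 8) ^ n * c < \<epsilon>"
    using \<epsilon> by (intro order_tendstoD) auto
  then obtain n where n: "(5 / 8) ^ n * c < \<epsilon>"
    by (auto simp: eventually_sequentially)
  obtain y where y: "y \<in> D" "Q y \<le> 16 / 3 * c * (1 - (5 / 8) ^ n)" "Q' (x - y) \<le> (5 / 8) ^ n * c"
    using *[of n] by blast
  have "16 / 3 * c * (1 - (5 / 8) ^ n) \<le> 16 / 3 * c * 1"
    using c by (intro mult_left_mono) auto
  then have "Q y \<le> 6 * c"
    using y(2) c by linarith
  then show ?thesis
    using y n by (intro bexI[of _ y]) auto
qed

text \<open>Along a sparse subsequence the increments are of size \<open>(1/2) ^ k\<close> for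
  \<open>Q'\<close>. Lifting each corrected increment at bounded cost makes the increments of
  \<open>t\<close> summable for \<open>Q\<close>.\<close>

theorem lift_Cauchy:
  assumes s: "\<And>n. s n \<in> D" and cauchy: "\<And>e. 0 < e \<Longrightarrow> \<exists>N. \<forall>m\<ge>N. \<forall>n\<ge>N. Q' (s m - s n) < e"
  obtains t where "\<And>n. t n \<in> D" "\<And>e. 0 < e \<Longrightarrow> \<exists>N. \<forall>m\<ge>N. \<forall>n\<ge>N. Q (t m - t n) < e"
    "(\<lambda>n. Q' (s n - t n)) \<longlonglongrightarrow> 0"
proof -
  let ?h = "\<lambda>k. (1 / 2 :: real) ^ k"
  have "\<exists>N. \<forall>m\<ge>N. \<forall>n\<ge>N. Q' (s m - s n) < ?h k" for k
    by (rule cauchy) simp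
  then obtain N where N: "\<And>k m n. m \<ge> N k \<Longrightarrow> n \<ge> N k \<Longrightarrow> Q' (s m - s n) < ?h k"
    by metis
  \<comment> \<open>The maximum ensures \<open>N j \<le> M k\<close> for all
    \<open>j \<le> k\<close>, and the summand \<open>k\<close> ensures
    \<open>k \<le> M k\<close>.\<close>
  define M where "M = (\<lambda>k. Max (N ` {..k}) + k)"
  have M_N: "N j \<le> M k" if "j \<le> k" for j k
    using that unfolding M_def by (intro trans_le_add1 Max_ge) auto
  have M_k: "k \<le> M k" for k
    by (simp add: M_def)
  define P where "P = (\<lambda>k y. y \<in> D \<and> Q' (s (M k) - y) \<le> ?h k)"
  define R where "R = (\<lambda>k y z. Q (z - y) \<le> 12 * ?h k)"
  have "\<exists>y. P 0 y"
    using s[of "M 0"] by (intro exI[of _ "s (M 0)"]) (simp add: P_def)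
  moreover have "\<exists>z. P (Suc k) z \<and> R k y z" if "P k y" for k y
  proof -
    have y: "y \<in> D" "Q' (s (M k) - y) \<le> ?h k" using that by (auto simp: P_def)
    have "Q' (s (M (Suc k)) - s (M k)) < ?h k"
      by (intro N M_N) auto
    moreover have "Q' (s (M (Suc k)) - y) \<le> Q' (s (M (Suc k)) - s (M k)) + Q' (s (M k) - y)"
      using B.Q_add[of "s (M (Suc k)) - s (M k)" "s (M k) - y"] by simp
    ultimately have "Q' (s (M (Suc k)) - y) \<le> 2 * ?h k"
      using y(2) by linarith
    \<comment> \<open>The distance \<open>2 * ?h k\<close> consists of the increment of the
      subsequence and the error left from \<open>y\<close>. Its lift costs six times as much, hence
      the 12 in \<open>R\<close>.\<close>
    then obtain d where d: "d \<in> D" "Q d \<le> 6 * (2 * ?h k)" "Q' (s (M (Suc k)) - y - d) \<le> ?h (Suc k)"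
      using lift_within_tolerance[OF diff_D[OF s y(1)], of "M (Suc k)" "2 * ?h k" "?h (Suc k)"] by auto
    then have "P (Suc k) (y + d)" "R k y (y + d)"
      using add_D[OF y(1) d(1)] by (simp_all add: P_def R_def diff_diff_eq)
    then show ?thesis by blast
  qed
  ultimately obtain t where t: "\<And>k. P k (t k)" "\<And>k. R k (t k) (t (Suc k))"
    using dependent_nat_choice[of P R] by metis
  have step: "Q (t (k + j) - t k) \<le> 24 * ?h k" for k j
  proof -
    \<comment> \<open>The subtracted term closes the telescoping induction:
      \<open>12 * ?h (k + j)\<close> is exactly the next drop of \<open>24 * ?h\<close>.\<close>
    have "Q (t (k + j) - t k) \<le> 24 * ?h k - 24 * ?h (k + j)"
    proof (induction j)
      case (Suc j)
      have "Q (t (k + Suc j) - t k) \<le> Q (t (Suc (k + j)) - t (k + j)) + Q (t (k + j) - t k)"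
        using A.Q_add[of "t (Suc (k + j)) - t (k + j)" "t (k + j) - t k"] by simp
      moreover have "Q (t (Suc (k + j)) - t (k + j)) \<le> 12 * ?h (k + j)"
        using t(2) by (simp add: R_def)
      ultimately show ?case using Suc by simp
    qed simp
    moreover have "0 \<le> ?h (k + j)" by simp
    ultimately show ?thesis by linarith
  qed
  have half0: "(\<lambda>k. c * ?h k) \<longlonglongrightarrow> 0" for c
    by (intro tendsto_mult_right_zero LIMSEQ_realpow_zero) auto
  show ?thesis
  proof (rule that[of t])
    show "t n \<in> D" for n using t(1) by (simp add: P_def)
    fix e :: real assume "0 < e"
    then have "\<forall>\<^sub>F k in sequentially. 48 * ?h k < e"
      using order_tendstoD(2)[OF half0] by blast
    then obtain K where K: "48 * ?h K < e"
      by (auto simp: eventually_sequentially)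
    have "Q (t m - t n) < e" if "m \<ge> K" "n \<ge> K" for m n
    proof -
      have "Q (t m - t n) \<le> Q (t m - t K) + Q (t n - t K)"
        using A.Q_diff[of "t m - t K" "t n - t K"] by simp
      then show ?thesis
        using step[of K "m - K"] step[of K "n - K"] that K by simp
    qed
    then show "\<exists>N. \<forall>m\<ge>N. \<forall>n\<ge>N. Q (t m - t n) < e" by blast
  next
    show "(\<lambda>n. Q' (s n - t n)) \<longlonglongrightarrow> 0"
    proof (rule LIMSEQ_I)
      fix e :: real assume "0 < e"
      then have "\<forall>\<^sub>F k in sequentially. 2 * ?h k < e"
        using order_tendstoD(2)[OF half0] by blast
      then obtain K where K: "\<And>k. k \<ge> K \<Longrightarrow> 2 * ?h k < e"
        by (auto simp: eventually_sequentially)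
      have "Q' (s n - t n) < e" if n: "n \<ge> max K (N K)" for n
      proof -
        have "Q' (s n - s (M n)) < ?h K"
          using n M_k[of n] by (intro N) auto
        moreover have "Q' (s (M n) - t n) \<le> ?h n" using t(1) by (simp add: P_def)
        moreover have "?h n \<le> ?h K" using n by (intro power_decreasing) auto
        moreover have "Q' (s n - t n) \<le> Q' (s n - s (M n)) + Q' (s (M n) - t n)"
          using B.Q_add[of "s n - s (M n)" "s (M n) - t n"] by simp
        ultimately show ?thesis using K[of K] by linarith
      qed
      then show "\<exists>N. \<forall>n\<ge>N. norm (Q' (s n - t n) - 0) < e"
        by (intro exI[of _ "max K (N K)"]) simp
    qed
  qed
qed

end

section \<open>The free *-algebra on all elements of a type\<close>

lemma star_algebra_free: "star_algebra (free_star_algebra S)"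
  unfolding free_star_algebra_def
proof (rule star_algebra_monoid_star_algebra)
  let ?M = "\<lparr>carrier = lists (S \<times> (UNIV :: bool set)), monoid.mult = (@), one = []\<rparr>"
  show "monoid ?M" by unfold_locales auto
  fix w assume "w \<in> carrier ?M"
  then show "rev (map (\<lambda>(i, b). (i, \<not> b)) w) \<in> carrier ?M"
    by (auto simp: lists_eq_set)
  show "rev (map (\<lambda>(i, b). (i, \<not> b)) (rev (map (\<lambda>(i, b). (i, \<not> b)) w))) = w"
    by (simp add: rev_map o_def case_prod_unfold)
qed auto

lemmas free_star_algebra_simps =
  monoid_star_algebra_simps[where M = "\<lparr>carrier = lists (S \<times> UNIV), monoid.mult = (@), one = []\<rparr>"
    and \<sigma> = "\<lambda>w. rev (map (\<lambda>(i, b). (i, \<not> b)) w)", folded free_star_algebra_def, simplified] for S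

lemma free_induct [consumes 1, case_names zero add]:
  assumes "f \<in> carrier (free_star_algebra S)" "P \<zero>\<^bsub>free_star_algebra S\<^esub>"
    and "\<And>f c w. f \<in> carrier (free_star_algebra S) \<Longrightarrow> w \<in> lists (S \<times> UNIV) \<Longrightarrow> P f \<Longrightarrow>
      P (c \<odot>\<^bsub>free_star_algebra S\<^esub> point_mass w \<oplus>\<^bsub>free_star_algebra S\<^esub> f)"
  shows "P f"
  using assms(1) unfolding free_star_algebra_def
proof (rule monoid_star_algebra_induct)
  let ?M = "\<lparr>carrier = lists (S \<times> UNIV), monoid.mult = (@), one = []\<rparr>"
  show "P (\<lambda>m. 0)" using assms(2) by (simp add: free_star_algebra_simps)
  show "P (c \<odot>\<^bsub>monoid_star_algebra ?M (\<lambda>w. rev (map (\<lambda>(i, b). (i, \<not> b)) w))\<^esub> point_mass m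
      \<oplus>\<^bsub>monoid_star_algebra ?M (\<lambda>w. rev (map (\<lambda>(i, b). (i, \<not> b)) w))\<^esub> f)"
    if "f \<in> carrier (monoid_star_algebra ?M (\<lambda>w. rev (map (\<lambda>(i, b). (i, \<not> b)) w)))" "m \<in> carrier ?M" "P f" for f c m
    using assms(3)[of f m c] that by (simp add: free_star_algebra_def)
qed

lemma free_point_mass:
  assumes "w \<in> lists (S \<times> UNIV)"
  shows "point_mass w \<in> carrier (free_star_algebra S)"
    and "point_mass w \<otimes>\<^bsub>free_star_algebra S\<^esub> point_mass w' = point_mass (w @ w')"
    and "star (free_star_algebra S) (point_mass w) = point_mass (rev (map (\<lambda>(i, b). (i, \<not> b)) w))"
proof -
  show "point_mass w \<in> carrier (free_star_algebra S)"
    using assms unfolding free_star_algebra_def by (intro point_mass_closed) simp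
  show "point_mass w \<otimes>\<^bsub>free_star_algebra S\<^esub> point_mass w' = point_mass (w @ w')"
    unfolding free_star_algebra_def point_mass_mult by simp
  show "star (free_star_algebra S) (point_mass w) = point_mass (rev (map (\<lambda>(i, b). (i, \<not> b)) w))"
    unfolding free_star_algebra_def using assms
    by (intro point_mass_star) (auto simp: lists_eq_set rev_map o_def case_prod_unfold)
qed

typedef 'i free_alg = "carrier (free_star_algebra (UNIV :: 'i set))"
  morphisms coeffs Abs_free_alg
  by (rule exI[of _ "\<lambda>_. 0"]) (simp add: free_star_algebra_simps)

instantiation free_alg :: (type) ring_1
begin

definition "0 = Abs_free_alg \<zero>\<^bsub>free_star_algebra UNIV\<^esub>"
definition "1 = Abs_free_alg \<one>\<^bsub>free_star_algebra UNIV\<^esub>"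
definition "x + y = Abs_free_alg (coeffs x \<oplus>\<^bsub>free_star_algebra UNIV\<^esub> coeffs y)"
definition "x * y = Abs_free_alg (coeffs x \<otimes>\<^bsub>free_star_algebra UNIV\<^esub> coeffs y)"
definition "- x = Abs_free_alg (\<ominus>\<^bsub>free_star_algebra UNIV\<^esub> coeffs x)"
definition "x - y = Abs_free_alg (coeffs x \<ominus>\<^bsub>free_star_algebra UNIV\<^esub> coeffs y)"

instance
proof -
  interpret F: star_algebra "free_star_algebra (UNIV :: 'a set)" by (rule star_algebra_free)
  have c: "coeffs x \<in> carrier (free_star_algebra UNIV)" for x :: "'a free_alg"
    by (rule coeffs)
  have simps: "coeffs (0 :: 'a free_alg) = \<zero>\<^bsub>free_star_algebra UNIV\<^esub>"
    "coeffs (1 :: 'a free_alg) = \<one>\<^bsub>free_star_algebra UNIV\<^esub>"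
    "coeffs (x + y) = coeffs x \<oplus>\<^bsub>free_star_algebra UNIV\<^esub> coeffs y"
    "coeffs (x * y) = coeffs x \<otimes>\<^bsub>free_star_algebra UNIV\<^esub> coeffs y"
    "coeffs (- x) = \<ominus>\<^bsub>free_star_algebra UNIV\<^esub> coeffs x"
    "coeffs (x - y) = coeffs x \<ominus>\<^bsub>free_star_algebra UNIV\<^esub> coeffs y" for x y :: "'a free_alg"
    by (simp_all add: zero_free_alg_def one_free_alg_def plus_free_alg_def times_free_alg_def
        uminus_free_alg_def minus_free_alg_def Abs_free_alg_inverse F.ring_rules c)
  have ne: "(0 :: 'a free_alg) \<noteq> 1"
    unfolding coeffs_inject[symmetric] simps
    by (simp add: free_star_algebra_simps point_mass_def fun_eq_iff)
  show "OFCLASS('a free_alg, ring_1_class)"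
    by standard (use ne in \<open>simp_all only: coeffs_inject[symmetric] simps\<close>, simp_all add: F.ring_rules c)
qed

end

lemma coeffs_simps:
  "coeffs 0 = \<zero>\<^bsub>free_star_algebra UNIV\<^esub>" "coeffs 1 = \<one>\<^bsub>free_star_algebra UNIV\<^esub>"
  "coeffs (x + y) = coeffs x \<oplus>\<^bsub>free_star_algebra UNIV\<^esub> coeffs y"
  "coeffs (x * y) = coeffs x \<otimes>\<^bsub>free_star_algebra UNIV\<^esub> coeffs y"
proof -
  interpret F: star_algebra "free_star_algebra UNIV" by (rule star_algebra_free)
  show "coeffs 0 = \<zero>\<^bsub>free_star_algebra UNIV\<^esub>" "coeffs 1 = \<one>\<^bsub>free_star_algebra UNIV\<^esub>"
    "coeffs (x + y) = coeffs x \<oplus>\<^bsub>free_star_algebra UNIV\<^esub> coeffs y"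
    "coeffs (x * y) = coeffs x \<otimes>\<^bsub>free_star_algebra UNIV\<^esub> coeffs y"
    by (simp_all add: zero_free_alg_def one_free_alg_def plus_free_alg_def times_free_alg_def
        Abs_free_alg_inverse F.ring_rules coeffs)
qed

definition free_const :: "complex \<Rightarrow> 'i free_alg" where
  "free_const c = Abs_free_alg (c \<odot>\<^bsub>free_star_algebra UNIV\<^esub> \<one>\<^bsub>free_star_algebra UNIV\<^esub>)"

definition free_adjoint :: "'i free_alg \<Rightarrow> 'i free_alg" where
  "free_adjoint x = Abs_free_alg (star (free_star_algebra UNIV) (coeffs x))"

lemma coeffs_const_mult: "coeffs (free_const c * x) = c \<odot>\<^bsub>free_star_algebra UNIV\<^esub> coeffs x"
  and coeffs_mult_const: "coeffs (x * free_const c) = c \<odot>\<^bsub>free_star_algebra UNIV\<^esub> coeffs x"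
  and coeffs_const: "coeffs (free_const c) = c \<odot>\<^bsub>free_star_algebra UNIV\<^esub> \<one>\<^bsub>free_star_algebra UNIV\<^esub>"
  and coeffs_adjoint: "coeffs (free_adjoint x) = star (free_star_algebra UNIV) (coeffs x)"
proof -
  interpret F: star_algebra "free_star_algebra UNIV" by (rule star_algebra_free)
  show c: "coeffs (free_const c) = c \<odot>\<^bsub>free_star_algebra UNIV\<^esub> \<one>\<^bsub>free_star_algebra UNIV\<^esub>"
    by (simp add: free_const_def Abs_free_alg_inverse F.ring_rules)
  show "coeffs (free_const c * x) = c \<odot>\<^bsub>free_star_algebra UNIV\<^esub> coeffs x"
    "coeffs (x * free_const c) = c \<odot>\<^bsub>free_star_algebra UNIV\<^esub> coeffs x"
    by (simp_all add: coeffs_simps c F.smult_mult_left F.smult_mult_right coeffs F.ring_rules)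
  show "coeffs (free_adjoint x) = star (free_star_algebra UNIV) (coeffs x)"
    by (simp add: free_adjoint_def Abs_free_alg_inverse F.star_closed coeffs)
qed

lemma star_ring_free: "star_ring free_const free_adjoint"
proof -
  interpret F: star_algebra "free_star_algebra (UNIV :: 'i set)" by (rule star_algebra_free)
  have st1: "star (free_star_algebra (UNIV :: 'i set)) \<one>\<^bsub>free_star_algebra UNIV\<^esub> = \<one>\<^bsub>free_star_algebra UNIV\<^esub>"
    using F.star_mult[of "star (free_star_algebra (UNIV :: 'i set)) \<one>\<^bsub>free_star_algebra UNIV\<^esub>" "\<one>\<^bsub>free_star_algebra UNIV\<^esub>"]
    by (simp add: F.star_closed F.star_star F.ring_rules)
  show "star_ring (free_const :: complex \<Rightarrow> 'i free_alg) free_adjoint"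
  proof
    fix c d and x y :: "'i free_alg"
    show "free_const (c * d) = free_const c * (free_const d :: 'i free_alg)"
      using F.smult_assoc1[of c d "\<one>\<^bsub>free_star_algebra UNIV\<^esub>"]
      by (simp only: coeffs_inject[symmetric] coeffs_const_mult coeffs_const) (simp add: F.ring_rules)
    show "free_const (c + d) = free_const c + (free_const d :: 'i free_alg)"
      "free_const 1 = (1 :: 'i free_alg)"
      "x * free_const c = free_const c * x"
      "free_adjoint (free_const c) = (free_const (cnj c) :: 'i free_alg)"
      by (simp_all add: coeffs_inject[symmetric] coeffs_const_mult coeffs_mult_const coeffs_const coeffs_adjoint
          coeffs_simps(2,3) F.star_smult st1 F.ring_rules F.smult_assoc1[simplified] F.smult_l_distr[simplified]
          F.smult_one[simplified])
    show "free_adjoint (x + y) = free_adjoint x + free_adjoint y"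
      "free_adjoint (x * y) = free_adjoint y * free_adjoint x"
      "free_adjoint (free_adjoint x) = x"
      by (simp_all add: coeffs_inject[symmetric] coeffs_adjoint coeffs_simps F.star_add F.star_mult F.star_star coeffs)
  qed
qed

text \<open>Evaluation in the free *-algebra on \<open>S\<close>, sending the generators outside \<open>S\<close> to 0.\<close>

definition restrict_gens :: "'i set \<Rightarrow> 'i free_alg \<Rightarrow> ('i \<times> bool) list \<Rightarrow> complex" where
  "restrict_gens S x = (\<lambda>w. if w \<in> lists (S \<times> UNIV) then coeffs x w else 0)"

lemma finite_coeffs: "finite {w. coeffs x w \<noteq> 0}"
  using coeffs[of x] by (simp add: free_star_algebra_simps)

lemma restrict_gens_support: "{w. restrict_gens S x w \<noteq> 0} \<subseteq> {w. coeffs x w \<noteq> 0}"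
  by (auto simp: restrict_gens_def)

lemma restrict_gens_closed [simp]: "restrict_gens S x \<in> carrier (free_star_algebra S)"
proof -
  have "finite {w. restrict_gens S x w \<noteq> 0}"
    by (rule finite_subset[OF restrict_gens_support finite_coeffs])
  moreover have "{w. restrict_gens S x w \<noteq> 0} \<subseteq> lists (S \<times> UNIV)"
    unfolding restrict_gens_def by auto
  ultimately show ?thesis by (simp add: free_star_algebra_simps)
qed

lemma restrict_gens_surj:
  assumes "f \<in> carrier (free_star_algebra S)" shows "restrict_gens S (Abs_free_alg f) = f"
proof -
  have "f \<in> carrier (free_star_algebra UNIV)" using assms by (simp add: free_star_algebra_simps)
  then show ?thesis
    using assms by (auto simp: restrict_gens_def Abs_free_alg_inverse free_star_algebra_simps fun_eq_iff)
qed

lemma restrict_gens_add: "restrict_gens S (x + y) = restrict_gens S x \<oplus>\<^bsub>free_star_algebra S\<^esub> restrict_gens S y"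
  and restrict_gens_const: "restrict_gens S (free_const c * x) = c \<odot>\<^bsub>free_star_algebra S\<^esub> restrict_gens S x"
  and restrict_gens_one: "restrict_gens S 1 = \<one>\<^bsub>free_star_algebra S\<^esub>"
  by (auto simp: restrict_gens_def coeffs_simps(1-3) coeffs_const_mult free_star_algebra_simps point_mass_def fun_eq_iff)

lemma restrict_gens_adjoint: "restrict_gens S (free_adjoint x) = star (free_star_algebra S) (restrict_gens S x)"
  by (auto simp: restrict_gens_def coeffs_adjoint free_star_algebra_simps fun_eq_iff lists_eq_set)

text \<open>A concatenation uses only letters of \<open>S\<close> exactly if both parts do, so
  discarding all other words is multiplicative.\<close>

lemma restrict_gens_mult:
  "restrict_gens S (x * y) = restrict_gens S x \<otimes>\<^bsub>free_star_algebra S\<^esub> restrict_gens S y"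
proof
  fix w
  let ?K = "{w. coeffs x w \<noteq> 0}" and ?L = "{w. coeffs y w \<noteq> 0}"
  have *: "coeffs (x * y) w = (\<Sum>k\<in>?K. \<Sum>l\<in>?L. if k @ l = w then coeffs x k * coeffs y l else 0)"
    unfolding coeffs_simps free_star_algebra_def
    by (subst monoid_star_algebra_mult[OF finite_coeffs order_refl finite_coeffs order_refl]) simp
  have **: "(restrict_gens S x \<otimes>\<^bsub>free_star_algebra S\<^esub> restrict_gens S y) w
      = (\<Sum>k\<in>?K. \<Sum>l\<in>?L. if k @ l = w then restrict_gens S x k * restrict_gens S y l else 0)"
    unfolding free_star_algebra_def
    by (subst monoid_star_algebra_mult[OF finite_coeffs restrict_gens_support finite_coeffs restrict_gens_support]) simp
  show "restrict_gens S (x * y) w = (restrict_gens S x \<otimes>\<^bsub>free_star_algebra S\<^esub> restrict_gens S y) w"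
  proof (cases "w \<in> lists (S \<times> UNIV)")
    case True
    then have "restrict_gens S k' k * restrict_gens S l' l = coeffs k' k * coeffs l' l" if "k @ l = w" for k' l' k l
      using that by (auto simp: restrict_gens_def)
    then have "(\<Sum>k\<in>?K. \<Sum>l\<in>?L. if k @ l = w then restrict_gens S x k * restrict_gens S y l else 0)
      = (\<Sum>k\<in>?K. \<Sum>l\<in>?L. if k @ l = w then coeffs x k * coeffs y l else 0)"
      by (intro sum.cong refl) simp
    with * ** True show ?thesis by (simp add: restrict_gens_def[of S "x * y"])
  next
    case False
    then have "restrict_gens S k' k * restrict_gens S l' l = 0" if "k @ l = w" for k' l' k l
      using that by (auto simp: restrict_gens_def)
    then have "(\<Sum>k\<in>?K. \<Sum>l\<in>?L. if k @ l = w then restrict_gens S x k * restrict_gens S y l else 0) = 0"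
      by (intro sum.neutral ballI) simp
    with ** False show ?thesis by (simp add: restrict_gens_def[of S "x * y"])
  qed
qed

lemma restrict_gens_diff: "restrict_gens S (x - y) = restrict_gens S x \<ominus>\<^bsub>free_star_algebra S\<^esub> restrict_gens S y"
proof -
  interpret F: star_algebra "free_star_algebra S" by (rule star_algebra_free)
  interpret star_ring "free_const :: complex \<Rightarrow> 'a free_alg" free_adjoint by (rule star_ring_free)
  have "x - y = x + free_const (- 1) * y" by (simp add: cs_minus)
  then show ?thesis
    by (simp only: restrict_gens_add restrict_gens_const a_minus_def F.minus_eq_smult restrict_gens_closed)
qed

lemma cstar_seminormed_restrict_gens:
  assumes "cstar_seminorm (free_star_algebra S) q"
  shows "cstar_seminormed free_const free_adjoint (\<lambda>x. q (restrict_gens S x))"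
proof -
  interpret F: star_algebra "free_star_algebra S" by (rule star_algebra_free)
  interpret F: seminormed_star_algebra "free_star_algebra S" q by unfold_locales (rule assms)
  show ?thesis
    by (intro cstar_seminormed.intro star_ring_free cstar_seminormed_axioms.intro)
      (simp_all add: restrict_gens_const F.p_smult,
       simp_all add: restrict_gens_add restrict_gens_mult restrict_gens_adjoint F.p_add F.p_mult F.p_cstar)
qed

text \<open>This makes the canonical map between the two completions of \<open>D\<close> surjective.\<close>

theorem lift_cauchy_seq:
  fixes S :: "'i set"
  defines "F \<equiv> free_star_algebra S"
  assumes p: "cstar_seminorm F p" and q: "cstar_seminorm F q"
    and le: "\<And>a. a \<in> carrier F \<Longrightarrow> q a \<le> p a"
    and D: "D \<subseteq> carrier F" "\<one>\<^bsub>F\<^esub> \<in> D" "\<And>a b. a \<in> D \<Longrightarrow> b \<in> D \<Longrightarrow> a \<oplus>\<^bsub>F\<^esub> b \<in> D"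
      "\<And>a b. a \<in> D \<Longrightarrow> b \<in> D \<Longrightarrow> a \<otimes>\<^bsub>F\<^esub> b \<in> D" "\<And>a c. a \<in> D \<Longrightarrow> c \<odot>\<^bsub>F\<^esub> a \<in> D"
      "\<And>a. a \<in> D \<Longrightarrow> star F a \<in> D"
    and s: "cauchy_seq F q s" "\<And>n. s n \<in> D"
  obtains t where "cauchy_seq F p t" "\<And>n. t n \<in> D" "(\<lambda>n. q (s n \<ominus>\<^bsub>F\<^esub> t n)) \<longlonglongrightarrow> 0"
proof -
  interpret cstar_seminorm_pair free_const free_adjoint "\<lambda>x. p (restrict_gens S x)" "\<lambda>x. q (restrict_gens S x)"
    "{x. restrict_gens S x \<in> D}"
    using p q D le unfolding F_def
    by (intro cstar_seminorm_pair.intro cstar_seminormed_restrict_gens cstar_seminorm_pair_axioms.intro)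
      (simp_all add: restrict_gens_const,
       simp_all add: restrict_gens_add restrict_gens_mult restrict_gens_adjoint restrict_gens_one)
  define s' where "s' = (\<lambda>n. Abs_free_alg (s n))"
  have s': "restrict_gens S (s' n) = s n" for n
    using s(2) D(1) unfolding s'_def F_def by (intro restrict_gens_surj) auto
  obtain t where t: "\<And>n. t n \<in> {x. restrict_gens S x \<in> D}"
    "\<And>e. 0 < e \<Longrightarrow> \<exists>N. \<forall>m\<ge>N. \<forall>n\<ge>N. p (restrict_gens S (t m - t n)) < e"
    "(\<lambda>n. q (restrict_gens S (s' n - t n))) \<longlonglongrightarrow> 0"
  proof (rule lift_Cauchy[of s'])
    show "s' n \<in> {x. restrict_gens S x \<in> D}" for n using s(2) s' by simp
    show "\<exists>N. \<forall>m\<ge>N. \<forall>n\<ge>N. q (restrict_gens S (s' m - s' n)) < e" if "0 < e" for e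
      using s(1) that by (simp add: cauchy_seq_def restrict_gens_diff s' F_def)
  qed blast
  show ?thesis
  proof (rule that[of "\<lambda>n. restrict_gens S (t n)"])
    show "cauchy_seq F p (\<lambda>n. restrict_gens S (t n))"
      using t(2) by (simp add: cauchy_seq_def restrict_gens_diff F_def)
    show "(\<lambda>n. q (s n \<ominus>\<^bsub>F\<^esub> restrict_gens S (t n))) \<longlonglongrightarrow> 0"
      using t(3) by (simp add: restrict_gens_diff s' F_def)
  qed (use t(1) in simp)
qed

section \<open>Homomorphisms out of group algebras and completions\<close>

context star_algebra
begin

lemma comm_monoid_add: "comm_monoid (add_monoid A)"
  using ag by (simp add: abelian_group_def abelian_monoid_def)

lemma group_algebra_map_superset:
  assumes "finite K" "{g. f g \<noteq> 0} \<subseteq> K" "u \<in> K \<rightarrow> carrier A"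
  shows "group_algebra_map A u f = (\<Oplus>g\<in>K. f g \<odot> u g)"
  unfolding group_algebra_map_def finsum_def
proof (rule comm_monoid.finprod_mono_neutral_cong_left[OF comm_monoid_add assms(1,2)])
  show "\<And>i. i \<in> K - {g. f g \<noteq> 0} \<Longrightarrow> f i \<odot> u i = \<one>\<^bsub>add_monoid A\<^esub>"
    using assms(3) smult_l_null by (auto simp: Pi_iff)
qed (use assms(3) in auto)

context
  fixes G :: "('g, 'k) monoid_scheme" and u :: "'g \<Rightarrow> 'a"
  assumes u: "\<And>g. g \<in> carrier G \<Longrightarrow> u g \<in> carrier A"
begin

lemma group_algebra_map_superset':
  assumes "finite K" "{g. f g \<noteq> 0} \<subseteq> K" "K \<subseteq> carrier G"
  shows "group_algebra_map A u f = (\<Oplus>g\<in>K. f g \<odot> u g)"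
  using assms u by (intro group_algebra_map_superset) auto

lemma group_algebra_map_closed:
  assumes "f \<in> carrier (group_algebra G)" shows "group_algebra_map A u f \<in> carrier A"
  unfolding group_algebra_map_def
  using assms u by (intro abelian_monoid.finsum_closed[OF abelian_group.axioms(1)[OF ag]])
    (auto simp: group_algebra_def monoid_star_algebra_simps subset_iff)

lemma group_algebra_map_add:
  assumes "f \<in> carrier (group_algebra G)" "h \<in> carrier (group_algebra G)"
  shows "group_algebra_map A u (f \<oplus>\<^bsub>group_algebra G\<^esub> h) = group_algebra_map A u f \<oplus> group_algebra_map A u h"
proof -
  define K where "K = {g. f g \<noteq> 0} \<union> {g. h g \<noteq> 0}"
  have K: "finite K" "K \<subseteq> carrier G"
    using assms by (auto simp: K_def group_algebra_def monoid_star_algebra_simps)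
  have "group_algebra_map A u (f \<oplus>\<^bsub>group_algebra G\<^esub> h) = (\<Oplus>g\<in>K. (f g + h g) \<odot> u g)"
    using K by (subst group_algebra_map_superset'[of K])
      (auto simp: group_algebra_def monoid_star_algebra_simps K_def)
  also have "\<dots> = (\<Oplus>g\<in>K. f g \<odot> u g \<oplus> h g \<odot> u g)"
    using K u smult_l_distr
    by (intro abelian_monoid.finsum_cong'[OF abelian_group.axioms(1)[OF ag]]) (auto simp: ring_rules subset_iff)
  also have "\<dots> = (\<Oplus>g\<in>K. f g \<odot> u g) \<oplus> (\<Oplus>g\<in>K. h g \<odot> u g)"
    using K u by (intro abelian_monoid.finsum_addf[OF abelian_group.axioms(1)[OF ag]]) auto
  also have "\<dots> = group_algebra_map A u f \<oplus> group_algebra_map A u h"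
    using K group_algebra_map_superset'[of K f] group_algebra_map_superset'[of K h] by (auto simp: K_def)
  finally show ?thesis .
qed

lemma group_algebra_map_single:
  assumes "g \<in> carrier G"
  shows "group_algebra_map A u (c \<odot>\<^bsub>group_algebra G\<^esub> point_mass g) = c \<odot> u g"
proof -
  have "group_algebra_map A u (c \<odot>\<^bsub>group_algebra G\<^esub> point_mass g)
      = (\<Oplus>k\<in>{g}. (c \<odot>\<^bsub>group_algebra G\<^esub> point_mass g) k \<odot> u k)"
    using assms by (intro group_algebra_map_superset')
      (auto simp: group_algebra_def monoid_star_algebra_simps point_mass_def)
  also have "\<dots> = c \<odot> u g"
    using assms u abelian_monoid.finsum_insert[OF abelian_group.axioms(1)[OF ag], of "{}" g]
      abelian_monoid.finsum_empty[OF abelian_group.axioms(1)[OF ag]]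
    by (simp add: group_algebra_def monoid_star_algebra_simps point_mass_def ring_rules)
  finally show ?thesis .
qed

lemma group_algebra_map_zero: "group_algebra_map A u (\<lambda>g. 0) = \<zero>"
  by (simp add: group_algebra_map_def abelian_monoid.finsum_empty[OF abelian_group.axioms(1)[OF ag]])

text \<open>The means of identifying two maps on the group algebra: linearity and the values on
  group elements suffice.\<close>

lemma group_algebra_map_unique:
  assumes f: "f \<in> carrier (group_algebra G)"
    and closed: "\<And>f. f \<in> carrier (group_algebra G) \<Longrightarrow> \<phi> f \<in> carrier A"
    and add: "\<And>f h. f \<in> carrier (group_algebra G) \<Longrightarrow> h \<in> carrier (group_algebra G) \<Longrightarrow>
      \<phi> (f \<oplus>\<^bsub>group_algebra G\<^esub> h) = \<phi> f \<oplus> \<phi> h"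
    and smult: "\<And>f c. f \<in> carrier (group_algebra G) \<Longrightarrow> \<phi> (c \<odot>\<^bsub>group_algebra G\<^esub> f) = c \<odot> \<phi> f"
    and single: "\<And>g. g \<in> carrier G \<Longrightarrow> \<phi> (point_mass g) = u g"
  shows "\<phi> f = group_algebra_map A u f"
  using f unfolding group_algebra_def
proof (induction f rule: monoid_star_algebra_induct)
  case zero
  have z: "(\<lambda>m. 0) \<in> carrier (group_algebra G)"
    by (simp add: group_algebra_def monoid_star_algebra_simps)
  have "\<phi> (0 \<odot>\<^bsub>group_algebra G\<^esub> (\<lambda>m. 0)) = 0 \<odot> \<phi> (\<lambda>m. 0)"
    by (rule smult[OF z])
  moreover have "0 \<odot>\<^bsub>group_algebra G\<^esub> (\<lambda>m. 0) = (\<lambda>m. 0)"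
    by (simp add: group_algebra_def monoid_star_algebra_simps)
  ultimately show ?case
    using closed[OF z] smult_l_null by (simp add: group_algebra_map_zero)
next
  case (add f c m)
  note add_case = this
  have pm: "point_mass m \<in> carrier (group_algebra G)"
    using add_case(2) unfolding group_algebra_def by (rule point_mass_closed)
  have cpm: "c \<odot>\<^bsub>group_algebra G\<^esub> point_mass m \<in> carrier (group_algebra G)"
    using pm by (auto simp: group_algebra_def monoid_star_algebra_simps point_mass_def)
  have fc: "f \<in> carrier (group_algebra G)"
    using add_case(1) by (simp add: group_algebra_def)
  have "\<phi> (c \<odot>\<^bsub>group_algebra G\<^esub> point_mass m \<oplus>\<^bsub>group_algebra G\<^esub> f)
    = group_algebra_map A u (c \<odot>\<^bsub>group_algebra G\<^esub> point_mass m \<oplus>\<^bsub>group_algebra G\<^esub> f)"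
    using add_case(2,5)
    by (simp only: assms(3)[OF cpm fc] smult[OF pm] single group_algebra_map_add[OF cpm fc] group_algebra_map_single)
  then show ?case by (simp add: group_algebra_def)
qed

end

end

lemma star_algebra_group_algebra:
  assumes "group G" shows "star_algebra (group_algebra G)"
proof -
  interpret group G by fact
  show ?thesis
    unfolding group_algebra_def
    by (rule star_algebra_monoid_star_algebra) (auto intro: inv_mult_group)
qed

lemma group_algebra_point_mass:
  assumes "group G" "g \<in> carrier G"
  shows "point_mass g \<in> carrier (group_algebra G)"
    and "h \<in> carrier G \<Longrightarrow> point_mass g \<otimes>\<^bsub>group_algebra G\<^esub> point_mass h = point_mass (g \<otimes>\<^bsub>G\<^esub> h)"
    and "star (group_algebra G) (point_mass g) = point_mass (inv\<^bsub>G\<^esub> g)"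
proof -
  interpret group G by fact
  show "point_mass g \<in> carrier (group_algebra G)"
    using assms(2) unfolding group_algebra_def by (rule point_mass_closed)
  show "point_mass g \<otimes>\<^bsub>group_algebra G\<^esub> point_mass h = point_mass (g \<otimes>\<^bsub>G\<^esub> h)"
    unfolding group_algebra_def by (rule point_mass_mult)
  show "star (group_algebra G) (point_mass g) = point_mass (inv\<^bsub>G\<^esub> g)"
    unfolding group_algebra_def by (rule point_mass_star) (use assms(2) in auto)
qed

lemma group_algebra_induct [consumes 2, case_names zero add]:
  assumes "group G" "f \<in> carrier (group_algebra G)"
    and "P (\<zero>\<^bsub>group_algebra G\<^esub>)"
    and "\<And>f c g. f \<in> carrier (group_algebra G) \<Longrightarrow> g \<in> carrier G \<Longrightarrow> P f \<Longrightarrow>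
      P (c \<odot>\<^bsub>group_algebra G\<^esub> point_mass g \<oplus>\<^bsub>group_algebra G\<^esub> f)"
  shows "P f"
  using assms(2) unfolding group_algebra_def
proof (rule monoid_star_algebra_induct)
  show "P (\<lambda>m. 0)"
    using assms(3) by (simp add: group_algebra_def monoid_star_algebra_simps)
  fix f c m
  assume "f \<in> carrier (monoid_star_algebra G (m_inv G))" "m \<in> carrier G" "P f"
  then show "P (c \<odot>\<^bsub>monoid_star_algebra G (m_inv G)\<^esub> point_mass m \<oplus>\<^bsub>monoid_star_algebra G (m_inv G)\<^esub> f)"
    using assms(4)[unfolded group_algebra_def] by blast
qed

context star_algebra
begin

lemma group_algebra_map_point_mass:
  fixes G :: "('g, 'k) monoid_scheme"
  assumes u: "\<And>g. g \<in> carrier G \<Longrightarrow> u g \<in> carrier A" and g: "g \<in> carrier G"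
  shows "group_algebra_map A u (point_mass g) = u g"
proof -
  have "point_mass g = 1 \<odot>\<^bsub>group_algebra G\<^esub> point_mass g"
    by (simp add: group_algebra_def monoid_star_algebra_simps)
  then show ?thesis
    using group_algebra_map_single[where G = G and u = u and c = 1, OF u g] smult_one[OF u[OF g]] by simp
qed

lemma group_algebra_map_smult:
  assumes G: "group G" and u: "\<And>g. g \<in> carrier G \<Longrightarrow> u g \<in> carrier A"
    and f: "f \<in> carrier (group_algebra G)"
  shows "group_algebra_map A u (c \<odot>\<^bsub>group_algebra G\<^esub> f) = c \<odot> group_algebra_map A u f"
  using G f
proof (induction f rule: group_algebra_induct)
  case zero
  interpret CG: star_algebra "group_algebra G" by (rule star_algebra_group_algebra[OF G])
  have "group_algebra_map A u \<zero>\<^bsub>group_algebra G\<^esub> = \<zero>"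
    using group_algebra_map_zero[where G = G and u = u, OF u] by (simp add: group_algebra_def monoid_star_algebra_simps)
  then show ?case using smult_r_null[of c] CG.smult_r_null[of c] by simp
next
  case (add f d g)
  interpret CG: star_algebra "group_algebra G" by (rule star_algebra_group_algebra[OF G])
  note pm = group_algebra_point_mass[OF G]
  have "c \<odot>\<^bsub>group_algebra G\<^esub> (d \<odot>\<^bsub>group_algebra G\<^esub> point_mass g \<oplus>\<^bsub>group_algebra G\<^esub> f)
      = (c * d) \<odot>\<^bsub>group_algebra G\<^esub> point_mass g \<oplus>\<^bsub>group_algebra G\<^esub> c \<odot>\<^bsub>group_algebra G\<^esub> f"
    using add.hyps pm CG.smult_assoc1[of c d] by (simp add: CG.smult_r_distr)
  then show ?case
    using add pm smult_assoc1[of c d "u g"] group_algebra_map_closed[where G = G and u = u, OF u]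
    by (simp add: group_algebra_map_add[where G = G and u = u, OF u]
        group_algebra_map_single[where G = G and u = u, OF u] u smult_r_distr)
qed

lemma group_algebra_map_cong:
  assumes u: "\<And>g. g \<in> carrier G \<Longrightarrow> u g \<in> carrier A" and f: "f \<in> carrier (group_algebra G)"
    and eq: "\<And>g. g \<in> carrier G \<Longrightarrow> v g = u g"
  shows "group_algebra_map A v f = group_algebra_map A u f"
  unfolding group_algebra_map_def using f u eq
  by (intro abelian_monoid.finsum_cong'[OF abelian_group.axioms(1)[OF ag]])
    (auto simp: group_algebra_def monoid_star_algebra_simps subset_iff)

end

lemma (in star_algebra) star_hom_group_algebra_map:
  assumes G: "group G"
    and u: "\<And>g. g \<in> carrier G \<Longrightarrow> u g \<in> carrier A" "u \<one>\<^bsub>G\<^esub> = \<one>"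
      "\<And>g h. g \<in> carrier G \<Longrightarrow> h \<in> carrier G \<Longrightarrow> u (g \<otimes>\<^bsub>G\<^esub> h) = u g \<otimes> u h"
      "\<And>g. g \<in> carrier G \<Longrightarrow> star A (u g) = u (inv\<^bsub>G\<^esub> g)"
  shows "star_hom (group_algebra G) A (group_algebra_map A u)"
proof -
  interpret group G by (rule G)
  interpret CG: star_algebra "group_algebra G" by (rule star_algebra_group_algebra[OF G])
  let ?\<phi> = "group_algebra_map A u"
  note pm = group_algebra_point_mass[OF G]
  note closed = group_algebra_map_closed[where G = G and u = u, OF u(1)]
  note add = group_algebra_map_add[where G = G and u = u, OF u(1)]
  have single: "?\<phi> (c \<odot>\<^bsub>group_algebra G\<^esub> point_mass g) = c \<odot> u g" if "g \<in> carrier G" for c g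
    using group_algebra_map_single[where G = G and u = u, OF u(1)] that by blast
  have map_zero: "?\<phi> \<zero>\<^bsub>group_algebra G\<^esub> = \<zero>"
    using group_algebra_map_zero[where G = G and u = u, OF u(1)] by (simp add: group_algebra_def monoid_star_algebra_simps)
  have pm_eq: "point_mass g = 1 \<odot>\<^bsub>group_algebra G\<^esub> point_mass g" for g
    by (simp add: group_algebra_def monoid_star_algebra_simps)
  have smult: "?\<phi> (c \<odot>\<^bsub>group_algebra G\<^esub> f) = c \<odot> ?\<phi> f" if "f \<in> carrier (group_algebra G)" for c f
    using group_algebra_map_smult[OF G u(1) that] .
  have map_pm: "?\<phi> (point_mass g) = u g" if "g \<in> carrier G" for g
    using group_algebra_map_point_mass[OF u(1) that] .
  have pm_mult: "?\<phi> (point_mass g \<otimes>\<^bsub>group_algebra G\<^esub> h) = u g \<otimes> ?\<phi> h"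
    if g: "g \<in> carrier G" and h: "h \<in> carrier (group_algebra G)" for g h
    using G h
  proof (induction h rule: group_algebra_induct)
    case zero
    then show ?case using g pm u by (simp add: map_zero CG.ring_rules ring_rules)
  next
    case (add f d k)
    then show ?case
      using g pm u closed
      by (simp add: CG.ring_rules(23) CG.smult_mult_right group_algebra_map_add[where G = G and u = u, OF u(1)] single
          CG.ring_rules(5) ring_rules(23) smult_mult_right)
  qed
  have mult: "?\<phi> (f \<otimes>\<^bsub>group_algebra G\<^esub> h) = ?\<phi> f \<otimes> ?\<phi> h"
    if f: "f \<in> carrier (group_algebra G)" and h: "h \<in> carrier (group_algebra G)" for f h
    using G f
  proof (induction f rule: group_algebra_induct)
    case zero
    then show ?case using h closed by (simp add: map_zero CG.ring_rules ring_rules)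
  next
    case (add f d k)
    then show ?case
      using h pm u closed
      by (simp add: CG.ring_rules(13) CG.smult_mult_left group_algebra_map_add[where G = G and u = u, OF u(1)] single
          CG.ring_rules(5) ring_rules(13) smult_mult_left smult pm_mult map_pm)
  qed
  have star: "?\<phi> (star (group_algebra G) f) = star A (?\<phi> f)" if f: "f \<in> carrier (group_algebra G)" for f
    using G f
  proof (induction f rule: group_algebra_induct)
    case zero
    have "star (group_algebra G) (0 \<odot>\<^bsub>group_algebra G\<^esub> \<zero>\<^bsub>group_algebra G\<^esub>) = 0 \<odot>\<^bsub>group_algebra G\<^esub> star (group_algebra G) \<zero>\<^bsub>group_algebra G\<^esub>"
      by (subst CG.star_smult) (simp_all add: CG.ring_rules)
    moreover have "star A (0 \<odot> \<zero>) = 0 \<odot> star A \<zero>"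
      by (subst star_smult) (simp_all add: ring_rules)
    ultimately show ?case
      using CG.smult_l_null smult_l_null by (simp add: map_zero CG.star_closed star_closed CG.ring_rules ring_rules)
  next
    case (add f d k)
    then show ?case
      using pm u closed
      by (simp add: CG.star_add CG.star_smult star_add star_smult group_algebra_map_add[where G = G and u = u, OF u(1)] single
          CG.star_closed)
  qed
  have "\<one>\<^bsub>group_algebra G\<^esub> = point_mass \<one>\<^bsub>G\<^esub>"
    by (simp add: group_algebra_def monoid_star_algebra_simps)
  then have "?\<phi> \<one>\<^bsub>group_algebra G\<^esub> = \<one>"
    using single[of "\<one>\<^bsub>G\<^esub>" 1] u(1)[of "\<one>\<^bsub>G\<^esub>"] smult_one by (simp add: pm_eq[symmetric] u(2))
  then show ?thesis
    unfolding star_hom_def by (auto intro!: ring_hom_memI simp: closed mult add smult star)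
qed

section \<open>Homomorphisms, suprema of C*-seminorms and maps between completions\<close>

lemma star_hom_closed: "star_hom A B f \<Longrightarrow> a \<in> carrier A \<Longrightarrow> f a \<in> carrier B"
  and star_hom_add: "star_hom A B f \<Longrightarrow> a \<in> carrier A \<Longrightarrow> b \<in> carrier A \<Longrightarrow> f (a \<oplus>\<^bsub>A\<^esub> b) = f a \<oplus>\<^bsub>B\<^esub> f b"
  and star_hom_mult: "star_hom A B f \<Longrightarrow> a \<in> carrier A \<Longrightarrow> b \<in> carrier A \<Longrightarrow> f (a \<otimes>\<^bsub>A\<^esub> b) = f a \<otimes>\<^bsub>B\<^esub> f b"
  and star_hom_one: "star_hom A B f \<Longrightarrow> f \<one>\<^bsub>A\<^esub> = \<one>\<^bsub>B\<^esub>"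
  and star_hom_smult: "star_hom A B f \<Longrightarrow> a \<in> carrier A \<Longrightarrow> f (c \<odot>\<^bsub>A\<^esub> a) = c \<odot>\<^bsub>B\<^esub> f a"
  and star_hom_star: "star_hom A B f \<Longrightarrow> a \<in> carrier A \<Longrightarrow> f (star A a) = star B (f a)"
  by (auto simp: star_hom_def ring_hom_def)

lemma star_homI:
  assumes "\<And>a. a \<in> carrier A \<Longrightarrow> f a \<in> carrier B"
    "\<And>a b. a \<in> carrier A \<Longrightarrow> b \<in> carrier A \<Longrightarrow> f (a \<oplus>\<^bsub>A\<^esub> b) = f a \<oplus>\<^bsub>B\<^esub> f b"
    "\<And>a b. a \<in> carrier A \<Longrightarrow> b \<in> carrier A \<Longrightarrow> f (a \<otimes>\<^bsub>A\<^esub> b) = f a \<otimes>\<^bsub>B\<^esub> f b"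
    "f \<one>\<^bsub>A\<^esub> = \<one>\<^bsub>B\<^esub>"
    "\<And>a c. a \<in> carrier A \<Longrightarrow> f (c \<odot>\<^bsub>A\<^esub> a) = c \<odot>\<^bsub>B\<^esub> f a"
    "\<And>a. a \<in> carrier A \<Longrightarrow> f (star A a) = star B (f a)"
  shows "star_hom A B f"
  using assms unfolding star_hom_def ring_hom_def by auto

lemma star_hom_compose: "star_hom A B f \<Longrightarrow> star_hom B C g \<Longrightarrow> star_hom A C (\<lambda>a. g (f a))"
  by (rule star_homI)
    (simp_all add: star_hom_closed star_hom_add[of A B f] star_hom_mult[of A B f] star_hom_one[of A B f]
      star_hom_smult[of A B f] star_hom_star[of A B f] star_hom_add[of B C g] star_hom_mult[of B C g]
      star_hom_one[of B C g] star_hom_smult[of B C g] star_hom_star[of B C g])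

lemma star_hom_diff:
  assumes "star_algebra A" "star_algebra B" "star_hom A B f" "a \<in> carrier A" "b \<in> carrier A"
  shows "f (a \<ominus>\<^bsub>A\<^esub> b) = f a \<ominus>\<^bsub>B\<^esub> f b"
proof -
  interpret A: star_algebra A by fact
  interpret B: star_algebra B by fact
  show ?thesis
    using assms star_hom_closed[OF assms(3)]
    by (simp add: a_minus_def A.minus_eq_smult B.minus_eq_smult star_hom_add star_hom_smult)
qed

lemma cstar_seminorm_pullback:
  assumes "star_hom A B f" "cstar_seminorm B q" "\<And>a. a \<in> carrier A \<Longrightarrow> star A a \<in> carrier A"
  shows "cstar_seminorm A (\<lambda>a. q (f a))"
  using assms(2) star_hom_closed[OF assms(1)] assms(3) unfolding cstar_seminorm_def
  by (simp add: star_hom_add[OF assms(1)] star_hom_smult[OF assms(1)] star_hom_mult[OF assms(1)]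
      star_hom_star[OF assms(1)])

text \<open>The C*-identity survives the supremum because squaring is monotone on nonnegative
  numbers. Homogeneity follows from one inequality, applied to \<open>c\<close> and to
  \<open>1 / c\<close>.\<close>

lemma cstar_seminorm_SUP:
  assumes A: "star_algebra A" and N: "N \<noteq> {}" "\<And>q. q \<in> N \<Longrightarrow> cstar_seminorm A q"
    and bdd: "\<And>a. a \<in> carrier A \<Longrightarrow> bdd_above ((\<lambda>q. q a) ` N)"
  shows "cstar_seminorm A (\<lambda>a. SUP q\<in>N. q a)"
proof -
  interpret A: star_algebra A by (rule A)
  let ?p = "\<lambda>a. SUP q\<in>N. q a"
  have q: "seminormed_star_algebra A q" if "q \<in> N" for q
    using A N(2)[OF that] by (intro seminormed_star_algebra.intro seminormed_star_algebra_axioms.intro)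
  have le: "q a \<le> ?p a" if "q \<in> N" "a \<in> carrier A" for q a
    by (rule cSUP_upper[OF that(1) bdd[OF that(2)]])
  have least: "?p a \<le> c" if "\<And>q. q \<in> N \<Longrightarrow> q a \<le> c" for a c
    using N(1) that by (intro cSUP_least)
  have nonneg: "0 \<le> ?p a" if "a \<in> carrier A" for a
  proof -
    obtain r where "r \<in> N" using N(1) by blast
    then show ?thesis
      using le[of r a] seminormed_star_algebra.p_nonneg[OF q, of r a] that by simp
  qed
  show ?thesis
    unfolding cstar_seminorm_def
  proof (intro conjI ballI allI)
    fix a c assume a: "a \<in> carrier A"
    show "0 \<le> ?p a" by (rule nonneg[OF a])
    have le1: "?p (c \<odot>\<^bsub>A\<^esub> a) \<le> cmod c * ?p a" if a: "a \<in> carrier A" for c a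
    proof (rule least)
      fix r assume r: "r \<in> N"
      show "r (c \<odot>\<^bsub>A\<^esub> a) \<le> cmod c * ?p a"
        using seminormed_star_algebra.p_smult[OF q[OF r] a] le[OF r a] by (simp add: mult_left_mono)
    qed
    show "?p (c \<odot>\<^bsub>A\<^esub> a) = cmod c * ?p a"
    proof (cases "c = 0")
      case True
      then show ?thesis using le1[OF a, of 0] nonneg[OF A.scale_closed[OF a, of 0]] by simp
    next
      case False
      have "(1 / c) \<odot>\<^bsub>A\<^esub> (c \<odot>\<^bsub>A\<^esub> a) = a"
        using A.smult_assoc1[of "1 / c" c a] A.smult_one[of a] a False by simp
      then have "?p a \<le> cmod (1 / c) * ?p (c \<odot>\<^bsub>A\<^esub> a)"
        using le1[OF A.scale_closed[OF a, of c], of "1 / c"] by simp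
      then have "cmod c * ?p a \<le> ?p (c \<odot>\<^bsub>A\<^esub> a)"
        using False by (simp add: norm_divide field_simps)
      then show ?thesis using le1[OF a, of c] by simp
    qed
    show "?p (star A a \<otimes>\<^bsub>A\<^esub> a) = (?p a)\<^sup>2"
    proof (rule antisym)
      show "?p (star A a \<otimes>\<^bsub>A\<^esub> a) \<le> (?p a)\<^sup>2"
      proof (rule least)
        fix r assume r: "r \<in> N"
        show "r (star A a \<otimes>\<^bsub>A\<^esub> a) \<le> (?p a)\<^sup>2"
          using seminormed_star_algebra.p_cstar[OF q[OF r] a] seminormed_star_algebra.p_nonneg[OF q[OF r] a] le[OF r a]
          by (simp add: power_mono)
      qed
      have "q a \<le> sqrt (?p (star A a \<otimes>\<^bsub>A\<^esub> a))" if "q \<in> N" for q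
        using le[OF that, of "star A a \<otimes>\<^bsub>A\<^esub> a"] a seminormed_star_algebra.p_cstar[OF q[OF that] a] A.star_closed
        by (intro real_le_rsqrt) (simp add: A.ring_rules)
      then have "?p a \<le> sqrt (?p (star A a \<otimes>\<^bsub>A\<^esub> a))" by (rule least)
      then have "(?p a)\<^sup>2 \<le> (sqrt (?p (star A a \<otimes>\<^bsub>A\<^esub> a)))\<^sup>2"
        using nonneg[OF a] by (rule power_mono)
      then show "(?p a)\<^sup>2 \<le> ?p (star A a \<otimes>\<^bsub>A\<^esub> a)"
        using nonneg[of "star A a \<otimes>\<^bsub>A\<^esub> a"] a A.star_closed by (simp add: A.ring_rules)
    qed
    fix b assume b: "b \<in> carrier A"
    show "?p (a \<oplus>\<^bsub>A\<^esub> b) \<le> ?p a + ?p b"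
    proof (rule least)
      fix r assume r: "r \<in> N"
      show "r (a \<oplus>\<^bsub>A\<^esub> b) \<le> ?p a + ?p b"
        using seminormed_star_algebra.p_add[OF q[OF r] a b] le[OF r a] le[OF r b] by simp
    qed
    show "?p (a \<otimes>\<^bsub>A\<^esub> b) \<le> ?p a * ?p b"
    proof (rule least)
      fix r assume r: "r \<in> N"
      have "r (a \<otimes>\<^bsub>A\<^esub> b) \<le> r a * r b"
        using seminormed_star_algebra.p_mult[OF q[OF r]] a b by blast
      also have "\<dots> \<le> ?p a * ?p b"
        using le[OF r] a b seminormed_star_algebra.p_nonneg[OF q[OF r]] nonneg by (intro mult_mono) auto
      finally show "r (a \<otimes>\<^bsub>A\<^esub> b) \<le> ?p a * ?p b" .
    qed
  qed
qed

text \<open>Cauchy and null sequences for \<open>p\<close> are such for the smaller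
  \<open>q\<close>, so the identity on sequences descends to classes. Its surjectivity is a
  different matter and needs the lifting theorem.\<close>

lemma completion_map:
  assumes A: "star_algebra A" and p: "cstar_seminorm A p" and q: "cstar_seminorm A q"
    and le: "\<And>a. a \<in> carrier A \<Longrightarrow> q a \<le> p a"
  defines "\<pi> \<equiv> \<lambda>P. completion_class A q (class_rep P)"
  shows "star_hom (cstar_completion A p) (cstar_completion A q) \<pi>"
    and "\<And>s. cauchy_seq A p s \<Longrightarrow> cauchy_seq A q s \<and> \<pi> (completion_class A p s) = completion_class A q s"
proof -
  interpret p: seminormed_star_algebra A p by (intro seminormed_star_algebra.intro A seminormed_star_algebra_axioms.intro p)
  interpret q: seminormed_star_algebra A q by (intro seminormed_star_algebra.intro A seminormed_star_algebra_axioms.intro q)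
  have cauchy: "q.cauchy s" if s: "p.cauchy s" for s
  proof (rule q.cauchyI)
    fix e :: real assume "0 < e"
    then obtain N where N: "\<forall>m\<ge>N. \<forall>n\<ge>N. p (s m \<ominus>\<^bsub>A\<^esub> s n) < e"
      using p.cauchyD[OF s] by blast
    have "q (s m \<ominus>\<^bsub>A\<^esub> s n) \<le> e" if "m \<ge> N" "n \<ge> N" for m n
    proof -
      have "s m \<ominus>\<^bsub>A\<^esub> s n \<in> carrier A" using s by (simp add: p.ring_rules(4))
      then show ?thesis using le N that by (meson less_imp_le order.trans)
    qed
    then show "\<exists>N. \<forall>m\<ge>N. \<forall>n\<ge>N. q (s m \<ominus>\<^bsub>A\<^esub> s n) \<le> e" by blast
  qed (use s in simp)
  have \<pi>: "\<pi> (p.cls s) = q.cls s" if s: "p.cauchy s" for s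
  proof -
    note r = p.class_rep[OF s]
    have "(\<lambda>n. q (s n \<ominus>\<^bsub>A\<^esub> class_rep (p.cls s) n)) \<longlonglongrightarrow> 0"
      by (rule null_comparison[OF _ _ r(2)]) (use s r in \<open>auto intro!: le q.p_nonneg simp: p.ring_rules(4)\<close>)
    then have "q.cls s = q.cls (class_rep (p.cls s))"
      using s r cauchy by (simp add: q.class_eq_iff)
    then show ?thesis by (simp add: \<pi>_def)
  qed
  show "\<And>s. p.cauchy s \<Longrightarrow> q.cauchy s \<and> \<pi> (p.cls s) = q.cls s"
    using cauchy \<pi> by blast
  show "star_hom p.C q.C \<pi>"
    by (rule star_homI) (auto elim!: p.completionE simp: p.completion_ops q.completion_ops \<pi> cauchy)
qed

section \<open>Norm limits and the extension of isometric homomorphisms\<close>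

context seminormed_star_algebra
begin

definition converges :: "(nat \<Rightarrow> 'a) \<Rightarrow> 'a \<Rightarrow> bool" where
  "converges x l \<longleftrightarrow> (\<forall>n. x n \<in> carrier A) \<and> l \<in> carrier A \<and> (\<lambda>n. p (x n \<ominus> l)) \<longlonglongrightarrow> 0"

lemma converges_closed: "converges x l \<Longrightarrow> x n \<in> carrier A" "converges x l \<Longrightarrow> l \<in> carrier A"
  by (simp_all add: converges_def)

lemma converges_const: "a \<in> carrier A \<Longrightarrow> converges (\<lambda>_. a) a"
  by (simp add: converges_def diff_self)

lemma converges_add:
  assumes "converges x l" "converges y k" shows "converges (\<lambda>n. x n \<oplus> y n) (l \<oplus> k)"
  unfolding converges_def
proof (intro conjI allI)
  have "(\<lambda>n. p (x n \<ominus> l) + p (y n \<ominus> k)) \<longlonglongrightarrow> 0"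
    using assms by (intro tendsto_add_zero) (simp_all add: converges_def)
  then show "(\<lambda>n. p (x n \<oplus> y n \<ominus> (l \<oplus> k))) \<longlonglongrightarrow> 0"
    using assms by (rule_tac null_comparison) (auto simp: converges_def add_diff_add intro!: p_nonneg p_add)
qed (use assms in \<open>simp_all add: converges_def ring_rules(1)\<close>)

lemma converges_smult: "converges x l \<Longrightarrow> converges (\<lambda>n. c \<odot> x n) (c \<odot> l)"
  using tendsto_mult_right_zero[of "\<lambda>n. p (x n \<ominus> l)" sequentially "cmod c"]
  by (simp add: converges_def smult_diff p_smult)

lemma converges_star: "converges x l \<Longrightarrow> converges (\<lambda>n. star A (x n)) (star A l)"
  by (simp add: converges_def star_diff p_star star_closed)

lemma converges_p:
  assumes "converges x l" shows "(\<lambda>n. p (x n)) \<longlonglongrightarrow> p l"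
proof -
  have "(\<lambda>n. p (x n) - p l) \<longlonglongrightarrow> 0"
    by (rule tendsto_rabs_zero_cancel, rule null_comparison[of _ "\<lambda>n. p (x n \<ominus> l)"])
      (use assms p_abs_diff in \<open>auto simp: converges_def\<close>)
  then show ?thesis by (simp add: LIM_zero_iff)
qed

lemma converges_mult:
  assumes "converges x l" "converges y k" shows "converges (\<lambda>n. x n \<otimes> y n) (l \<otimes> k)"
  unfolding converges_def
proof (intro conjI allI)
  have "(\<lambda>n. p (x n) * p (y n \<ominus> k) + p (x n \<ominus> l) * p k) \<longlonglongrightarrow> p l * 0 + 0 * p k"
    using assms converges_p[OF assms(1)] by (intro tendsto_intros) (simp_all add: converges_def)
  then have "(\<lambda>n. p (x n) * p (y n \<ominus> k) + p (x n \<ominus> l) * p k) \<longlonglongrightarrow> 0" by simp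
  then show "(\<lambda>n. p (x n \<otimes> y n \<ominus> l \<otimes> k)) \<longlonglongrightarrow> 0"
    by (rule null_comparison[rotated 2]) (use assms in \<open>auto simp: converges_def intro!: p_nonneg p_mult_diff_mult\<close>)
qed (use assms in \<open>simp_all add: converges_def ring_rules(5)\<close>)

lemma converges_diff: "converges x l \<Longrightarrow> converges y k \<Longrightarrow> converges (\<lambda>n. x n \<ominus> y n) (l \<ominus> k)"
  using converges_add[of x l "\<lambda>n. (- 1) \<odot> y n" "(- 1) \<odot> k"] converges_smult[of y k "- 1"]
  by (simp add: a_minus_def minus_eq_smult converges_closed)

end

lemma (in unital_cstar_algebra) seminormed: "seminormed_star_algebra A (nrm A)"
  by unfold_locales (rule nrm_cstar_seminorm)

lemma (in unital_cstar_algebra) norm_limit_unique: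
  assumes "seminormed_star_algebra.converges A (nrm A) x l" "seminormed_star_algebra.converges A (nrm A) x k"
  shows "l = k"
proof -
  interpret seminormed_star_algebra A "nrm A" by (rule seminormed)
  have "(\<lambda>n. nrm A (x n \<ominus> x n)) \<longlonglongrightarrow> nrm A (l \<ominus> k)"
    by (rule converges_p[OF converges_diff[OF assms]])
  then have "nrm A (l \<ominus> k) = 0"
    using assms by (simp add: converges_closed diff_self LIMSEQ_const_iff)
  moreover have lk: "l \<in> carrier A" "k \<in> carrier A"
    using assms converges_closed by blast+
  ultimately have "l \<ominus> k = \<zero>"
    by (intro nrm_definite) (auto simp: ring_rules(4))
  moreover have "(l \<ominus> k) \<oplus> k = l"
    using lk by (simp add: a_minus_def ring_rules(3,7,9,15))
  ultimately show ?thesis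
    using lk by (simp add: ring_rules(8))
qed

text \<open>Isometry makes images of Cauchy sequences Cauchy, the extension injective, and preimages
  of convergent sequences Cauchy; the last point makes the range the whole closure. The limit
  formula in the conclusion determines \<Phi> on every class.\<close>

theorem isometric_extension:
  assumes A: "star_algebra A" and p: "cstar_seminorm A p" and B: "unital_cstar_algebra B"
    and \<phi>: "star_hom A B \<phi>" and isometric: "\<And>a. a \<in> carrier A \<Longrightarrow> nrm B (\<phi> a) = p a"
  obtains \<Phi> where
    "cstar_iso (cstar_completion A p) (B\<lparr>carrier := norm_closure B (\<phi> ` carrier A)\<rparr>) \<Phi>"
    "\<And>a. a \<in> carrier A \<Longrightarrow> \<Phi> (completion_embed A p a) = \<phi> a"
    "\<And>s. cauchy_seq A p s \<Longrightarrow> seminormed_star_algebra.converges B (nrm B) (\<lambda>n. \<phi> (s n)) (\<Phi> (completion_class A p s))"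
proof -
  interpret A: seminormed_star_algebra A p by (intro seminormed_star_algebra.intro A seminormed_star_algebra_axioms.intro p)
  interpret B: unital_cstar_algebra B by (rule B)
  interpret B: seminormed_star_algebra B "nrm B" by (rule B.seminormed)
  note [simp] = star_hom_closed[OF \<phi>]
  have diff: "\<phi> a \<ominus>\<^bsub>B\<^esub> \<phi> b = \<phi> (a \<ominus>\<^bsub>A\<^esub> b)" if "a \<in> carrier A" "b \<in> carrier A" for a b
    using star_hom_diff[OF A B.star_algebra_axioms \<phi> that] by simp
  note unique = B.norm_limit_unique
  have ex: "\<exists>l. B.converges (\<lambda>n. \<phi> (s n)) l" if s: "A.cauchy s" for s
  proof -
    have "B.cauchy (\<lambda>n. \<phi> (s n))"
      using s A.cauchyD[OF s] by (simp add: cauchy_seq_def diff isometric A.ring_rules(4))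
    then show ?thesis
      using B.nrm_complete s unfolding complete_wrt_def B.converges_def by fastforce
  qed
  define \<Phi> where "\<Phi> = (\<lambda>P. SOME l. B.converges (\<lambda>n. \<phi> (class_rep P n)) l)"
  have conv: "B.converges (\<lambda>n. \<phi> (s n)) (\<Phi> (A.cls s))" if s: "A.cauchy s" for s
  proof -
    note r = A.class_rep[OF s]
    have 1: "B.converges (\<lambda>n. \<phi> (class_rep (A.cls s) n)) (\<Phi> (A.cls s))"
      unfolding \<Phi>_def by (rule someI_ex[OF ex[OF r(1)]])
    have "B.converges (\<lambda>n. \<phi> (s n) \<ominus>\<^bsub>B\<^esub> \<phi> (class_rep (A.cls s) n)) \<zero>\<^bsub>B\<^esub>"
      using r s by (simp add: B.converges_def B.diff_zero diff isometric B.ring_rules(2,4) A.ring_rules(4))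
    from B.converges_add[OF this 1]
    have "B.converges (\<lambda>n. (\<phi> (s n) \<ominus>\<^bsub>B\<^esub> \<phi> (class_rep (A.cls s) n)) \<oplus>\<^bsub>B\<^esub> \<phi> (class_rep (A.cls s) n))
      (\<zero>\<^bsub>B\<^esub> \<oplus>\<^bsub>B\<^esub> \<Phi> (A.cls s))" .
    moreover have "(\<phi> (s n) \<ominus>\<^bsub>B\<^esub> \<phi> (class_rep (A.cls s) n)) \<oplus>\<^bsub>B\<^esub> \<phi> (class_rep (A.cls s) n) = \<phi> (s n)" for n
      using s r by (simp add: a_minus_def B.ring_rules(3,7,9,15))
    moreover have "\<zero>\<^bsub>B\<^esub> \<oplus>\<^bsub>B\<^esub> \<Phi> (A.cls s) = \<Phi> (A.cls s)"
      using B.converges_closed(2)[OF 1] by (simp add: B.ring_rules(8))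
    ultimately show ?thesis by simp
  qed
  have eqI: "\<Phi> (A.cls s) = l" if "A.cauchy s" "B.converges (\<lambda>n. \<phi> (s n)) l" for s l
    using unique[OF conv[OF that(1)] that(2)] .
  have nrm: "nrm B (\<Phi> (A.cls s)) = nrm A.C (A.cls s)" if s: "A.cauchy s" for s
    using LIMSEQ_unique[OF _ A.completion_nrm[OF s]] B.converges_p[OF conv[OF s]] s by (simp add: isometric)
  let ?K = "norm_closure B (\<phi> ` carrier A)"
  have in_K: "\<Phi> (A.cls s) \<in> ?K" if s: "A.cauchy s" for s
    unfolding norm_closure_def
  proof (intro CollectI conjI allI impI)
    show "\<Phi> (A.cls s) \<in> carrier B" using B.converges_closed[OF conv[OF s]] by simp
    fix e :: real assume "0 < e"
    then have "\<forall>\<^sub>F n in sequentially. nrm B (\<phi> (s n) \<ominus>\<^bsub>B\<^esub> \<Phi> (A.cls s)) < e"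
      using conv[OF s] unfolding B.converges_def by (intro order_tendstoD) auto
    then obtain n where "nrm B (\<phi> (s n) \<ominus>\<^bsub>B\<^esub> \<Phi> (A.cls s)) < e"
      by (auto simp: eventually_sequentially)
    then show "\<exists>b\<in>\<phi> ` carrier A. nrm B (\<Phi> (A.cls s) \<ominus>\<^bsub>B\<^esub> b) < e"
      using s B.converges_closed[OF conv[OF s]] by (intro bexI[of _ "\<phi> (s n)"]) (auto simp: B.p_diff_commute)
  qed
  have hom: "star_hom A.C (B\<lparr>carrier := ?K\<rparr>) \<Phi>"
  proof (rule star_homI)
    show "\<Phi> P \<in> carrier (B\<lparr>carrier := ?K\<rparr>)" if "P \<in> carrier A.C" for P
      using that in_K by (auto elim!: A.completionE)
    show "\<Phi> \<one>\<^bsub>A.C\<^esub> = \<one>\<^bsub>B\<lparr>carrier := ?K\<rparr>\<^esub>"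
      unfolding A.completion_one using B.converges_const[of "\<one>\<^bsub>B\<^esub>"]
      by (intro eqI) (simp_all add: star_hom_one[OF \<phi>] A.ring_rules B.ring_rules)
    fix P assume "P \<in> carrier A.C"
    then obtain s where s: "A.cauchy s" "P = A.cls s" by (rule A.completionE)
    show "\<Phi> (c \<odot>\<^bsub>A.C\<^esub> P) = c \<odot>\<^bsub>B\<lparr>carrier := ?K\<rparr>\<^esub> \<Phi> P" for c
      using s B.converges_smult[OF conv[OF s(1)], of c]
      by (simp add: A.completion_ops star_hom_smult[OF \<phi>] eqI)
    show "\<Phi> (star A.C P) = star (B\<lparr>carrier := ?K\<rparr>) (\<Phi> P)"
      using s B.converges_star[OF conv[OF s(1)]]
      by (simp add: A.completion_ops star_hom_star[OF \<phi>] eqI)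
    fix Q assume "Q \<in> carrier A.C"
    then obtain t where t: "A.cauchy t" "Q = A.cls t" by (rule A.completionE)
    show "\<Phi> (P \<oplus>\<^bsub>A.C\<^esub> Q) = \<Phi> P \<oplus>\<^bsub>B\<lparr>carrier := ?K\<rparr>\<^esub> \<Phi> Q"
      using s t B.converges_add[OF conv[OF s(1)] conv[OF t(1)]]
      by (simp add: A.completion_ops star_hom_add[OF \<phi>] eqI)
    show "\<Phi> (P \<otimes>\<^bsub>A.C\<^esub> Q) = \<Phi> P \<otimes>\<^bsub>B\<lparr>carrier := ?K\<rparr>\<^esub> \<Phi> Q"
      using s t B.converges_mult[OF conv[OF s(1)] conv[OF t(1)]]
      by (simp add: A.completion_ops star_hom_mult[OF \<phi>] eqI)
  qed
  have inj: "inj_on \<Phi> (carrier A.C)"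
  proof (rule inj_onI)
    fix P Q assume PQ: "P \<in> carrier A.C" "Q \<in> carrier A.C" "\<Phi> P = \<Phi> Q"
    obtain s where s: "A.cauchy s" "P = A.cls s" using PQ(1) by (rule A.completionE)
    obtain t where t: "A.cauchy t" "Q = A.cls t" using PQ(2) by (rule A.completionE)
    have "(\<lambda>n. nrm B (\<phi> (s n) \<ominus>\<^bsub>B\<^esub> \<phi> (t n))) \<longlonglongrightarrow> nrm B (\<Phi> P \<ominus>\<^bsub>B\<^esub> \<Phi> Q)"
      using B.converges_p[OF B.converges_diff[OF conv[OF s(1)] conv[OF t(1)]]] s t by simp
    then have "(\<lambda>n. p (s n \<ominus>\<^bsub>A\<^esub> t n)) \<longlonglongrightarrow> 0"
      using s t PQ(3) B.converges_closed[OF conv[OF t(1)]] by (simp add: diff isometric B.diff_self A.ring_rules(4))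
    then show "P = Q" using s t by (simp add: A.class_eq_iff)
  qed
  have surj: "b \<in> \<Phi> ` carrier A.C" if b: "b \<in> ?K" for b
  proof -
    have bc: "b \<in> carrier B" using b by (simp add: norm_closure_def)
    have "\<exists>a. a \<in> carrier A \<and> nrm B (b \<ominus>\<^bsub>B\<^esub> \<phi> a) < 1 / Suc n" for n
    proof -
      have "0 < 1 / real (Suc n)" by simp
      then show ?thesis using b unfolding norm_closure_def by blast
    qed
    then obtain a where a: "\<And>n. a n \<in> carrier A" "\<And>n. nrm B (b \<ominus>\<^bsub>B\<^esub> \<phi> (a n)) < 1 / Suc n"
      by metis
    have lim0: "(\<lambda>k. 1 / real (Suc k)) \<longlonglongrightarrow> 0"
      by (rule LIMSEQ_Suc) (rule lim_1_over_n)
    have conv_b: "B.converges (\<lambda>n. \<phi> (a n)) b"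
      unfolding B.converges_def
    proof (intro conjI allI bc)
      show "(\<lambda>n. nrm B (\<phi> (a n) \<ominus>\<^bsub>B\<^esub> b)) \<longlonglongrightarrow> 0"
        by (rule null_comparison[OF _ _ lim0])
          (use a bc B.p_diff_commute in \<open>auto simp: less_imp_le B.ring_rules(4) intro!: B.p_nonneg\<close>)
    qed (use a in simp)
    have "A.cauchy a"
    proof (rule A.cauchyI)
      fix e :: real assume e: "0 < e"
      then have "\<forall>\<^sub>F n in sequentially. 1 / real (Suc n) < e / 2"
        by (intro order_tendstoD(2)[OF lim0]) simp
      then obtain N where N: "\<forall>n\<ge>N. 1 / real (Suc n) < e / 2"
        unfolding eventually_sequentially by blast
      have "p (a m \<ominus>\<^bsub>A\<^esub> a n) \<le> e" if mn: "m \<ge> N" "n \<ge> N" for m n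
      proof -
        have "p (a m \<ominus>\<^bsub>A\<^esub> a n) = nrm B (\<phi> (a m) \<ominus>\<^bsub>B\<^esub> \<phi> (a n))"
          using a by (simp add: diff isometric A.ring_rules(4))
        also have "\<dots> \<le> nrm B (\<phi> (a m) \<ominus>\<^bsub>B\<^esub> b) + nrm B (b \<ominus>\<^bsub>B\<^esub> \<phi> (a n))"
          using a bc by (intro B.p_triangle) auto
        also have "\<dots> \<le> e / 2 + e / 2"
          using a(2)[of m] a(2)[of n] N mn B.p_diff_commute[of "\<phi> (a m)" b] a(1) bc
          by (intro add_mono) (auto intro: order.trans less_imp_le order.strict_trans)
        finally show ?thesis by simp
      qed
      then show "\<exists>N. \<forall>m\<ge>N. \<forall>n\<ge>N. p (a m \<ominus>\<^bsub>A\<^esub> a n) \<le> e" by blast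
    qed (rule a(1))
    then show ?thesis
      using eqI[OF _ conv_b] by (intro image_eqI[of _ _ "A.cls a"]) auto
  qed
  have "\<Phi> ` carrier A.C = ?K"
    using in_K surj by (auto elim!: A.completionE)
  then have "cstar_iso A.C (B\<lparr>carrier := ?K\<rparr>) \<Phi>"
    using hom inj nrm unfolding cstar_iso_def bij_betw_def by (auto elim!: A.completionE)
  moreover have "\<Phi> (completion_embed A p a) = \<phi> a" if "a \<in> carrier A" for a
    unfolding A.embed_cauchy using that by (intro eqI) (simp_all add: B.converges_const)
  ultimately show ?thesis using that conv by blast
qed

section \<open>C*-seminorms respecting the Cuntz-Pimsner relations\<close>

definition cp_gens :: "('g, 'm) monoid_scheme \<Rightarrow> ('g, 'x) cp_gen set" where
  "cp_gens G = Group_Gen ` carrier G \<union> range Letter_Gen"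

lemma cp_free_algebra_eq: "cp_free_algebra G = free_star_algebra (cp_gens G)"
  by (simp add: cp_free_algebra_def cp_gens_def)

lemma star_algebra_cp_free: "star_algebra (cp_free_algebra G)"
  unfolding cp_free_algebra_eq by (rule star_algebra_free)

lemma free_gen_closed: "i \<in> S \<Longrightarrow> free_gen i \<in> carrier (free_star_algebra S)"
  unfolding free_gen_def free_star_algebra_def by (rule point_mass_closed) simp

lemma cp_gen_closed [simp]:
  "g \<in> carrier G \<Longrightarrow> free_gen (Group_Gen g) \<in> carrier (cp_free_algebra G)"
  "free_gen (Letter_Gen x) \<in> carrier (cp_free_algebra G)"
  unfolding cp_free_algebra_eq by (rule free_gen_closed; simp add: cp_gens_def)+

definition cp_admissible ::
    "('g, 'm) monoid_scheme \<Rightarrow> ('g \<Rightarrow> 'x::finite list \<Rightarrow> 'x list) \<Rightarrow> (('g, 'x) cp_free \<Rightarrow> real) \<Rightarrow> bool" where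
  "cp_admissible G act q \<longleftrightarrow> cstar_seminorm (cp_free_algebra G) q \<and>
     (\<forall>(l, r)\<in>cp_relations G act. q (l \<ominus>\<^bsub>cp_free_algebra G\<^esub> r) = 0)"

text \<open>Both kinds of completions are shown to be exactly the completions of this form.\<close>

definition cp_extends ::
    "('g, 'm) monoid_scheme \<Rightarrow> ('g \<Rightarrow> 'x::finite list \<Rightarrow> 'x list) \<Rightarrow> (('g \<Rightarrow> complex) \<Rightarrow> real) \<Rightarrow>
     (('g, 'x) cp_free \<Rightarrow> real) \<Rightarrow> bool" where
  "cp_extends G act p q \<longleftrightarrow> cp_admissible G act q \<and> q \<one>\<^bsub>cp_free_algebra G\<^esub> \<noteq> 0 \<and>
     (\<forall>f\<in>carrier (group_algebra G).
        q (group_algebra_map (cp_free_algebra G) (\<lambda>g. free_gen (Group_Gen g)) f) = p f)"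

locale cp_group = group G for G :: "('g, 'm) monoid_scheme" (structure) +
  fixes act :: "'g \<Rightarrow> 'x::finite list \<Rightarrow> 'x list"
begin

abbreviation F :: "('g, 'x) cp_free star_alg" where "F \<equiv> cp_free_algebra G"
abbreviation gen :: "'g \<Rightarrow> ('g, 'x) cp_free" where "gen g \<equiv> free_gen (Group_Gen g)"
abbreviation letter :: "'x \<Rightarrow> ('g, 'x) cp_free" where "letter x \<equiv> free_gen (Letter_Gen x)"
abbreviation \<iota> :: "('g \<Rightarrow> complex) \<Rightarrow> ('g, 'x) cp_free" where "\<iota> \<equiv> group_algebra_map F gen"

sublocale F: star_algebra F by (rule star_algebra_cp_free)

lemma is_group: "Group.group G" ..

sublocale CG: star_algebra "group_algebra G" by (rule star_algebra_group_algebra[OF is_group])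

lemma gen_closed: "g \<in> carrier G \<Longrightarrow> gen g \<in> carrier F"
  by simp

lemma cp_admissible_relations:
  assumes "cp_admissible G act q"
  shows "q (gen \<one> \<ominus>\<^bsub>F\<^esub> \<one>\<^bsub>F\<^esub>) = 0"
    "\<And>g h. g \<in> carrier G \<Longrightarrow> h \<in> carrier G \<Longrightarrow> q (gen g \<otimes>\<^bsub>F\<^esub> gen h \<ominus>\<^bsub>F\<^esub> gen (g \<otimes> h)) = 0"
    "\<And>g. g \<in> carrier G \<Longrightarrow> q (star F (gen g) \<otimes>\<^bsub>F\<^esub> gen g \<ominus>\<^bsub>F\<^esub> \<one>\<^bsub>F\<^esub>) = 0"
    "\<And>g. g \<in> carrier G \<Longrightarrow> q (gen g \<otimes>\<^bsub>F\<^esub> star F (gen g) \<ominus>\<^bsub>F\<^esub> \<one>\<^bsub>F\<^esub>) = 0"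
    "\<And>x. q (star F (letter x) \<otimes>\<^bsub>F\<^esub> letter x \<ominus>\<^bsub>F\<^esub> \<one>\<^bsub>F\<^esub>) = 0"
    "q ((\<Oplus>\<^bsub>F\<^esub>x\<in>UNIV. letter x \<otimes>\<^bsub>F\<^esub> star F (letter x)) \<ominus>\<^bsub>F\<^esub> \<one>\<^bsub>F\<^esub>) = 0"
    "\<And>g h x y. g \<in> carrier G \<Longrightarrow> h \<in> carrier G \<Longrightarrow> restricts act g x y h \<Longrightarrow>
      q (gen g \<otimes>\<^bsub>F\<^esub> letter x \<ominus>\<^bsub>F\<^esub> letter y \<otimes>\<^bsub>F\<^esub> gen h) = 0"
proof -
  have R: "q (l \<ominus>\<^bsub>F\<^esub> r) = 0" if "(l, r) \<in> cp_relations G act" for l r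
    using assms that by (auto simp: cp_admissible_def)
  note R = R[unfolded cp_relations_def Let_def]
  show "q (gen \<one> \<ominus>\<^bsub>F\<^esub> \<one>\<^bsub>F\<^esub>) = 0" by (rule R) simp
  show "\<And>g h. g \<in> carrier G \<Longrightarrow> h \<in> carrier G \<Longrightarrow> q (gen g \<otimes>\<^bsub>F\<^esub> gen h \<ominus>\<^bsub>F\<^esub> gen (g \<otimes> h)) = 0"
    by (rule R) blast
  show "\<And>g. g \<in> carrier G \<Longrightarrow> q (star F (gen g) \<otimes>\<^bsub>F\<^esub> gen g \<ominus>\<^bsub>F\<^esub> \<one>\<^bsub>F\<^esub>) = 0" by (rule R) blast
  show "\<And>g. g \<in> carrier G \<Longrightarrow> q (gen g \<otimes>\<^bsub>F\<^esub> star F (gen g) \<ominus>\<^bsub>F\<^esub> \<one>\<^bsub>F\<^esub>) = 0" by (rule R) blast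
  show "\<And>x. q (star F (letter x) \<otimes>\<^bsub>F\<^esub> letter x \<ominus>\<^bsub>F\<^esub> \<one>\<^bsub>F\<^esub>) = 0" by (rule R) blast
  show "q ((\<Oplus>\<^bsub>F\<^esub>x\<in>UNIV. letter x \<otimes>\<^bsub>F\<^esub> star F (letter x)) \<ominus>\<^bsub>F\<^esub> \<one>\<^bsub>F\<^esub>) = 0" by (rule R) blast
  show "\<And>g h x y. g \<in> carrier G \<Longrightarrow> h \<in> carrier G \<Longrightarrow> restricts act g x y h \<Longrightarrow>
      q (gen g \<otimes>\<^bsub>F\<^esub> letter x \<ominus>\<^bsub>F\<^esub> letter y \<otimes>\<^bsub>F\<^esub> gen h) = 0"
    by (rule R) blast
qed

lemma cp_admissibleI:
  assumes "cstar_seminorm F q"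
    and "q (gen \<one> \<ominus>\<^bsub>F\<^esub> \<one>\<^bsub>F\<^esub>) = 0"
    "\<And>g h. g \<in> carrier G \<Longrightarrow> h \<in> carrier G \<Longrightarrow> q (gen g \<otimes>\<^bsub>F\<^esub> gen h \<ominus>\<^bsub>F\<^esub> gen (g \<otimes> h)) = 0"
    "\<And>g. g \<in> carrier G \<Longrightarrow> q (star F (gen g) \<otimes>\<^bsub>F\<^esub> gen g \<ominus>\<^bsub>F\<^esub> \<one>\<^bsub>F\<^esub>) = 0"
    "\<And>g. g \<in> carrier G \<Longrightarrow> q (gen g \<otimes>\<^bsub>F\<^esub> star F (gen g) \<ominus>\<^bsub>F\<^esub> \<one>\<^bsub>F\<^esub>) = 0"
    "\<And>x. q (star F (letter x) \<otimes>\<^bsub>F\<^esub> letter x \<ominus>\<^bsub>F\<^esub> \<one>\<^bsub>F\<^esub>) = 0"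
    "q ((\<Oplus>\<^bsub>F\<^esub>x\<in>UNIV. letter x \<otimes>\<^bsub>F\<^esub> star F (letter x)) \<ominus>\<^bsub>F\<^esub> \<one>\<^bsub>F\<^esub>) = 0"
    "\<And>g h x y. g \<in> carrier G \<Longrightarrow> h \<in> carrier G \<Longrightarrow> restricts act g x y h \<Longrightarrow>
      q (gen g \<otimes>\<^bsub>F\<^esub> letter x \<ominus>\<^bsub>F\<^esub> letter y \<otimes>\<^bsub>F\<^esub> gen h) = 0"
  shows "cp_admissible G act q"
  unfolding cp_admissible_def cp_relations_def Let_def using assms by auto

lemma letter_sum_closed: "(\<Oplus>\<^bsub>F\<^esub>x\<in>UNIV. letter x \<otimes>\<^bsub>F\<^esub> star F (letter x)) \<in> carrier F"
  by (intro abelian_monoid.finsum_closed[OF abelian_group.axioms(1)[OF F.ag]])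
    (auto simp: F.star_closed F.ring_rules(5))

end

locale cp_seminorm_on = cp_group G act for G :: "('g, 'm) monoid_scheme" (structure) and act :: "'g \<Rightarrow> 'x::finite list \<Rightarrow> 'x list" +
  fixes q :: "('g, 'x) cp_free \<Rightarrow> real"
  assumes admissible: "cp_admissible G act q"
begin

sublocale Fq: seminormed_star_algebra F q
  by unfold_locales (use admissible in \<open>simp add: cp_admissible_def\<close>)

sublocale Cq: unital_cstar_algebra "cstar_completion F q"
  by (rule Fq.unital_cstar_algebra_completion)

sublocale Cq: seminormed_star_algebra "cstar_completion F q" "nrm (cstar_completion F q)"
  by (rule Cq.seminormed)

abbreviation E :: "('g, 'x) cp_free \<Rightarrow> ('g, 'x) cp_elem" where "E \<equiv> completion_embed F q"

lemma E_eq: "a \<in> carrier F \<Longrightarrow> b \<in> carrier F \<Longrightarrow> q (a \<ominus>\<^bsub>F\<^esub> b) = 0 \<Longrightarrow> E a = E b"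
  by (simp add: Fq.embed_cauchy Fq.class_eq_iff)

lemma q_eq: "a \<in> carrier F \<Longrightarrow> b \<in> carrier F \<Longrightarrow> q (a \<ominus>\<^bsub>F\<^esub> b) = 0 \<Longrightarrow> q a = q b"
  using Fq.p_abs_diff[of a b] by simp

lemma q_one_le: "q \<one>\<^bsub>F\<^esub> \<le> 1"
proof -
  have "star F \<one>\<^bsub>F\<^esub> \<otimes>\<^bsub>F\<^esub> \<one>\<^bsub>F\<^esub> = star F \<one>\<^bsub>F\<^esub>" by (simp add: F.star_closed F.ring_rules)
  then have "q \<one>\<^bsub>F\<^esub> = q \<one>\<^bsub>F\<^esub> * q \<one>\<^bsub>F\<^esub>"
    using Fq.p_cstar[of "\<one>\<^bsub>F\<^esub>"] Fq.p_star[of "\<one>\<^bsub>F\<^esub>"] by (simp add: F.ring_rules power2_eq_square)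
  then show ?thesis by (metis linear mult_cancel_right1 zero_le_one)
qed

text \<open>The relation \<open>a\<^sup>* a = 1\<close> and the C*-identity give
  \<open>(q a)\<^sup>2 = q 1\<close>, which is at most 1.\<close>

lemma q_gen_le: "g \<in> carrier G \<Longrightarrow> q (gen g) \<le> 1" "q (letter x) \<le> 1"
proof -
  have *: "q a \<le> 1" if "a \<in> carrier F" "q (star F a \<otimes>\<^bsub>F\<^esub> a \<ominus>\<^bsub>F\<^esub> \<one>\<^bsub>F\<^esub>) = 0" for a
  proof -
    have "(q a)\<^sup>2 = q \<one>\<^bsub>F\<^esub>"
      using q_eq[OF _ _ that(2)] Fq.p_cstar[OF that(1)] that(1) by (simp add: F.star_closed F.ring_rules(5,6))
    then show ?thesis using q_one_le by (metis abs_le_square_iff abs_1 abs_ge_self order.trans one_power2)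
  qed
  show "g \<in> carrier G \<Longrightarrow> q (gen g) \<le> 1" "q (letter x) \<le> 1"
    using *[of "gen g"] *[of "letter x"] cp_admissible_relations[OF admissible] by auto
qed

text \<open>The bound does not depend on \<open>q\<close>; this is what makes the supremum over all
  admissible seminorms finite.\<close>

lemma q_word_le:
  assumes "w \<in> lists (cp_gens G \<times> UNIV)" shows "q (point_mass w) \<le> 1"
  using assms
proof (induction w)
  case Nil
  have "(point_mass [] :: ('g, 'x) cp_free) = \<one>\<^bsub>F\<^esub>" by (simp add: cp_free_algebra_eq free_star_algebra_simps)
  then show ?case using q_one_le by simp
next
  case (Cons l w)
  obtain i b where l: "l = (i, b)" "i \<in> cp_gens G" using Cons.hyps by auto
  have pm: "point_mass v \<in> carrier F" if "v \<in> lists (cp_gens G \<times> UNIV)" for v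
    using that unfolding cp_free_algebra_eq free_star_algebra_def by (intro point_mass_closed) simp
  have gen: "free_gen i \<in> carrier F" "q (free_gen i) \<le> 1"
    using l(2) q_gen_le by (auto simp: cp_gens_def)
  have "q (point_mass [l]) \<le> 1"
  proof (cases b)
    case False
    then show ?thesis using gen l by (simp add: free_gen_def)
  next
    case True
    have "star F (free_gen i) = point_mass [l]"
      using l True by (auto simp: cp_free_algebra_eq free_star_algebra_simps free_gen_def point_mass_def fun_eq_iff
          rev_swap split: if_splits)
    then show ?thesis using gen Fq.p_star[of "free_gen i"] by simp
  qed
  moreover have "point_mass (l # w) = point_mass [l] \<otimes>\<^bsub>F\<^esub> (point_mass w :: ('g, 'x) cp_free)"
    unfolding cp_free_algebra_eq free_star_algebra_def by (subst point_mass_mult) simp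
  then have "q (point_mass (l # w)) \<le> q (point_mass [l]) * q (point_mass w)"
    using Fq.p_mult[OF pm pm, of "[l]" w] Cons.hyps by simp
  ultimately show ?case
    using Cons mult_mono[of "q (point_mass [l])" 1 "q (point_mass w)" 1] Fq.p_nonneg[OF pm, of w] by simp
qed

definition v :: "'g \<Rightarrow> ('g, 'x) cp_elem" where "v g = E (gen g)"

lemma v_closed: "g \<in> carrier G \<Longrightarrow> v g \<in> carrier (cstar_completion F q)"
  by (simp add: v_def)

lemma v_unitary:
  "v \<one> = \<one>\<^bsub>cstar_completion F q\<^esub>"
  "\<And>g h. g \<in> carrier G \<Longrightarrow> h \<in> carrier G \<Longrightarrow> v (g \<otimes> h) = v g \<otimes>\<^bsub>cstar_completion F q\<^esub> v h"
  "\<And>g. g \<in> carrier G \<Longrightarrow> star (cstar_completion F q) (v g) = v (inv g)"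
proof -
  let ?C = "cstar_completion F q"
  note rel = cp_admissible_relations[OF admissible]
  note hom = Fq.star_hom_embed
  show one: "v \<one> = \<one>\<^bsub>?C\<^esub>"
    using E_eq[OF _ _ rel(1)] star_hom_one[OF hom] by (simp add: v_def F.ring_rules(6))
  show mult: "v (g \<otimes> h) = v g \<otimes>\<^bsub>?C\<^esub> v h" if "g \<in> carrier G" "h \<in> carrier G" for g h
    using E_eq[OF _ _ rel(2)[OF that]] star_hom_mult[OF hom] that by (simp add: v_def F.ring_rules(5))
  fix g assume g: "g \<in> carrier G"
  \<comment> \<open>The left inverse \<open>star (v g)\<close> and the right inverse
    \<open>v (inv g)\<close> of \<open>v g\<close> coincide.\<close>
  have "star ?C (v g) \<otimes>\<^bsub>?C\<^esub> v g = \<one>\<^bsub>?C\<^esub>"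
    using E_eq[OF _ _ rel(3)[OF g]] star_hom_mult[OF hom] star_hom_star[OF hom] star_hom_one[OF hom] g
    by (simp add: v_def F.ring_rules(5,6) F.star_closed)
  moreover have "v g \<otimes>\<^bsub>?C\<^esub> v (inv g) = \<one>\<^bsub>?C\<^esub>"
    using mult[of g "inv g"] one g by simp
  moreover have "star ?C (v g) = star ?C (v g) \<otimes>\<^bsub>?C\<^esub> (v g \<otimes>\<^bsub>?C\<^esub> v (inv g))"
    using g calculation(2) by (simp add: v_closed Cq.star_closed Cq.ring_rules)
  moreover have "\<dots> = (star ?C (v g) \<otimes>\<^bsub>?C\<^esub> v g) \<otimes>\<^bsub>?C\<^esub> v (inv g)"
    using g by (simp add: v_closed Cq.star_closed Cq.ring_rules)
  ultimately show "star ?C (v g) = v (inv g)"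
    using g by (simp add: v_closed Cq.ring_rules)
qed

abbreviation \<phi> :: "('g \<Rightarrow> complex) \<Rightarrow> ('g, 'x) cp_elem" where
  "\<phi> \<equiv> group_algebra_map (cstar_completion F q) v"

lemma star_hom_\<phi>: "star_hom (group_algebra G) (cstar_completion F q) \<phi>"
  by (rule Cq.star_hom_group_algebra_map[OF is_group v_closed v_unitary])

lemma \<iota>_closed: "f \<in> carrier (group_algebra G) \<Longrightarrow> \<iota> f \<in> carrier F"
  by (rule F.group_algebra_map_closed[where G = G and u = gen, OF gen_closed])

lemma E_\<iota>: assumes "f \<in> carrier (group_algebra G)" shows "E (\<iota> f) = \<phi> f"
proof (rule Cq.group_algebra_map_unique[where G = G and u = v and \<phi> = "\<lambda>f. E (\<iota> f)", OF v_closed assms])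
  show "E (\<iota> (f \<oplus>\<^bsub>group_algebra G\<^esub> h)) = E (\<iota> f) \<oplus>\<^bsub>cstar_completion F q\<^esub> E (\<iota> h)"
    if "f \<in> carrier (group_algebra G)" "h \<in> carrier (group_algebra G)" for f h
    using that star_hom_add[OF Fq.star_hom_embed] \<iota>_closed
    by (simp add: F.group_algebra_map_add[where G = G and u = gen, OF gen_closed])
  show "E (\<iota> (c \<odot>\<^bsub>group_algebra G\<^esub> f)) = c \<odot>\<^bsub>cstar_completion F q\<^esub> E (\<iota> f)"
    if "f \<in> carrier (group_algebra G)" for f c
    using that star_hom_smult[OF Fq.star_hom_embed] \<iota>_closed
    by (simp add: F.group_algebra_map_smult[OF is_group gen_closed])
  show "E (\<iota> (point_mass g)) = v g" if "g \<in> carrier G" for g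
    using that by (simp add: F.group_algebra_map_point_mass[where G = G and u = gen, OF gen_closed] v_def)
qed (use \<iota>_closed in auto)

lemma nrm_\<phi>: "f \<in> carrier (group_algebra G) \<Longrightarrow> nrm (cstar_completion F q) (\<phi> f) = q (\<iota> f)"
  using Fq.nrm_embed[OF \<iota>_closed] E_\<iota> by simp

end

section \<open>Finiteness and maximality of the universal seminorm\<close>

context cp_group
begin

text \<open>Keeps the set under the supremum nonempty; a supremum over the empty set of reals has no
  useful value.\<close>

lemma cp_admissible_zero: "cp_admissible G act (\<lambda>_. 0)"
  by (simp add: cp_admissible_def cstar_seminorm_def split_beta)

lemma cp_seminorm_SUP: "cp_seminorm G act a = (SUP q\<in>Collect (cp_admissible G act). q a)"
  unfolding cp_seminorm_def universal_seminorm_def cp_admissible_def by simp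

text \<open>Induction on the support: every word contributes at most the modulus of its
  coefficient.\<close>

lemma cp_admissible_bounded:
  assumes "a \<in> carrier F" shows "bdd_above ((\<lambda>q. q a) ` Collect (cp_admissible G act))"
proof -
  have "\<exists>B. \<forall>q. cp_admissible G act q \<longrightarrow> q a \<le> B"
    using assms unfolding cp_free_algebra_eq free_star_algebra_def
  proof (induction a rule: monoid_star_algebra_induct)
    case zero
    have "q (\<lambda>m. 0) \<le> 0" if "cp_admissible G act q" for q
    proof -
      interpret cp_seminorm_on G act q by unfold_locales (rule that)
      have "\<zero>\<^bsub>F\<^esub> = (\<lambda>m. 0)" by (simp add: cp_free_algebra_eq free_star_algebra_simps)
      then show ?thesis using Fq.p_zero by simp
    qed
    then show ?case by blast
  next
    case (add f c m)
    then obtain B where B: "\<And>q. cp_admissible G act q \<Longrightarrow> q f \<le> B" by blast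
    have f: "f \<in> carrier F" and m: "m \<in> lists (cp_gens G \<times> UNIV)"
      using add.hyps by (simp_all add: cp_free_algebra_eq free_star_algebra_def)
    have pm: "point_mass m \<in> carrier F"
      using m unfolding cp_free_algebra_eq free_star_algebra_def by (intro point_mass_closed) simp
    have "q (c \<odot>\<^bsub>F\<^esub> point_mass m \<oplus>\<^bsub>F\<^esub> f) \<le> cmod c * 1 + B" if q: "cp_admissible G act q" for q
    proof -
      interpret cp_seminorm_on G act q by unfold_locales (rule q)
      have "q (c \<odot>\<^bsub>F\<^esub> point_mass m \<oplus>\<^bsub>F\<^esub> f) \<le> cmod c * q (point_mass m) + q f"
        using Fq.p_add[of "c \<odot>\<^bsub>F\<^esub> point_mass m" f] Fq.p_smult[OF pm, of c] f pm by simp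
      also have "\<dots> \<le> cmod c * 1 + B"
        using B[OF q] q_word_le[OF m] by (intro add_mono mult_left_mono) auto
      finally show ?thesis .
    qed
    then show ?case unfolding cp_free_algebra_eq free_star_algebra_def by blast
  qed
  then obtain B where "\<And>q. cp_admissible G act q \<Longrightarrow> q a \<le> B" by blast
  then show ?thesis by (intro bdd_aboveI2[of _ _ B]) simp
qed

lemma cp_seminorm_ge: "cp_admissible G act q \<Longrightarrow> a \<in> carrier F \<Longrightarrow> q a \<le> cp_seminorm G act a"
  unfolding cp_seminorm_SUP by (intro cSUP_upper cp_admissible_bounded) simp_all

lemma cp_admissible_cp_seminorm: "cp_admissible G act (cp_seminorm G act)"
proof -
  have ne: "Collect (cp_admissible G act) \<noteq> {}" using cp_admissible_zero by blast
  have "cstar_seminorm F (cp_seminorm G act)"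
    using cstar_seminorm_SUP[OF F.star_algebra_axioms ne _ cp_admissible_bounded]
    unfolding cp_seminorm_SUP[abs_def] by (simp add: cp_admissible_def)
  moreover have "cp_seminorm G act (l \<ominus>\<^bsub>F\<^esub> r) = 0" if "(l, r) \<in> cp_relations G act" for l r
  proof -
    have "cp_seminorm G act (l \<ominus>\<^bsub>F\<^esub> r) = (SUP q\<in>Collect (cp_admissible G act). 0)"
      unfolding cp_seminorm_SUP using that by (intro SUP_cong refl) (auto simp: cp_admissible_def)
    also have "\<dots> = 0" by (rule cSUP_const[OF ne])
    finally show ?thesis .
  qed
  ultimately show ?thesis by (auto simp: cp_admissible_def)
qed

end

section \<open>Closures in homomorphic images of the Cuntz-Pimsner algebra\<close>

lemma star_hom_inv_into:
  assumes A: "star_algebra A" and f: "cstar_iso A B f"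
  shows "star_hom B A (inv_into (carrier A) f)"
proof -
  interpret A: star_algebra A by (rule A)
  have hom: "star_hom A B f" and bij: "bij_betw f (carrier A) (carrier B)"
    using f by (auto simp: cstar_iso_def)
  let ?g = "inv_into (carrier A) f"
  have g: "?g b \<in> carrier A" "f (?g b) = b" if "b \<in> carrier B" for b
    using that bij by (auto simp: bij_betw_def inv_into_into f_inv_into_f)
  have gf: "?g (f a) = a" if "a \<in> carrier A" for a
    using that bij by (simp add: bij_betw_def)
  show ?thesis
  proof (rule star_homI)
    show "?g \<one>\<^bsub>B\<^esub> = \<one>\<^bsub>A\<^esub>" using gf[of "\<one>\<^bsub>A\<^esub>"] star_hom_one[OF hom] by (simp add: A.ring_rules)
    fix a assume a: "a \<in> carrier B"
    show "?g a \<in> carrier A" by (rule g[OF a])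
    show "?g (c \<odot>\<^bsub>B\<^esub> a) = c \<odot>\<^bsub>A\<^esub> ?g a" for c
      using gf[of "c \<odot>\<^bsub>A\<^esub> ?g a"] g[OF a] star_hom_smult[OF hom, of "?g a" c] by simp
    show "?g (star B a) = star A (?g a)"
      using gf[of "star A (?g a)"] g[OF a] star_hom_star[OF hom, of "?g a"] A.star_closed by simp
    fix b assume b: "b \<in> carrier B"
    show "?g (a \<oplus>\<^bsub>B\<^esub> b) = ?g a \<oplus>\<^bsub>A\<^esub> ?g b"
      using gf[of "?g a \<oplus>\<^bsub>A\<^esub> ?g b"] g[OF a] g[OF b] star_hom_add[OF hom, of "?g a" "?g b"] by (simp add: A.ring_rules(1))
    show "?g (a \<otimes>\<^bsub>B\<^esub> b) = ?g a \<otimes>\<^bsub>A\<^esub> ?g b"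
      using gf[of "?g a \<otimes>\<^bsub>A\<^esub> ?g b"] g[OF a] g[OF b] star_hom_mult[OF hom, of "?g a" "?g b"] by (simp add: A.ring_rules(5))
  qed
qed

context cp_group
begin

lemma cuntz_pimsner_eq: "cuntz_pimsner G act = cstar_completion F (cp_seminorm G act)"
  by (simp add: cuntz_pimsner_def)

text \<open>The norm of \<open>B\<close> is pulled back along the free *-algebra, O_G and
  \<open>B\<close>. The value at the unit is nonzero because \<open>1 \<noteq> 0\<close> in
  \<open>B\<close>. On the group algebra it is \<open>p\<close>, since the isometry \<Phi> and \<pi>
  agree on group elements and hence on all linear combinations.\<close>

lemma cp_extends_of_closure:
  assumes p: "cstar_seminorm (group_algebra G) p"
    and closure: "closure_in_cuntz_pimsner_image TYPE('b) G act p"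
  shows "\<exists>q. cp_extends G act p q"
proof -
  interpret U: cp_seminorm_on G act "cp_seminorm G act"
    by unfold_locales (rule cp_admissible_cp_seminorm)
  interpret p: seminormed_star_algebra "group_algebra G" p by unfold_locales (rule p)
  obtain B :: "'b cstar_alg" and \<pi> \<Phi> where B: "unital_cstar_algebra B" "\<one>\<^bsub>B\<^esub> \<noteq> \<zero>\<^bsub>B\<^esub>"
    and \<pi>: "star_hom (cuntz_pimsner G act) B \<pi>"
    and \<Phi>: "cstar_iso (group_completion G p) (B\<lparr>carrier := norm_closure B
         (group_algebra_map B (\<lambda>g. \<pi> (cp_unitary G act g)) ` carrier (group_algebra G))\<rparr>) \<Phi>"
      "\<And>g. g \<in> carrier G \<Longrightarrow> \<Phi> (completion_unitary G p g) = \<pi> (cp_unitary G act g)"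
    using closure unfolding closure_in_cuntz_pimsner_image_def same_completion_def by blast
  interpret B: unital_cstar_algebra B by (rule B)
  interpret B: seminormed_star_algebra B "nrm B" by (rule B.seminormed)
  let ?w = "\<lambda>g. \<pi> (cp_unitary G act g)"
  define q where "q = (\<lambda>a. nrm B (\<pi> (U.E a)))"
  have hom: "star_hom F B (\<lambda>a. \<pi> (U.E a))"
    using star_hom_compose[OF U.Fq.star_hom_embed] \<pi> unfolding cuntz_pimsner_eq by blast
  have "cstar_seminorm F q"
    unfolding q_def by (rule cstar_seminorm_pullback[OF hom B.seminorm F.star_closed])
  have rel: "q (a \<ominus>\<^bsub>F\<^esub> b) = 0" if "a \<in> carrier F" "b \<in> carrier F" "cp_seminorm G act (a \<ominus>\<^bsub>F\<^esub> b) = 0" for a b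
    using U.E_eq[OF that] that star_hom_diff[OF F.star_algebra_axioms B.star_algebra_axioms hom] star_hom_closed[OF hom]
    by (simp add: q_def B.diff_self)
  have "cp_admissible G act q"
    using \<open>cstar_seminorm F q\<close> cp_admissible_relations[OF cp_admissible_cp_seminorm] letter_sum_closed
    by (intro cp_admissibleI rel) (auto simp: F.star_closed F.ring_rules(5,6))
  moreover have "q \<one>\<^bsub>F\<^esub> \<noteq> 0"
    using B.nrm_definite[of "\<one>\<^bsub>B\<^esub>"] B(2) star_hom_one[OF hom] by (auto simp: q_def B.ring_rules)
  moreover have "q (\<iota> f) = p f" if f: "f \<in> carrier (group_algebra G)" for f
  proof -
    have w: "?w g \<in> carrier B" if "g \<in> carrier G" for g
      using star_hom_closed[OF hom gen_closed[OF that]] by (simp add: cp_unitary_def)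
    have hom\<Phi>: "star_hom (group_completion G p) (B\<lparr>carrier := norm_closure B
         (group_algebra_map B ?w ` carrier (group_algebra G))\<rparr>) \<Phi>"
      and nrm\<Phi>: "\<And>P. P \<in> carrier (group_completion G p) \<Longrightarrow> nrm B (\<Phi> P) = nrm (group_completion G p) P"
      using \<Phi>(1) by (auto simp: cstar_iso_def)
    let ?e = "completion_embed (group_algebra G) p"
    have hom_e: "star_hom (group_algebra G) (B\<lparr>carrier := norm_closure B
         (group_algebra_map B ?w ` carrier (group_algebra G))\<rparr>) (\<lambda>f. \<Phi> (?e f))"
      using star_hom_compose[OF p.star_hom_embed] hom\<Phi> unfolding group_completion_def by blast
    have 1: "\<Phi> (?e f) = group_algebra_map B ?w f"
    proof (rule B.group_algebra_map_unique[where G = G and u = ?w and \<phi> = "\<lambda>f. \<Phi> (?e f)", OF w f])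
      show "\<Phi> (?e f) \<in> carrier B" if "f \<in> carrier (group_algebra G)" for f
        using star_hom_closed[OF hom_e that] by (simp add: norm_closure_def)
    qed (use star_hom_add[OF hom_e] star_hom_smult[OF hom_e] \<Phi>(2) in
        \<open>simp_all add: completion_unitary_def\<close>)
    have 2: "\<pi> (U.E (\<iota> f)) = group_algebra_map B ?w f"
    proof (rule B.group_algebra_map_unique[where G = G and u = ?w and \<phi> = "\<lambda>f. \<pi> (U.E (\<iota> f))", OF w f])
      show "\<pi> (U.E (\<iota> f)) \<in> carrier B" if "f \<in> carrier (group_algebra G)" for f
        using star_hom_closed[OF hom U.\<iota>_closed[OF that]] .
      show "\<pi> (U.E (\<iota> (f \<oplus>\<^bsub>group_algebra G\<^esub> h))) = \<pi> (U.E (\<iota> f)) \<oplus>\<^bsub>B\<^esub> \<pi> (U.E (\<iota> h))"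
        if "f \<in> carrier (group_algebra G)" "h \<in> carrier (group_algebra G)" for f h
        using that star_hom_add[OF hom U.\<iota>_closed U.\<iota>_closed]
        by (simp add: F.group_algebra_map_add[where G = G and u = gen, OF gen_closed])
      show "\<pi> (U.E (\<iota> (c \<odot>\<^bsub>group_algebra G\<^esub> f))) = c \<odot>\<^bsub>B\<^esub> \<pi> (U.E (\<iota> f))"
        if "f \<in> carrier (group_algebra G)" for f c
        using that star_hom_smult[OF hom U.\<iota>_closed]
        by (simp add: F.group_algebra_map_smult[OF is_group gen_closed])
      show "\<pi> (U.E (\<iota> (point_mass g))) = ?w g" if "g \<in> carrier G" for g
        using that by (simp add: F.group_algebra_map_point_mass[where G = G and u = gen, OF gen_closed] cp_unitary_def)
    qed
    have "p f = nrm (group_completion G p) (?e f)"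
      using p.nrm_embed[OF f] by (simp add: group_completion_def)
    also have "\<dots> = nrm B (\<Phi> (?e f))"
      using nrm\<Phi>[of "?e f"] f by (simp add: group_completion_def)
    also have "\<dots> = q (\<iota> f)" by (simp add: 1 2 q_def)
    finally show ?thesis by simp
  qed
  ultimately show ?thesis unfolding cp_extends_def by blast
qed

end

text \<open>The converse direction starts from \<open>q\<close> alone: the homomorphic image is the
  completion for \<open>q\<close>, and the Hilbert space is built from states for
  \<open>q\<close>.\<close>

locale cp_extension = cp_seminorm_on G act q for G :: "('g, 'm) monoid_scheme" (structure)
    and act :: "'g \<Rightarrow> 'x::finite list \<Rightarrow> 'x list" and q +
  fixes p :: "('g \<Rightarrow> complex) \<Rightarrow> real"
  assumes p: "cstar_seminorm (group_algebra G) p"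
    and q_one: "q \<one>\<^bsub>cp_free_algebra G\<^esub> \<noteq> 0"
    and q_\<iota>: "\<And>f. f \<in> carrier (group_algebra G) \<Longrightarrow>
      q (group_algebra_map (cp_free_algebra G) (\<lambda>g. free_gen (Group_Gen g)) f) = p f"
begin

sublocale U: cp_seminorm_on G act "cp_seminorm G act"
  by unfold_locales (rule cp_admissible_cp_seminorm)

sublocale p: seminormed_star_algebra "group_algebra G" p
  by unfold_locales (rule p)

abbreviation Cq where "Cq \<equiv> cstar_completion F q"
abbreviation O\<^sub>G where "O\<^sub>G \<equiv> cstar_completion F (cp_seminorm G act)"

definition \<pi> :: "('g, 'x) cp_elem \<Rightarrow> ('g, 'x) cp_elem" where
  "\<pi> P = completion_class F q (class_rep P)"

lemma star_hom_\<pi>: "star_hom O\<^sub>G Cq \<pi>"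
  and \<pi>_class: "U.Fq.cauchy s \<Longrightarrow> Fq.cauchy s \<and> \<pi> (U.Fq.cls s) = Fq.cls s"
  using completion_map[OF F.star_algebra_axioms U.Fq.seminorm Fq.seminorm cp_seminorm_ge[OF admissible]]
  unfolding \<pi>_def by blast+

lemma \<pi>_embed: "a \<in> carrier F \<Longrightarrow> \<pi> (U.E a) = E a"
  using \<pi>_class[OF U.Fq.cauchy_const] by (simp add: U.Fq.embed_cauchy Fq.embed_cauchy)

lemma \<pi>_unitary: "g \<in> carrier G \<Longrightarrow> \<pi> (cp_unitary G act g) = v g"
  by (simp add: cp_unitary_def \<pi>_embed v_def)

lemma \<pi>_contractive: assumes "P \<in> carrier O\<^sub>G" shows "nrm Cq (\<pi> P) \<le> nrm O\<^sub>G P"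
proof -
  obtain s where s: "U.Fq.cauchy s" "P = U.Fq.cls s" using assms by (rule U.Fq.completionE)
  show ?thesis
    unfolding s(2) using \<pi>_class[OF s(1)] s(1) cp_seminorm_ge[OF admissible]
    by (auto intro!: LIMSEQ_le[OF Fq.completion_nrm U.Fq.completion_nrm])
qed

text \<open>The lifting theorem in terms of classes, from the seminorm \<open>q\<close> to the
  universal one.\<close>

lemma lift:
  assumes "D \<subseteq> carrier F" "\<one>\<^bsub>F\<^esub> \<in> D" "\<And>a b. a \<in> D \<Longrightarrow> b \<in> D \<Longrightarrow> a \<oplus>\<^bsub>F\<^esub> b \<in> D"
      "\<And>a b. a \<in> D \<Longrightarrow> b \<in> D \<Longrightarrow> a \<otimes>\<^bsub>F\<^esub> b \<in> D" "\<And>a c. a \<in> D \<Longrightarrow> c \<odot>\<^bsub>F\<^esub> a \<in> D"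
      "\<And>a. a \<in> D \<Longrightarrow> star F a \<in> D"
    and s: "Fq.cauchy s" "\<And>n. s n \<in> D"
  obtains t where "U.Fq.cauchy t" "\<And>n. t n \<in> D" "\<pi> (U.Fq.cls t) = Fq.cls s"
proof -
  obtain t where t: "U.Fq.cauchy t" "\<And>n. t n \<in> D" "(\<lambda>n. q (s n \<ominus>\<^bsub>F\<^esub> t n)) \<longlonglongrightarrow> 0"
    using lift_cauchy_seq[where S = "cp_gens G", folded cp_free_algebra_eq,
        OF U.Fq.seminorm Fq.seminorm cp_seminorm_ge[OF admissible] assms] by blast
  have "\<pi> (U.Fq.cls t) = Fq.cls s"
    using \<pi>_class[OF t(1)] s(1) t(3) by (simp add: Fq.class_eq_iff Fq.null_sym)
  with t(1,2) show ?thesis using that by blast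
qed

text \<open>Here \<open>D\<close> is the whole free *-algebra. Without lifting, only the density of
  the range would be clear.\<close>

lemma \<pi>_surj: "\<pi> ` carrier O\<^sub>G = carrier Cq"
proof
  show "\<pi> ` carrier O\<^sub>G \<subseteq> carrier Cq" using star_hom_closed[OF star_hom_\<pi>] by blast
  show "carrier Cq \<subseteq> \<pi> ` carrier O\<^sub>G"
  proof
    fix P assume "P \<in> carrier Cq"
    then obtain s where s: "Fq.cauchy s" "P = Fq.cls s" by (rule Fq.completionE)
    obtain t where "U.Fq.cauchy t" "\<pi> (U.Fq.cls t) = Fq.cls s"
      by (rule lift[of "carrier F" s]) (use s in \<open>auto simp: F.ring_rules(1,5,6) F.star_closed\<close>)
    then show "P \<in> \<pi> ` carrier O\<^sub>G" using s by (intro image_eqI[of _ _ "U.Fq.cls t"]) auto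
  qed
qed

definition K where "K = norm_closure Cq (\<phi> ` carrier (group_algebra G))"

text \<open>The last conjunct records \<Phi> on limits; surjectivity from A_max is proved by
  comparing limits of one sequence.\<close>

definition extends_\<phi> :: "((nat \<Rightarrow> 'g \<Rightarrow> complex) set \<Rightarrow> ('g, 'x) cp_elem) \<Rightarrow> bool" where
  "extends_\<phi> \<Phi> \<longleftrightarrow> cstar_iso (group_completion G p) (Cq\<lparr>carrier := K\<rparr>) \<Phi> \<and>
     (\<forall>g\<in>carrier G. \<Phi> (completion_unitary G p g) = v g) \<and>
     (\<forall>s. p.cauchy s \<longrightarrow> Cq.converges (\<lambda>n. \<phi> (s n)) (\<Phi> (p.cls s)))"

lemma isomorphism: "\<exists>\<Phi>. extends_\<phi> \<Phi>"
proof (rule isometric_extension[OF CG.star_algebra_axioms p Cq.unital_cstar_algebra_axioms star_hom_\<phi>])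
  show "nrm Cq (\<phi> a) = p a" if "a \<in> carrier (group_algebra G)" for a
    using that by (simp add: nrm_\<phi> q_\<iota>)
  fix \<Phi>
  assume \<Phi>: "cstar_iso p.C (Cq\<lparr>carrier := norm_closure Cq (\<phi> ` carrier (group_algebra G))\<rparr>) \<Phi>"
    "\<And>a. a \<in> carrier (group_algebra G) \<Longrightarrow> \<Phi> (completion_embed (group_algebra G) p a) = \<phi> a"
    "\<And>s. p.cauchy s \<Longrightarrow> Cq.converges (\<lambda>n. \<phi> (s n)) (\<Phi> (p.cls s))"
  have "\<Phi> (completion_unitary G p g) = v g" if "g \<in> carrier G" for g
    using \<Phi>(2)[OF group_algebra_point_mass(1)[OF is_group that]] that
    by (simp add: completion_unitary_def Cq.group_algebra_map_point_mass[where G = G and u = v, OF v_closed])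
  with \<Phi>(1,3) have "extends_\<phi> \<Phi>" unfolding extends_\<phi>_def group_completion_def K_def by simp
  then show "\<exists>\<Phi>. extends_\<phi> \<Phi>" by (intro exI[of extends_\<phi> \<Phi>])
qed

theorem closure_in_image: "closure_in_cuntz_pimsner_image TYPE(('g, 'x) cp_elem) G act p"
proof -
  have "nrm Cq \<one>\<^bsub>Cq\<^esub> \<noteq> 0"
    using Fq.nrm_embed[of "\<one>\<^bsub>F\<^esub>"] q_one star_hom_one[OF Fq.star_hom_embed] by (simp add: F.ring_rules)
  then have one: "\<one>\<^bsub>Cq\<^esub> \<noteq> \<zero>\<^bsub>Cq\<^esub>" by auto
  have image: "group_algebra_map Cq (\<lambda>g. \<pi> (cp_unitary G act g)) ` carrier (group_algebra G)
      = \<phi> ` carrier (group_algebra G)"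
    by (intro image_cong refl Cq.group_algebra_map_cong[where G = G, OF v_closed] \<pi>_unitary)
  obtain \<Phi> where "extends_\<phi> \<Phi>"
    using isomorphism by blast
  then have \<Phi>: "cstar_iso (group_completion G p) (Cq\<lparr>carrier := K\<rparr>) \<Phi>"
    "\<And>g. g \<in> carrier G \<Longrightarrow> \<Phi> (completion_unitary G p g) = v g"
    unfolding extends_\<phi>_def by simp_all
  then have "same_completion G (group_completion G p) (completion_unitary G p)
      (Cq\<lparr>carrier := norm_closure Cq (group_algebra_map Cq (\<lambda>g. \<pi> (cp_unitary G act g)) ` carrier (group_algebra G))\<rparr>)
      (\<lambda>g. \<pi> (cp_unitary G act g))"
    unfolding same_completion_def image K_def[symmetric] using \<pi>_unitary by auto
  then show ?thesis
    unfolding closure_in_cuntz_pimsner_image_def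
    using Cq.unital_cstar_algebra_axioms one star_hom_\<pi> \<pi>_surj
    unfolding cuntz_pimsner_eq[symmetric] by blast
qed

text \<open>The map is \<pi>, restricted to A_max, followed by the inverse of the isomorphism of the
  group completion with \<open>K\<close>. That it is onto requires lifts inside A_max and not merely
  in O_G.\<close>

theorem A_max_image: "image_of_A_max G act p"
proof -
  obtain \<Phi> where "extends_\<phi> \<Phi>"
    using isomorphism by blast
  then have \<Phi>: "cstar_iso (group_completion G p) (Cq\<lparr>carrier := K\<rparr>) \<Phi>"
    "\<And>g. g \<in> carrier G \<Longrightarrow> \<Phi> (completion_unitary G p g) = v g"
    "\<And>s. p.cauchy s \<Longrightarrow> Cq.converges (\<lambda>n. \<phi> (s n)) (\<Phi> (p.cls s))"
    unfolding extends_\<phi>_def by simp_all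
  have hom\<Phi>: "star_hom p.C (Cq\<lparr>carrier := K\<rparr>) \<Phi>" and bij\<Phi>: "bij_betw \<Phi> (carrier p.C) K"
    using \<Phi>(1) by (auto simp: cstar_iso_def group_completion_def)
  interpret pC: star_algebra p.C by (rule p.star_algebra_completion)
  have K_sub: "K \<subseteq> carrier Cq" by (auto simp: K_def norm_closure_def)
  have K_eq: "K = \<Phi> ` carrier p.C" using bij\<Phi> by (simp add: bij_betw_def)
  have K_ops: "\<zero>\<^bsub>Cq\<^esub> \<in> K" "\<And>a b. a \<in> K \<Longrightarrow> b \<in> K \<Longrightarrow> a \<oplus>\<^bsub>Cq\<^esub> b \<in> K"
    "\<And>a b. a \<in> K \<Longrightarrow> b \<in> K \<Longrightarrow> a \<otimes>\<^bsub>Cq\<^esub> b \<in> K"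
    "\<And>a c. a \<in> K \<Longrightarrow> c \<odot>\<^bsub>Cq\<^esub> a \<in> K" "\<And>a. a \<in> K \<Longrightarrow> star Cq a \<in> K"
  proof -
    show add: "\<And>a b. a \<in> K \<Longrightarrow> b \<in> K \<Longrightarrow> a \<oplus>\<^bsub>Cq\<^esub> b \<in> K"
      unfolding K_eq using star_hom_add[OF hom\<Phi>] pC.ring_rules(1) by (auto intro!: image_eqI)
    show "\<And>a b. a \<in> K \<Longrightarrow> b \<in> K \<Longrightarrow> a \<otimes>\<^bsub>Cq\<^esub> b \<in> K"
      unfolding K_eq using star_hom_mult[OF hom\<Phi>] pC.ring_rules(5) by (auto intro!: image_eqI)
    show smult: "\<And>a c. a \<in> K \<Longrightarrow> c \<odot>\<^bsub>Cq\<^esub> a \<in> K"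
      unfolding K_eq using star_hom_smult[OF hom\<Phi>] by (auto intro!: image_eqI)
    show "\<And>a. a \<in> K \<Longrightarrow> star Cq a \<in> K"
      unfolding K_eq using star_hom_star[OF hom\<Phi>] pC.star_closed by (auto intro!: image_eqI)
    have "\<Phi> \<one>\<^bsub>p.C\<^esub> \<in> K" unfolding K_eq by (simp add: pC.ring_rules)
    from smult[OF this, of 0] show "\<zero>\<^bsub>Cq\<^esub> \<in> K"
      using K_sub \<open>\<Phi> \<one>\<^bsub>p.C\<^esub> \<in> K\<close> Cq.smult_l_null[of "\<Phi> \<one>\<^bsub>p.C\<^esub>"] by auto
  qed
  have K_closed: "b \<in> K" if b: "b \<in> carrier Cq" and near: "\<And>e. 0 < e \<Longrightarrow> \<exists>k\<in>K. nrm Cq (b \<ominus>\<^bsub>Cq\<^esub> k) < e" for b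
    unfolding K_def norm_closure_def
  proof (intro CollectI conjI allI impI b)
    fix e :: real assume "0 < e"
    then obtain k where k: "k \<in> K" "nrm Cq (b \<ominus>\<^bsub>Cq\<^esub> k) < e / 2" using near[of "e / 2"] by auto
    have "\<forall>e>0. \<exists>s\<in>\<phi> ` carrier (group_algebra G). nrm Cq (k \<ominus>\<^bsub>Cq\<^esub> s) < e"
      using k(1) unfolding K_def norm_closure_def by simp
    with half_gt_zero[OF \<open>0 < e\<close>]
    obtain s where s: "s \<in> \<phi> ` carrier (group_algebra G)" "nrm Cq (k \<ominus>\<^bsub>Cq\<^esub> s) < e / 2"
      by blast
    have "nrm Cq (b \<ominus>\<^bsub>Cq\<^esub> s) \<le> nrm Cq (b \<ominus>\<^bsub>Cq\<^esub> k) + nrm Cq (k \<ominus>\<^bsub>Cq\<^esub> s)"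
      using b k K_sub s star_hom_closed[OF star_hom_\<phi>] by (intro Cq.p_triangle) auto
    then show "\<exists>s\<in>\<phi> ` carrier (group_algebra G). nrm Cq (b \<ominus>\<^bsub>Cq\<^esub> s) < e"
      using k s by (intro bexI[of _ s]) auto
  qed
  define A where "A = cstar_generated O\<^sub>G (cp_unitary G act ` carrier G)"
  \<comment> \<open>The preimage of \<open>K\<close> under \<pi> is a C*-subalgebra containing the
    unitaries, so it contains everything they generate.\<close>
  define Y where "Y = {P \<in> carrier O\<^sub>G. \<pi> P \<in> K}"
  have cpu: "cp_unitary G act g = U.v g" for g by (simp add: cp_unitary_def U.v_def)
  have v_K: "v g \<in> K" if "g \<in> carrier G" for g
    using \<Phi>(2)[OF that] that group_algebra_point_mass(1)[OF is_group that]
    unfolding K_eq by (intro image_eqI[of _ _ "completion_unitary G p g"]) (simp_all add: completion_unitary_def)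
  have \<pi>_diff: "\<pi> (P \<ominus>\<^bsub>O\<^sub>G\<^esub> Q) = \<pi> P \<ominus>\<^bsub>Cq\<^esub> \<pi> Q" if "P \<in> carrier O\<^sub>G" "Q \<in> carrier O\<^sub>G" for P Q
    using star_hom_diff[OF U.Cq.star_algebra_axioms Cq.star_algebra_axioms star_hom_\<pi> that] .
  have "cstar_subalgebra Y O\<^sub>G"
    unfolding cstar_subalgebra_def
  proof (intro conjI ballI allI)
    show "Y \<subseteq> carrier O\<^sub>G" by (auto simp: Y_def)
    have "\<pi> (0 \<odot>\<^bsub>O\<^sub>G\<^esub> \<zero>\<^bsub>O\<^sub>G\<^esub>) = 0 \<odot>\<^bsub>Cq\<^esub> \<pi> \<zero>\<^bsub>O\<^sub>G\<^esub>"
      by (rule star_hom_smult[OF star_hom_\<pi>]) (simp add: U.Cq.ring_rules)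
    then have "\<pi> \<zero>\<^bsub>O\<^sub>G\<^esub> = \<zero>\<^bsub>Cq\<^esub>"
      using U.Cq.smult_l_null[of "\<zero>\<^bsub>O\<^sub>G\<^esub>"] Cq.smult_l_null[of "\<pi> \<zero>\<^bsub>O\<^sub>G\<^esub>"] star_hom_closed[OF star_hom_\<pi>, of "\<zero>\<^bsub>O\<^sub>G\<^esub>"]
      by (simp add: U.Cq.ring_rules)
    then show "\<zero>\<^bsub>O\<^sub>G\<^esub> \<in> Y" using K_ops(1) by (simp add: Y_def U.Cq.ring_rules)
    fix P assume P: "P \<in> Y"
    show "star O\<^sub>G P \<in> Y" "c \<odot>\<^bsub>O\<^sub>G\<^esub> P \<in> Y" for c
      using P K_ops U.Cq.star_closed by (simp_all add: Y_def star_hom_star[OF star_hom_\<pi>] star_hom_smult[OF star_hom_\<pi>])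
    fix Q assume Q: "Q \<in> Y"
    show "P \<oplus>\<^bsub>O\<^sub>G\<^esub> Q \<in> Y" "P \<otimes>\<^bsub>O\<^sub>G\<^esub> Q \<in> Y"
      using P Q K_ops by (simp_all add: Y_def star_hom_add[OF star_hom_\<pi>] star_hom_mult[OF star_hom_\<pi>] U.Cq.ring_rules(1,5))
  next
    show "norm_closure O\<^sub>G Y \<subseteq> Y"
    proof
      fix P assume P: "P \<in> norm_closure O\<^sub>G Y"
      then have Pc: "P \<in> carrier O\<^sub>G" by (simp add: norm_closure_def)
      have "\<pi> P \<in> K"
      proof (rule K_closed)
        show "\<pi> P \<in> carrier Cq" by (rule star_hom_closed[OF star_hom_\<pi> Pc])
        fix e :: real assume "0 < e"
        then obtain Q where Q: "Q \<in> Y" "nrm O\<^sub>G (P \<ominus>\<^bsub>O\<^sub>G\<^esub> Q) < e" using P unfolding norm_closure_def by blast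
        have "nrm Cq (\<pi> P \<ominus>\<^bsub>Cq\<^esub> \<pi> Q) \<le> nrm O\<^sub>G (P \<ominus>\<^bsub>O\<^sub>G\<^esub> Q)"
          using \<pi>_contractive[of "P \<ominus>\<^bsub>O\<^sub>G\<^esub> Q"] \<pi>_diff[OF Pc, of Q] Pc Q(1) by (simp add: Y_def U.Cq.ring_rules(4))
        then show "\<exists>k\<in>K. nrm Cq (\<pi> P \<ominus>\<^bsub>Cq\<^esub> k) < e"
          using Q by (intro bexI[of _ "\<pi> Q"]) (auto simp: Y_def)
      qed
      then show "P \<in> Y" using Pc by (simp add: Y_def)
    qed
  qed
  moreover have "cp_unitary G act ` carrier G \<subseteq> Y"
    using v_K \<pi>_unitary U.v_closed by (auto simp: Y_def cpu)
  ultimately have "A \<subseteq> Y" unfolding A_def cstar_generated_def by blast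
  have "star_hom (O\<^sub>G\<lparr>carrier := A\<rparr>) (Cq\<lparr>carrier := K\<rparr>) \<pi>"
    using \<open>A \<subseteq> Y\<close> star_hom_add[OF star_hom_\<pi>] star_hom_mult[OF star_hom_\<pi>] star_hom_one[OF star_hom_\<pi>]
      star_hom_smult[OF star_hom_\<pi>] star_hom_star[OF star_hom_\<pi>]
    by (intro star_homI) (auto simp: Y_def subset_iff)
  note hom\<pi> = this
  let ?\<Psi> = "inv_into (carrier p.C) \<Phi>"
  have "star_hom (Cq\<lparr>carrier := K\<rparr>) p.C ?\<Psi>"
    using \<Phi>(1) unfolding group_completion_def by (rule star_hom_inv_into[OF pC.star_algebra_axioms])
  from star_hom_compose[OF hom\<pi> this]
  have hom\<theta>: "star_hom (A_max G act) (group_completion G p) (\<lambda>P. ?\<Psi> (\<pi> P))"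
    by (simp add: A_max_def cuntz_pimsner_eq A_def group_completion_def)
  moreover have "?\<Psi> (\<pi> (cp_unitary G act g)) = completion_unitary G p g" if "g \<in> carrier G" for g
  proof -
    have "completion_unitary G p g \<in> carrier p.C"
      using group_algebra_point_mass(1)[OF is_group that] by (simp add: completion_unitary_def)
    then show ?thesis
      using bij\<Phi> \<pi>_unitary[OF that] \<Phi>(2)[OF that] by (metis bij_betw_def inv_into_f_f)
  qed
  moreover have "Q \<in> (\<lambda>P. ?\<Psi> (\<pi> P)) ` A" if Q: "Q \<in> carrier p.C" for Q
  proof -
    obtain f where f: "p.cauchy f" "Q = p.cls f" using Q by (rule p.completionE)
    \<comment> \<open>The range of \<iota> would not do, as it is not closed under products in the
      free *-algebra: there \<open>gen g\<close> times \<open>gen h\<close> is a word of length two.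
      Its saturation modulo the universal seminorm is a *-subalgebra.\<close>
    define D where "D = {a \<in> carrier F. U.E a \<in> U.\<phi> ` carrier (group_algebra G)}"
    have \<iota>_D: "\<iota> h \<in> D" if "h \<in> carrier (group_algebra G)" for h
      using that U.E_\<iota> \<iota>_closed by (auto simp: D_def)
    have \<iota>_diff: "q (\<iota> (f m) \<ominus>\<^bsub>F\<^esub> \<iota> (f n)) = p (f m \<ominus>\<^bsub>group_algebra G\<^esub> f n)" for m n
    proof -
      have c: "f k \<in> carrier (group_algebra G)" for k using f(1) by simp
      have "q (\<iota> (f m) \<ominus>\<^bsub>F\<^esub> \<iota> (f n)) = nrm Cq (E (\<iota> (f m) \<ominus>\<^bsub>F\<^esub> \<iota> (f n)))"
        using c \<iota>_closed by (simp add: Fq.nrm_embed F.ring_rules(4))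
      also have "E (\<iota> (f m) \<ominus>\<^bsub>F\<^esub> \<iota> (f n)) = E (\<iota> (f m)) \<ominus>\<^bsub>Cq\<^esub> E (\<iota> (f n))"
        using c \<iota>_closed by (intro star_hom_diff[OF F.star_algebra_axioms Cq.star_algebra_axioms Fq.star_hom_embed]) auto
      also have "\<dots> = \<phi> (f m \<ominus>\<^bsub>group_algebra G\<^esub> f n)"
        using c star_hom_diff[OF CG.star_algebra_axioms Cq.star_algebra_axioms star_hom_\<phi>] by (simp add: E_\<iota>)
      finally show ?thesis using c nrm_\<phi> q_\<iota> by (simp add: CG.ring_rules(4))
    qed
    have s: "Fq.cauchy (\<lambda>n. \<iota> (f n))"
      using f(1) p.cauchyD[OF f(1)] \<iota>_closed by (simp add: cauchy_seq_def \<iota>_diff)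
    have "U.E \<one>\<^bsub>F\<^esub> \<in> U.\<phi> ` carrier (group_algebra G)"
      using star_hom_one[OF U.Fq.star_hom_embed] star_hom_one[OF U.star_hom_\<phi>] by (metis CG.ring_rules(6) image_eqI)
    then obtain t where t: "U.Fq.cauchy t" "\<And>n. t n \<in> D" "\<pi> (U.Fq.cls t) = Fq.cls (\<lambda>n. \<iota> (f n))"
    proof (rule_tac lift[of D "\<lambda>n. \<iota> (f n)"])
      show "D \<subseteq> carrier F" by (auto simp: D_def)
      show "U.E \<one>\<^bsub>F\<^esub> \<in> U.\<phi> ` carrier (group_algebra G) \<Longrightarrow> \<one>\<^bsub>F\<^esub> \<in> D" by (simp add: D_def F.ring_rules)
      show "a \<oplus>\<^bsub>F\<^esub> b \<in> D" "a \<otimes>\<^bsub>F\<^esub> b \<in> D" if "a \<in> D" "b \<in> D" for a b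
        using that CG.ring_rules(1,5)
        by (auto simp: D_def F.ring_rules(1,5) star_hom_add[OF U.Fq.star_hom_embed] star_hom_mult[OF U.Fq.star_hom_embed]
            simp flip: star_hom_add[OF U.star_hom_\<phi>] star_hom_mult[OF U.star_hom_\<phi>])
      show "c \<odot>\<^bsub>F\<^esub> a \<in> D" "star F a \<in> D" if "a \<in> D" for a c
        using that CG.star_closed
        by (auto simp: D_def F.star_closed star_hom_smult[OF U.Fq.star_hom_embed] star_hom_star[OF U.Fq.star_hom_embed]
            simp flip: star_hom_smult[OF U.star_hom_\<phi>] star_hom_star[OF U.star_hom_\<phi>])
    qed (use s \<iota>_D f(1) in auto)
    \<comment> \<open>Every term of \<open>t\<close> has its class in the image of the group
      algebra, which lies in each C*-subalgebra containing the unitaries; the class of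
      \<open>t\<close> is the limit of these classes.\<close>
    have "U.Fq.cls t \<in> A"
      unfolding A_def cstar_generated_def
    proof (intro InterI, clarify)
      fix Y assume Y: "cstar_subalgebra Y O\<^sub>G" and gens: "cp_unitary G act ` carrier G \<subseteq> Y"
      have image: "U.\<phi> h \<in> Y" if h: "h \<in> carrier (group_algebra G)" for h
        using is_group h
      proof (induction h rule: group_algebra_induct)
        case zero
        have "U.\<phi> (0 \<odot>\<^bsub>group_algebra G\<^esub> \<zero>\<^bsub>group_algebra G\<^esub>) = 0 \<odot>\<^bsub>O\<^sub>G\<^esub> U.\<phi> \<zero>\<^bsub>group_algebra G\<^esub>"
          by (rule star_hom_smult[OF U.star_hom_\<phi>]) (simp add: CG.ring_rules)
        then have "U.\<phi> \<zero>\<^bsub>group_algebra G\<^esub> = \<zero>\<^bsub>O\<^sub>G\<^esub>"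
          using CG.smult_l_null[of "\<zero>\<^bsub>group_algebra G\<^esub>"] U.Cq.smult_l_null[of "U.\<phi> \<zero>\<^bsub>group_algebra G\<^esub>"]
            star_hom_closed[OF U.star_hom_\<phi>, of "\<zero>\<^bsub>group_algebra G\<^esub>"] by (simp add: CG.ring_rules)
        then show ?case using Y by (simp add: cstar_subalgebra_def)
      next
        case (add h c g)
        have "U.\<phi> (c \<odot>\<^bsub>group_algebra G\<^esub> point_mass g \<oplus>\<^bsub>group_algebra G\<^esub> h) = c \<odot>\<^bsub>O\<^sub>G\<^esub> U.v g \<oplus>\<^bsub>O\<^sub>G\<^esub> U.\<phi> h"
          using add.hyps group_algebra_point_mass(1)[OF is_group add.hyps(2)]
          by (simp add: star_hom_add[OF U.star_hom_\<phi>] U.Cq.group_algebra_map_single[where G = G and u = U.v, OF U.v_closed])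
        moreover have "U.v g \<in> Y" using gens add.hyps cpu by auto
        ultimately show ?case using Y add.IH by (simp add: cstar_subalgebra_def)
      qed
      have "U.Fq.cls t \<in> norm_closure O\<^sub>G Y"
        unfolding norm_closure_def
      proof (intro CollectI conjI allI impI)
        show "U.Fq.cls t \<in> carrier O\<^sub>G" using t(1) by simp
        fix e :: real assume "0 < e"
        then obtain N where "\<forall>n\<ge>N. nrm O\<^sub>G (U.Fq.cls t \<ominus>\<^bsub>O\<^sub>G\<^esub> U.E (t n)) \<le> e / 2"
          using U.Fq.class_limit[OF t(1), of "e / 2"] by auto
        moreover have "U.E (t N) \<in> Y" using t(2)[of N] image by (auto simp: D_def)
        ultimately show "\<exists>s\<in>Y. nrm O\<^sub>G (U.Fq.cls t \<ominus>\<^bsub>O\<^sub>G\<^esub> s) < e"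
          using \<open>0 < e\<close> by (intro bexI[of _ "U.E (t N)"]) (auto dest!: spec[of _ N])
      qed
      then show "U.Fq.cls t \<in> Y" using Y by (auto simp: cstar_subalgebra_def)
    qed
    \<comment> \<open>Both sides are limits of \<open>\<phi> (f n)\<close>.\<close>
    moreover have "\<pi> (U.Fq.cls t) = \<Phi> Q"
    proof (rule Cq.norm_limit_unique)
      show "Cq.converges (\<lambda>n. \<phi> (f n)) (\<Phi> Q)" unfolding f(2) by (rule \<Phi>(3)[OF f(1)])
      show "Cq.converges (\<lambda>n. \<phi> (f n)) (\<pi> (U.Fq.cls t))"
        unfolding Cq.converges_def t(3)
      proof (intro conjI allI)
        show "\<phi> (f n) \<in> carrier Cq" for n using star_hom_closed[OF star_hom_\<phi>] f(1) by simp
        show "Fq.cls (\<lambda>n. \<iota> (f n)) \<in> carrier Cq" using s by simp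
        show "(\<lambda>n. nrm Cq (\<phi> (f n) \<ominus>\<^bsub>Cq\<^esub> Fq.cls (\<lambda>n. \<iota> (f n)))) \<longlonglongrightarrow> 0"
        proof (rule LIMSEQ_I)
          fix e :: real assume "0 < e"
          then obtain N where N: "\<forall>n\<ge>N. nrm Cq (Fq.cls (\<lambda>n. \<iota> (f n)) \<ominus>\<^bsub>Cq\<^esub> E (\<iota> (f n))) \<le> e / 2"
            using Fq.class_limit[OF s, of "e / 2"] by auto
          have "norm (nrm Cq (\<phi> (f n) \<ominus>\<^bsub>Cq\<^esub> Fq.cls (\<lambda>n. \<iota> (f n))) - 0) < e" if "n \<ge> N" for n
          proof -
            have c: "\<phi> (f n) \<in> carrier Cq" "Fq.cls (\<lambda>n. \<iota> (f n)) \<in> carrier Cq"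
              using star_hom_closed[OF star_hom_\<phi>] f(1) s by simp_all
            have "nrm Cq (\<phi> (f n) \<ominus>\<^bsub>Cq\<^esub> Fq.cls (\<lambda>n. \<iota> (f n))) \<le> e / 2"
              using N[rule_format, OF that] Cq.p_diff_commute[OF c] E_\<iota>[of "f n"] f(1) by simp
            then show ?thesis
              using \<open>0 < e\<close> Cq.p_nonneg[of "\<phi> (f n) \<ominus>\<^bsub>Cq\<^esub> Fq.cls (\<lambda>n. \<iota> (f n))"] c by (simp add: Cq.ring_rules(4))
          qed
          then show "\<exists>N. \<forall>n\<ge>N. norm (nrm Cq (\<phi> (f n) \<ominus>\<^bsub>Cq\<^esub> Fq.cls (\<lambda>n. \<iota> (f n))) - 0) < e" by blast
        qed
      qed
    qed
    moreover have "?\<Psi> (\<Phi> Q) = Q" using bij\<Phi> Q by (simp add: bij_betw_def)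
    ultimately show ?thesis by (intro image_eqI[of _ _ "U.Fq.cls t"]) simp_all
  qed
  then have "(\<lambda>P. ?\<Psi> (\<pi> P)) ` carrier (A_max G act) = carrier (group_completion G p)"
    using star_hom_closed[OF hom\<theta>] by (auto simp: A_max_def cuntz_pimsner_eq A_def group_completion_def)
  ultimately show ?thesis unfolding image_of_A_max_def by blast
qed

end

section \<open>Hilbert space completion of a semi-inner product space\<close>

text \<open>
  The injection \<open>J\<close> moves the elements of the completion, chosen representatives of classes of
  Cauchy sequences, into a prescribed type.
\<close>

locale semi_inner_space =
  fixes sc :: "complex \<Rightarrow> 'v \<Rightarrow> 'v::ab_group_add" and B :: "'v \<Rightarrow> 'v \<Rightarrow> complex"
    and J :: "(nat \<Rightarrow> 'v) \<Rightarrow> 'h"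
  assumes sc_add_left: "sc (a + b) v = sc a v + sc b v"
    and sc_add: "sc a (v + w) = sc a v + sc a w"
    and sc_sc: "sc a (sc b v) = sc (a * b) v"
    and sc_1 [simp]: "sc 1 v = v"
    and B_add: "B (u + v) w = B u w + B v w"
    and B_sc: "B (sc c u) v = c * B u v"
    and B_commute: "B v u = cnj (B u v)"
    and B_nonneg: "0 \<le> Re (B v v)"
    and inj_J: "inj J"
begin

lemma sc_0 [simp]: "sc 0 v = 0"
  using sc_add_left[of 0 0 v] by simp

lemma sc_minus: "sc (- 1) v = - v"
  using sc_add_left[of "- 1" 1 v] by (simp add: eq_neg_iff_add_eq_0)

lemma sc_diff: "sc c (v - w) = sc c v - sc c w"
  using sc_add[of c "v - w" w] by simp

lemma B_0 [simp]: "B 0 w = 0" "B w 0 = 0"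
  using B_add[of 0 0 w] B_commute[of w 0] by auto

lemma B_minus: "B (- u) w = - B u w"
  using B_sc[of "- 1" u w] by (simp add: sc_minus)

lemma B_diff: "B (u - v) w = B u w - B v w"
  using B_add[of u "- v" w] by (simp add: B_minus)

lemma B_add_right: "B w (u + v) = B w u + B w v"
  by (simp add: B_commute[of w "u + v"] B_add B_commute[of u w] B_commute[of v w])

lemma B_diff_right: "B w (u - v) = B w u - B w v"
  by (simp add: B_commute[of w "u - v"] B_diff B_commute[of u w] B_commute[of v w])

lemma B_sc_right: "B w (sc c u) = cnj c * B w u"
  by (simp add: B_commute[of w "sc c u"] B_sc B_commute[of u w])

definition N :: "'v \<Rightarrow> real" where "N v = sqrt (Re (B v v))"

lemma N_nonneg [simp]: "0 \<le> N v"
  by (simp add: N_def B_nonneg)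

lemma N_square: "(N v)\<^sup>2 = Re (B v v)"
  by (simp add: N_def B_nonneg)

lemma B_self: "B v v = of_real ((N v)\<^sup>2)"
  using B_commute[of v v] by (simp add: N_square complex_eq_iff)

text \<open>The form may be degenerate, so the real parameter \<open>t\<close> in
  \<open>u - t b v\<close> is kept free: for \<open>N v = 0\<close> a large \<open>t\<close> forces
  \<open>b = 0\<close>, otherwise \<open>t = 1 / (N v)\<^sup>2\<close> is the optimal value.\<close>

lemma Cauchy_Schwarz: "cmod (B u v) \<le> N u * N v"
proof -
  define b where "b = B u v"
  have key: "2 * t * (cmod b)\<^sup>2 \<le> (N u)\<^sup>2 + t\<^sup>2 * (cmod b)\<^sup>2 * (N v)\<^sup>2" for t :: real
  proof -
    let ?c = "of_real t * b"
    have vu: "B v u = cnj b" by (simp add: b_def B_commute[of v u])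
    have "B (u - sc ?c v) (u - sc ?c v) = B u u - cnj ?c * b - ?c * cnj b + ?c * cnj ?c * B v v"
      by (simp add: B_diff B_diff_right B_sc B_sc_right vu b_def[symmetric] algebra_simps)
    also have "\<dots> = of_real ((N u)\<^sup>2 - 2 * t * (cmod b)\<^sup>2 + t\<^sup>2 * (cmod b)\<^sup>2 * (N v)\<^sup>2)"
      using complex_norm_square[of b] by (simp add: B_self power2_eq_square algebra_simps)
    finally have "Re (B (u - sc ?c v) (u - sc ?c v)) = (N u)\<^sup>2 - 2 * t * (cmod b)\<^sup>2 + t\<^sup>2 * (cmod b)\<^sup>2 * (N v)\<^sup>2"
      by simp
    then show ?thesis using B_nonneg[of "u - sc ?c v"] by simp
  qed
  have "(cmod b)\<^sup>2 \<le> (N u * N v)\<^sup>2"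
  proof (cases "N v = 0")
    case True
    have "2 * (((N u)\<^sup>2 + 1) / (2 * (cmod b)\<^sup>2)) * (cmod b)\<^sup>2 \<le> (N u)\<^sup>2"
      using key[of "((N u)\<^sup>2 + 1) / (2 * (cmod b)\<^sup>2)"] True by simp
    then have "b = 0" by (cases "b = 0") auto
    then show ?thesis by simp
  next
    case False
    then have "2 * (1 / (N v)\<^sup>2) * (cmod b)\<^sup>2 \<le> (N u)\<^sup>2 + (1 / (N v)\<^sup>2) * (cmod b)\<^sup>2"
      using key[of "1 / (N v)\<^sup>2"] by (simp add: power2_eq_square)
    then have "(1 / (N v)\<^sup>2) * (cmod b)\<^sup>2 \<le> (N u)\<^sup>2" by simp
    then show ?thesis using False by (simp add: field_simps power_mult_distrib)
  qed
  then have "cmod b \<le> N u * N v"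
    by (rule power2_le_imp_le) simp
  then show ?thesis by (simp add: b_def)
qed

lemma N_triangle: "N (u + v) \<le> N u + N v"
proof -
  have "(N (u + v))\<^sup>2 = (N u)\<^sup>2 + 2 * Re (B u v) + (N v)\<^sup>2"
    by (simp add: N_square B_add B_add_right B_commute[of v u])
  also have "\<dots> \<le> (N u + N v)\<^sup>2"
    using Cauchy_Schwarz[of u v] complex_Re_le_cmod[of "B u v"] by (simp add: power2_sum)
  finally show ?thesis by (rule power2_le_imp_le) simp
qed

lemma N_sc: "N (sc c v) = cmod c * N v"
proof -
  have "B (sc c v) (sc c v) = (c * cnj c) * B v v"
    by (simp add: B_sc B_sc_right)
  also have "\<dots> = of_real ((cmod c * N v)\<^sup>2)"
    unfolding complex_norm_square[symmetric] B_self by (simp add: power_mult_distrib)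
  finally have "(N (sc c v))\<^sup>2 = (cmod c * N v)\<^sup>2"
    by (simp only: N_square Re_complex_of_real)
  then show ?thesis by (simp add: power2_eq_iff_nonneg)
qed

lemma N_minus [simp]: "N (- v) = N v"
  using N_sc[of "- 1" v] by (simp add: sc_minus)

lemma N_0 [simp]: "N 0 = 0"
  by (simp add: N_def)

lemma N_diff_commute: "N (u - v) = N (v - u)"
  using N_minus[of "u - v"] by simp

lemma N_triangle_diff: "N (u - w) \<le> N (u - v) + N (v - w)"
  using N_triangle[of "u - v" "v - w"] by simp

lemma N_abs_diff: "\<bar>N u - N v\<bar> \<le> N (u - v)"
  using N_triangle[of "u - v" v] N_triangle[of "v - u" u] N_diff_commute[of u v] by simp

definition cau :: "(nat \<Rightarrow> 'v) \<Rightarrow> bool" where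
  "cau s \<longleftrightarrow> (\<forall>e>0. \<exists>M. \<forall>m\<ge>M. \<forall>n\<ge>M. N (s m - s n) < e)"

lemma cau_const [simp]: "cau (\<lambda>_. v)"
  by (simp add: cau_def)

lemma cau_image:
  assumes "cau s" "\<And>m n. N (t m - t n) \<le> K * N (s m - s n)" shows "cau t"
  unfolding cau_def
proof (intro allI impI)
  fix e :: real assume e: "0 < e"
  then have "0 < e / (\<bar>K\<bar> + 1)" by (simp add: add_nonneg_pos)
  then obtain M where M: "\<forall>m\<ge>M. \<forall>n\<ge>M. N (s m - s n) < e / (\<bar>K\<bar> + 1)"
    using assms(1) unfolding cau_def by blast
  have "N (t m - t n) < e" if "m \<ge> M" "n \<ge> M" for m n
  proof -
    have "K * N (s m - s n) \<le> (\<bar>K\<bar> + 1) * N (s m - s n)"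
      by (intro mult_right_mono) auto
    also have "\<dots> < (\<bar>K\<bar> + 1) * (e / (\<bar>K\<bar> + 1))"
      using M that by (intro mult_strict_left_mono) auto
    finally show ?thesis using assms(2)[of m n] by simp
  qed
  then show "\<exists>M. \<forall>m\<ge>M. \<forall>n\<ge>M. N (t m - t n) < e" by blast
qed

lemma cau_add:
  assumes "cau s" "cau t" shows "cau (\<lambda>n. s n + t n)"
  unfolding cau_def
proof (intro allI impI)
  fix e :: real assume "0 < e"
  then have "0 < e / 2" by simp
  then obtain L M where LM: "\<forall>m\<ge>L. \<forall>n\<ge>L. N (s m - s n) < e / 2" "\<forall>m\<ge>M. \<forall>n\<ge>M. N (t m - t n) < e / 2"
    using assms unfolding cau_def by meson
  have "N (s m + t m - (s n + t n)) < e" if "m \<ge> max L M" "n \<ge> max L M" for m n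
  proof -
    have "N (s m + t m - (s n + t n)) \<le> N (s m - s n) + N (t m - t n)"
      using N_triangle[of "s m - s n" "t m - t n"] by (simp add: algebra_simps)
    moreover have "N (s m - s n) < e / 2" "N (t m - t n) < e / 2" using LM that by auto
    ultimately show ?thesis by linarith
  qed
  then show "\<exists>M. \<forall>m\<ge>M. \<forall>n\<ge>M. N (s m + t m - (s n + t n)) < e" by blast
qed

lemma cau_sc: "cau s \<Longrightarrow> cau (\<lambda>n. sc c (s n))"
  by (rule cau_image[of s _ "cmod c"]) (simp_all add: N_sc flip: sc_diff)

lemma cau_minus: "cau s \<Longrightarrow> cau (\<lambda>n. - s n)"
  using cau_sc[of s "- 1"] by (simp add: sc_minus)

lemma cau_diff: "cau s \<Longrightarrow> cau t \<Longrightarrow> cau (\<lambda>n. s n - t n)"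
  using cau_add[OF _ cau_minus, of s t] by simp

lemma cau_N_convergent: assumes "cau s" shows "convergent (\<lambda>n. N (s n))"
proof (rule Cauchy_convergent, rule metric_CauchyI)
  fix e :: real assume "0 < e"
  then obtain M where "\<forall>m\<ge>M. \<forall>n\<ge>M. N (s m - s n) < e"
    using assms unfolding cau_def by blast
  then show "\<exists>M. \<forall>m\<ge>M. \<forall>n\<ge>M. dist (N (s m)) (N (s n)) < e"
    unfolding dist_real_def using N_abs_diff by (meson order.strict_trans1)
qed

lemma cau_bounded: assumes "cau s" obtains M where "0 < M" "\<And>n. N (s n) \<le> M"
proof -
  obtain M where "0 < M" "\<And>n. norm (N (s n)) \<le> M"
    using convergent_imp_Bseq[OF cau_N_convergent[OF assms]] unfolding Bseq_def by blast
  then show ?thesis using that by simp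
qed

definition equiv_seq :: "(nat \<Rightarrow> 'v) \<Rightarrow> (nat \<Rightarrow> 'v) \<Rightarrow> bool" where
  "equiv_seq s t \<longleftrightarrow> (\<lambda>n. N (s n - t n)) \<longlonglongrightarrow> 0"

lemma equiv_refl: "equiv_seq s s"
  by (simp add: equiv_seq_def)

lemma equiv_sym: "equiv_seq s t \<Longrightarrow> equiv_seq t s"
  by (simp add: equiv_seq_def N_diff_commute)

lemma equiv_trans: "equiv_seq s t \<Longrightarrow> equiv_seq t u \<Longrightarrow> equiv_seq s u"
  unfolding equiv_seq_def
  by (rule null_comparison[OF _ N_triangle_diff tendsto_add_zero]) auto

text \<open>A chosen representative stands for the class. The choice depends only on the class,
  since equivalent sequences satisfy the same predicate.\<close>

definition K :: "(nat \<Rightarrow> 'v) \<Rightarrow> 'h" where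
  "K s = J (SOME t. cau t \<and> equiv_seq s t)"

definition R :: "'h \<Rightarrow> nat \<Rightarrow> 'v" where
  "R \<xi> = (SOME s. cau s \<and> K s = \<xi>)"

lemma K_eq_iff: assumes "cau s" "cau t" shows "K s = K t \<longleftrightarrow> equiv_seq s t"
proof
  have some: "equiv_seq s (SOME t. cau t \<and> equiv_seq s t)" if "cau s" for s
    using someI[of "\<lambda>t. cau t \<and> equiv_seq s t" s] that equiv_refl by blast
  assume "K s = K t"
  then have "(SOME u. cau u \<and> equiv_seq s u) = (SOME u. cau u \<and> equiv_seq t u)"
    using inj_J by (simp add: K_def inj_eq)
  then show "equiv_seq s t"
    using some[OF assms(1)] some[OF assms(2)] equiv_sym equiv_trans by metis
next
  assume "equiv_seq s t"
  then have "(cau u \<and> equiv_seq s u) = (cau u \<and> equiv_seq t u)" for u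
    using equiv_sym equiv_trans by blast
  then show "K s = K t" by (simp add: K_def)
qed

lemma R_K: assumes "cau s" shows "cau (R (K s))" "equiv_seq s (R (K s))" "equiv_seq (R (K s)) s"
proof -
  have *: "cau (R (K s)) \<and> K (R (K s)) = K s"
    unfolding R_def by (rule someI[of _ s]) (use assms in simp)
  then show "cau (R (K s))" "equiv_seq s (R (K s))" "equiv_seq (R (K s)) s"
    using K_eq_iff[of "R (K s)" s] assms equiv_sym by auto
qed

definition H :: "'h hilbert_space" where
  "H = \<lparr>carrier = K ` Collect cau, monoid.mult = undefined, one = undefined,
     zero = K (\<lambda>_. 0),
     add = (\<lambda>\<xi> \<eta>. K (\<lambda>n. R \<xi> n + R \<eta> n)),
     module.smult = (\<lambda>c \<xi>. K (\<lambda>n. sc c (R \<xi> n))),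
     cinner = (\<lambda>\<xi> \<eta>. lim (\<lambda>n. B (R \<xi> n) (R \<eta> n)))\<rparr>"

lemma carrier_H: "carrier H = K ` Collect cau"
  by (simp add: H_def)

lemma K_closed [simp]: "cau s \<Longrightarrow> K s \<in> carrier H"
  by (simp add: carrier_H)

lemma HE: assumes "\<xi> \<in> carrier H" obtains s where "cau s" "\<xi> = K s"
  using assms by (auto simp: carrier_H)

lemma H_zero: "\<zero>\<^bsub>H\<^esub> = K (\<lambda>_. 0)"
  by (simp add: H_def)

lemma H_add: assumes "cau s" "cau t" shows "K s \<oplus>\<^bsub>H\<^esub> K t = K (\<lambda>n. s n + t n)"
proof -
  note r = R_K[OF assms(1)] R_K[OF assms(2)]
  have "equiv_seq (\<lambda>n. R (K s) n + R (K t) n) (\<lambda>n. s n + t n)"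
    unfolding equiv_seq_def
  proof (rule null_comparison)
    show "(\<lambda>n. N (R (K s) n - s n) + N (R (K t) n - t n)) \<longlonglongrightarrow> 0"
      using r by (intro tendsto_add_zero) (simp_all add: equiv_seq_def)
    show "N (R (K s) n + R (K t) n - (s n + t n)) \<le> N (R (K s) n - s n) + N (R (K t) n - t n)" for n
      using N_triangle[of "R (K s) n - s n" "R (K t) n - t n"] by (simp add: algebra_simps)
  qed simp
  then show ?thesis using assms r by (simp add: H_def K_eq_iff cau_add)
qed

definition ext :: "('v \<Rightarrow> 'v) \<Rightarrow> 'h \<Rightarrow> 'h" where
  "ext T \<xi> = K (\<lambda>n. T (R \<xi> n))"

lemma ext_K:
  assumes T: "\<And>u v. T (u - v) = T u - T v" "\<And>v. N (T v) \<le> M * N v" and s: "cau s"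
  shows "cau (\<lambda>n. T (s n))" "ext T (K s) = K (\<lambda>n. T (s n))"
proof -
  have cau: "cau (\<lambda>n. T (s n))" if "cau s" for s
    using T(2) by (intro cau_image[OF that, of _ M]) (simp flip: T(1))
  show "cau (\<lambda>n. T (s n))" by (rule cau[OF s])
  note r = R_K[OF s]
  have "(\<lambda>n. M * N (R (K s) n - s n)) \<longlonglongrightarrow> 0"
    using r(3) by (intro tendsto_mult_right_zero) (simp add: equiv_seq_def)
  then have "equiv_seq (\<lambda>n. T (R (K s) n)) (\<lambda>n. T (s n))"
    unfolding equiv_seq_def
    by (rule null_comparison[rotated 2]) (use T(2) in \<open>simp_all flip: T(1)\<close>)
  then show "ext T (K s) = K (\<lambda>n. T (s n))"
    unfolding ext_def using cau[OF s] cau[OF r(1)] by (simp add: K_eq_iff)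
qed

lemma H_smult: assumes "cau s" shows "c \<odot>\<^bsub>H\<^esub> K s = K (\<lambda>n. sc c (s n))"
proof -
  have "c \<odot>\<^bsub>H\<^esub> K s = ext (sc c) (K s)" by (simp add: H_def ext_def)
  also have "\<dots> = K (\<lambda>n. sc c (s n))"
    using ext_K(2)[of "sc c" "cmod c" s] assms by (simp add: sc_diff N_sc)
  finally show ?thesis .
qed

lemma B_difference: "cmod (B u v - B u' v') \<le> N (u - u') * N v + N u' * N (v - v')"
proof -
  have "B u v - B u' v' = B (u - u') v + B u' (v - v')"
    by (simp add: B_diff B_diff_right)
  then show ?thesis
    using norm_triangle_ineq[of "B (u - u') v" "B u' (v - v')"] Cauchy_Schwarz[of "u - u'" v] Cauchy_Schwarz[of u' "v - v'"]
    by simp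
qed

lemma B_convergent: assumes "cau s" "cau t" shows "convergent (\<lambda>n. B (s n) (t n))"
proof (rule Cauchy_convergent, rule metric_CauchyI)
  obtain L M where L: "0 < L" "\<And>n. N (s n) \<le> L" and M: "0 < M" "\<And>n. N (t n) \<le> M"
    using cau_bounded[OF assms(1)] cau_bounded[OF assms(2)] by metis
  fix e :: real assume e: "0 < e"
  have "0 < e / (2 * M)" "0 < e / (2 * L)" using e L M by simp_all
  then obtain m0 n0 where mn: "\<forall>m\<ge>m0. \<forall>n\<ge>m0. N (s m - s n) < e / (2 * M)" "\<forall>m\<ge>n0. \<forall>n\<ge>n0. N (t m - t n) < e / (2 * L)"
    using assms unfolding cau_def by meson
  have "dist (B (s m) (t m)) (B (s n) (t n)) < e" if "m \<ge> max m0 n0" "n \<ge> max m0 n0" for m n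
  proof -
    have a: "N (s m - s n) < e / (2 * M)" "N (t m - t n) < e / (2 * L)" using mn that by auto
    have "N (s m - s n) * N (t m) \<le> N (s m - s n) * M" using M by (intro mult_left_mono) auto
    also have "\<dots> < e / (2 * M) * M" using a M by (intro mult_strict_right_mono) auto
    finally have 1: "N (s m - s n) * N (t m) < e / 2" using M by simp
    have "N (s n) * N (t m - t n) \<le> L * N (t m - t n)" using L by (intro mult_right_mono) auto
    also have "\<dots> < L * (e / (2 * L))" using a L by (intro mult_strict_left_mono) auto
    finally have 2: "N (s n) * N (t m - t n) < e / 2" using L by simp
    show ?thesis
      using B_difference[of "s m" "t m" "s n" "t n"] 1 2 by (simp add: dist_norm)
  qed
  then show "\<exists>M. \<forall>m\<ge>M. \<forall>n\<ge>M. dist (B (s m) (t m)) (B (s n) (t n)) < e" by blast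
qed

lemma H_cinner: assumes "cau s" "cau t" shows "(\<lambda>n. B (s n) (t n)) \<longlonglongrightarrow> cinner H (K s) (K t)"
proof -
  note r = R_K[OF assms(1)] R_K[OF assms(2)]
  obtain L M where L: "0 < L" "\<And>n. N (R (K s) n) \<le> L" and M: "0 < M" "\<And>n. N (t n) \<le> M"
    using cau_bounded[OF r(1)] cau_bounded[OF assms(2)] by metis
  have 1: "(\<lambda>n. B (R (K s) n) (R (K t) n)) \<longlonglongrightarrow> cinner H (K s) (K t)"
    using B_convergent[OF r(1) r(4)] by (simp add: H_def convergent_LIMSEQ_iff)
  have "(\<lambda>n. B (s n) (t n) - B (R (K s) n) (R (K t) n)) \<longlonglongrightarrow> 0"
  proof (rule tendsto_norm_zero_cancel, rule null_comparison)
    show "(\<lambda>n. N (s n - R (K s) n) * M + L * N (t n - R (K t) n)) \<longlonglongrightarrow> 0"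
      using r(2,5) unfolding equiv_seq_def
      by (intro tendsto_add_zero tendsto_mult_right_zero tendsto_mult_left_zero)
    fix n
    have "N (s n - R (K s) n) * N (t n) \<le> N (s n - R (K s) n) * M" using M by (intro mult_left_mono) auto
    moreover have "N (R (K s) n) * N (t n - R (K t) n) \<le> L * N (t n - R (K t) n)" using L by (intro mult_right_mono) auto
    ultimately show "norm (B (s n) (t n) - B (R (K s) n) (R (K t) n)) \<le> N (s n - R (K s) n) * M + L * N (t n - R (K t) n)"
      using B_difference[of "s n" "t n" "R (K s) n" "R (K t) n"] by simp
  qed simp
  from tendsto_add[OF 1 this] show ?thesis by simp
qed

lemma H_cinner_eqI: "cau s \<Longrightarrow> cau t \<Longrightarrow> (\<lambda>n. B (s n) (t n)) \<longlonglongrightarrow> x \<Longrightarrow> cinner H (K s) (K t) = x"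
  using LIMSEQ_unique[OF H_cinner] .

lemma hnorm_H: assumes "cau s" shows "(\<lambda>n. N (s n)) \<longlonglongrightarrow> hnorm H (K s)"
  unfolding hnorm_def N_def by (intro tendsto_real_sqrt tendsto_Re H_cinner assms)

lemmas H_ops = H_zero H_add H_smult cau_add cau_sc cau_minus

lemma module_H: "Module.module complex_ring H"
proof (rule moduleI[OF cring_from_type_algebra])
  show "abelian_group H"
  proof (rule abelian_groupI)
    fix \<xi> assume "\<xi> \<in> carrier H"
    then obtain s where s: "cau s" "\<xi> = K s" by (rule HE)
    then show "\<exists>\<eta>\<in>carrier H. \<eta> \<oplus>\<^bsub>H\<^esub> \<xi> = \<zero>\<^bsub>H\<^esub>"
      by (intro bexI[of _ "K (\<lambda>n. - s n)"]) (simp_all add: H_ops)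
  qed (auto elim!: HE simp: H_ops add_ac)
qed (auto elim!: HE simp: H_ops sc_add_left sc_add sc_sc)

lemma H_diff: assumes "cau s" "cau t" shows "K s \<ominus>\<^bsub>H\<^esub> K t = K (\<lambda>n. s n - t n)"
proof -
  interpret M: Module.module complex_ring H by (rule module_H)
  have "\<ominus>\<^bsub>H\<^esub> K t = K (\<lambda>n. - t n)"
    using assms by (intro abelian_group.minus_equality[OF M.abelian_group_axioms]) (simp_all add: H_ops)
  then show ?thesis using assms by (simp add: a_minus_def H_ops)
qed

lemma hnorm_triangle:
  assumes "\<xi> \<in> carrier H" "\<eta> \<in> carrier H" "\<zeta> \<in> carrier H"
  shows "hnorm H (\<xi> \<ominus>\<^bsub>H\<^esub> \<zeta>) \<le> hnorm H (\<xi> \<ominus>\<^bsub>H\<^esub> \<eta>) + hnorm H (\<eta> \<ominus>\<^bsub>H\<^esub> \<zeta>)"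
proof -
  obtain s t u where s: "cau s" "\<xi> = K s" and t: "cau t" "\<eta> = K t" and u: "cau u" "\<zeta> = K u"
    using assms by (meson HE)
  show ?thesis
    using LIMSEQ_le[OF hnorm_H[OF cau_diff[OF s(1) u(1)]]
        tendsto_add[OF hnorm_H[OF cau_diff[OF s(1) t(1)]] hnorm_H[OF cau_diff[OF t(1) u(1)]]]] s t u
    by (simp add: H_diff N_triangle_diff)
qed

lemma hnorm_diff_commute:
  assumes "\<xi> \<in> carrier H" "\<eta> \<in> carrier H" shows "hnorm H (\<xi> \<ominus>\<^bsub>H\<^esub> \<eta>) = hnorm H (\<eta> \<ominus>\<^bsub>H\<^esub> \<xi>)"
proof -
  obtain s t where s: "cau s" "\<xi> = K s" and t: "cau t" "\<eta> = K t"
    using assms by (meson HE)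
  show ?thesis
    using LIMSEQ_unique[OF hnorm_H[OF cau_diff[OF s(1) t(1)]]] hnorm_H[OF cau_diff[OF t(1) s(1)]] s t
    by (simp add: H_diff N_diff_commute)
qed

lemma hnorm_H_nonneg: "\<xi> \<in> carrier H \<Longrightarrow> 0 \<le> hnorm H \<xi>"
  by (auto elim!: HE intro!: LIMSEQ_le_const[OF hnorm_H])

lemma K_limit:
  assumes "cau s" "0 < e" shows "\<exists>M. \<forall>n\<ge>M. hnorm H (K s \<ominus>\<^bsub>H\<^esub> K (\<lambda>_. s n)) \<le> e"
proof -
  obtain M where M: "\<forall>m\<ge>M. \<forall>n\<ge>M. N (s m - s n) < e"
    using assms unfolding cau_def by blast
  have "hnorm H (K s \<ominus>\<^bsub>H\<^esub> K (\<lambda>_. s n)) \<le> e" if "n \<ge> M" for n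
  proof -
    have "(\<lambda>k. N (s k - s n)) \<longlonglongrightarrow> hnorm H (K s \<ominus>\<^bsub>H\<^esub> K (\<lambda>_. s n))"
      using hnorm_H[OF cau_diff[OF assms(1) cau_const[of "s n"]]] assms(1) by (simp add: H_diff)
    moreover have "\<forall>k\<ge>M. N (s k - s n) \<le> e"
      using M that less_imp_le by blast
    ultimately show ?thesis
      by (rule LIMSEQ_le_const2[OF _ exI])
  qed
  then show ?thesis by blast
qed

text \<open>The diagonal argument again, with constant sequences as the dense subspace.\<close>

theorem complete_H: "complete_wrt H (hnorm H)"
  unfolding complete_wrt_def
proof (intro allI impI)
  fix S assume S: "cauchy_seq H (hnorm H) S"
  have Sc: "S k \<in> carrier H" for k using S by (simp add: cauchy_seq_def)
  have "\<exists>a. hnorm H (S k \<ominus>\<^bsub>H\<^esub> K (\<lambda>_. a)) \<le> 1 / Suc k" for k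
  proof -
    obtain s where s: "cau s" "S k = K s" using Sc by (rule HE)
    have "0 < 1 / real (Suc k)" by simp
    from K_limit[OF s(1) this] show ?thesis using s(2) by auto
  qed
  then obtain a where a: "\<And>k. hnorm H (S k \<ominus>\<^bsub>H\<^esub> K (\<lambda>_. a k)) \<le> 1 / Suc k"
    by metis
  let ?E = "\<lambda>k. K (\<lambda>_. a k)"
  have a': "hnorm H (?E k \<ominus>\<^bsub>H\<^esub> S k) \<le> 1 / Suc k" for k
    using a[of k] hnorm_diff_commute[of "?E k" "S k"] Sc by simp
  have tri: "N (a m - a n) \<le> 1 / Suc m + hnorm H (S m \<ominus>\<^bsub>H\<^esub> S n) + 1 / Suc n" for m n
  proof -
    have "N (a m - a n) = hnorm H (?E m \<ominus>\<^bsub>H\<^esub> ?E n)"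
      using hnorm_H[OF cau_const[of "a m - a n"]] by (simp add: H_diff LIMSEQ_const_iff)
    also have "\<dots> \<le> hnorm H (?E m \<ominus>\<^bsub>H\<^esub> S m) + (hnorm H (S m \<ominus>\<^bsub>H\<^esub> S n) + hnorm H (S n \<ominus>\<^bsub>H\<^esub> ?E n))"
      using hnorm_triangle[of "?E m" "S m" "?E n"] hnorm_triangle[of "S m" "S n" "?E n"] Sc by simp
    finally show ?thesis using a[of n] a'[of m] by linarith
  qed
  have lim0: "(\<lambda>k. 1 / real (Suc k)) \<longlonglongrightarrow> 0"
    by (rule LIMSEQ_Suc) (rule lim_1_over_n)
  have ca: "cau a"
    unfolding cau_def
  proof (intro allI impI)
    fix e :: real assume e: "0 < e"
    then have "0 < e / 3" by simp
    then obtain L where L: "\<forall>m\<ge>L. \<forall>n\<ge>L. hnorm H (S m \<ominus>\<^bsub>H\<^esub> S n) < e / 3"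
      using S unfolding cauchy_seq_def by blast
    have "\<forall>\<^sub>F k in sequentially. 1 / real (Suc k) < e / 3"
      using e by (intro order_tendstoD(2)[OF lim0]) simp
    then obtain M where M: "\<forall>k\<ge>M. 1 / real (Suc k) < e / 3"
      unfolding eventually_sequentially by blast
    have "N (a m - a n) < e" if "m \<ge> max L M" "n \<ge> max L M" for m n
    proof -
      have "1 / real (Suc m) < e / 3" "1 / real (Suc n) < e / 3" "hnorm H (S m \<ominus>\<^bsub>H\<^esub> S n) < e / 3"
        using that L M by simp_all
      then show ?thesis using tri[of m n] by linarith
    qed
    then show "\<exists>M. \<forall>m\<ge>M. \<forall>n\<ge>M. N (a m - a n) < e" by blast
  qed
  have "(\<lambda>n. hnorm H (S n \<ominus>\<^bsub>H\<^esub> K a)) \<longlonglongrightarrow> 0"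
  proof (rule null_comparison)
    interpret M: Module.module complex_ring H by (rule module_H)
    fix n
    show "0 \<le> hnorm H (S n \<ominus>\<^bsub>H\<^esub> K a)"
      using Sc ca by (intro hnorm_H_nonneg abelian_group.minus_closed[OF M.abelian_group_axioms]) auto
    show "hnorm H (S n \<ominus>\<^bsub>H\<^esub> K a) \<le> 1 / Suc n + hnorm H (?E n \<ominus>\<^bsub>H\<^esub> K a)"
      using hnorm_triangle[of "S n" "?E n" "K a"] a[of n] Sc ca by simp
  next
    have "(\<lambda>n. hnorm H (?E n \<ominus>\<^bsub>H\<^esub> K a)) \<longlonglongrightarrow> 0"
    proof (rule LIMSEQ_I)
      fix r :: real assume r: "0 < r"
      then obtain M where M: "\<forall>n\<ge>M. hnorm H (K a \<ominus>\<^bsub>H\<^esub> ?E n) \<le> r / 2"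
        using K_limit[OF ca, of "r / 2"] by auto
      have "norm (hnorm H (?E n \<ominus>\<^bsub>H\<^esub> K a) - 0) < r" if "n \<ge> M" for n
      proof -
        have "hnorm H (?E n \<ominus>\<^bsub>H\<^esub> K a) \<le> r / 2"
          using M[rule_format, OF that] hnorm_diff_commute[of "?E n" "K a"] ca by simp
        moreover have "0 \<le> hnorm H (?E n \<ominus>\<^bsub>H\<^esub> K a)"
          by (rule hnorm_H_nonneg) (simp add: H_diff cau_diff ca)
        ultimately show ?thesis using r by simp
      qed
      then show "\<exists>M. \<forall>n\<ge>M. norm (hnorm H (?E n \<ominus>\<^bsub>H\<^esub> K a) - 0) < r" by blast
    qed
    then show "(\<lambda>n. 1 / Suc n + hnorm H (?E n \<ominus>\<^bsub>H\<^esub> K a)) \<longlonglongrightarrow> 0"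
      using tendsto_add_zero[OF lim0] by simp
  qed
  then show "\<exists>l\<in>carrier H. (\<lambda>n. hnorm H (S n \<ominus>\<^bsub>H\<^esub> l)) \<longlonglongrightarrow> 0"
    using ca by (intro bexI[of _ "K a"]) auto
qed

theorem hilbert_H: "hilbert H"
proof (intro hilbert.intro module_H hilbert_axioms.intro complete_H)
  fix \<xi> \<eta> \<zeta> c
  assume "\<xi> \<in> carrier H" "\<eta> \<in> carrier H"
  then obtain s t where st: "cau s" "\<xi> = K s" "cau t" "\<eta> = K t" by (meson HE)
  show "cinner H (c \<odot>\<^bsub>H\<^esub> \<xi>) \<eta> = c * cinner H \<xi> \<eta>"
    using st tendsto_mult_left[OF H_cinner[OF st(1,3)], of c]
    by (simp add: H_ops) (rule H_cinner_eqI; simp add: H_ops B_sc)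
  show "cinner H \<eta> \<xi> = cnj (cinner H \<xi> \<eta>)"
    using st tendsto_cnj[OF H_cinner[OF st(1,3)]] by (simp add: H_cinner_eqI B_commute[of "t _" "s _"])
  assume "\<zeta> \<in> carrier H"
  then obtain u where u: "cau u" "\<zeta> = K u" by (rule HE)
  show "cinner H (\<xi> \<oplus>\<^bsub>H\<^esub> \<eta>) \<zeta> = cinner H \<xi> \<zeta> + cinner H \<eta> \<zeta>"
    using st u tendsto_add[OF H_cinner[OF st(1) u(1)] H_cinner[OF st(3) u(1)]]
    by (simp add: H_ops) (rule H_cinner_eqI; simp add: H_ops B_add)
next
  fix \<xi> assume "\<xi> \<in> carrier H" and ne: "\<xi> \<noteq> \<zero>\<^bsub>H\<^esub>"
  then obtain s where s: "cau s" "\<xi> = K s" by (meson HE)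
  have "0 \<le> Re (cinner H \<xi> \<xi>)"
    unfolding s(2) by (rule LIMSEQ_le_const[OF tendsto_Re[OF H_cinner[OF s(1) s(1)]]]) (use B_nonneg in auto)
  moreover have "Re (cinner H \<xi> \<xi>) \<noteq> 0"
  proof
    assume "Re (cinner H \<xi> \<xi>) = 0"
    then have "(\<lambda>n. N (s n - 0)) \<longlonglongrightarrow> 0"
      using hnorm_H[OF s(1)] by (simp add: hnorm_def s(2))
    then have "K s = K (\<lambda>_. 0)" using s(1) by (simp add: K_eq_iff equiv_seq_def)
    then show False using ne s(2) by (simp add: H_zero)
  qed
  ultimately show "0 < Re (cinner H \<xi> \<xi>)" by simp
qed

end

section \<open>Hilbert spaces\<close>

context hilbert
begin

lemma vec_smult_closed: "v \<in> carrier H \<Longrightarrow> c \<odot> v \<in> carrier H"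
  using smult_closed[of c v] by simp

lemma add_group_H: "abelian_group H"
  by (rule abelian_group_axioms)

lemmas am = abelian_group.axioms(1)[OF add_group_H]
lemmas vec_add_closed = abelian_monoid.a_closed[OF am]
lemmas vec_zero_closed = abelian_monoid.zero_closed[OF am]

lemma cinner_zero_left: "v \<in> carrier H \<Longrightarrow> cinner H \<zero> v = 0"
  using cinner_smult[of v v 0] smult_l_null[of v] by simp

lemma cinner_add_right:
  assumes "u \<in> carrier H" "v \<in> carrier H" "w \<in> carrier H"
  shows "cinner H u (v \<oplus> w) = cinner H u v + cinner H u w"
  using assms by (simp add: cinner_commute[of "v \<oplus> w" u] cinner_commute[of v u] cinner_commute[of w u] vec_add_closed cinner_add)

lemma cinner_smult_right:
  assumes "u \<in> carrier H" "v \<in> carrier H" shows "cinner H u (c \<odot> v) = cnj c * cinner H u v"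
  using assms by (simp add: cinner_commute[of "c \<odot> v" u] cinner_commute[of v u] vec_smult_closed cinner_smult)

lemma cinner_self_nonneg: "v \<in> carrier H \<Longrightarrow> 0 \<le> Re (cinner H v v)"
  by (cases "v = \<zero>") (auto simp: cinner_zero_left less_imp_le cinner_pos)

lemma hnorm_nonneg: "v \<in> carrier H \<Longrightarrow> 0 \<le> hnorm H v"
  by (simp add: hnorm_def cinner_self_nonneg)

lemma hnorm_square: "v \<in> carrier H \<Longrightarrow> (hnorm H v)\<^sup>2 = Re (cinner H v v)"
  by (simp add: hnorm_def cinner_self_nonneg)

lemma hnorm_zero: "hnorm H \<zero> = 0"
  by (simp add: hnorm_def cinner_zero_left vec_zero_closed)

lemma cinner_self: "v \<in> carrier H \<Longrightarrow> cinner H v v = of_real ((hnorm H v)\<^sup>2)"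
  using cinner_commute[of v v] by (simp add: hnorm_square complex_eq_iff)

lemma Cauchy_Schwarz:
  assumes u: "u \<in> carrier H" and v: "v \<in> carrier H"
  shows "cmod (cinner H u v) \<le> hnorm H u * hnorm H v"
proof (cases "v = \<zero>")
  case True
  then show ?thesis using u cinner_commute[of \<zero> u] by (simp add: cinner_zero_left hnorm_zero vec_zero_closed)
next
  case False
  define b n where "b = cinner H u v" and "n = (hnorm H v)\<^sup>2"
  \<comment> \<open>With this scalar \<open>u \<oplus> c \<odot> v\<close> is the component of
    \<open>u\<close> orthogonal to \<open>v\<close>.\<close>
  define c where "c = - (b / of_real n)"
  have n: "0 < n" using cinner_pos[OF v False] by (simp add: n_def hnorm_square v)
  have vv: "cinner H v v = of_real n" and vu: "cinner H v u = cnj b"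
    using cinner_commute[OF u v] v by (simp_all add: n_def b_def cinner_self)
  have "cinner H (u \<oplus> c \<odot> v) (u \<oplus> c \<odot> v) = cinner H u u + (c * cnj b + cnj c * b + c * (cnj c * of_real n))"
    using u v by (simp add: cinner_add cinner_add_right cinner_smult cinner_smult_right vec_add_closed vec_smult_closed
        vv vu algebra_simps flip: b_def)
  also have "c * cnj b + cnj c * b + c * (cnj c * of_real n) = - of_real ((cmod b)\<^sup>2 / n)"
    using n complex_norm_square[of b] by (simp add: c_def field_simps)
  finally have "(cmod b)\<^sup>2 / n \<le> (hnorm H u)\<^sup>2"
    using cinner_self_nonneg[of "u \<oplus> c \<odot> v"] u v by (simp add: hnorm_square vec_add_closed vec_smult_closed)
  then have "(cmod b)\<^sup>2 \<le> (hnorm H u * hnorm H v)\<^sup>2"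
    using n by (simp add: n_def field_simps power_mult_distrib)
  then show ?thesis
    unfolding b_def by (rule power2_le_imp_le) (simp add: u v hnorm_nonneg)
qed

lemma hnorm_add:
  assumes u: "u \<in> carrier H" and v: "v \<in> carrier H"
  shows "hnorm H (u \<oplus> v) \<le> hnorm H u + hnorm H v"
proof -
  have "(hnorm H (u \<oplus> v))\<^sup>2 = (hnorm H u)\<^sup>2 + 2 * Re (cinner H u v) + (hnorm H v)\<^sup>2"
    using u v cinner_commute[OF u v] by (simp add: hnorm_square cinner_add cinner_add_right vec_add_closed)
  also have "\<dots> \<le> (hnorm H u + hnorm H v)\<^sup>2"
    using Cauchy_Schwarz[OF u v] complex_Re_le_cmod[of "cinner H u v"] by (simp add: power2_sum)
  finally show ?thesis by (rule power2_le_imp_le) (simp add: u v hnorm_nonneg)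
qed

lemma hnorm_smult: assumes v: "v \<in> carrier H" shows "hnorm H (c \<odot> v) = cmod c * hnorm H v"
proof -
  have "cinner H (c \<odot> v) (c \<odot> v) = (c * cnj c) * cinner H v v"
    using v by (simp add: cinner_smult cinner_smult_right vec_smult_closed)
  also have "\<dots> = of_real ((cmod c * hnorm H v)\<^sup>2)"
    unfolding complex_norm_square[symmetric] cinner_self[OF v] by (simp add: power_mult_distrib)
  finally have "(hnorm H (c \<odot> v))\<^sup>2 = (cmod c * hnorm H v)\<^sup>2"
    using v by (simp only: hnorm_square vec_smult_closed Re_complex_of_real)
  then show ?thesis using v by (simp add: power2_eq_iff_nonneg hnorm_nonneg vec_smult_closed)
qed

end

lemma module_hom_finsum:
  assumes M: "abelian_group M" and N: "abelian_group N"
    and f: "\<And>v. v \<in> carrier M \<Longrightarrow> f v \<in> carrier N"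
      "\<And>v w. v \<in> carrier M \<Longrightarrow> w \<in> carrier M \<Longrightarrow> f (v \<oplus>\<^bsub>M\<^esub> w) = f v \<oplus>\<^bsub>N\<^esub> f w"
    and g: "finite A" "g \<in> A \<rightarrow> carrier M"
  shows "f (\<Oplus>\<^bsub>M\<^esub>i\<in>A. g i) = (\<Oplus>\<^bsub>N\<^esub>i\<in>A. f (g i))"
proof -
  interpret M: abelian_group M by (rule M)
  interpret N: abelian_group N by (rule N)
  have f0: "f \<zero>\<^bsub>M\<^esub> = \<zero>\<^bsub>N\<^esub>"
  proof -
    have "f \<zero>\<^bsub>M\<^esub> \<oplus>\<^bsub>N\<^esub> f \<zero>\<^bsub>M\<^esub> = f \<zero>\<^bsub>M\<^esub>" using f(2)[of "\<zero>\<^bsub>M\<^esub>" "\<zero>\<^bsub>M\<^esub>"] by simp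
    then show ?thesis using f(1)[of "\<zero>\<^bsub>M\<^esub>"] by (metis M.zero_closed N.add.r_cancel_one)
  qed
  show ?thesis
    using g
  proof (induction A rule: finite_induct)
    case (insert a A)
    then show ?case using f by (simp add: Pi_iff)
  qed (simp add: f0)
qed

text \<open>A linear map of a finite-dimensional space onto itself is injective.\<close>

lemma no_finite_span:
  assumes M: "Module.module complex_ring M"
    and f: "\<And>v. v \<in> carrier M \<Longrightarrow> f v \<in> carrier M"
      "\<And>v w. v \<in> carrier M \<Longrightarrow> w \<in> carrier M \<Longrightarrow> f (v \<oplus>\<^bsub>M\<^esub> w) = f v \<oplus>\<^bsub>M\<^esub> f w"
      "\<And>c v. v \<in> carrier M \<Longrightarrow> f (c \<odot>\<^bsub>M\<^esub> v) = c \<odot>\<^bsub>M\<^esub> f v"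
      "\<And>v. v \<in> carrier M \<Longrightarrow> \<exists>w\<in>carrier M. f w = v"
    and \<zeta>: "\<zeta> \<in> carrier M" "\<zeta> \<noteq> \<zero>\<^bsub>M\<^esub>" "f \<zeta> = \<zero>\<^bsub>M\<^esub>"
    and I: "finite I" "b \<in> I \<rightarrow> carrier M"
  shows "\<not> (\<forall>v\<in>carrier M. \<exists>c. v = (\<Oplus>\<^bsub>M\<^esub>i\<in>I. c i \<odot>\<^bsub>M\<^esub> b i))"
  using I
proof (induction "card I" arbitrary: I b rule: less_induct)
  case less
  interpret M: Module.module complex_ring M by (rule M)
  have ag: "abelian_group M" by unfold_locales
  note am = abelian_group.axioms(1)[OF ag]
  have sm: "c \<odot>\<^bsub>M\<^esub> v \<in> carrier M" if "v \<in> carrier M" for c v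
    using M.smult_closed[of c v] that by simp
  show ?case
  proof
    assume span: "\<forall>v\<in>carrier M. \<exists>c. v = (\<Oplus>\<^bsub>M\<^esub>i\<in>I. c i \<odot>\<^bsub>M\<^esub> b i)"
    then obtain d where d: "\<zeta> = (\<Oplus>\<^bsub>M\<^esub>i\<in>I. d i \<odot>\<^bsub>M\<^esub> b i)" using \<zeta>(1) by blast
    have bc: "b i \<in> carrier M" if "i \<in> I" for i using less.prems(2) that by auto
    have "\<exists>j\<in>I. d j \<noteq> 0"
    proof (rule ccontr)
      assume "\<not> (\<exists>j\<in>I. d j \<noteq> 0)"
      then have "(\<Oplus>\<^bsub>M\<^esub>i\<in>I. d i \<odot>\<^bsub>M\<^esub> b i) = (\<Oplus>\<^bsub>M\<^esub>i\<in>I. \<zero>\<^bsub>M\<^esub>)"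
        using bc M.smult_l_null by (intro abelian_monoid.finsum_cong'[OF am]) auto
      then show False using d \<zeta>(2) abelian_monoid.finsum_zero[OF am] by simp
    qed
    then obtain j where j: "j \<in> I" "d j \<noteq> 0" by blast
    define I' where "I' = I - {j}"
    have I': "finite I'" "j \<notin> I'" "I = insert j I'" using j less.prems(1) by (auto simp: I'_def)
    have "\<exists>e. v = (\<Oplus>\<^bsub>M\<^esub>i\<in>I'. e i \<odot>\<^bsub>M\<^esub> f (b i))" if v: "v \<in> carrier M" for v
    proof -
      obtain w where w: "w \<in> carrier M" "f w = v" using f(4)[OF v] by blast
      then obtain c where c: "w = (\<Oplus>\<^bsub>M\<^esub>i\<in>I. c i \<odot>\<^bsub>M\<^esub> b i)" using span by blast
      \<comment> \<open>Adding \<open>t\<close> times the kernel vector \<zeta> to \<open>w\<close>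
        removes the coefficient of \<open>b j\<close> without changing the image. So the vectors
        \<open>f (b i)\<close> with \<open>i \<noteq> j\<close> already span, and the index set
        shrinks.\<close>
      define t where "t = - (c j / d j)"
      define e where "e = (\<lambda>i. c i + t * d i)"
      have ej: "e j = 0" using j by (simp add: e_def t_def)
      have "(\<Oplus>\<^bsub>M\<^esub>i\<in>I. e i \<odot>\<^bsub>M\<^esub> b i) = (\<Oplus>\<^bsub>M\<^esub>i\<in>I. c i \<odot>\<^bsub>M\<^esub> b i \<oplus>\<^bsub>M\<^esub> t \<odot>\<^bsub>M\<^esub> (d i \<odot>\<^bsub>M\<^esub> b i))"
        using bc sm by (intro abelian_monoid.finsum_cong'[OF am])
          (auto simp: e_def M.smult_l_distr[simplified] M.smult_assoc1[simplified])
      also have "\<dots> = w \<oplus>\<^bsub>M\<^esub> (\<Oplus>\<^bsub>M\<^esub>i\<in>I. t \<odot>\<^bsub>M\<^esub> (d i \<odot>\<^bsub>M\<^esub> b i))"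
        unfolding c using bc sm by (intro abelian_monoid.finsum_addf[OF am]) auto
      also have "(\<Oplus>\<^bsub>M\<^esub>i\<in>I. t \<odot>\<^bsub>M\<^esub> (d i \<odot>\<^bsub>M\<^esub> b i)) = t \<odot>\<^bsub>M\<^esub> \<zeta>"
        unfolding d using bc sm less.prems(1) M.smult_r_distr
        by (intro module_hom_finsum[OF ag ag, symmetric]) auto
      finally have "f (\<Oplus>\<^bsub>M\<^esub>i\<in>I. e i \<odot>\<^bsub>M\<^esub> b i) = v"
        using w \<zeta> f sm M.smult_r_null[of t] v by simp
      moreover have "f (\<Oplus>\<^bsub>M\<^esub>i\<in>I. e i \<odot>\<^bsub>M\<^esub> b i) = (\<Oplus>\<^bsub>M\<^esub>i\<in>I. f (e i \<odot>\<^bsub>M\<^esub> b i))"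
        using bc sm less.prems(1) f by (intro module_hom_finsum[OF ag ag]) auto
      moreover have "\<dots> = (\<Oplus>\<^bsub>M\<^esub>i\<in>I. e i \<odot>\<^bsub>M\<^esub> f (b i))"
        using bc sm f by (intro abelian_monoid.finsum_cong'[OF am]) auto
      moreover have "\<dots> = e j \<odot>\<^bsub>M\<^esub> f (b j) \<oplus>\<^bsub>M\<^esub> (\<Oplus>\<^bsub>M\<^esub>i\<in>I'. e i \<odot>\<^bsub>M\<^esub> f (b i))"
        unfolding I'(3) using I' bc sm f(1) by (intro abelian_monoid.finsum_insert[OF am]) auto
      moreover have "\<dots> = (\<Oplus>\<^bsub>M\<^esub>i\<in>I'. e i \<odot>\<^bsub>M\<^esub> f (b i))"
      proof -
        have "(\<Oplus>\<^bsub>M\<^esub>i\<in>I'. e i \<odot>\<^bsub>M\<^esub> f (b i)) \<in> carrier M"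
          using I' bc sm f(1) by (intro abelian_monoid.finsum_closed[OF am]) auto
        then show ?thesis using ej M.smult_l_null[of "f (b j)"] f(1) bc[OF j(1)] by simp
      qed
      ultimately show ?thesis by metis
    qed
    then have "\<forall>v\<in>carrier M. \<exists>e. v = (\<Oplus>\<^bsub>M\<^esub>i\<in>I'. e i \<odot>\<^bsub>M\<^esub> f (b i))" by blast
    moreover have "card I' < card I" using I' by (simp add: card_insert_if)
    ultimately show False
      using less.hyps[of I' "\<lambda>i. f (b i)"] I' bc f(1) by auto
  qed
qed

section \<open>The representation on the direct sum of the GNS spaces\<close>

text \<open>
  Component \<open>a\<close> of the direct sum carries a state \<open>\<omega>\<close> with \<open>\<omega> (a\<^sup>* a) = (Q a)\<^sup>2\<close>, so that the
  operator norm of the sum representation is \<open>Q\<close>.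
\<close>

locale gns = cstar_seminormed cs st Q for cs :: "complex \<Rightarrow> 'a::ring_1" and st Q +
  fixes J :: "(nat \<Rightarrow> 'a \<Rightarrow>\<^sub>0 'a) \<Rightarrow> 'h"
  assumes Q_1: "Q 1 = 1" and inj_J: "inj J"
begin

text \<open>One state need not attain the seminorm at every element, so each index \<open>a\<close>
  chooses its own; position \<open>a\<close> of a finitely supported family represents a vector of
  the GNS space of \<open>\<omega> a\<close>.\<close>

definition \<omega> :: "'a \<Rightarrow> 'a \<Rightarrow> complex" where
  "\<omega> a = (SOME w. state w \<and> w (st a * a) = of_real ((Q a)\<^sup>2))"

lemma \<omega>: "state (\<omega> a)" "\<omega> a (st a * a) = of_real ((Q a)\<^sup>2)"
proof -
  have "\<exists>w. state w \<and> w (st a * a) = of_real ((Q a)\<^sup>2)"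
    using state_exists[OF Q_1, of a] by blast
  then have "state (\<omega> a) \<and> \<omega> a (st a * a) = of_real ((Q a)\<^sup>2)"
    unfolding \<omega>_def by (rule someI_ex)
  then show "state (\<omega> a)" "\<omega> a (st a * a) = of_real ((Q a)\<^sup>2)" by auto
qed

lemma \<omega>_add: "\<omega> a (x + y) = \<omega> a x + \<omega> a y"
  and \<omega>_cs: "\<omega> a (cs c * x) = c * \<omega> a x"
  and \<omega>_st: "\<omega> a (st x) = cnj (\<omega> a x)"
  and \<omega>_1: "\<omega> a 1 = 1"
  and \<omega>_pos: "0 \<le> Re (\<omega> a (st x * x))"
  using \<omega>(1)[of a] Pos_adjoint_mult[of x] unfolding state_def by blast+

lemma \<omega>_0 [simp]: "\<omega> a 0 = 0"
  using \<omega>_add[of a 0 0] by simp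

definition act :: "'a \<Rightarrow> ('a \<Rightarrow>\<^sub>0 'a) \<Rightarrow> 'a \<Rightarrow>\<^sub>0 'a" where
  "act x v = Poly_Mapping.map ((*) x) v"

lemma lookup_act [simp]: "Poly_Mapping.lookup (act x v) a = x * Poly_Mapping.lookup v a"
  by (simp add: act_def Poly_Mapping.map.rep_eq when_def)

definition form :: "('a \<Rightarrow>\<^sub>0 'a) \<Rightarrow> ('a \<Rightarrow>\<^sub>0 'a) \<Rightarrow> complex" where
  "form v w = (\<Sum>a\<in>Poly_Mapping.keys v. \<omega> a (st (Poly_Mapping.lookup w a) * Poly_Mapping.lookup v a))"

lemma form_superset:
  assumes "finite A" "Poly_Mapping.keys v \<subseteq> A"
  shows "form v w = (\<Sum>a\<in>A. \<omega> a (st (Poly_Mapping.lookup w a) * Poly_Mapping.lookup v a))"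
  unfolding form_def using assms by (intro sum.mono_neutral_left) (auto simp: in_keys_iff)

lemma keys_act: "Poly_Mapping.keys (act x v) \<subseteq> Poly_Mapping.keys v"
  by (auto simp: in_keys_iff)

sublocale V: semi_inner_space "\<lambda>c. act (cs c)" form J
proof
  fix a b c and u v w :: "'a \<Rightarrow>\<^sub>0 'a"
  show "act (cs (a + b)) v = act (cs a) v + act (cs b) v"
    by (rule poly_mapping_eqI) (simp add: lookup_add cs_add distrib_right)
  show "act (cs a) (v + w) = act (cs a) v + act (cs a) w"
    by (rule poly_mapping_eqI) (simp add: lookup_add distrib_left)
  show "act (cs a) (act (cs b) v) = act (cs (a * b)) v"
    by (rule poly_mapping_eqI) (simp add: cs_mult mult.assoc)
  show "act (cs 1) v = v"
    by (rule poly_mapping_eqI) simp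
  show "form (u + v) w = form u w + form v w"
  proof -
    let ?A = "Poly_Mapping.keys u \<union> Poly_Mapping.keys v"
    have "Poly_Mapping.keys (u + v) \<subseteq> ?A" by (rule Poly_Mapping.keys_add)
    then show ?thesis
      by (simp add: form_superset[of ?A] lookup_add distrib_left \<omega>_add sum.distrib)
  qed
  show "form (act (cs c) u) v = c * form u v"
    using keys_act[of "cs c" u]
    by (simp add: form_superset[of "Poly_Mapping.keys u"] cs_left \<omega>_cs sum_distrib_left)
  show "form v u = cnj (form u v)"
    by (simp add: form_superset[of "Poly_Mapping.keys u \<union> Poly_Mapping.keys v"] st_mult flip: \<omega>_st)
  show "0 \<le> Re (form v v)"
    by (simp add: form_def Re_sum \<omega>_pos sum_nonneg)
  show "inj J" by (rule inj_J)
qed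

lemma form_act: "form (act x v) w = form v (act (st x) w)"
  using keys_act[of x v]
  by (simp add: form_superset[of "Poly_Mapping.keys v"] st_mult mult.assoc)

text \<open>\<open>state_bound\<close> in every position, with the same factor
  \<open>(Q x)\<^sup>2\<close>; therefore the direct sum operator is bounded.\<close>

lemma N_act: "V.N (act x v) \<le> Q x * V.N v"
proof -
  have "(V.N (act x v))\<^sup>2 = (\<Sum>a\<in>Poly_Mapping.keys v. Re (\<omega> a (st (Poly_Mapping.lookup v a) * (st x * x) * Poly_Mapping.lookup v a)))"
    using keys_act[of x v]
    by (simp add: V.N_square form_superset[of "Poly_Mapping.keys v"] st_mult mult.assoc)
  also have "\<dots> \<le> (\<Sum>a\<in>Poly_Mapping.keys v. (Q x)\<^sup>2 * Re (\<omega> a (st (Poly_Mapping.lookup v a) * Poly_Mapping.lookup v a)))"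
    by (intro sum_mono state_bound \<omega>)
  also have "\<dots> = (Q x * V.N v)\<^sup>2"
    by (simp add: V.N_square form_def power_mult_distrib sum_distrib_left)
  finally show ?thesis
    by (rule power2_le_imp_le) simp
qed

lemma act_diff: "act x (v - w) = act x v - act x w"
  by (rule poly_mapping_eqI) (simp add: lookup_minus right_diff_distrib)

definition L :: "'a \<Rightarrow> 'h \<Rightarrow> 'h" where
  "L x = V.ext (act x)"

lemma L_K: assumes "V.cau s" shows "V.cau (\<lambda>n. act x (s n))" "L x (V.K s) = V.K (\<lambda>n. act x (s n))"
  unfolding L_def using V.ext_K[of "act x" "Q x" s] act_diff N_act assms by blast+

lemma L_closed: "\<xi> \<in> carrier V.H \<Longrightarrow> L x \<xi> \<in> carrier V.H"
  by (auto elim!: V.HE simp: L_K)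

lemma L_vec_add: "\<xi> \<in> carrier V.H \<Longrightarrow> \<eta> \<in> carrier V.H \<Longrightarrow> L x (\<xi> \<oplus>\<^bsub>V.H\<^esub> \<eta>) = L x \<xi> \<oplus>\<^bsub>V.H\<^esub> L x \<eta>"
proof -
  have "act x (v + w) = act x v + act x w" for v w
    by (rule poly_mapping_eqI) (simp add: lookup_add distrib_left)
  then show "\<xi> \<in> carrier V.H \<Longrightarrow> \<eta> \<in> carrier V.H \<Longrightarrow> L x (\<xi> \<oplus>\<^bsub>V.H\<^esub> \<eta>) = L x \<xi> \<oplus>\<^bsub>V.H\<^esub> L x \<eta>"
    by (auto elim!: V.HE simp: L_K V.H_ops)
qed

lemma L_vec_smult: "\<xi> \<in> carrier V.H \<Longrightarrow> L x (c \<odot>\<^bsub>V.H\<^esub> \<xi>) = c \<odot>\<^bsub>V.H\<^esub> L x \<xi>"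
proof -
  have "act x (act (cs c) v) = act (cs c) (act x v)" for v
    by (rule poly_mapping_eqI) (simp add: cs_left)
  then show "\<xi> \<in> carrier V.H \<Longrightarrow> L x (c \<odot>\<^bsub>V.H\<^esub> \<xi>) = c \<odot>\<^bsub>V.H\<^esub> L x \<xi>"
    by (auto elim!: V.HE simp: L_K V.H_ops)
qed

lemma L_add: "\<xi> \<in> carrier V.H \<Longrightarrow> L (x + y) \<xi> = L x \<xi> \<oplus>\<^bsub>V.H\<^esub> L y \<xi>"
proof -
  have "act (x + y) v = act x v + act y v" for v
    by (rule poly_mapping_eqI) (simp add: lookup_add distrib_right)
  then show "\<xi> \<in> carrier V.H \<Longrightarrow> L (x + y) \<xi> = L x \<xi> \<oplus>\<^bsub>V.H\<^esub> L y \<xi>"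
    by (auto elim!: V.HE simp: L_K V.H_ops)
qed

lemma L_mult: "\<xi> \<in> carrier V.H \<Longrightarrow> L (x * y) \<xi> = L x (L y \<xi>)"
proof -
  have "act (x * y) v = act x (act y v)" for v
    by (rule poly_mapping_eqI) (simp add: mult.assoc)
  then show "\<xi> \<in> carrier V.H \<Longrightarrow> L (x * y) \<xi> = L x (L y \<xi>)"
    by (auto elim!: V.HE simp: L_K)
qed

lemma L_cs: "\<xi> \<in> carrier V.H \<Longrightarrow> L (cs c) \<xi> = c \<odot>\<^bsub>V.H\<^esub> \<xi>"
  by (auto elim!: V.HE simp: L_K V.H_ops)

lemma L_1: "\<xi> \<in> carrier V.H \<Longrightarrow> L 1 \<xi> = \<xi>"
proof -
  have "act 1 v = v" for v
    by (rule poly_mapping_eqI) simp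
  then show "\<xi> \<in> carrier V.H \<Longrightarrow> L 1 \<xi> = \<xi>"
    by (auto elim!: V.HE simp: L_K)
qed

lemma L_0: "\<xi> \<in> carrier V.H \<Longrightarrow> L 0 \<xi> = \<zero>\<^bsub>V.H\<^esub>"
proof -
  have "act 0 v = 0" for v
    by (rule poly_mapping_eqI) simp
  then show "\<xi> \<in> carrier V.H \<Longrightarrow> L 0 \<xi> = \<zero>\<^bsub>V.H\<^esub>"
    by (auto elim!: V.HE simp: L_K V.H_ops)
qed

lemma L_adjoint:
  "\<xi> \<in> carrier V.H \<Longrightarrow> \<eta> \<in> carrier V.H \<Longrightarrow> cinner V.H (L x \<xi>) \<eta> = cinner V.H \<xi> (L (st x) \<eta>)"
proof (elim V.HE)
  fix s t assume st: "V.cau s" "\<xi> = V.K s" "V.cau t" "\<eta> = V.K t"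
  then show ?thesis
    using V.H_cinner[OF st(1) L_K(1)[OF st(3), of "st x"]]
    by (simp add: L_K) (rule V.H_cinner_eqI; simp add: L_K form_act)
qed

lemma hnorm_L: assumes "\<xi> \<in> carrier V.H" shows "hnorm V.H (L x \<xi>) \<le> Q x * hnorm V.H \<xi>"
proof -
  obtain s where s: "V.cau s" "\<xi> = V.K s" using assms by (rule V.HE)
  show ?thesis
    using LIMSEQ_le[OF V.hnorm_H[OF L_K(1)[OF s(1), of x]] tendsto_mult_left[OF V.hnorm_H[OF s(1)], of "Q x"]]
      N_act s by (simp add: L_K)
qed

text \<open>Turns relations that hold only up to seminorm 0 into identities of operators.\<close>

lemma L_cong: assumes "Q (x - y) = 0" "\<xi> \<in> carrier V.H" shows "L x \<xi> = L y \<xi>"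
proof -
  obtain s where s: "V.cau s" "\<xi> = V.K s" using assms(2) by (rule V.HE)
  have "V.N (act x (s n) - act y (s n)) = 0" for n
  proof -
    have "act x (s n) - act y (s n) = act (x - y) (s n)"
      by (rule poly_mapping_eqI) (simp add: lookup_minus left_diff_distrib)
    then show ?thesis using N_act[of "x - y" "s n"] assms(1) V.N_nonneg[of "act (x - y) (s n)"] by simp
  qed
  then show ?thesis using s by (simp add: L_K V.K_eq_iff V.equiv_seq_def)
qed

text \<open>The vector is the unit in position \<open>x\<close>: it has norm 1, and the state there
  gives its image the square norm \<open>(Q x)\<^sup>2\<close>.\<close>

lemma L_attained: "\<exists>\<xi>\<in>carrier V.H. hnorm V.H \<xi> = 1 \<and> hnorm V.H (L x \<xi>) = Q x"
proof -
  define d where "d = Poly_Mapping.single x (1 :: 'a)"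
  have hn: "hnorm V.H (V.K (\<lambda>_. v)) = V.N v" for v
    using V.hnorm_H[OF V.cau_const[of v]] by (simp add: LIMSEQ_const_iff)
  have "(V.N (act x d))\<^sup>2 = (Q x)\<^sup>2" "(V.N d)\<^sup>2 = 1"
    using keys_act[of x d] \<omega>(2)[of x] \<omega>_1[of x]
    by (simp_all add: V.N_square form_superset[of "{x}"] d_def del: of_real_power)
  then have "V.N (act x d) = Q x" "V.N d = 1"
    by (simp_all add: power2_eq_iff_nonneg power2_eq_1_iff) (metis V.N_nonneg neg_0_le_iff_le not_one_le_zero)
  then show ?thesis
    by (intro bexI[of _ "V.K (\<lambda>_. d)"]) (simp_all add: L_K hn)
qed

end

section \<open>Similarities from isometries with complementary ranges\<close>

context gns
begin

sublocale Hs: hilbert V.H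
  by (rule V.hilbert_H)

lemma L_sum:
  assumes "finite A" "\<xi> \<in> carrier V.H"
  shows "L (\<Sum>i\<in>A. f i) \<xi> = (\<Oplus>\<^bsub>V.H\<^esub>i\<in>A. L (f i) \<xi>)"
  using assms(1)
proof (induction A rule: finite_induct)
  case empty
  then show ?case using L_0[OF assms(2)] by (simp add: abelian_monoid.finsum_empty[OF Hs.am])
next
  case (insert a A)
  have "(\<Oplus>\<^bsub>V.H\<^esub>i\<in>insert a A. L (f i) \<xi>) = L (f a) \<xi> \<oplus>\<^bsub>V.H\<^esub> (\<Oplus>\<^bsub>V.H\<^esub>i\<in>A. L (f i) \<xi>)"
    using insert.hyps assms(2) L_closed by (intro abelian_monoid.finsum_insert[OF Hs.am]) auto
  then show ?case using insert assms(2) by (simp add: L_add)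
qed

lemma cinner_L_sum:
  assumes "finite A" "\<xi> \<in> carrier V.H" "\<eta> \<in> carrier V.H"
  shows "cinner V.H (L (\<Sum>i\<in>A. f i) \<xi>) \<eta> = (\<Sum>i\<in>A. cinner V.H (L (f i) \<xi>) \<eta>)"
  using assms(1)
  by (induction A rule: finite_induct) (use assms in \<open>simp_all add: L_0 Hs.cinner_zero_left L_add Hs.cinner_add L_closed\<close>)

lemma operator_norm_L: "(SUP \<xi>\<in>{\<xi> \<in> carrier V.H. hnorm V.H \<xi> \<le> 1}. hnorm V.H (L x \<xi>)) = Q x"
proof -
  let ?U = "{\<xi> \<in> carrier V.H. hnorm V.H \<xi> \<le> 1}"
  obtain \<zeta> where \<zeta>: "\<zeta> \<in> carrier V.H" "hnorm V.H \<zeta> = 1" "hnorm V.H (L x \<zeta>) = Q x"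
    using L_attained by blast
  have le: "hnorm V.H (L x \<xi>) \<le> Q x" if "\<xi> \<in> ?U" for \<xi>
    using hnorm_L[of \<xi> x] that mult_left_le[of "hnorm V.H \<xi>" "Q x"] by simp
  show ?thesis
  proof (rule antisym)
    show "(SUP \<xi>\<in>?U. hnorm V.H (L x \<xi>)) \<le> Q x"
      using \<zeta> le by (intro cSUP_least) auto
    have "hnorm V.H (L x \<zeta>) \<le> (SUP \<xi>\<in>?U. hnorm V.H (L x \<xi>))"
      using \<zeta> le by (intro cSUP_upper bdd_aboveI2[of _ _ "Q x"]) auto
    then show "Q x \<le> (SUP \<xi>\<in>?U. hnorm V.H (L x \<xi>))" using \<zeta>(3) by simp
  qed
qed

lemma L_isometry:
  assumes "Q (st u * u - 1) = 0" "\<xi> \<in> carrier V.H"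
  shows "L (st u) (L u \<xi>) = \<xi>"
  using assms L_cong[of "st u * u" 1 \<xi>] by (simp add: L_mult L_1)

lemma cinner_L_isometry:
  assumes "Q (st u * u - 1) = 0" "\<xi> \<in> carrier V.H" "\<eta> \<in> carrier V.H"
  shows "cinner V.H (L u \<xi>) (L u \<eta>) = cinner V.H \<xi> \<eta>"
  using assms by (simp add: L_adjoint L_closed L_isometry)

lemma hilbert_iso_L:
  assumes "Q (st u * u - 1) = 0" "Q (u * st u - 1) = 0"
  shows "hilbert_iso V.H V.H (L u)"
proof -
  have "bij_betw (L u) (carrier V.H) (carrier V.H)"
    using assms L_isometry[of u] L_isometry[of "st u"] L_closed
    by (intro bij_betw_byWitness[of _ "L (st u)"]) auto
  then show ?thesis
    using assms(1) by (simp add: hilbert_iso_def L_vec_add L_vec_smult cinner_L_isometry)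
qed

context
  fixes a :: "'x::finite \<Rightarrow> 'a"
  assumes isometry: "\<And>x. Q (st (a x) * a x - 1) = 0"
    and ranges_sum: "Q ((\<Sum>x\<in>UNIV. a x * st (a x)) - 1) = 0"
begin

lemma Parseval:
  assumes "\<xi> \<in> carrier V.H" "\<eta> \<in> carrier V.H"
  shows "(\<Sum>x\<in>UNIV. cinner V.H (L (st (a x)) \<xi>) (L (st (a x)) \<eta>)) = cinner V.H \<xi> \<eta>"
proof -
  have "(\<Sum>x\<in>UNIV. cinner V.H (L (st (a x)) \<xi>) (L (st (a x)) \<eta>)) = (\<Sum>x\<in>UNIV. cinner V.H (L (a x * st (a x)) \<xi>) \<eta>)"
    using assms by (simp add: L_mult L_adjoint[of _ _ "a _"] L_closed)
  also have "\<dots> = cinner V.H (L (\<Sum>x\<in>UNIV. a x * st (a x)) \<xi>) \<eta>"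
    using assms by (simp add: cinner_L_sum)
  also have "L (\<Sum>x\<in>UNIV. a x * st (a x)) \<xi> = \<xi>"
    using L_cong[OF ranges_sum assms(1)] assms by (simp add: L_1)
  finally show ?thesis .
qed

text \<open>By \<open>Parseval\<close> the coordinates of \<open>L (a x) \<xi>\<close> share its
  square norm, and coordinate \<open>x\<close> alone already exhausts it because \<open>a x\<close>
  is an isometry. Hence the other coordinates vanish.\<close>

lemma orthogonal_ranges:
  assumes "x \<noteq> y" "\<xi> \<in> carrier V.H" shows "L (st (a y)) (L (a x) \<xi>) = \<zero>\<^bsub>V.H\<^esub>"
proof (rule ccontr)
  let ?t = "\<lambda>z. Re (cinner V.H (L (st (a z)) (L (a x) \<xi>)) (L (st (a z)) (L (a x) \<xi>)))"
  assume ne: "L (st (a y)) (L (a x) \<xi>) \<noteq> \<zero>\<^bsub>V.H\<^esub>"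
  have nonneg: "0 \<le> ?t z" for z
    using Hs.hnorm_square[of "L (st (a z)) (L (a x) \<xi>)"] assms(2) L_closed by (metis zero_le_power2)
  have "(\<Sum>z\<in>UNIV. ?t z) = Re (cinner V.H (L (a x) \<xi>) (L (a x) \<xi>))"
    using Parseval[of "L (a x) \<xi>" "L (a x) \<xi>"] assms(2) L_closed by (simp flip: Re_sum)
  also have "\<dots> = ?t x"
    using assms(2) isometry by (simp add: cinner_L_isometry L_isometry)
  finally have "(\<Sum>z\<in>UNIV. ?t z) = ?t x" .
  moreover have "(\<Sum>z\<in>{x, y}. ?t z) \<le> (\<Sum>z\<in>UNIV. ?t z)"
    using nonneg by (intro sum_mono2) auto
  ultimately have "?t y \<le> 0" using assms(1) by simp
  then show False
    using Hs.cinner_pos[OF _ ne] assms(2) L_closed by (simp add: leD)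
qed

definition \<psi> :: "'h \<Rightarrow> 'x \<Rightarrow> 'h" where "\<psi> \<xi> = (\<lambda>x. L (st (a x)) \<xi>)"

lemma \<psi>_L: "\<xi> \<in> carrier V.H \<Longrightarrow> \<psi> (L (a x) \<xi>) = (\<lambda>y. if y = x then \<xi> else \<zero>\<^bsub>V.H\<^esub>)"
  using orthogonal_ranges isometry by (auto simp: \<psi>_def fun_eq_iff L_isometry)

text \<open>The two Cuntz relations say that \<psi> and the summation of the
  \<open>L (a x) (v x)\<close> are inverse to each other.\<close>

lemma bij_\<psi>: "bij_betw \<psi> (carrier V.H) {v. \<forall>x. v x \<in> carrier V.H}"
proof (rule bij_betw_byWitness[of _ "\<lambda>v. \<Oplus>\<^bsub>V.H\<^esub>x\<in>UNIV. L (a x) (v x)"])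
  show "\<forall>\<xi>\<in>carrier V.H. (\<Oplus>\<^bsub>V.H\<^esub>x\<in>UNIV. L (a x) (\<psi> \<xi> x)) = \<xi>"
  proof
    fix \<xi> assume \<xi>: "\<xi> \<in> carrier V.H"
    have "L (\<Sum>x\<in>UNIV. a x * st (a x)) \<xi> = \<xi>"
      using L_cong[OF ranges_sum \<xi>] \<xi> by (simp add: L_1)
    then show "(\<Oplus>\<^bsub>V.H\<^esub>x\<in>UNIV. L (a x) (\<psi> \<xi> x)) = \<xi>"
      using \<xi> by (simp add: L_sum L_mult \<psi>_def)
  qed
  show "\<forall>v\<in>{v. \<forall>x. v x \<in> carrier V.H}. \<psi> (\<Oplus>\<^bsub>V.H\<^esub>x\<in>UNIV. L (a x) (v x)) = v"
  proof (intro ballI ext)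
    fix v :: "'x \<Rightarrow> 'h" and y assume "v \<in> {v. \<forall>x. v x \<in> carrier V.H}"
    then have v: "v x \<in> carrier V.H" for x by simp
    have "\<psi> (\<Oplus>\<^bsub>V.H\<^esub>x\<in>UNIV. L (a x) (v x)) y = (\<Oplus>\<^bsub>V.H\<^esub>x\<in>UNIV. L (st (a y)) (L (a x) (v x)))"
      unfolding \<psi>_def using v L_closed L_vec_add
      by (intro module_hom_finsum[OF Hs.add_group_H Hs.add_group_H]) auto
    also have "(\<lambda>x. L (st (a y)) (L (a x) (v x))) = (\<lambda>x. if y = x then v x else \<zero>\<^bsub>V.H\<^esub>)"
      using v isometry orthogonal_ranges by (auto simp: fun_eq_iff L_isometry)
    also have "(\<Oplus>\<^bsub>V.H\<^esub>x\<in>UNIV. if y = x then v x else \<zero>\<^bsub>V.H\<^esub>) = v y"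
      using v by (intro abelian_monoid.finsum_singleton[OF Hs.am]) auto
    finally show "\<psi> (\<Oplus>\<^bsub>V.H\<^esub>x\<in>UNIV. L (a x) (v x)) y = v y" .
  qed
  show "\<psi> ` carrier V.H \<subseteq> {v. \<forall>x. v x \<in> carrier V.H}"
    using L_closed by (auto simp: \<psi>_def)
  show "(\<lambda>v. \<Oplus>\<^bsub>V.H\<^esub>x\<in>UNIV. L (a x) (v x)) ` {v. \<forall>x. v x \<in> carrier V.H} \<subseteq> carrier V.H"
    using L_closed by (auto intro!: abelian_monoid.finsum_closed[OF Hs.am])
qed

lemma hilbert_iso_\<psi>: "hilbert_iso V.H (hilbert_power V.H) \<psi>"
  unfolding hilbert_iso_def
proof (intro conjI ballI allI)
  show "bij_betw \<psi> (carrier V.H) (carrier (hilbert_power V.H))"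
    using bij_\<psi> by (simp add: hilbert_power_def)
  fix \<xi> \<eta> c assume *: "\<xi> \<in> carrier V.H"
  show "\<psi> (c \<odot>\<^bsub>V.H\<^esub> \<xi>) = c \<odot>\<^bsub>hilbert_power V.H\<^esub> \<psi> \<xi>"
    using * by (simp add: \<psi>_def hilbert_power_def L_vec_smult)
  assume **: "\<eta> \<in> carrier V.H"
  show "\<psi> (\<xi> \<oplus>\<^bsub>V.H\<^esub> \<eta>) = \<psi> \<xi> \<oplus>\<^bsub>hilbert_power V.H\<^esub> \<psi> \<eta>"
    using * ** by (simp add: \<psi>_def hilbert_power_def L_vec_add)
  show "cinner (hilbert_power V.H) (\<psi> \<xi>) (\<psi> \<eta>) = cinner V.H \<xi> \<eta>"
    using Parseval[OF * **] by (simp add: \<psi>_def hilbert_power_def)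
qed

lemma similarity_shift_L:
  assumes "\<xi> \<in> carrier V.H" shows "similarity_shift V.H \<psi> x \<xi> = L (a x) \<xi>"
  unfolding similarity_shift_def \<psi>_L[OF assms, symmetric]
  using bij_\<psi> L_closed[OF assms] by (simp add: bij_betw_def)

text \<open>For two distinct letters, the adjoint of \<open>a y\<close> is onto and yet kills the
  nonzero range of \<open>a x\<close>.\<close>

lemma infinite_dimensional_H: assumes "2 \<le> CARD('x)" shows "infinite_dimensional V.H"
  unfolding infinite_dimensional_def
proof (rule notI, elim exE conjE)
  fix S assume S: "finite S" "S \<subseteq> carrier V.H" "\<forall>v\<in>carrier V.H. \<exists>c. v = (\<Oplus>\<^bsub>V.H\<^esub>s\<in>S. c s \<odot>\<^bsub>V.H\<^esub> s)"
  obtain x y :: 'x where xy: "x \<noteq> y"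
    using assms card_le_Suc0_iff_eq[of "UNIV :: 'x set"] by fastforce
  obtain \<eta> where \<eta>: "\<eta> \<in> carrier V.H" "hnorm V.H \<eta> = 1"
    using L_attained by blast
  let ?\<zeta> = "L (a x) \<eta>"
  have "?\<zeta> \<noteq> \<zero>\<^bsub>V.H\<^esub>"
  proof
    assume "?\<zeta> = \<zero>\<^bsub>V.H\<^esub>"
    then have "cinner V.H \<eta> \<eta> = 0"
      using cinner_L_isometry[OF isometry \<eta>(1) \<eta>(1), of x] Hs.cinner_zero_left[OF L_closed[OF \<eta>(1)], of "a x"] by simp
    then show False using \<eta>(2) by (simp add: hnorm_def)
  qed
  moreover have "\<exists>w\<in>carrier V.H. L (st (a y)) w = v" if "v \<in> carrier V.H" for v
    using L_isometry[OF isometry that, of y] L_closed[OF that] by blast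
  ultimately have "\<not> (\<forall>v\<in>carrier V.H. \<exists>c. v = (\<Oplus>\<^bsub>V.H\<^esub>s\<in>S. c s \<odot>\<^bsub>V.H\<^esub> s))"
    using S(1,2) \<eta>(1) L_closed orthogonal_ranges[OF xy \<eta>(1)]
    by (intro no_finite_span[OF V.module_H, of "L (st (a y))" ?\<zeta>]) (auto simp: L_vec_add L_vec_smult)
  then show False using S(3) by blast
qed

lemma similarity_\<psi>: "2 \<le> CARD('x) \<Longrightarrow> similarity V.H \<psi>"
  by (simp add: similarity_def V.hilbert_H infinite_dimensional_H hilbert_iso_\<psi>)

end

end

section \<open>Self-similar representations from C*-seminorms\<close>

lemma cstar_seminorm_cong:
  assumes "star_algebra A" "cstar_seminorm A p" "\<And>a. a \<in> carrier A \<Longrightarrow> p' a = p a"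
  shows "cstar_seminorm A p'"
proof -
  interpret star_algebra A by fact
  show ?thesis
    using assms(2) unfolding cstar_seminorm_def by (simp add: assms(3) ring_rules(1,5) star_closed)
qed

text \<open>Agreement on the carrier is all that is known of \<open>rep_seminorm\<close> and
  \<open>p\<close>, so the completions are compared by an isomorphism instead of being equated as
  records.\<close>

lemma same_completion_cong:
  assumes G: "group G" and p: "cstar_seminorm (group_algebra G) p"
    and eq: "\<And>f. f \<in> carrier (group_algebra G) \<Longrightarrow> p' f = p f"
  shows "same_completion G (group_completion G p) (completion_unitary G p)
    (group_completion G p') (completion_unitary G p')"
proof -
  interpret CG: star_algebra "group_algebra G" by (rule star_algebra_group_algebra[OF G])
  have p': "cstar_seminorm (group_algebra G) p'"
    by (rule cstar_seminorm_cong[OF CG.star_algebra_axioms p eq])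
  interpret p: seminormed_star_algebra "group_algebra G" p by unfold_locales (rule p)
  interpret p': seminormed_star_algebra "group_algebra G" p' by unfold_locales (rule p')
  define \<Phi> where "\<Phi> = (\<lambda>P. completion_class (group_algebra G) p' (class_rep P))"
  have hom: "star_hom p.C p'.C \<Phi>"
    and cls: "\<And>s. p.cauchy s \<Longrightarrow> p'.cauchy s \<and> \<Phi> (p.cls s) = p'.cls s"
    using completion_map[OF CG.star_algebra_axioms p p'] eq unfolding \<Phi>_def by simp_all
  have cau: "p.cauchy s" if "p'.cauchy s" for s
    using completion_map(2)[OF CG.star_algebra_axioms p' p] eq that by simp
  have diff: "p' (s n \<ominus>\<^bsub>group_algebra G\<^esub> t n) = p (s n \<ominus>\<^bsub>group_algebra G\<^esub> t n)"
    if "p.cauchy s" "p.cauchy t" for s t n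
    using that by (intro eq) (simp add: CG.ring_rules(4))
  have "inj_on \<Phi> (carrier p.C)"
  proof (rule inj_onI)
    fix P Q assume PQ: "P \<in> carrier p.C" "Q \<in> carrier p.C" "\<Phi> P = \<Phi> Q"
    obtain s t where s: "p.cauchy s" "P = p.cls s" and t: "p.cauchy t" "Q = p.cls t"
      using PQ(1,2) by (meson p.completionE)
    then show "P = Q" using PQ(3) cls diff by (simp add: p.class_eq_iff p'.class_eq_iff)
  qed
  moreover have "\<Phi> ` carrier p.C = carrier p'.C"
  proof
    show "carrier p'.C \<subseteq> \<Phi> ` carrier p.C"
    proof
      fix P assume "P \<in> carrier p'.C"
      then obtain s where "p'.cauchy s" "P = p'.cls s" by (rule p'.completionE)
      then show "P \<in> \<Phi> ` carrier p.C"
        using cau cls by (intro image_eqI[of _ _ "p.cls s"]) simp_all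
    qed
  qed (use star_hom_closed[OF hom] in blast)
  moreover have "nrm p'.C (\<Phi> P) = nrm p.C P" if P: "P \<in> carrier p.C" for P
  proof -
    obtain s where s: "p.cauchy s" "P = p.cls s" using P by (rule p.completionE)
    have "(\<lambda>n. p' (s n)) = (\<lambda>n. p (s n))" using s eq by auto
    then show ?thesis
      using p.completion_nrm[OF s(1)] cls s by (simp add: p'.completion_nrm_eqI)
  qed
  ultimately have "cstar_iso p.C p'.C \<Phi>"
    using hom by (simp add: cstar_iso_def bij_betw_def)
  moreover have "\<Phi> (completion_unitary G p g) = completion_unitary G p' g" if "g \<in> carrier G" for g
    using group_algebra_point_mass(1)[OF G that] cls
    by (simp add: completion_unitary_def p.embed_cauchy p'.embed_cauchy)
  ultimately show ?thesis
    unfolding same_completion_def group_completion_def by blast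
qed

lemma restrict_gens_sum:
  assumes "finite A"
  shows "restrict_gens S (\<Sum>i\<in>A. f i) = (\<Oplus>\<^bsub>free_star_algebra S\<^esub>i\<in>A. restrict_gens S (f i))"
proof -
  interpret F: star_algebra "free_star_algebra S" by (rule star_algebra_free)
  note am = abelian_group.axioms(1)[OF F.ag]
  show ?thesis
    using assms
  proof (induction A rule: finite_induct)
    case empty
    have "restrict_gens S 0 = \<zero>\<^bsub>free_star_algebra S\<^esub>"
      by (simp add: restrict_gens_def coeffs_simps(1) free_star_algebra_simps fun_eq_iff)
    then show ?case by (simp add: abelian_monoid.finsum_empty[OF am])
  next
    case (insert a A)
    have "(\<Oplus>\<^bsub>free_star_algebra S\<^esub>i\<in>insert a A. restrict_gens S (f i))
      = restrict_gens S (f a) \<oplus>\<^bsub>free_star_algebra S\<^esub> (\<Oplus>\<^bsub>free_star_algebra S\<^esub>i\<in>A. restrict_gens S (f i))"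
      using insert.hyps by (intro abelian_monoid.finsum_insert[OF am]) auto
    then show ?case using insert by (simp add: restrict_gens_add)
  qed
qed

section \<open>The self-similar representation attached to an admissible seminorm\<close>

context cp_extension
begin

definition QT :: "('g, 'x) cp_gen free_alg \<Rightarrow> real" where
  "QT x = q (restrict_gens (cp_gens G) x)"

text \<open>The target type consists of functions into sets of sequences. Exchanging time and index,
  and wrapping each sequence of coefficients in a singleton, fits a sequence of finitely supported
  families into it.\<close>

definition J :: "(nat \<Rightarrow> ('g, 'x) cp_gen free_alg \<Rightarrow>\<^sub>0 ('g, 'x) cp_gen free_alg) \<Rightarrow> ('g, 'x) cp_hilbert" where
  "J s = (\<lambda>f. {\<lambda>n. coeffs (Poly_Mapping.lookup (s n) (Abs_free_alg f))})"

lemma inj_J: "inj J"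
proof (rule injI)
  fix s t assume "J s = J t"
  then have "coeffs (Poly_Mapping.lookup (s n) (Abs_free_alg (coeffs a))) = coeffs (Poly_Mapping.lookup (t n) (Abs_free_alg (coeffs a)))" for n a
    by (simp add: J_def fun_eq_iff)
  then have "s n = t n" for n
    by (intro poly_mapping_eqI) (simp add: coeffs_inverse coeffs_inject)
  then show "s = t" by auto
qed

lemma QT_1: "QT 1 = 1"
proof -
  interpret QT: cstar_seminormed free_const free_adjoint QT
    using cstar_seminormed_restrict_gens[of "cp_gens G" q] Fq.seminorm
    unfolding QT_def[abs_def] cp_free_algebra_eq by blast
  show ?thesis
    using QT.Q_1_cases q_one by (simp add: QT_def restrict_gens_one cp_free_algebra_eq)
qed

sublocale W: gns free_const free_adjoint QT J
  using cstar_seminormed_restrict_gens[of "cp_gens G" q] Fq.seminorm QT_1 inj_J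
  unfolding QT_def[abs_def] cp_free_algebra_eq
  by (intro gns.intro gns_axioms.intro) simp_all

abbreviation gen' where "gen' g \<equiv> Abs_free_alg (gen g)"
abbreviation letter' where "letter' x \<equiv> Abs_free_alg (letter x)"

lemma restrict_gen: "g \<in> carrier G \<Longrightarrow> restrict_gens (cp_gens G) (gen' g) = gen g"
  and restrict_letter: "restrict_gens (cp_gens G) (letter' x) = letter x"
  using restrict_gens_surj[of "gen g" "cp_gens G"] restrict_gens_surj[of "letter x" "cp_gens G"]
    cp_gen_closed(1)[of g G] cp_gen_closed(2)[of x G]
  by (simp_all add: cp_free_algebra_eq)

lemmas restrict_simps = restrict_gens_diff[of "cp_gens G", folded cp_free_algebra_eq]
  restrict_gens_mult[of "cp_gens G", folded cp_free_algebra_eq]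
  restrict_gens_one[of "cp_gens G", folded cp_free_algebra_eq]
  restrict_gens_adjoint[of "cp_gens G", folded cp_free_algebra_eq]
  restrict_gens_sum[of UNIV "cp_gens G", folded cp_free_algebra_eq] restrict_gen restrict_letter

lemma QT_relations:
  "\<And>g h. g \<in> carrier G \<Longrightarrow> h \<in> carrier G \<Longrightarrow> QT (gen' g * gen' h - gen' (g \<otimes> h)) = 0"
  "\<And>g. g \<in> carrier G \<Longrightarrow> QT (free_adjoint (gen' g) * gen' g - 1) = 0"
  "\<And>g. g \<in> carrier G \<Longrightarrow> QT (gen' g * free_adjoint (gen' g) - 1) = 0"
  "\<And>x. QT (free_adjoint (letter' x) * letter' x - 1) = 0"
  "QT ((\<Sum>x\<in>UNIV. letter' x * free_adjoint (letter' x)) - 1) = 0"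
  "\<And>g h x y. g \<in> carrier G \<Longrightarrow> h \<in> carrier G \<Longrightarrow> restricts act g x y h \<Longrightarrow>
     QT (gen' g * letter' x - letter' y * gen' h) = 0"
  using cp_admissible_relations[OF admissible]
  by (simp_all add: QT_def restrict_simps F.ring_rules(5))

definition \<rho> :: "'g \<Rightarrow> ('g, 'x) cp_hilbert \<Rightarrow> ('g, 'x) cp_hilbert" where
  "\<rho> g = W.L (gen' g)"

lemma unitary_rep_\<rho>: "unitary_rep G W.V.H \<rho>"
  unfolding unitary_rep_def \<rho>_def
  using W.hilbert_iso_L QT_relations(2,3) W.L_cong[OF QT_relations(1)] by (simp flip: W.L_mult)

lemma self_similar_rep_\<rho>: assumes "2 \<le> CARD('x)" shows "self_similar_rep G act W.V.H \<rho>"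
proof -
  note cuntz = QT_relations(4,5)
  have "\<rho> g (similarity_shift W.V.H (W.\<psi> letter') x \<xi>) = similarity_shift W.V.H (W.\<psi> letter') y (\<rho> h \<xi>)"
    if "g \<in> carrier G" "h \<in> carrier G" "restricts act g x y h" "\<xi> \<in> carrier W.V.H" for g h x y \<xi>
    using W.L_cong[OF QT_relations(6)[OF that(1-3)] that(4)] that(4)
    by (simp add: W.similarity_shift_L[OF cuntz] W.L_closed \<rho>_def W.L_mult)
  then show ?thesis
    using unitary_rep_\<rho> W.similarity_\<psi>[OF cuntz assms] unfolding self_similar_rep_def by blast
qed

text \<open>The operator of \<open>f\<close> is \<open>L x\<close> for the element \<open>x\<close>
  of the free algebra that corresponds to \<open>\<iota> f\<close>; its operator norm is
  \<open>q (\<iota> f)\<close>.\<close>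

lemma rep_seminorm_\<rho>:
  assumes "f \<in> carrier (group_algebra G)" shows "rep_seminorm W.V.H \<rho> f = p f"
proof -
  let ?K = "{g. f g \<noteq> 0}"
  have K: "finite ?K" "?K \<subseteq> carrier G"
    using assms by (auto simp: group_algebra_def monoid_star_algebra_simps)
  define x where "x = (\<Sum>g\<in>?K. free_const (f g) * gen' g)"
  have "(\<Oplus>\<^bsub>W.V.H\<^esub>g\<in>?K. f g \<odot>\<^bsub>W.V.H\<^esub> \<rho> g \<xi>) = W.L x \<xi>" if "\<xi> \<in> carrier W.V.H" for \<xi>
    using that K by (simp add: x_def W.L_sum W.L_mult W.L_cs W.L_closed \<rho>_def)
  then have "rep_seminorm W.V.H \<rho> f = (SUP \<xi>\<in>{\<xi> \<in> carrier W.V.H. hnorm W.V.H \<xi> \<le> 1}. hnorm W.V.H (W.L x \<xi>))"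
    unfolding rep_seminorm_def by (intro SUP_cong refl) simp
  also have "\<dots> = q (restrict_gens (cp_gens G) x)" unfolding W.operator_norm_L by (simp add: QT_def)
  also have "restrict_gens (cp_gens G) x = (\<Oplus>\<^bsub>F\<^esub>g\<in>?K. f g \<odot>\<^bsub>F\<^esub> restrict_gens (cp_gens G) (gen' g))"
    unfolding x_def cp_free_algebra_eq by (simp add: restrict_gens_sum K(1) restrict_gens_const)
  also have "\<dots> = \<iota> f"
    unfolding group_algebra_map_def using K gen_closed
    by (intro abelian_monoid.finsum_cong'[OF abelian_group.axioms(1)[OF F.ag]]) (auto simp: restrict_gen subset_iff)
  finally show ?thesis using q_\<iota>[OF assms] by simp
qed

theorem self_similar:
  assumes "2 \<le> CARD('x)" shows "self_similar_completion TYPE(('g, 'x) cp_hilbert) G act p"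
  unfolding self_similar_completion_def
  using self_similar_rep_\<rho>[OF assms] same_completion_cong[OF is_group p rep_seminorm_\<rho>] by blast

end

section \<open>The operator seminorm of a *-representation\<close>

locale hilbert_rep = A: star_algebra A + H: hilbert H
  for A :: "('a, 'm) star_alg_scheme" and H :: "('h, 'n) hilbert_space_scheme" +
  fixes L :: "'a \<Rightarrow> 'h \<Rightarrow> 'h"
  assumes L_closed: "a \<in> carrier A \<Longrightarrow> v \<in> carrier H \<Longrightarrow> L a v \<in> carrier H"
    and L_vec_smult: "a \<in> carrier A \<Longrightarrow> v \<in> carrier H \<Longrightarrow> L a (c \<odot>\<^bsub>H\<^esub> v) = c \<odot>\<^bsub>H\<^esub> L a v"
    and L_add: "a \<in> carrier A \<Longrightarrow> b \<in> carrier A \<Longrightarrow> v \<in> carrier H \<Longrightarrow> L (a \<oplus>\<^bsub>A\<^esub> b) v = L a v \<oplus>\<^bsub>H\<^esub> L b v"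
    and L_smult: "a \<in> carrier A \<Longrightarrow> v \<in> carrier H \<Longrightarrow> L (c \<odot>\<^bsub>A\<^esub> a) v = c \<odot>\<^bsub>H\<^esub> L a v"
    and L_mult: "a \<in> carrier A \<Longrightarrow> b \<in> carrier A \<Longrightarrow> v \<in> carrier H \<Longrightarrow> L (a \<otimes>\<^bsub>A\<^esub> b) v = L a (L b v)"
    and L_adjoint: "a \<in> carrier A \<Longrightarrow> v \<in> carrier H \<Longrightarrow> w \<in> carrier H \<Longrightarrow>
      cinner H (L a v) w = cinner H v (L (star A a) w)"
    and L_bounded: "a \<in> carrier A \<Longrightarrow> \<exists>M. \<forall>v\<in>carrier H. hnorm H (L a v) \<le> M * hnorm H v"
begin

definition opn :: "'a \<Rightarrow> real" where
  "opn a = (SUP v\<in>{v \<in> carrier H. hnorm H v \<le> 1}. hnorm H (L a v))"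

lemma opn_upper: assumes a: "a \<in> carrier A" and v: "v \<in> carrier H" "hnorm H v \<le> 1" shows "hnorm H (L a v) \<le> opn a"
  unfolding opn_def
proof (rule cSUP_upper)
  obtain M where M: "\<And>v. v \<in> carrier H \<Longrightarrow> hnorm H (L a v) \<le> M * hnorm H v"
    using L_bounded[OF a] by blast
  have "hnorm H (L a w) \<le> \<bar>M\<bar>" if "w \<in> carrier H" "hnorm H w \<le> 1" for w
  proof -
    have "M * hnorm H w \<le> \<bar>M\<bar> * 1"
      using that H.hnorm_nonneg[OF that(1)] by (intro mult_mono) auto
    then show ?thesis using M[OF that(1)] by simp
  qed
  then show "bdd_above ((\<lambda>v. hnorm H (L a v)) ` {v \<in> carrier H. hnorm H v \<le> 1})"
    by (intro bdd_aboveI2[of _ _ "\<bar>M\<bar>"]) auto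
qed (use v in auto)

lemma L_vec_zero: assumes "a \<in> carrier A" shows "L a \<zero>\<^bsub>H\<^esub> = \<zero>\<^bsub>H\<^esub>"
  using L_vec_smult[OF assms H.vec_zero_closed, of 0] H.smult_l_null[OF H.vec_zero_closed]
    H.smult_l_null[OF L_closed[OF assms H.vec_zero_closed]] by simp

lemma opn_nonneg: "a \<in> carrier A \<Longrightarrow> 0 \<le> opn a"
  using opn_upper[OF _ H.vec_zero_closed, of a] by (simp add: L_vec_zero H.hnorm_zero)

lemma opn_bound:
  assumes a: "a \<in> carrier A" and v: "v \<in> carrier H" shows "hnorm H (L a v) \<le> opn a * hnorm H v"
proof (cases "hnorm H v = 0")
  case True
  then have "v = \<zero>\<^bsub>H\<^esub>" using H.cinner_pos[OF v] H.hnorm_square[OF v] by fastforce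
  then show ?thesis using a by (simp add: L_vec_zero H.hnorm_zero)
next
  case False
  then have pos: "0 < hnorm H v" using H.hnorm_nonneg[OF v] by simp
  let ?c = "complex_of_real (1 / hnorm H v)"
  have "hnorm H (L a (?c \<odot>\<^bsub>H\<^esub> v)) \<le> opn a"
    using pos v by (intro opn_upper a H.vec_smult_closed) (simp_all add: H.hnorm_smult norm_divide)
  then show ?thesis
    using pos a v by (simp add: L_vec_smult H.hnorm_smult L_closed norm_divide field_simps)
qed

lemma opn_least:
  assumes "0 \<le> c" "\<And>v. v \<in> carrier H \<Longrightarrow> hnorm H (L a v) \<le> c * hnorm H v" shows "opn a \<le> c"
  unfolding opn_def
proof (rule cSUP_least)
  show "{v \<in> carrier H. hnorm H v \<le> 1} \<noteq> {}"
    using H.vec_zero_closed H.hnorm_zero by force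
  show "hnorm H (L a v) \<le> c" if "v \<in> {v \<in> carrier H. hnorm H v \<le> 1}" for v
    using assms(2)[of v] mult_left_le[of "hnorm H v" c] that assms(1) by simp
qed

text \<open>Only the C*-identity goes beyond routine estimates: the square norm of
  \<open>L a v\<close> is the inner product of \<open>v\<close> with
  \<open>L (star A a \<otimes> a) v\<close>, to which Cauchy-Schwarz applies.\<close>

theorem cstar_seminorm_opn: "cstar_seminorm A opn"
proof -
  have smult_le: "opn (c \<odot>\<^bsub>A\<^esub> a) \<le> cmod c * opn a" if a: "a \<in> carrier A" for a c
  proof (rule opn_least)
    show "hnorm H (L (c \<odot>\<^bsub>A\<^esub> a) v) \<le> cmod c * opn a * hnorm H v" if v: "v \<in> carrier H" for v
      using opn_bound[OF a v] a v by (simp add: L_smult H.hnorm_smult L_closed mult.assoc mult_left_mono)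
  qed (simp add: opn_nonneg a)
  have add: "opn (a \<oplus>\<^bsub>A\<^esub> b) \<le> opn a + opn b" if "a \<in> carrier A" "b \<in> carrier A" for a b
  proof (rule opn_least)
    show "hnorm H (L (a \<oplus>\<^bsub>A\<^esub> b) v) \<le> (opn a + opn b) * hnorm H v" if v: "v \<in> carrier H" for v
      using opn_bound[OF \<open>a \<in> _\<close> v] opn_bound[OF \<open>b \<in> _\<close> v] H.hnorm_add[of "L a v" "L b v"] \<open>a \<in> _\<close> \<open>b \<in> _\<close> v
      by (simp add: L_add L_closed algebra_simps)
  qed (simp add: opn_nonneg that)
  have mult: "opn (a \<otimes>\<^bsub>A\<^esub> b) \<le> opn a * opn b" if a: "a \<in> carrier A" and b: "b \<in> carrier A" for a b
  proof (rule opn_least)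
    show "hnorm H (L (a \<otimes>\<^bsub>A\<^esub> b) v) \<le> opn a * opn b * hnorm H v" if v: "v \<in> carrier H" for v
    proof -
      have "hnorm H (L a (L b v)) \<le> opn a * hnorm H (L b v)" using a b v by (intro opn_bound L_closed)
      also have "\<dots> \<le> opn a * (opn b * hnorm H v)"
        using a b v by (intro mult_left_mono opn_bound opn_nonneg)
      finally show ?thesis using a b v by (simp add: L_mult mult.assoc)
    qed
  qed (simp add: opn_nonneg that)
  have square: "(opn a)\<^sup>2 \<le> opn (star A a \<otimes>\<^bsub>A\<^esub> a)" if a: "a \<in> carrier A" for a
  proof -
    let ?b = "star A a \<otimes>\<^bsub>A\<^esub> a"
    have b: "?b \<in> carrier A" using a A.star_closed by (simp add: A.ring_rules)
    have "opn a \<le> sqrt (opn ?b)"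
    proof (rule opn_least)
      fix v assume v: "v \<in> carrier H"
      have "cinner H (L a v) (L a v) = cinner H v (L ?b v)"
        using a v A.star_closed by (simp add: L_adjoint L_mult L_closed)
      then have "(hnorm H (L a v))\<^sup>2 \<le> cmod (cinner H v (L ?b v))"
        using a v complex_Re_le_cmod[of "cinner H v (L ?b v)"] by (simp add: H.hnorm_square L_closed)
      also have "\<dots> \<le> hnorm H v * hnorm H (L ?b v)"
        using b v by (intro H.Cauchy_Schwarz L_closed)
      also have "\<dots> \<le> hnorm H v * (opn ?b * hnorm H v)"
        using b v by (intro mult_left_mono opn_bound H.hnorm_nonneg)
      also have "\<dots> = (sqrt (opn ?b) * hnorm H v)\<^sup>2"
        using opn_nonneg[OF b] by (simp add: power_mult_distrib power2_eq_square mult_ac)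
      finally show "hnorm H (L a v) \<le> sqrt (opn ?b) * hnorm H v"
        by (rule power2_le_imp_le) (simp add: opn_nonneg b H.hnorm_nonneg v)
    qed (simp add: opn_nonneg b)
    then have "(opn a)\<^sup>2 \<le> (sqrt (opn ?b))\<^sup>2" using opn_nonneg[OF a] by (rule power_mono)
    then show ?thesis using opn_nonneg[OF b] by simp
  qed
  have le_star: "opn a \<le> opn (star A a)" if a: "a \<in> carrier A" for a
  proof (cases "opn a = 0")
    case False
    then have "0 < opn a" using opn_nonneg[OF a] by simp
    moreover have "opn a * opn a \<le> opn (star A a) * opn a"
      using square[OF a] mult[OF A.star_closed[OF a] a] by (simp add: power2_eq_square)
    ultimately show ?thesis by (rule mult_right_le_imp_le[rotated])
  qed (use a opn_nonneg A.star_closed in simp)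
  show ?thesis
    unfolding cstar_seminorm_def
  proof (intro conjI ballI allI)
    fix a c assume a: "a \<in> carrier A"
    show "0 \<le> opn a" by (rule opn_nonneg[OF a])
    show "opn (c \<odot>\<^bsub>A\<^esub> a) = cmod c * opn a"
    proof (cases "c = 0")
      case True
      then show ?thesis using smult_le[OF a, of 0] opn_nonneg[OF A.scale_closed[OF a, of 0]] by simp
    next
      case False
      have "(1 / c) \<odot>\<^bsub>A\<^esub> (c \<odot>\<^bsub>A\<^esub> a) = a"
        using A.smult_assoc1[of "1 / c" c a] A.smult_one[of a] a False by simp
      then have "opn a \<le> cmod (1 / c) * opn (c \<odot>\<^bsub>A\<^esub> a)"
        using smult_le[OF A.scale_closed[OF a, of c], of "1 / c"] by simp
      then have "cmod c * opn a \<le> opn (c \<odot>\<^bsub>A\<^esub> a)"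
        using False by (simp add: norm_divide field_simps)
      then show ?thesis using smult_le[OF a, of c] by simp
    qed
    have "opn (star A a) = opn a"
      using le_star[OF a] le_star[OF A.star_closed[OF a]] a by (simp add: A.star_star)
    then show "opn (star A a \<otimes>\<^bsub>A\<^esub> a) = (opn a)\<^sup>2"
      using square[OF a] mult[OF A.star_closed[OF a] a] by (simp add: power2_eq_square)
  qed (use add mult in auto)
qed

lemma opn_diff_eq_0:
  assumes a: "a \<in> carrier A" and b: "b \<in> carrier A" and eq: "\<And>v. v \<in> carrier H \<Longrightarrow> L a v = L b v"
  shows "opn (a \<ominus>\<^bsub>A\<^esub> b) = 0"
proof -
  have c: "a \<ominus>\<^bsub>A\<^esub> b \<in> carrier A" using a b by (simp add: A.ring_rules)
  have "opn (a \<ominus>\<^bsub>A\<^esub> b) \<le> 0"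
  proof (rule opn_least)
    fix v assume v: "v \<in> carrier H"
    have "L (a \<ominus>\<^bsub>A\<^esub> b) v = 1 \<odot>\<^bsub>H\<^esub> L b v \<oplus>\<^bsub>H\<^esub> (- 1) \<odot>\<^bsub>H\<^esub> L b v"
      using a b v eq H.smult_one[OF L_closed[OF b v]] by (simp add: a_minus_def A.minus_eq_smult L_add L_smult)
    also have "\<dots> = \<zero>\<^bsub>H\<^esub>"
      using H.smult_l_distr[of 1 "- 1" "L b v"] H.smult_l_null[OF L_closed[OF b v]] L_closed[OF b v] by simp
    finally show "hnorm H (L (a \<ominus>\<^bsub>A\<^esub> b) v) \<le> 0 * hnorm H v" by (simp add: H.hnorm_zero)
  qed simp
  then show ?thesis using opn_nonneg[OF c] by simp
qed

end

section \<open>Linear extension from a monoid to its algebra\<close>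

definition lin_ext :: "('h, 'n) hilbert_space_scheme \<Rightarrow> ('w \<Rightarrow> 'h) \<Rightarrow> ('w \<Rightarrow> complex) \<Rightarrow> 'h" where
  "lin_ext H U f = (\<Oplus>\<^bsub>H\<^esub>w\<in>{w. f w \<noteq> 0}. f w \<odot>\<^bsub>H\<^esub> U w)"

context hilbert
begin

context
  fixes M :: "('w, 'k) monoid_scheme" and \<sigma> :: "'w \<Rightarrow> 'w" and U :: "'w \<Rightarrow> 'h"
  assumes U: "\<And>w. w \<in> carrier M \<Longrightarrow> U w \<in> carrier H"
begin

lemma lin_ext_superset:
  assumes "finite K" "{w. f w \<noteq> 0} \<subseteq> K" "K \<subseteq> carrier M"
  shows "lin_ext H U f = (\<Oplus>w\<in>K. f w \<odot> U w)"
  unfolding lin_ext_def finsum_def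
proof (rule comm_monoid.finprod_mono_neutral_cong_left[OF _ assms(1,2)])
  show "comm_monoid (add_monoid H)" using am by (simp add: abelian_monoid_def)
  show "\<And>i. i \<in> K - {w. f w \<noteq> 0} \<Longrightarrow> f i \<odot> U i = \<one>\<^bsub>add_monoid H\<^esub>"
    using assms(3) U smult_l_null by auto
qed (use assms(3) U vec_smult_closed in auto)

lemma lin_ext_closed:
  "f \<in> carrier (monoid_star_algebra M \<sigma>) \<Longrightarrow> lin_ext H U f \<in> carrier H"
  unfolding lin_ext_def using U vec_smult_closed
  by (intro abelian_monoid.finsum_closed[OF am]) (auto simp: monoid_star_algebra_simps subset_iff)

lemma lin_ext_add:
  assumes "f \<in> carrier (monoid_star_algebra M \<sigma>)" "h \<in> carrier (monoid_star_algebra M \<sigma>)"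
  shows "lin_ext H U (f \<oplus>\<^bsub>monoid_star_algebra M \<sigma>\<^esub> h) = lin_ext H U f \<oplus> lin_ext H U h"
proof -
  define K where "K = {g. f g \<noteq> 0} \<union> {g. h g \<noteq> 0}"
  have K: "finite K" "K \<subseteq> carrier M"
    using assms by (auto simp: K_def monoid_star_algebra_simps)
  have "lin_ext H U (f \<oplus>\<^bsub>monoid_star_algebra M \<sigma>\<^esub> h) = (\<Oplus>g\<in>K. (f g + h g) \<odot> U g)"
    using K by (subst lin_ext_superset[of K]) (auto simp: monoid_star_algebra_simps K_def)
  also have "\<dots> = (\<Oplus>g\<in>K. f g \<odot> U g \<oplus> h g \<odot> U g)"
    using K U smult_l_distr vec_smult_closed vec_add_closed
    by (intro abelian_monoid.finsum_cong'[OF am]) (auto simp: subset_iff)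
  also have "\<dots> = (\<Oplus>g\<in>K. f g \<odot> U g) \<oplus> (\<Oplus>g\<in>K. h g \<odot> U g)"
    using K U vec_smult_closed by (intro abelian_monoid.finsum_addf[OF am]) auto
  also have "\<dots> = lin_ext H U f \<oplus> lin_ext H U h"
    using K lin_ext_superset[of K f] lin_ext_superset[of K h] by (auto simp: K_def)
  finally show ?thesis .
qed

lemma lin_ext_smult:
  assumes "f \<in> carrier (monoid_star_algebra M \<sigma>)"
  shows "lin_ext H U (c \<odot>\<^bsub>monoid_star_algebra M \<sigma>\<^esub> f) = c \<odot> lin_ext H U f"
proof -
  define K where "K = {g. f g \<noteq> 0}"
  have K: "finite K" "K \<subseteq> carrier M"
    using assms by (auto simp: K_def monoid_star_algebra_simps)
  have "lin_ext H U (c \<odot>\<^bsub>monoid_star_algebra M \<sigma>\<^esub> f) = (\<Oplus>g\<in>K. (c * f g) \<odot> U g)"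
    using K by (subst lin_ext_superset[of K]) (auto simp: monoid_star_algebra_simps K_def)
  also have "\<dots> = (\<Oplus>g\<in>K. c \<odot> (f g \<odot> U g))"
    using K U smult_assoc1 vec_smult_closed
    by (intro abelian_monoid.finsum_cong'[OF am]) (auto simp: subset_iff)
  also have "\<dots> = c \<odot> (\<Oplus>g\<in>K. f g \<odot> U g)"
    using K U smult_r_distr vec_smult_closed
    by (intro module_hom_finsum[OF add_group_H add_group_H, symmetric]) auto
  finally show ?thesis by (simp add: lin_ext_def K_def)
qed

lemma lin_ext_zero: "lin_ext H U (\<lambda>w. 0) = \<zero>"
  by (simp add: lin_ext_def abelian_monoid.finsum_empty[OF am])

lemma lin_ext_point_mass: assumes "w \<in> carrier M" shows "lin_ext H U (point_mass w) = U w"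
proof -
  have "lin_ext H U (point_mass w) = (\<Oplus>k\<in>{w}. point_mass w k \<odot> U k)"
    using assms by (intro lin_ext_superset) (auto simp: point_mass_def)
  also have "\<dots> = U w"
    using assms U vec_smult_closed abelian_monoid.finsum_insert[OF am, of "{}" w "\<lambda>k. point_mass w k \<odot> U k"]
      abelian_monoid.finsum_empty[OF am] abelian_monoid.r_zero[OF am]
    by (simp add: point_mass_def smult_one[simplified])
  finally show ?thesis .
qed

end

end

section \<open>Representations of the free *-algebra by contractions\<close>

context hilbert
begin

context
  fixes S :: "'i set" and op :: "'i \<times> bool \<Rightarrow> 'h \<Rightarrow> 'h"
  assumes op_closed: "\<And>i b v. i \<in> S \<Longrightarrow> v \<in> carrier H \<Longrightarrow> op (i, b) v \<in> carrier H"
    and op_add: "\<And>i b v w. i \<in> S \<Longrightarrow> v \<in> carrier H \<Longrightarrow> w \<in> carrier H \<Longrightarrow> op (i, b) (v \<oplus> w) = op (i, b) v \<oplus> op (i, b) w"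
    and op_smult: "\<And>i b v c. i \<in> S \<Longrightarrow> v \<in> carrier H \<Longrightarrow> op (i, b) (c \<odot> v) = c \<odot> op (i, b) v"
    and op_adjoint: "\<And>i b v w. i \<in> S \<Longrightarrow> v \<in> carrier H \<Longrightarrow> w \<in> carrier H \<Longrightarrow>
      cinner H (op (i, b) v) w = cinner H v (op (i, \<not> b) w)"
    and op_contraction: "\<And>i b v. i \<in> S \<Longrightarrow> v \<in> carrier H \<Longrightarrow> hnorm H (op (i, b) v) \<le> hnorm H v"
begin

abbreviation word_op :: "('i \<times> bool) list \<Rightarrow> 'h \<Rightarrow> 'h" where "word_op w \<equiv> foldr op w"

lemma word_op_closed: "w \<in> lists (S \<times> UNIV) \<Longrightarrow> v \<in> carrier H \<Longrightarrow> word_op w v \<in> carrier H"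
  by (induction w) (auto simp: op_closed)

lemma word_op_add: "w \<in> lists (S \<times> UNIV) \<Longrightarrow> u \<in> carrier H \<Longrightarrow> v \<in> carrier H \<Longrightarrow>
    word_op w (u \<oplus> v) = word_op w u \<oplus> word_op w v"
  by (induction w) (auto simp: op_add word_op_closed in_listsI)

lemma word_op_smult: "w \<in> lists (S \<times> UNIV) \<Longrightarrow> v \<in> carrier H \<Longrightarrow> word_op w (c \<odot> v) = c \<odot> word_op w v"
  by (induction w) (auto simp: op_smult word_op_closed in_listsI)

lemma word_op_zero: "w \<in> lists (S \<times> UNIV) \<Longrightarrow> word_op w \<zero> = \<zero>"
  using word_op_smult[of w \<zero> 0] smult_l_null[OF vec_zero_closed] smult_l_null[OF word_op_closed[of w \<zero>]]
  by (simp add: vec_zero_closed)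

lemma word_op_contraction: "w \<in> lists (S \<times> UNIV) \<Longrightarrow> v \<in> carrier H \<Longrightarrow> hnorm H (word_op w v) \<le> hnorm H v"
  by (induction w) (auto intro: order.trans[OF op_contraction] simp: word_op_closed in_listsI)

lemma word_op_adjoint: "w \<in> lists (S \<times> UNIV) \<Longrightarrow> u \<in> carrier H \<Longrightarrow> v \<in> carrier H \<Longrightarrow>
    cinner H (word_op w u) v = cinner H u (word_op (rev (map (\<lambda>(i, b). (i, \<not> b)) w)) v)"
  by (induction w arbitrary: v) (auto simp: op_adjoint word_op_closed op_closed in_listsI)

abbreviation rep :: "(('i \<times> bool) list \<Rightarrow> complex) \<Rightarrow> 'h \<Rightarrow> 'h" where
  "rep f v \<equiv> lin_ext H (\<lambda>w. word_op w v) f"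

abbreviation words :: "('i \<times> bool) list monoid" where
  "words \<equiv> \<lparr>carrier = lists (S \<times> UNIV), monoid.mult = (@), one = []\<rparr>"

lemma rep_rules:
  assumes "v \<in> carrier H" "f \<in> carrier (free_star_algebra S)"
  shows "rep f v \<in> carrier H"
    "h \<in> carrier (free_star_algebra S) \<Longrightarrow> rep (f \<oplus>\<^bsub>free_star_algebra S\<^esub> h) v = rep f v \<oplus> rep h v"
    "rep (c \<odot>\<^bsub>free_star_algebra S\<^esub> f) v = c \<odot> rep f v"
proof -
  have U: "word_op w v \<in> carrier H" if "w \<in> carrier words" for w
    using that assms(1) by (simp add: word_op_closed)
  note rules = lin_ext_closed[where U = "\<lambda>w. word_op w v", OF U] lin_ext_add[where U = "\<lambda>w. word_op w v", OF U]
    lin_ext_smult[where U = "\<lambda>w. word_op w v", OF U]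
  note f = assms(2)[unfolded free_star_algebra_def]
  show "rep f v \<in> carrier H" by (rule rules(1)[OF _ f])
  show "rep (f \<oplus>\<^bsub>free_star_algebra S\<^esub> h) v = rep f v \<oplus> rep h v" if "h \<in> carrier (free_star_algebra S)"
    unfolding free_star_algebra_def by (rule rules(2)[OF _ f that[unfolded free_star_algebra_def]])
  show "rep (c \<odot>\<^bsub>free_star_algebra S\<^esub> f) v = c \<odot> rep f v"
    unfolding free_star_algebra_def by (rule rules(3)[OF _ f])
qed

lemma rep_point_mass: "w \<in> lists (S \<times> UNIV) \<Longrightarrow> v \<in> carrier H \<Longrightarrow> rep (point_mass w) v = word_op w v"
  by (rule lin_ext_point_mass[where M = words and U = "\<lambda>w. word_op w v"]) (simp_all add: word_op_closed)

lemma rep_zero: "v \<in> carrier H \<Longrightarrow> rep \<zero>\<^bsub>free_star_algebra S\<^esub> v = \<zero>"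
  using lin_ext_zero[where M = words and U = "\<lambda>w. word_op w v"] word_op_closed by (simp add: free_star_algebra_simps)

text \<open>The universal property of the free *-algebra. A word acts by the composite of its
  letters, reversing a word and flipping its letters gives the adjoint, and contractivity of the
  letters makes each finite combination bounded.\<close>

lemma hilbert_rep_free: "hilbert_rep (free_star_algebra S) H rep"
proof -
  let ?F = "free_star_algebra S"
  interpret F: star_algebra ?F by (rule star_algebra_free)
  note fpm = free_point_mass[where S = S]
  have pm: "c \<odot>\<^bsub>?F\<^esub> point_mass w \<in> carrier ?F" if "w \<in> lists (S \<times> UNIV)" for c w
    using fpm(1)[OF that] by simp
  have comb: "rep (c \<odot>\<^bsub>?F\<^esub> point_mass w \<oplus>\<^bsub>?F\<^esub> f) v = c \<odot> word_op w v \<oplus> rep f v"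
    if "w \<in> lists (S \<times> UNIV)" "f \<in> carrier ?F" "v \<in> carrier H" for c w f v
    using that pm[OF that(1)] fpm(1)[OF that(1)] by (simp add: rep_rules rep_point_mass)
  note closed = vec_add_closed vec_smult_closed word_op_closed rep_rules(1)
  have smult2: "c \<odot> (d \<odot> v) = (c * d) \<odot> v" if "v \<in> carrier H" for c d v
    using smult_assoc1[of c d v] that by simp
  have distr: "c \<odot> (u \<oplus> v) = c \<odot> u \<oplus> c \<odot> v" if "u \<in> carrier H" "v \<in> carrier H" for c u v
    using smult_r_distr[of c u v] that by simp
  have vec_smult: "rep f (c \<odot> v) = c \<odot> rep f v" if f: "f \<in> carrier ?F" and v: "v \<in> carrier H" for f c v
    using f
  proof (induction f rule: free_induct)
    case zero
    then show ?case using v smult_r_null[of c] by (simp add: rep_zero closed)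
  next
    case (add f d w)
    then show ?case using v by (simp add: comb closed distr smult2 word_op_smult mult.commute)
  qed
  have pm_mult: "rep (point_mass w \<otimes>\<^bsub>?F\<^esub> h) v = word_op w (rep h v)"
    if w: "w \<in> lists (S \<times> UNIV)" and h: "h \<in> carrier ?F" and v: "v \<in> carrier H" for w h v
    using h
  proof (induction h rule: free_induct)
    case zero
    then show ?case using w v fpm(1)[OF w] by (simp add: F.ring_rules rep_zero word_op_zero)
  next
    case (add h d w')
    have "point_mass w \<otimes>\<^bsub>?F\<^esub> (d \<odot>\<^bsub>?F\<^esub> point_mass w' \<oplus>\<^bsub>?F\<^esub> h)
        = d \<odot>\<^bsub>?F\<^esub> point_mass (w @ w') \<oplus>\<^bsub>?F\<^esub> point_mass w \<otimes>\<^bsub>?F\<^esub> h"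
      using w add.hyps pm fpm(1) by (simp add: F.ring_rules(23) F.smult_mult_right fpm(2))
    moreover have "w @ w' \<in> lists (S \<times> UNIV)" using w add.hyps by simp
    moreover have "point_mass w \<otimes>\<^bsub>?F\<^esub> h \<in> carrier ?F"
      using fpm(1)[OF w] add.hyps(1) by (rule F.ring_rules(5))
    ultimately show ?case
      using w v add by (simp add: comb closed word_op_add word_op_smult)
  qed
  have mult: "rep (f \<otimes>\<^bsub>?F\<^esub> h) v = rep f (rep h v)"
    if f: "f \<in> carrier ?F" and h: "h \<in> carrier ?F" and v: "v \<in> carrier H" for f h v
    using f
  proof (induction f rule: free_induct)
    case zero
    then show ?case using h v by (simp add: F.ring_rules rep_zero closed)
  next
    case (add f d w)
    have "(d \<odot>\<^bsub>?F\<^esub> point_mass w \<oplus>\<^bsub>?F\<^esub> f) \<otimes>\<^bsub>?F\<^esub> h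
        = d \<odot>\<^bsub>?F\<^esub> (point_mass w \<otimes>\<^bsub>?F\<^esub> h) \<oplus>\<^bsub>?F\<^esub> f \<otimes>\<^bsub>?F\<^esub> h"
      using h add.hyps pm fpm(1) by (simp add: F.ring_rules(13) F.smult_mult_left)
    moreover have "point_mass w \<otimes>\<^bsub>?F\<^esub> h \<in> carrier ?F" "f \<otimes>\<^bsub>?F\<^esub> h \<in> carrier ?F"
      using fpm(1) add.hyps h by (simp_all add: F.ring_rules(5))
    ultimately show ?case
      using v h add by (simp add: rep_rules comb pm_mult closed)
  qed
  have adjoint: "cinner H (rep f u) v = cinner H u (rep (star ?F f) v)"
    if f: "f \<in> carrier ?F" and u: "u \<in> carrier H" and v: "v \<in> carrier H" for f u v
    using f
  proof (induction f rule: free_induct)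
    case zero
    have "star ?F \<zero>\<^bsub>?F\<^esub> = \<zero>\<^bsub>?F\<^esub>" by (simp add: free_star_algebra_simps fun_eq_iff)
    then show ?case using u v cinner_commute[OF _ u, of \<zero>] by (simp add: rep_zero cinner_zero_left vec_zero_closed)
  next
    case (add f d w)
    have "star ?F (d \<odot>\<^bsub>?F\<^esub> point_mass w \<oplus>\<^bsub>?F\<^esub> f)
        = cnj d \<odot>\<^bsub>?F\<^esub> point_mass (rev (map (\<lambda>(i, b). (i, \<not> b)) w)) \<oplus>\<^bsub>?F\<^esub> star ?F f"
      using add.hyps pm fpm(1) by (simp add: F.star_add F.star_smult fpm(3))
    moreover have "rev (map (\<lambda>(i, b). (i, \<not> b)) w) \<in> lists (S \<times> UNIV)"
      using add.hyps(2) by (auto simp: lists_eq_set)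
    ultimately show ?case
      using u v add F.star_closed[OF add.hyps(1)]
      by (simp add: comb closed cinner_add cinner_smult cinner_add_right cinner_smult_right word_op_adjoint del: rev_map)
  qed
  have bounded: "\<exists>M. \<forall>v\<in>carrier H. hnorm H (rep f v) \<le> M * hnorm H v" if f: "f \<in> carrier ?F" for f
    using f
  proof (induction f rule: free_induct)
    case zero
    then show ?case by (intro exI[of _ 0]) (simp add: rep_zero hnorm_zero)
  next
    case (add f d w)
    then obtain M where M: "\<And>v. v \<in> carrier H \<Longrightarrow> hnorm H (rep f v) \<le> M * hnorm H v" by blast
    have "hnorm H (rep (d \<odot>\<^bsub>?F\<^esub> point_mass w \<oplus>\<^bsub>?F\<^esub> f) v) \<le> (cmod d + M) * hnorm H v"
      if v: "v \<in> carrier H" for v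
    proof -
      have "hnorm H (d \<odot> word_op w v \<oplus> rep f v) \<le> cmod d * hnorm H (word_op w v) + hnorm H (rep f v)"
        using hnorm_add[of "d \<odot> word_op w v" "rep f v"] add.hyps v by (simp add: closed hnorm_smult)
      also have "\<dots> \<le> cmod d * hnorm H v + M * hnorm H v"
        using add.hyps v M by (intro add_mono mult_left_mono word_op_contraction) auto
      finally show ?thesis using add.hyps v by (simp add: comb algebra_simps)
    qed
    then show ?case by blast
  qed
  show ?thesis
    by (intro hilbert_rep.intro star_algebra_free hilbert_axioms hilbert_rep_axioms.intro)
      (simp_all add: rep_rules vec_smult mult adjoint bounded)
qed

end

end

text \<open>The isomorphism and the canonical embedding agree on group elements, hence on the group
  algebra. Being isometric, it identifies the seminorms, so equality of completions determines the
  seminorm on the carrier.\<close>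

lemma same_completion_seminorm_eq:
  assumes G: "group G" and p: "cstar_seminorm (group_algebra G) p" and p': "cstar_seminorm (group_algebra G) p'"
    and same: "same_completion G (group_completion G p) (completion_unitary G p)
      (group_completion G p') (completion_unitary G p')"
    and f: "f \<in> carrier (group_algebra G)"
  shows "p f = p' f"
proof -
  interpret CG: star_algebra "group_algebra G" by (rule star_algebra_group_algebra[OF G])
  interpret p: seminormed_star_algebra "group_algebra G" p by unfold_locales (rule p)
  interpret p': seminormed_star_algebra "group_algebra G" p' by unfold_locales (rule p')
  interpret C': unital_cstar_algebra p'.C by (rule p'.unital_cstar_algebra_completion)
  let ?e = "completion_embed (group_algebra G) p" and ?e' = "completion_embed (group_algebra G) p'"
  obtain \<Phi> where \<Phi>: "cstar_iso p.C p'.C \<Phi>" "\<And>g. g \<in> carrier G \<Longrightarrow> \<Phi> (?e (point_mass g)) = ?e' (point_mass g)"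
    using same unfolding same_completion_def group_completion_def completion_unitary_def by blast
  then have hom: "star_hom (group_algebra G) p'.C (\<lambda>f. \<Phi> (?e f))"
    using star_hom_compose[OF p.star_hom_embed] by (auto simp: cstar_iso_def)
  have closed: "?e' (point_mass g) \<in> carrier p'.C" if "g \<in> carrier G" for g
    using group_algebra_point_mass(1)[OF G that] by simp
  note unique = C'.group_algebra_map_unique[where G = G and u = "\<lambda>g. ?e' (point_mass g)", OF closed f]
  have "\<Phi> (?e f) = group_algebra_map p'.C (\<lambda>g. ?e' (point_mass g)) f"
    by (rule unique[where \<phi> = "\<lambda>f. \<Phi> (?e f)"]) (use \<Phi>(2) star_hom_closed[OF hom] star_hom_add[OF hom] star_hom_smult[OF hom] in auto)
  moreover have "?e' f = group_algebra_map p'.C (\<lambda>g. ?e' (point_mass g)) f"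
    by (rule unique[where \<phi> = ?e']) (use star_hom_add[OF p'.star_hom_embed] star_hom_smult[OF p'.star_hom_embed] in auto)
  ultimately have "nrm p'.C (\<Phi> (?e f)) = p' f" using p'.nrm_embed[OF f] by simp
  moreover have "nrm p'.C (\<Phi> (?e f)) = nrm p.C (?e f)" using \<Phi>(1) f by (simp add: cstar_iso_def)
  ultimately show ?thesis using p.nrm_embed[OF f] by simp
qed

section \<open>Self-similar representations as representations of the free *-algebra\<close>

locale self_similar_hilbert = cp_group G act + H: hilbert H
  for G :: "('g, 'm) monoid_scheme" (structure) and act :: "'g \<Rightarrow> 'x::finite list \<Rightarrow> 'x list"
    and H :: "'h hilbert_space" +
  fixes \<rho> :: "'g \<Rightarrow> 'h \<Rightarrow> 'h" and \<psi> :: "'h \<Rightarrow> 'x \<Rightarrow> 'h"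
  assumes \<rho>: "unitary_rep G H \<rho>" and \<psi>: "similarity H \<psi>"
    and self_similar: "\<And>g h x y \<xi>. g \<in> carrier G \<Longrightarrow> h \<in> carrier G \<Longrightarrow> restricts act g x y h \<Longrightarrow> \<xi> \<in> carrier H \<Longrightarrow>
      \<rho> g (similarity_shift H \<psi> x \<xi>) = similarity_shift H \<psi> y (\<rho> h \<xi>)"
begin

abbreviation T :: "'x \<Rightarrow> 'h \<Rightarrow> 'h" where "T \<equiv> similarity_shift H \<psi>"

lemma \<rho>_rules:
  assumes "g \<in> carrier G" "v \<in> carrier H"
  shows "\<rho> g v \<in> carrier H"
    "w \<in> carrier H \<Longrightarrow> \<rho> g (v \<oplus>\<^bsub>H\<^esub> w) = \<rho> g v \<oplus>\<^bsub>H\<^esub> \<rho> g w"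
    "\<rho> g (c \<odot>\<^bsub>H\<^esub> v) = c \<odot>\<^bsub>H\<^esub> \<rho> g v"
    "w \<in> carrier H \<Longrightarrow> cinner H (\<rho> g v) (\<rho> g w) = cinner H v w"
    "h \<in> carrier G \<Longrightarrow> \<rho> (g \<otimes> h) v = \<rho> g (\<rho> h v)"
proof -
  have "\<rho> g ` carrier H = carrier H" using assms \<rho> by (simp add: unitary_rep_def hilbert_iso_def bij_betw_def)
  then show "\<rho> g v \<in> carrier H" using assms(2) by blast
qed (use assms \<rho> in \<open>simp_all add: unitary_rep_def hilbert_iso_def\<close>)

text \<open>\<open>unitary_rep\<close> demands multiplicativity only; at the unit this gives an
  idempotent, and an injective idempotent is the identity.\<close>

lemma \<rho>_one: assumes "v \<in> carrier H" shows "\<rho> \<one> v = v"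
proof -
  have "inj_on (\<rho> \<one>) (carrier H)" using \<rho> by (simp add: unitary_rep_def hilbert_iso_def bij_betw_def)
  moreover have "\<rho> \<one> (\<rho> \<one> v) = \<rho> \<one> v" using \<rho>_rules(5)[of \<one> v \<one>] assms by simp
  ultimately show ?thesis using assms \<rho>_rules(1)[of \<one> v] by (simp add: inj_on_eq_iff)
qed

lemma \<rho>_inv: "g \<in> carrier G \<Longrightarrow> v \<in> carrier H \<Longrightarrow> \<rho> (inv g) (\<rho> g v) = v"
  "g \<in> carrier G \<Longrightarrow> v \<in> carrier H \<Longrightarrow> \<rho> g (\<rho> (inv g) v) = v"
  by (simp_all add: \<rho>_one flip: \<rho>_rules(5))

lemma \<rho>_adjoint:
  assumes "g \<in> carrier G" "v \<in> carrier H" "w \<in> carrier H"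
  shows "cinner H (\<rho> g v) w = cinner H v (\<rho> (inv g) w)"
  using \<rho>_rules(4)[of "inv g" "\<rho> g v" w] assms by (simp add: \<rho>_rules(1) \<rho>_inv)

lemma bij_\<psi>: "bij_betw \<psi> (carrier H) {v. \<forall>x. v x \<in> carrier H}"
  using \<psi> by (simp add: similarity_def hilbert_iso_def hilbert_power_def)

lemma \<psi>_rules:
  assumes "v \<in> carrier H"
  shows "\<psi> v x \<in> carrier H"
    "w \<in> carrier H \<Longrightarrow> \<psi> (v \<oplus>\<^bsub>H\<^esub> w) x = \<psi> v x \<oplus>\<^bsub>H\<^esub> \<psi> w x"
    "\<psi> (c \<odot>\<^bsub>H\<^esub> v) x = c \<odot>\<^bsub>H\<^esub> \<psi> v x"
    "w \<in> carrier H \<Longrightarrow> (\<Sum>x\<in>UNIV. cinner H (\<psi> v x) (\<psi> w x)) = cinner H v w"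
proof -
  show "\<psi> v x \<in> carrier H" using bij_\<psi> assms by (auto simp: bij_betw_def)
qed (use \<psi> assms in \<open>simp_all add: similarity_def hilbert_iso_def hilbert_power_def\<close>)

lemma \<psi>_eqI: "v \<in> carrier H \<Longrightarrow> w \<in> carrier H \<Longrightarrow> (\<And>x. \<psi> v x = \<psi> w x) \<Longrightarrow> v = w"
  using bij_\<psi> unfolding bij_betw_def by (metis ext inj_onD)

lemma T_closed: "v \<in> carrier H \<Longrightarrow> T x v \<in> carrier H"
  and \<psi>_T: "v \<in> carrier H \<Longrightarrow> \<psi> (T x v) y = (if y = x then v else \<zero>\<^bsub>H\<^esub>)"
proof -
  assume v: "v \<in> carrier H"
  have "(\<lambda>y. if y = x then v else \<zero>\<^bsub>H\<^esub>) \<in> \<psi> ` carrier H"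
    using bij_\<psi> v H.vec_zero_closed by (simp add: bij_betw_def)
  then show "T x v \<in> carrier H" "\<psi> (T x v) y = (if y = x then v else \<zero>\<^bsub>H\<^esub>)"
    unfolding similarity_shift_def by (simp_all add: inv_into_into f_inv_into_f)
qed

lemma T_add: "v \<in> carrier H \<Longrightarrow> w \<in> carrier H \<Longrightarrow> T x (v \<oplus>\<^bsub>H\<^esub> w) = T x v \<oplus>\<^bsub>H\<^esub> T x w"
  by (rule \<psi>_eqI) (simp_all add: T_closed H.vec_add_closed \<psi>_rules \<psi>_T H.vec_zero_closed abelian_monoid.l_zero[OF H.am])

lemma T_smult: "v \<in> carrier H \<Longrightarrow> T x (c \<odot>\<^bsub>H\<^esub> v) = c \<odot>\<^bsub>H\<^esub> T x v"
  by (rule \<psi>_eqI) (use H.smult_r_null[of c] in \<open>simp_all add: T_closed H.vec_smult_closed \<psi>_rules \<psi>_T\<close>)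

text \<open>Under \<psi> the vector \<open>T x v\<close> has a single nonzero coordinate, so one
  term of the inner product remains. Thus the coordinate maps of \<psi> are the adjoints of the
  shifts, and \<open>op\<close> lets adjoint letters act in this way.\<close>

lemma T_adjoint:
  assumes "v \<in> carrier H" "w \<in> carrier H" shows "cinner H (T x v) w = cinner H v (\<psi> w x)"
proof -
  have "cinner H (T x v) w = (\<Sum>y\<in>UNIV. cinner H (\<psi> (T x v) y) (\<psi> w y))"
    using assms by (simp add: \<psi>_rules(4) T_closed)
  also have "\<dots> = (\<Sum>y\<in>{x}. cinner H (\<psi> (T x v) y) (\<psi> w y))"
    using assms by (intro sum.mono_neutral_right) (auto simp: \<psi>_T \<psi>_rules(1) H.cinner_zero_left)
  finally show ?thesis using assms by (simp add: \<psi>_T)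
qed

fun op :: "('g, 'x) cp_gen \<times> bool \<Rightarrow> 'h \<Rightarrow> 'h" where
  "op (Group_Gen g, b) = \<rho> (if b then inv g else g)"
| "op (Letter_Gen x, b) = (if b then (\<lambda>v. \<psi> v x) else T x)"

lemma op_rules:
  assumes "i \<in> cp_gens G" "v \<in> carrier H"
  shows "op (i, b) v \<in> carrier H"
    "w \<in> carrier H \<Longrightarrow> op (i, b) (v \<oplus>\<^bsub>H\<^esub> w) = op (i, b) v \<oplus>\<^bsub>H\<^esub> op (i, b) w"
    "op (i, b) (c \<odot>\<^bsub>H\<^esub> v) = c \<odot>\<^bsub>H\<^esub> op (i, b) v"
    "w \<in> carrier H \<Longrightarrow> cinner H (op (i, b) v) w = cinner H v (op (i, \<not> b) w)"
    "hnorm H (op (i, b) v) \<le> hnorm H v"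
proof -
  have \<psi>_adjoint: "cinner H (\<psi> u x) w = cinner H u (T x w)" if "u \<in> carrier H" "w \<in> carrier H" for u w x
    using T_adjoint[OF that(2,1), of x] H.cinner_commute[of "T x w" u] H.cinner_commute[of w "\<psi> u x"] that
    by (simp add: T_closed \<psi>_rules(1))
  show closed: "op (i, b) v \<in> carrier H"
    using assms by (auto simp: cp_gens_def \<rho>_rules(1) \<psi>_rules(1) T_closed)
  show "w \<in> carrier H \<Longrightarrow> op (i, b) (v \<oplus>\<^bsub>H\<^esub> w) = op (i, b) v \<oplus>\<^bsub>H\<^esub> op (i, b) w"
    "op (i, b) (c \<odot>\<^bsub>H\<^esub> v) = c \<odot>\<^bsub>H\<^esub> op (i, b) v"
    using assms by (auto simp: cp_gens_def \<rho>_rules \<psi>_rules T_add T_smult)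
  show "w \<in> carrier H \<Longrightarrow> cinner H (op (i, b) v) w = cinner H v (op (i, \<not> b) w)"
    using assms by (auto simp: cp_gens_def \<rho>_adjoint T_adjoint \<psi>_adjoint)
  have "Re (cinner H (\<psi> v x) (\<psi> v x)) \<le> Re (cinner H v v)" for x
  proof -
    have "(\<Sum>y\<in>{x}. Re (cinner H (\<psi> v y) (\<psi> v y))) \<le> (\<Sum>y\<in>UNIV. Re (cinner H (\<psi> v y) (\<psi> v y)))"
      using assms H.cinner_self_nonneg by (intro sum_mono2) (auto simp: \<psi>_rules(1))
    then show ?thesis using \<psi>_rules(4)[of v v] assms by (simp flip: Re_sum)
  qed
  then show "hnorm H (op (i, b) v) \<le> hnorm H v"
    using assms by (auto simp: cp_gens_def hnorm_def \<rho>_rules(4) T_adjoint T_closed \<psi>_T)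
qed

sublocale rep: hilbert_rep F H "H.rep op"
  unfolding cp_free_algebra_eq by (rule H.hilbert_rep_free[OF op_rules])

abbreviation L where "L \<equiv> H.rep op"

lemma L_point_mass: "w \<in> lists (cp_gens G \<times> UNIV) \<Longrightarrow> v \<in> carrier H \<Longrightarrow> L (point_mass w) v = foldr op w v"
  by (rule H.rep_point_mass[OF op_rules])

lemma F_one: "\<one>\<^bsub>F\<^esub> = point_mass []"
  by (simp add: cp_free_algebra_eq free_star_algebra_simps)

lemma L_one: "v \<in> carrier H \<Longrightarrow> L \<one>\<^bsub>F\<^esub> v = v"
  unfolding F_one by (subst L_point_mass) simp_all

lemma star_free_gen: "i \<in> cp_gens G \<Longrightarrow> star F (free_gen i) = point_mass [(i, True)]"
  unfolding cp_free_algebra_eq free_gen_def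
  by (subst free_point_mass(3)) simp_all

lemma L_gens:
  assumes "v \<in> carrier H"
  shows "g \<in> carrier G \<Longrightarrow> L (gen g) v = \<rho> g v" "g \<in> carrier G \<Longrightarrow> L (star F (gen g)) v = \<rho> (inv g) v"
    "L (letter x) v = T x v" "L (star F (letter x)) v = \<psi> v x"
  using assms by (simp_all add: star_free_gen cp_gens_def, simp_all add: free_gen_def L_point_mass cp_gens_def)

lemma L_finsum:
  assumes "finite A" "f \<in> A \<rightarrow> carrier F" "v \<in> carrier H"
  shows "L (\<Oplus>\<^bsub>F\<^esub>i\<in>A. f i) v = (\<Oplus>\<^bsub>H\<^esub>i\<in>A. L (f i) v)"
  using assms rep.L_closed rep.L_add
  by (intro module_hom_finsum[OF F.ag H.add_group_H, of "\<lambda>a. L a v"]) auto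

lemma ranges_sum: assumes v: "v \<in> carrier H" shows "(\<Oplus>\<^bsub>H\<^esub>x\<in>UNIV. T x (\<psi> v x)) = v"
proof (rule \<psi>_eqI)
  show "(\<Oplus>\<^bsub>H\<^esub>x\<in>UNIV. T x (\<psi> v x)) \<in> carrier H"
    using v by (intro abelian_monoid.finsum_closed[OF H.am]) (auto simp: T_closed \<psi>_rules(1))
  fix y
  have "\<psi> (\<Oplus>\<^bsub>H\<^esub>x\<in>UNIV. T x (\<psi> v x)) y = (\<Oplus>\<^bsub>H\<^esub>x\<in>UNIV. \<psi> (T x (\<psi> v x)) y)"
    using v by (intro module_hom_finsum[OF H.add_group_H H.add_group_H, of "\<lambda>v. \<psi> v y"]) (auto simp: T_closed \<psi>_rules)
  also have "\<dots> = (\<Oplus>\<^bsub>H\<^esub>x\<in>UNIV. if y = x then \<psi> v x else \<zero>\<^bsub>H\<^esub>)"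
    using v by (simp add: \<psi>_T \<psi>_rules(1))
  also have "\<dots> = \<psi> v y"
    using v by (intro abelian_monoid.finsum_singleton[OF H.am]) (auto simp: \<psi>_rules(1))
  finally show "\<psi> (\<Oplus>\<^bsub>H\<^esub>x\<in>UNIV. T x (\<psi> v x)) y = \<psi> v y" .
qed (rule v)

text \<open>Every relation is checked as an identity of operators on vectors: the bijection \<psi>
  yields the Cuntz relations, and self-similarity yields the last one.\<close>

lemma cp_admissible_opn: "cp_admissible G act rep.opn"
proof (rule cp_admissibleI[OF rep.cstar_seminorm_opn])
  note closed = F.star_closed F.ring_rules(5,6) rep.L_mult L_gens L_one \<rho>_rules(1) \<psi>_rules(1) T_closed
  show "rep.opn (gen \<one> \<ominus>\<^bsub>F\<^esub> \<one>\<^bsub>F\<^esub>) = 0"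
    by (rule rep.opn_diff_eq_0) (simp_all add: closed \<rho>_one)
  show "rep.opn (star F (letter x) \<otimes>\<^bsub>F\<^esub> letter x \<ominus>\<^bsub>F\<^esub> \<one>\<^bsub>F\<^esub>) = 0" for x
    by (rule rep.opn_diff_eq_0) (simp_all add: closed \<psi>_T)
  show "rep.opn ((\<Oplus>\<^bsub>F\<^esub>x\<in>UNIV. letter x \<otimes>\<^bsub>F\<^esub> star F (letter x)) \<ominus>\<^bsub>F\<^esub> \<one>\<^bsub>F\<^esub>) = 0"
  proof (rule rep.opn_diff_eq_0[OF letter_sum_closed])
    fix v assume v: "v \<in> carrier H"
    have "L (\<Oplus>\<^bsub>F\<^esub>x\<in>UNIV. letter x \<otimes>\<^bsub>F\<^esub> star F (letter x)) v = (\<Oplus>\<^bsub>H\<^esub>x\<in>UNIV. L (letter x \<otimes>\<^bsub>F\<^esub> star F (letter x)) v)"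
      using v by (intro L_finsum) (auto simp: closed)
    then show "L (\<Oplus>\<^bsub>F\<^esub>x\<in>UNIV. letter x \<otimes>\<^bsub>F\<^esub> star F (letter x)) v = L \<one>\<^bsub>F\<^esub> v"
      using v ranges_sum by (simp add: closed)
  qed (simp add: closed)
  fix g assume g: "g \<in> carrier G"
  show "rep.opn (star F (gen g) \<otimes>\<^bsub>F\<^esub> gen g \<ominus>\<^bsub>F\<^esub> \<one>\<^bsub>F\<^esub>) = 0" "rep.opn (gen g \<otimes>\<^bsub>F\<^esub> star F (gen g) \<ominus>\<^bsub>F\<^esub> \<one>\<^bsub>F\<^esub>) = 0"
    by (rule rep.opn_diff_eq_0; use g in \<open>simp add: closed \<rho>_inv\<close>)+
  fix h assume h: "h \<in> carrier G"
  show "rep.opn (gen g \<otimes>\<^bsub>F\<^esub> gen h \<ominus>\<^bsub>F\<^esub> gen (g \<otimes> h)) = 0"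
    by (rule rep.opn_diff_eq_0) (use g h in \<open>simp_all add: closed \<rho>_rules(5)\<close>)
  show "rep.opn (gen g \<otimes>\<^bsub>F\<^esub> letter x \<ominus>\<^bsub>F\<^esub> letter y \<otimes>\<^bsub>F\<^esub> gen h) = 0" if "restricts act g x y h" for x y
    by (rule rep.opn_diff_eq_0) (use g h that self_similar in \<open>simp_all add: closed\<close>)
qed

text \<open>Infinite dimension enters here: it excludes the zero space, which the empty set would
  span.\<close>

lemma opn_one: "rep.opn \<one>\<^bsub>F\<^esub> \<noteq> 0"
proof
  assume 0: "rep.opn \<one>\<^bsub>F\<^esub> = 0"
  have "v = \<zero>\<^bsub>H\<^esub>" if v: "v \<in> carrier H" for v
  proof (rule ccontr)
    assume "v \<noteq> \<zero>\<^bsub>H\<^esub>"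
    from H.cinner_pos[OF v this] have "0 < hnorm H v" by (simp add: hnorm_def)
    then show False using rep.opn_bound[of "\<one>\<^bsub>F\<^esub>" v] v 0 by (simp add: L_one F.ring_rules(6))
  qed
  then have "\<forall>v\<in>carrier H. \<exists>c. v = (\<Oplus>\<^bsub>H\<^esub>s\<in>{}. c s \<odot>\<^bsub>H\<^esub> s)"
    by (simp add: abelian_monoid.finsum_empty[OF H.am])
  moreover have "infinite_dimensional H" using \<psi> by (simp add: similarity_def)
  ultimately show False unfolding infinite_dimensional_def by blast
qed

lemma opn_\<iota>:
  assumes "f \<in> carrier (group_algebra G)" shows "rep.opn (\<iota> f) = rep_seminorm H \<rho> f"
proof -
  let ?K = "{g. f g \<noteq> 0}"
  have K: "finite ?K" "?K \<subseteq> carrier G"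
    using assms by (auto simp: group_algebra_def monoid_star_algebra_simps)
  have "L (\<iota> f) v = (\<Oplus>\<^bsub>H\<^esub>g\<in>?K. f g \<odot>\<^bsub>H\<^esub> \<rho> g v)" if v: "v \<in> carrier H" for v
  proof -
    have "L (\<iota> f) v = (\<Oplus>\<^bsub>H\<^esub>g\<in>?K. L (f g \<odot>\<^bsub>F\<^esub> gen g) v)"
      unfolding group_algebra_map_def using K v by (intro L_finsum) auto
    also have "\<dots> = (\<Oplus>\<^bsub>H\<^esub>g\<in>?K. f g \<odot>\<^bsub>H\<^esub> \<rho> g v)"
      using K v H.vec_smult_closed
      by (intro abelian_monoid.finsum_cong'[OF H.am]) (auto simp: rep.L_smult L_gens \<rho>_rules(1) subset_iff)
    finally show ?thesis .
  qed
  then show ?thesis unfolding rep.opn_def rep_seminorm_def by (intro SUP_cong refl) simp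
qed

lemma cp_extends_opn:
  assumes p: "cstar_seminorm (group_algebra G) p"
    and same: "same_completion G (group_completion G p) (completion_unitary G p)
      (group_completion G (rep_seminorm H \<rho>)) (completion_unitary G (rep_seminorm H \<rho>))"
  shows "cp_extends G act p rep.opn"
proof -
  interpret O: cp_seminorm_on G act rep.opn by unfold_locales (rule cp_admissible_opn)
  \<comment> \<open>Since \<open>rep_seminorm\<close> is \<open>rep.opn\<close> along \<iota>, it is
    a C*-seminorm as the pullback of a C*-norm along \<phi>; \<iota> itself is not
    multiplicative.\<close>
  have "cstar_seminorm (group_algebra G) (\<lambda>f. nrm (cstar_completion F rep.opn) (O.\<phi> f))"
    by (rule cstar_seminorm_pullback[OF O.star_hom_\<phi> O.Cq.nrm_cstar_seminorm CG.star_closed])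
  then have "cstar_seminorm (group_algebra G) (rep_seminorm H \<rho>)"
    by (rule cstar_seminorm_cong[OF CG.star_algebra_axioms]) (simp add: O.nrm_\<phi> opn_\<iota>)
  from same_completion_seminorm_eq[OF is_group p this same]
  show ?thesis using cp_admissible_opn opn_one opn_\<iota> unfolding cp_extends_def by simp
qed

end

lemma (in cp_group) cp_extends_of_self_similar:
  assumes p: "cstar_seminorm (group_algebra G) p" and self_similar: "self_similar_completion TYPE('h) G act p"
  shows "\<exists>q. cp_extends G act p q"
proof -
  obtain H :: "'h hilbert_space" and \<rho> \<psi> where *: "unitary_rep G H \<rho>" "similarity H \<psi>"
    "\<forall>g\<in>carrier G. \<forall>h\<in>carrier G. \<forall>x y. restricts act g x y h \<longrightarrow>
        (\<forall>\<xi>\<in>carrier H. \<rho> g (similarity_shift H \<psi> x \<xi>) = similarity_shift H \<psi> y (\<rho> h \<xi>))"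
    "same_completion G (group_completion G p) (completion_unitary G p)
        (group_completion G (rep_seminorm H \<rho>)) (completion_unitary G (rep_seminorm H \<rho>))"
    using self_similar unfolding self_similar_completion_def self_similar_rep_def by blast
  have "hilbert H" using *(2) by (simp add: similarity_def)
  then interpret self_similar_hilbert G act H \<rho> \<psi>
    by (intro self_similar_hilbert.intro self_similar_hilbert_axioms.intro cp_group_axioms) (use * in auto)
  show ?thesis using cp_extends_opn[OF p *(4)] by blast
qed

text \<open>A witness in whatever type is first turned into an admissible seminorm \<open>q\<close>
  extending \<open>p\<close>, and from \<open>q\<close> witnesses arise in the two large types. This
  one passage gives the equivalence, the image of A_max and the independence of the chosen
  types.\<close>

theorem proposition3p3:
  fixes G :: "('g, 'm) monoid_scheme"
    and act :: "'g \<Rightarrow> 'x::finite list \<Rightarrow> 'x list"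
    and p :: "('g \<Rightarrow> complex) \<Rightarrow> real"
  assumes "self_similar_group G act"
    and "CARD('x) \<ge> 2"
    and "cstar_seminorm (group_algebra G) p"
  shows "(self_similar_completion TYPE(('g, 'x) cp_hilbert) G act p \<longleftrightarrow>
            closure_in_cuntz_pimsner_image TYPE(('g, 'x) cp_elem) G act p)
       \<and> (self_similar_completion TYPE(('g, 'x) cp_hilbert) G act p \<longrightarrow> image_of_A_max G act p)
       \<and> (self_similar_completion TYPE('h) G act p \<longrightarrow>
            self_similar_completion TYPE(('g, 'x) cp_hilbert) G act p)
       \<and> (closure_in_cuntz_pimsner_image TYPE('b) G act p \<longrightarrow>
            closure_in_cuntz_pimsner_image TYPE(('g, 'x) cp_elem) G act p)"
proof -
  interpret self_similar_group G act by fact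
  interpret cp_group G act
    by (intro cp_group.intro) (rule group_hom.axioms(1)[OF group_hom])
  have extension: "cp_extension G act q p" if "cp_extends G act p q" for q
    using that assms(3) by unfold_locales (auto simp: cp_extends_def)
  note consequences = extension[THEN cp_extension.self_similar, OF _ assms(2)]
    extension[THEN cp_extension.closure_in_image] extension[THEN cp_extension.A_max_image]
  show ?thesis
    using cp_extends_of_self_similar[OF assms(3)] cp_extends_of_closure[OF assms(3)] consequences by meson
qed

end
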